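(* Let $n\ge2$, let $\varphi:\mathbb{R}^{n-1}\to\mathbb{R}$ be a smooth function which is globally Lipschitz, let $\Omega=\{(x',x_n)\in\mathbb{R}^n: x_n>\varphi(x')\}$, and let $W$ be a double well potential satisfying (W1)–(W5) (listed in the context). Suppose the overdetermined problem $$\Delta u=W'(u),\quad u>0\ \text{ in }\Omega,\qquad u=0\ \text{ on }\partial\Omega,\qquad \frac{\partial u}{\partial\nu}=\text{const. on }\partial\Omega$$ (the constant not being prescribed a priori) has a solution $u$. Then $\Omega$ must be a half space and, up to an isometry of $\mathbb{R}^n$, $\Omega=\{x\cdot e>0\}$ and $u(x)=g(x\cdot e)$ for $x\in\Omega$, for some unit vector $e$, where $g$ is the one-dimensional profile defined in the context.
   Context: Here $\nu$ is the outer unit normal to $\partial\Omega$; a solution is a classical one, $u\in C^2(\Omega)\cap C^1(\overline\Omega)$. Assumptions on $W\in C^2([0,+\infty))$: (W1) $W\ge 0$, $W(1)=0$ and $W>0$ in $[0,1)$; (W2) for some $\gamma\in(0,1)$, $W'<0$ on $(\gamma,1)$; (W3) there is a constant $\kappa>0$ with $W''(s)\ge\kappa$ for all $s\ge\gamma$; (W4) there are constants $p>1$ and $c>0$ with $W'(s)\ge c(s-1)^p$ for $s>1$; (W5) $W'<0$ in $(0,1)$, and either $W'(0)\ne0$, or $W'(0)=0$ and $W''(0)\neq0$. The profile $g:[0,+\infty)\to[0,1)$ is the unique function satisfying $g''=W'(g)$ on $[0,+\infty)$, $g(0)=0$, $\lim_{t\to+\infty}g(t)=1$. It satisfies $g'(t)=\sqrt{2W(g(t))}>0$.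 *)

theory Defs
  imports "HOL-Analysis.Analysis"
begin

text \<open>
  Throughout, the space \<open>R\<^sup>n\<close> with \<open>n \<ge> 2\<close> is \<open>(real ^ 'm) \<times> real\<close> with \<open>CARD('m) = n - 1 \<ge> 1\<close>; the
  library's norm and inner product on this product type are the Euclidean ones.
\<close>

definition partial_deriv :: "'a::euclidean_space \<Rightarrow> ('a \<Rightarrow> real) \<Rightarrow> 'a \<Rightarrow> real" where
  "partial_deriv b f x = frechet_derivative f (at x) b"

text \<open>\<open>C_k_on k S f\<close> is meant for open \<open>S\<close>; a differentiable function is continuous, so
  this is the usual class \<open>C\<^sup>k(S)\<close>.\<close>

primrec C_k_on :: "nat \<Rightarrow> 'a::euclidean_space set \<Rightarrow> ('a \<Rightarrow> real) \<Rightarrow> bool" where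
  "C_k_on 0 S f \<longleftrightarrow> continuous_on S f"
| "C_k_on (Suc k) S f \<longleftrightarrow>
     (\<forall>x\<in>S. f differentiable (at x)) \<and> (\<forall>b\<in>Basis. C_k_on k S (partial_deriv b f))"

definition smooth :: "('a::euclidean_space \<Rightarrow> real) \<Rightarrow> bool" where
  "smooth f \<longleftrightarrow> (\<forall>k. C_k_on k UNIV f)"

text \<open>\<open>C\<^sup>1\<close> up to the boundary of an open set: the function is continuous on the closure and its
  first partial derivatives in the interior extend continuously to the closure.\<close>

definition C1_on_closure :: "'a::euclidean_space set \<Rightarrow> ('a \<Rightarrow> real) \<Rightarrow> bool" where
  "C1_on_closure S f \<longleftrightarrow> C_k_on 1 S f \<and> continuous_on (closure S) f \<and>
     (\<forall>b\<in>Basis. \<exists>h. continuous_on (closure S) h \<and> (\<forall>x\<in>S. h x = partial_deriv b f x))"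

definition grad :: "('a::euclidean_space \<Rightarrow> real) \<Rightarrow> 'a \<Rightarrow> 'a" where
  "grad f x = (\<Sum>b\<in>Basis. partial_deriv b f x *\<^sub>R b)"

definition laplacian :: "('a::euclidean_space \<Rightarrow> real) \<Rightarrow> 'a \<Rightarrow> real" where
  "laplacian f x = (\<Sum>b\<in>Basis. partial_deriv b (partial_deriv b f) x)"

definition strict_epigraph :: "('a::euclidean_space \<Rightarrow> real) \<Rightarrow> ('a \<times> real) set" where
  "strict_epigraph \<phi> = {(x', t). t > \<phi> x'}"

text \<open>Outer unit normal of the epigraph at its boundary point \<open>(x', \<phi> x')\<close>: the normalized
  gradient of the function \<open>(x', t) \<mapsto> \<phi> x' - t\<close>, which is negative inside the epigraph.\<close>

definition outer_normal :: "('a::euclidean_space \<Rightarrow> real) \<Rightarrow> 'a \<Rightarrow> 'a \<times> real" where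
  "outer_normal \<phi> x' = (1 / sqrt (1 + (norm (grad \<phi> x'))\<^sup>2)) *\<^sub>R (grad \<phi> x', -1)"

text \<open>Only the values of \<open>u\<close> on the closure of the domain matter, so the derivative in direction of
  the outer normal at a boundary point is the one-sided one, taken from inside.\<close>

definition has_outer_normal_derivative ::
    "('a::real_normed_vector \<Rightarrow> real) \<Rightarrow> real \<Rightarrow> 'a \<Rightarrow> 'a \<Rightarrow> bool" where
  "has_outer_normal_derivative u c x \<nu> \<longleftrightarrow>
     ((\<lambda>t. u (x + t *\<^sub>R \<nu>)) has_real_derivative c) (at_left 0)"

text \<open>\<open>W'\<close> and \<open>W''\<close> are the first and second derivatives of \<open>W\<close> on \<open>[0,\<infinity>)\<close>, one-sided at \<open>0\<close>.
  Values at negative arguments are irrelevant.\<close>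

definition C2_on_nonneg :: "(real \<Rightarrow> real) \<Rightarrow> (real \<Rightarrow> real) \<Rightarrow> (real \<Rightarrow> real) \<Rightarrow> bool" where
  "C2_on_nonneg W W' W'' \<longleftrightarrow>
     (\<forall>s\<ge>0. (W has_real_derivative W' s) (at s within {0..})) \<and>
     (\<forall>s\<ge>0. (W' has_real_derivative W'' s) (at s within {0..})) \<and>
     continuous_on {0..} W''"

definition double_well :: "(real \<Rightarrow> real) \<Rightarrow> (real \<Rightarrow> real) \<Rightarrow> (real \<Rightarrow> real) \<Rightarrow> bool" where
  "double_well W W' W'' \<longleftrightarrow>
     C2_on_nonneg W W' W'' \<and>
     (\<forall>s\<ge>0. W s \<ge> 0) \<and> W 1 = 0 \<and> (\<forall>s\<in>{0..<1}. W s > 0) \<and>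
     (\<exists>\<gamma>\<in>{0<..<1}. (\<forall>s\<in>{\<gamma><..<1}. W' s < 0) \<and> (\<exists>\<kappa>>0. \<forall>s\<ge>\<gamma>. W'' s \<ge> \<kappa>)) \<and>
     (\<exists>p>1. \<exists>c>0. \<forall>s>1. W' s \<ge> c * (s - 1) powr p) \<and>
     (\<forall>s\<in>{0<..<1}. W' s < 0) \<and> (W' 0 \<noteq> 0 \<or> (W' 0 = 0 \<and> W'' 0 \<noteq> 0))"

definition is_profile :: "(real \<Rightarrow> real) \<Rightarrow> (real \<Rightarrow> real) \<Rightarrow> bool" where
  "is_profile W' g \<longleftrightarrow>
     (\<forall>t\<ge>0. 0 \<le> g t \<and> g t < 1) \<and>
     (\<exists>g'. \<forall>t\<ge>0. (g has_real_derivative g' t) (at t within {0..}) \<and>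
                  (g' has_real_derivative W' (g t)) (at t within {0..})) \<and>
     g 0 = 0 \<and> (g \<longlongrightarrow> 1) at_top"

text \<open>The profile is a function on \<open>[0,\<infinity>)\<close>; it is extended by \<open>0\<close> to make it unique as a total
  function.\<close>

definition profile :: "(real \<Rightarrow> real) \<Rightarrow> real \<Rightarrow> real" where
  "profile W' = (THE g. is_profile W' g \<and> (\<forall>t<0. g t = 0))"

definition half_space :: "'a::euclidean_space set \<Rightarrow> bool" where
  "half_space S \<longleftrightarrow> (\<exists>a b. a \<noteq> 0 \<and> S = {x. x \<bullet> a > b})"

end

theory Submission
 imports Defs "HOL-Analysis.Analysis"
begin

text \<open>
  The proof only uses maximum principles and a Liouville theorem for uniformly elliptic equations in divergence
  form; no regularity or existence theory for elliptic equations enters.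

  Barriers give \<open>0 < u < 1\<close> and \<open>u \<rightarrow> 1\<close> far from the boundary. Sliding \<open>u\<close> along the cone of directions pointing
  into the epigraph shows that \<open>u\<close> is monotone in these directions, so \<open>\<bar>\<nabla>'u\<bar> \<le> L u\<^sub>n\<close>; doubling of variables with
  a coupling by reflection sharpens this to \<open>k\<^sub>0 (1 - u) \<le> u\<^sub>n \<le> k\<^sub>1 (1 - u)\<close>. Hence the level sets
  \<open>u = 1 - e\<^sup>-\<^sup>t\<close> are the graphs of functions \<open>h(\<cdot>, t)\<close> such that \<open>h\<close> has a bounded gradient \<open>(p, q)\<close> and \<open>q\<close> is bounded
  below. The equation for \<open>u\<close> says that the field \<open>e\<^sup>-\<^sup>2\<^sup>t (p / q, - (1 + \<bar>p\<bar>\<^sup>2) / (2 q\<^sup>2))\<close> has a divergence that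
  depends on \<open>t\<close> only, and the overdetermined condition says that its normal component is constant on \<open>t = 0\<close>.
  As this field is a uniformly monotone function of \<open>(p, q)\<close>, every difference \<open>h(x + \<tau>, t) - h(x, t)\<close> is a bounded
  solution of a uniformly elliptic equation with weight \<open>e\<^sup>-\<^sup>2\<^sup>t\<close> and a no-flux condition on \<open>t = 0\<close>.
  De Giorgi's method shows that it is constant, so \<open>h(\<cdot>, t)\<close> is affine with a slope independent of \<open>t\<close>.
\<close>

section \<open>Second-order jets and comparison principles\<close>

text \<open>Derivative bounds are therefore proved for finite increments (sliding, doubling,
  horizontal differences of \<open>h\<close>) and passed to the limit afterwards. The coordinate
  \<open>t = - ln (1 - u)\<close> is dictated by the exponential decay of \<open>1 - u\<close>: the
  two-sided bound of \<open>u_n\<close> by \<open>1 - u\<close> becomes a uniform bound for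
  \<open>e^t\<close> times the gradient, and the equation for \<open>h\<close> becomes uniformly
  elliptic. In return the weight \<open>e^(-2t)\<close> has finite mass in \<open>t\<close>, so at
  large scales the half-cylinder behaves like the space of the variables \<open>x'\<close>, and De
  Giorgi's method applies in every dimension. The monotonicity of the flux has a simple origin: it
  is the gradient of \<open>(1 + |p|^2) / (2 q)\<close>, which is jointly convex for
  \<open>q > 0\<close>. Since two solutions are subtracted instead of linearizing, only this
  monotonicity and a Lipschitz bound enter.\<close>

lemma has_derivative_grad:
 assumes "f differentiable (at x)" shows "(f has_derivative (\<lambda>h. grad f x \<bullet> h)) (at x)"
proof -
 have d: "(f has_derivative frechet_derivative f (at x)) (at x)" using assms frechet_derivative_works by blast
 hence l: "linear (frechet_derivative f (at x))" by (rule has_derivative_linear)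
 have "frechet_derivative f (at x) h = grad f x \<bullet> h" for h
 proof -
  have "frechet_derivative f (at x) h = frechet_derivative f (at x) (\<Sum>i\<in>Basis. (h \<bullet> i) *\<^sub>R i)"
   by (simp add: euclidean_representation)
  also have "... = (\<Sum>i\<in>Basis. (h \<bullet> i) * frechet_derivative f (at x) i)"
   using l by (simp add: linear_sum linear_scale)
  also have "... = grad f x \<bullet> h"
   unfolding grad_def partial_deriv_def inner_sum_left inner_scaleR_left by (intro sum.cong) (auto simp: inner_commute)
  finally show ?thesis .
 qed
 hence "frechet_derivative f (at x) = (\<lambda>h. grad f x \<bullet> h)" by blast
 thus ?thesis using d by simp
qed

section \<open>Second-order calculus along coordinate lines\<close>

definition d2 :: "(real \<Rightarrow> real) \<Rightarrow> real \<Rightarrow> real \<Rightarrow> bool" where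
 "d2 F p q \<longleftrightarrow> (\<exists>F1. (\<forall>\<^sub>F s in nhds 0. (F has_real_derivative F1 s) (at s)) \<and> F1 0 = p \<and>
   (F1 has_real_derivative q) (at 0))"

text \<open>\<open>l\<close> is a sum of pure second derivatives along the coordinate lines; the maximum principle needs no
  more, so that no Hessian and no regularity of barriers at their singular points is required.\<close>
definition jet2 :: "('a::euclidean_space \<Rightarrow> real) \<Rightarrow> 'a \<Rightarrow> ('a \<Rightarrow> real) \<Rightarrow> real \<Rightarrow> bool" where
 "jet2 f x g l \<longleftrightarrow>
   (\<exists>f2. (\<forall>b\<in>Basis. d2 (\<lambda>s. f (x + s *\<^sub>R b)) (g b) (f2 b)) \<and> l = (\<Sum>b\<in>Basis. f2 b))"

lemma d2_first: "d2 F p q \<Longrightarrow> (F has_real_derivative p) (at 0)"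
 unfolding d2_def using eventually_nhds_x_imp_x by blast

lemma d2_const: "d2 (\<lambda>_. k) 0 0"
 unfolding d2_def by (rule exI[of _ "\<lambda>_. 0"]) auto

lemma d2_add:
 assumes "d2 F p q" "d2 G p' q'"
 shows "d2 (\<lambda>s. F s + G s) (p + p') (q + q')"
proof -
 obtain F1 G1 where *: "\<forall>\<^sub>F s in nhds 0. (F has_real_derivative F1 s) (at s)" "F1 0 = p"
   "(F1 has_real_derivative q) (at 0)" "\<forall>\<^sub>F s in nhds 0. (G has_real_derivative G1 s) (at s)" "G1 0 = p'"
   "(G1 has_real_derivative q') (at 0)" using assms unfolding d2_def by blast
 show ?thesis unfolding d2_def
 proof (intro exI[of _ "\<lambda>s. F1 s + G1 s"] conjI)
  show "\<forall>\<^sub>F s in nhds 0. ((\<lambda>s. F s + G s) has_real_derivative F1 s + G1 s) (at s)"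
   using *(1,4) by eventually_elim (rule DERIV_add)
 qed (use * in \<open>auto intro!: DERIV_add\<close>)
qed

lemma d2_mult:
 assumes "d2 F p q" "d2 G p' q'"
 shows "d2 (\<lambda>s. F s * G s) (p * G 0 + F 0 * p') (q * G 0 + 2 * p * p' + F 0 * q')"
proof -
 obtain F1 G1 where *: "\<forall>\<^sub>F s in nhds 0. (F has_real_derivative F1 s) (at s)" "F1 0 = p"
   "(F1 has_real_derivative q) (at 0)" "\<forall>\<^sub>F s in nhds 0. (G has_real_derivative G1 s) (at s)" "G1 0 = p'"
   "(G1 has_real_derivative q') (at 0)" using assms unfolding d2_def by blast
 have F: "(F has_real_derivative p) (at 0)" and G: "(G has_real_derivative p') (at 0)"
  using assms d2_first by auto
 show ?thesis unfolding d2_def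
 proof (intro exI[of _ "\<lambda>s. F1 s * G s + F s * G1 s"] conjI)
  show "\<forall>\<^sub>F s in nhds 0. ((\<lambda>s. F s * G s) has_real_derivative F1 s * G s + F s * G1 s) (at s)"
   using *(1,4) by eventually_elim (auto intro!: derivative_eq_intros)
  show "((\<lambda>s. F1 s * G s + F s * G1 s) has_real_derivative q * G 0 + 2 * p * p' + F 0 * q') (at 0)"
   by (rule derivative_eq_intros *(3,6) F G refl)+ (simp add: * algebra_simps)
 qed (use * in auto)
qed

lemma d2_compose:
 assumes "d2 F p q" "\<forall>\<^sub>F y in nhds (F 0). (P has_real_derivative P1 y) (at y)"
  "(P1 has_real_derivative P2) (at (F 0))"
 shows "d2 (\<lambda>s. P (F s)) (P1 (F 0) * p) (P2 * p^2 + P1 (F 0) * q)"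
proof -
 obtain F1 where *: "\<forall>\<^sub>F s in nhds 0. (F has_real_derivative F1 s) (at s)" "F1 0 = p"
   "(F1 has_real_derivative q) (at 0)" using assms unfolding d2_def by blast
 have F: "(F has_real_derivative p) (at 0)" using assms d2_first by auto
 hence "isCont F 0" using DERIV_isCont by blast
 hence "filterlim F (nhds (F 0)) (nhds 0)"
  by (simp add: isCont_def tendsto_at_iff_tendsto_nhds)
 hence ev: "\<forall>\<^sub>F s in nhds 0. (P has_real_derivative P1 (F s)) (at (F s))"
  using assms(2) eventually_compose_filterlim by blast
 show ?thesis unfolding d2_def
 proof (intro exI[of _ "\<lambda>s. P1 (F s) * F1 s"] conjI)
  show "\<forall>\<^sub>F s in nhds 0. ((\<lambda>s. P (F s)) has_real_derivative P1 (F s) * F1 s) (at s)"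
   using *(1) ev by eventually_elim (rule DERIV_chain2)
  have "((\<lambda>s. P1 (F s)) has_real_derivative P2 * p) (at 0)"
   by (rule DERIV_chain2[OF assms(3) F])
  from DERIV_mult[OF this *(3)]
  show "((\<lambda>s. P1 (F s) * F1 s) has_real_derivative P2 * p^2 + P1 (F 0) * q) (at 0)"
   by (simp add: * power2_eq_square algebra_simps)
 qed (use * in auto)
qed

lemma d2_neg_arg:
 assumes "d2 F p q" shows "d2 (\<lambda>s. F (- s)) (- p) q"
proof -
 obtain F1 where *: "\<forall>\<^sub>F s in nhds 0. (F has_real_derivative F1 s) (at s)" "F1 0 = p"
   "(F1 has_real_derivative q) (at 0)" using assms unfolding d2_def by blast
 have "filterlim uminus (nhds (0::real)) (nhds 0)"
  using tendsto_minus[OF filterlim_ident, of "0::real"] by simp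
 hence ev: "\<forall>\<^sub>F s in nhds 0. (F has_real_derivative F1 (-s)) (at (-s))"
  using *(1) eventually_compose_filterlim by fastforce
 show ?thesis unfolding d2_def
 proof (intro exI[of _ "\<lambda>s. - F1 (- s)"] conjI)
  show "\<forall>\<^sub>F s in nhds 0. ((\<lambda>s. F (- s)) has_real_derivative - F1 (- s)) (at s)"
   using ev by eventually_elim (simp add: DERIV_mirror)
  show "((\<lambda>s. - F1 (- s)) has_real_derivative q) (at 0)"
  proof -
   have "((\<lambda>s. F1 (- s)) has_real_derivative - q) (at 0)"
    using *(3) DERIV_mirror[of F1 q 0] by simp
   from DERIV_minus[OF this] show ?thesis by simp
  qed
 qed (use * in auto)
qed

lemma d2_local_min:
 assumes "d2 F p q" "\<forall>\<^sub>F s in nhds 0. F s \<ge> F 0"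
 shows "p = 0" "q \<ge> 0"
proof -
 obtain F1 where *: "\<forall>\<^sub>F s in nhds 0. (F has_real_derivative F1 s) (at s)" "F1 0 = p"
   "(F1 has_real_derivative q) (at 0)" using assms unfolding d2_def by blast
 have F: "(F has_real_derivative p) (at 0)" using assms d2_first by auto
 obtain d where d: "d > 0" "\<And>s. \<bar>s\<bar> < d \<Longrightarrow> (F has_real_derivative F1 s) (at s) \<and> F s \<ge> F 0"
  using eventually_conj[OF *(1) assms(2)] unfolding eventually_nhds_metric by (auto simp: dist_real_def)
 show p: "p = 0" by (rule DERIV_local_min[OF F d(1)]) (use d in auto)
 show "q \<ge> 0"
 proof (rule ccontr)
  assume "\<not> q \<ge> 0"
  then obtain e where e: "e > 0" "\<And>h. 0 < h \<Longrightarrow> h < e \<Longrightarrow> F1 (0 + h) < F1 0"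
   using DERIV_neg_dec_right[OF *(3)] by auto
  define h where "h = min d e / 2"
  have h: "h > 0" "h < d" "h < e" using d e by (auto simp: h_def)
  have "\<exists>z. 0 < z \<and> z < h \<and> F h - F 0 = (h - 0) * F1 z"
   by (rule MVT2) (use h d in auto)
  then obtain z where z: "0 < z" "z < h" "F h - F 0 = h * F1 z" by auto
  have "F1 z < 0" using e(2)[of z] z h * p by auto
  hence "F h < F 0" using z h mult_pos_neg[of h "F1 z"] by linarith
  thus False using d(2)[of h] h by auto
 qed
qed

lemma jet2_const: "jet2 (\<lambda>_. k) x (\<lambda>_. 0) 0"
 unfolding jet2_def by (rule exI[of _ "\<lambda>_. 0"]) (auto intro: d2_const)

lemma jet2_add:
 assumes "jet2 f x g l" "jet2 f' x g' l'"
 shows "jet2 (\<lambda>y. f y + f' y) x (\<lambda>b. g b + g' b) (l + l')"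
proof -
 obtain f2 f2' where "\<forall>b\<in>Basis. d2 (\<lambda>s. f (x + s *\<^sub>R b)) (g b) (f2 b)" "l = sum f2 Basis"
  "\<forall>b\<in>Basis. d2 (\<lambda>s. f' (x + s *\<^sub>R b)) (g' b) (f2' b)" "l' = sum f2' Basis"
  using assms unfolding jet2_def by auto
 thus ?thesis unfolding jet2_def
  by (intro exI[of _ "\<lambda>b. f2 b + f2' b"]) (auto intro!: d2_add simp: sum.distrib)
qed

lemma jet2_mult:
 assumes "jet2 f x g l" "jet2 f' x g' l'"
 shows "jet2 (\<lambda>y. f y * f' y) x (\<lambda>b. g b * f' x + f x * g' b)
      (l * f' x + 2 * (\<Sum>b\<in>Basis. g b * g' b) + f x * l')"
proof -
 obtain f2 f2' where *: "\<forall>b\<in>Basis. d2 (\<lambda>s. f (x + s *\<^sub>R b)) (g b) (f2 b)" "l = sum f2 Basis"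
  "\<forall>b\<in>Basis. d2 (\<lambda>s. f' (x + s *\<^sub>R b)) (g' b) (f2' b)" "l' = sum f2' Basis"
  using assms unfolding jet2_def by auto
 show ?thesis unfolding jet2_def
 proof (intro exI[of _ "\<lambda>b. f2 b * f' x + 2 * g b * g' b + f x * f2' b"] conjI ballI)
  fix b :: 'a assume "b \<in> Basis"
  thus "d2 (\<lambda>s. f (x + s *\<^sub>R b) * f' (x + s *\<^sub>R b)) (g b * f' x + f x * g' b)
     (f2 b * f' x + 2 * g b * g' b + f x * f2' b)"
   using d2_mult[OF *(1)[rule_format, of b] *(3)[rule_format, of b]] by simp
 qed (simp add: * sum.distrib sum_distrib_left sum_distrib_right algebra_simps)
qed

lemma jet2_compose:
 assumes "jet2 f x g l" "\<forall>\<^sub>F y in nhds (f x). (P has_real_derivative P1 y) (at y)"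
  "(P1 has_real_derivative P2) (at (f x))"
 shows "jet2 (\<lambda>y. P (f y)) x (\<lambda>b. P1 (f x) * g b) (P2 * (\<Sum>b\<in>Basis. (g b)^2) + P1 (f x) * l)"
proof -
 obtain f2 where *: "\<forall>b\<in>Basis. d2 (\<lambda>s. f (x + s *\<^sub>R b)) (g b) (f2 b)" "l = sum f2 Basis"
  using assms unfolding jet2_def by auto
 show ?thesis unfolding jet2_def
 proof (intro exI[of _ "\<lambda>b. P2 * (g b)^2 + P1 (f x) * f2 b"] conjI ballI)
  fix b :: 'a assume "b \<in> Basis"
  thus "d2 (\<lambda>s. P (f (x + s *\<^sub>R b))) (P1 (f x) * g b) (P2 * (g b)^2 + P1 (f x) * f2 b)"
   using d2_compose[OF *(1)[rule_format, of b], of P P1 P2] assms by simp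
 qed (simp add: * sum.distrib sum_distrib_left)
qed

lemma jet2_cmult: "jet2 f x g l \<Longrightarrow> jet2 (\<lambda>y. k * f y) x (\<lambda>b. k * g b) (k * l)"
 using jet2_mult[OF jet2_const, of f x g l k] by simp

lemma jet2_diff:
 assumes "jet2 f x g l" "jet2 f' x g' l'"
 shows "jet2 (\<lambda>y. f y - f' y) x (\<lambda>b. g b - g' b) (l - l')"
 using jet2_add[OF assms(1) jet2_cmult[OF assms(2), of "-1"]] by simp

lemma jet2_translate: "jet2 f (x + a) g l \<Longrightarrow> jet2 (\<lambda>y. f (y + a)) x g l"
 unfolding jet2_def by (simp add: algebra_simps)

text \<open>\<open>\<sigma>\<close> records the signs with which a reflection acts on the basis
  vectors. First derivatives pick up the sign, second derivatives along lines do not see it.\<close>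

lemma jet2_reflect:
 fixes f :: "'a::euclidean_space \<Rightarrow> real"
 assumes "jet2 f (R x) g l" "linear R" "\<And>b. b \<in> Basis \<Longrightarrow> R b = \<sigma> b *\<^sub>R b"
  "\<And>b. b \<in> Basis \<Longrightarrow> \<sigma> b = 1 \<or> \<sigma> b = -1"
 shows "jet2 (\<lambda>y. f (R y)) x (\<lambda>b. \<sigma> b * g b) l"
proof -
 obtain f2 where *: "\<forall>b\<in>Basis. d2 (\<lambda>s. f (R x + s *\<^sub>R b)) (g b) (f2 b)" "l = sum f2 Basis"
  using assms unfolding jet2_def by auto
 show ?thesis unfolding jet2_def
 proof (intro exI[of _ f2] conjI ballI)
  fix b :: 'a assume b: "b \<in> Basis"
  have 1: "d2 (\<lambda>s. f (R x + s *\<^sub>R b)) (g b) (f2 b)" using * b by auto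
  have eq: "R (x + s *\<^sub>R b) = R x + (\<sigma> b * s) *\<^sub>R b" for s
   using assms(2) b assms(3) by (simp add: linear_add linear_scale mult.commute)
  from assms(4)[OF b] show "d2 (\<lambda>s. f (R (x + s *\<^sub>R b))) (\<sigma> b * g b) (f2 b)"
   using 1 d2_neg_arg[OF 1] by (auto simp: eq)
 qed (use * in auto)
qed

lemma jet2_inner: "jet2 (\<lambda>y. y \<bullet> v) x (\<lambda>b. b \<bullet> v) 0"
 unfolding jet2_def
proof (intro exI[of _ "\<lambda>_. 0"] conjI ballI)
 fix b :: 'a
 show "d2 (\<lambda>s. (x + s *\<^sub>R b) \<bullet> v) (b \<bullet> v) 0"
  unfolding d2_def inner_add_left inner_scaleR_left
  by (intro exI[of _ "\<lambda>s. b \<bullet> v"] conjI always_eventually) (auto intro!: derivative_eq_intros)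
qed auto

lemma jet2_sqnorm:
 fixes x c :: "'a::euclidean_space"
 shows "jet2 (\<lambda>y. (norm (y - c))^2) x (\<lambda>b. 2 * ((x - c) \<bullet> b)) (2 * DIM('a))"
 unfolding jet2_def
proof (intro exI[of _ "\<lambda>_. 2"] conjI ballI)
 fix b :: 'a assume b: "b \<in> Basis"
 have eq: "(norm (x + s *\<^sub>R b - c))^2 = (norm (x - c))^2 + 2 * ((x - c) \<bullet> b) * s + s^2" for s
  using b unfolding power2_norm_eq_inner
  by (simp add: inner_simps inner_commute power2_eq_square algebra_simps)
 show "d2 (\<lambda>s. (norm (x + s *\<^sub>R b - c))^2) (2 * ((x - c) \<bullet> b)) 2"
  unfolding d2_def eq
  by (intro exI[of _ "\<lambda>s. 2 * ((x - c) \<bullet> b) + 2 * s"] conjI always_eventually)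
    (auto intro!: derivative_eq_intros)
qed auto

lemma jet2_radial:
 fixes x c :: "'a::euclidean_space"
 assumes "\<forall>\<^sub>F y in nhds ((norm (x - c))^2). (P has_real_derivative P1 y) (at y)"
  "(P1 has_real_derivative P2) (at ((norm (x - c))^2))"
 shows "jet2 (\<lambda>y. P ((norm (y - c))^2)) x (\<lambda>b. P1 ((norm (x - c))^2) * (2 * ((x - c) \<bullet> b)))
   (4 * P2 * (norm (x - c))^2 + 2 * real DIM('a) * P1 ((norm (x - c))^2))"
proof -
 have "(\<Sum>b\<in>Basis. (2 * ((x - c) \<bullet> b))^2) = 4 * (norm (x - c))^2"
  unfolding power2_norm_eq_inner
  by (subst euclidean_inner) (simp add: power2_eq_square sum_distrib_left algebra_simps)
 thus ?thesis using jet2_compose[OF jet2_sqnorm assms] by (simp add: algebra_simps)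
qed

lemma jet2_local_min:
 assumes "jet2 f x g l" "\<forall>\<^sub>F y in nhds x. f y \<ge> f x"
 shows "l \<ge> 0" "\<And>b. b \<in> Basis \<Longrightarrow> g b = 0"
proof -
 obtain f2 where *: "\<forall>b\<in>Basis. d2 (\<lambda>s. f (x + s *\<^sub>R b)) (g b) (f2 b)" "l = sum f2 Basis"
  using assms unfolding jet2_def by auto
 have ev: "\<forall>\<^sub>F s in nhds 0. f (x + s *\<^sub>R b) \<ge> f (x + 0 *\<^sub>R b)" for b
 proof -
  have "filterlim (\<lambda>s. x + s *\<^sub>R b) (nhds x) (nhds (0::real))"
   by (rule tendsto_eq_intros filterlim_ident refl | simp)+
  from eventually_compose_filterlim[OF assms(2) this] show ?thesis by simp
 qed
 show "g b = 0" if "b \<in> Basis" for b using d2_local_min[OF *(1)[rule_format, OF that] ev] by simp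
 show "l \<ge> 0" unfolding *(2)
  by (intro sum_nonneg) (use d2_local_min[OF *(1)[rule_format] ev] in auto)
qed

lemma jet2_C2:
 fixes u :: "'a::euclidean_space \<Rightarrow> real"
 assumes "C_k_on 2 S u" "open S" "x \<in> S"
 shows "jet2 u x (\<lambda>b. partial_deriv b u x) (laplacian u x)"
proof -
 have 2: "\<forall>x\<in>S. u differentiable (at x)"
  "\<forall>b\<in>Basis. \<forall>x\<in>S. partial_deriv b u differentiable (at x)"
  using assms(1) by (auto simp: numeral_2_eq_2)
 have line: "((\<lambda>s. f (x + s *\<^sub>R b)) has_real_derivative partial_deriv b f (x + s *\<^sub>R b)) (at s)"
  if "f differentiable (at (x + s *\<^sub>R b))" for f :: "'a \<Rightarrow> real" and b s
 proof -
  have f: "(f has_derivative frechet_derivative f (at (x + s *\<^sub>R b))) (at (x + s *\<^sub>R b))"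
   using that frechet_derivative_works by blast
  interpret linear "frechet_derivative f (at (x + s *\<^sub>R b))"
   using f has_derivative_linear by blast
  have "((\<lambda>s. x + s *\<^sub>R b) has_derivative (\<lambda>h. h *\<^sub>R b)) (at s)"
   by (auto intro!: derivative_eq_intros)
  from has_derivative_compose[OF this f] show ?thesis
   by (simp add: has_field_derivative_def partial_deriv_def scale mult_commute_abs)
 qed
 have ev: "\<forall>\<^sub>F s in nhds 0. x + s *\<^sub>R b \<in> S" for b
 proof -
  have "filterlim (\<lambda>s. x + s *\<^sub>R b) (nhds x) (nhds (0::real))"
   by (rule tendsto_eq_intros filterlim_ident refl | simp)+
  moreover have "\<forall>\<^sub>F y in nhds x. y \<in> S" using assms by (simp add: eventually_nhds_in_open)
  ultimately show ?thesis using eventually_compose_filterlim by blast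
 qed
 show ?thesis unfolding jet2_def laplacian_def
 proof (intro exI[of _ "\<lambda>b. partial_deriv b (partial_deriv b u) x"] conjI ballI refl)
  fix b :: 'a assume b: "b \<in> Basis"
  show "d2 (\<lambda>s. u (x + s *\<^sub>R b)) (partial_deriv b u x) (partial_deriv b (partial_deriv b u) x)"
   unfolding d2_def
  proof (intro exI[of _ "\<lambda>s. partial_deriv b u (x + s *\<^sub>R b)"] conjI)
   show "\<forall>\<^sub>F s in nhds 0. ((\<lambda>s. u (x + s *\<^sub>R b)) has_real_derivative
       partial_deriv b u (x + s *\<^sub>R b)) (at s)"
    using ev[of b] by eventually_elim (use 2 line in auto)
   show "((\<lambda>s. partial_deriv b u (x + s *\<^sub>R b)) has_real_derivative
       partial_deriv b (partial_deriv b u) x) (at 0)"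
    using line[of "partial_deriv b u" 0 b] 2 b assms by auto
  qed auto
 qed
qed

text \<open>At a negative minimum the jet would satisfy both \<open>l < 0\<close> and
  \<open>l \<ge> 0\<close>. The boundary condition is hidden in the hypothesis: a point with
  \<open>f x < 0\<close> has to be interior, and the differential inequality is asked for only
  there, so barriers may exploit the sign of \<open>f\<close>.\<close>

lemma comparison_compact:
 fixes f :: "'a::euclidean_space \<Rightarrow> real"
 assumes "compact K" "continuous_on K f"
  "\<And>x. x \<in> K \<Longrightarrow> f x < 0 \<Longrightarrow> x \<in> interior K \<and> (\<exists>g l. jet2 f x g l \<and> l < 0)"
  "x \<in> K"
 shows "f x \<ge> 0"
proof (rule ccontr)
 assume neg: "\<not> f x \<ge> 0"
 obtain y where y: "y \<in> K" "\<And>z. z \<in> K \<Longrightarrow> f y \<le> f z"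
  using continuous_attains_inf[OF assms(1) _ assms(2)] assms(4) by auto
 have "f y < 0" using y(2)[OF assms(4)] neg by auto
 then obtain g l where gl: "y \<in> interior K" "jet2 f y g l" "l < 0" using assms(3)[OF y(1)] by auto
 have "\<forall>\<^sub>F z in nhds y. z \<in> interior K" using gl by (simp add: eventually_nhds_in_open)
 hence "\<forall>\<^sub>F z in nhds y. f z \<ge> f y"
  by eventually_elim (use y(2) interior_subset in auto)
 thus False using jet2_local_min(1)[OF gl(2)] gl(3) by auto
qed

text \<open>The infimum need not be attained, so a small multiple of the squared norm is added to
  force a minimum. The zero-order term \<open>\<kappa> * f\<close> absorbs the Laplacian
  \<open>2 * DIM('a) * eps\<close> of this perturbation, which accounts for the additive constant in
  \<open>F\<close>.\<close>

lemma comparison_unbounded: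
 fixes f :: "'a::euclidean_space \<Rightarrow> real"
 assumes "closed K" "continuous_on K f" "\<And>x. x \<in> K \<Longrightarrow> f x \<ge> - B" "\<kappa> > 0"
  "\<And>x. x \<in> K \<Longrightarrow> f x < 0 \<Longrightarrow> x \<in> interior K \<and> (\<exists>g l. jet2 f x g l \<and> l \<le> \<kappa> * f x)"
  "x \<in> K"
 shows "f x \<ge> 0"
proof (rule ccontr)
 assume neg: "\<not> f x \<ge> 0"
 \<comment> \<open>So small that the perturbation at the given point stays below
   \<open>- f x\<close>; then \<open>F x \<ge> 0\<close> contradicts \<open>f x < 0\<close>.\<close>
 define eps where "eps = - f x / (2 * (1 + (norm x)^2 + (2 * DIM('a) + 1) / \<kappa>))"
 have pos: "1 + (norm x)^2 + (2 * DIM('a) + 1) / \<kappa> > 0"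
  using assms(4) by (auto intro!: add_pos_nonneg)
 have e: "eps > 0" unfolding eps_def
  by (rule divide_pos_pos, use neg in simp, rule mult_pos_pos) (use pos in simp_all)
 have e2: "eps * ((norm x)^2 + (2 * DIM('a) + 1) / \<kappa>) < - f x"
 proof -
  have "eps * ((norm x)^2 + (2 * DIM('a) + 1) / \<kappa>) < eps * (2 * (1 + (norm x)^2 + (2 * DIM('a) + 1) / \<kappa>))"
  proof (rule mult_strict_left_mono[OF _ e])
   have "(2 * DIM('a) + 1) / \<kappa> \<ge> 0" "(norm x)^2 \<ge> 0" using assms(4) by simp_all
   thus "(norm x)^2 + (2 * DIM('a) + 1) / \<kappa> < 2 * (1 + (norm x)^2 + (2 * DIM('a) + 1) / \<kappa>)"
    by argo
  qed
  also have "... = - f x"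
  proof -
   have "2 * (1 + (norm x)^2 + (2 * DIM('a) + 1) / \<kappa>) \<noteq> 0" using pos by argo
   thus ?thesis unfolding eps_def by (metis nonzero_divide_eq_eq)
  qed
  finally show ?thesis .
 qed
 define F where "F y = f y + eps * (norm y)^2 + eps * (2 * DIM('a) + 1) / \<kappa>" for y
 \<comment> \<open>Outside this ball \<open>eps * (norm y)^2\<close> exceeds the lower bound
   \<open>B\<close>, so \<open>F\<close> cannot be negative there.\<close>
 define R where "R = norm x + sqrt (\<bar>B\<bar> / eps) + 1"
 have "F x \<ge> 0"
 proof (rule comparison_compact[of "K \<inter> cball 0 R" F])
  show "compact (K \<inter> cball 0 R)" using assms(1) by (simp add: closed_Int_compact)
  show "continuous_on (K \<inter> cball 0 R) F" unfolding F_def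
   by (intro continuous_intros continuous_on_subset[OF assms(2)]) auto
  show "x \<in> K \<inter> cball 0 R" using assms(6) e by (simp add: R_def)
  fix y assume y: "y \<in> K \<inter> cball 0 R" "F y < 0"
  have k: "eps * (2 * DIM('a) + 1) / \<kappa> \<ge> 0" using e assms(4) by simp
  have "f y < 0" using y(2) e k unfolding F_def
   by (smt (verit) mult_nonneg_nonneg zero_le_power2)
  then obtain g l where gl: "y \<in> interior K" "jet2 f y g l" "l \<le> \<kappa> * f y" using assms(5) y by blast
  have "eps * (norm y)^2 < \<bar>B\<bar>" using y k assms(3)[of y] unfolding F_def by auto
  hence "(norm y)^2 < \<bar>B\<bar> / eps" using e by (simp add: field_simps)
  hence "norm y < sqrt (\<bar>B\<bar> / eps)" using real_less_rsqrt by blast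
  hence "y \<in> ball 0 R" using norm_ge_zero[of x] unfolding R_def mem_ball_0 by linarith
  hence int: "y \<in> interior (K \<inter> cball 0 R)" using gl by simp
  have 1: "jet2 F y (\<lambda>b. g b + eps * (2 * ((y - 0) \<bullet> b)) + 0) (l + eps * (2 * DIM('a)) + 0)"
   unfolding F_def
   using jet2_add[OF jet2_add[OF gl(2) jet2_cmult[OF jet2_sqnorm[of 0 y], of eps]]
     jet2_const[of "eps * (2 * DIM('a) + 1) / \<kappa>"]] by simp
  have "\<kappa> * F y < 0" using y assms(4) by (simp add: mult_pos_neg)
  hence "\<kappa> * f y + \<kappa> * (eps * (norm y)^2) + eps * (2 * DIM('a) + 1) < 0"
   using assms(4) by (simp add: F_def distrib_left add_divide_distrib)
  moreover have "\<kappa> * (eps * (norm y)^2) \<ge> 0" using e assms(4) by simp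
  ultimately have "l + eps * (2 * DIM('a)) < 0" using gl(3) e by (simp add: algebra_simps)
  thus "y \<in> interior (K \<inter> cball 0 R) \<and> (\<exists>g l. jet2 F y g l \<and> l < 0)" using int 1 by auto
 qed
 thus False using e2 unfolding F_def by (simp add: algebra_simps)
qed

lemma jet2_cong_grad:
 "jet2 f x g l \<Longrightarrow> (\<And>b. b \<in> Basis \<Longrightarrow> g b = g' b) \<Longrightarrow> jet2 f x g' l"
 unfolding jet2_def by (elim exE conjE, intro exI conjI) (auto)

lemma has_real_derivative_inverse_power:
 assumes "q > (0::real)"
 shows "((\<lambda>q. a / q ^ k) has_real_derivative (- (a * real k) / q ^ (k + 1))) (at q)"
proof (cases k)
 case 0
 thus ?thesis by auto
next
 case (Suc m)
 have "((\<lambda>q. a * inverse (q ^ k)) has_real_derivative a * (- (inverse (q ^ k) * (real k * q ^ m) * inverse (q ^ k)))) (at q)"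
  using assms Suc
  by (intro DERIV_cmult DERIV_inverse') (use DERIV_pow[of k q] in auto)
 moreover have "a * (- (inverse (q ^ k) * (real k * q ^ m) * inverse (q ^ k))) = - (a * real k) / q ^ (k + 1)"
 proof -
  have "inverse (q ^ k) * q ^ m = inverse q" using assms Suc by (simp add: field_simps)
  hence "inverse (q ^ k) * (real k * q ^ m) * inverse (q ^ k) = real k * (inverse q * inverse (q ^ k))"
   by (metis mult.assoc mult.left_commute)
  thus ?thesis by (simp only: divide_inverse) simp
 qed
 ultimately show ?thesis by (simp only: divide_inverse)
qed

text \<open>A quantitative strong minimum principle. The barrier is a multiple of
  \<open>|x - y|^(-2k)\<close>, whose Laplacian dominates \<open>C\<close> times itself for large
  \<open>k\<close>, minus its value on the sphere of radius \<open>2 * R\<close>. The constant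
  \<open>\<theta>\<close> is fixed before \<open>S\<close>, \<open>f\<close>, \<open>a\<close> and
  \<open>y\<close>; this uniformity replaces compactness in the unbounded epigraph.\<close>

lemma spreading:
 fixes r R C :: real
 assumes "0 < r" "r \<le> R" "C \<ge> 0"
 shows "\<exists>\<theta>>0. \<forall>(S::'a::euclidean_space set) f a y. closed S \<longrightarrow> continuous_on S f \<longrightarrow>
   (\<forall>x\<in>S. f x \<ge> 0) \<longrightarrow> a \<ge> 0 \<longrightarrow> (\<forall>x\<in>S - interior S. f x \<ge> a) \<longrightarrow>
   (\<forall>x\<in>S \<inter> cball y r. f x \<ge> a) \<longrightarrow>
   (\<forall>x\<in>interior S. \<exists>g l. jet2 f x g l \<and> l \<le> C * f x) \<longrightarrow>
   (\<forall>x\<in>S \<inter> cball y R. f x \<ge> \<theta> * a)"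
proof -
 define n where "n = DIM('a)"
 \<comment> \<open>The Laplacian of \<open>|z|^(-2k)\<close> is
   \<open>k * (4 * k + 4 - 2 * n) * |z|^(-2k-2)\<close>. The summand \<open>n\<close> makes the
   bracket at least 1, and the other summand makes \<open>k\<close> at least
   \<open>(C + 1) * |z|^2\<close> for \<open>|z| \<le> 2 * R\<close>.\<close>
 define k where "k = n + nat \<lceil>(C + 1) * (4 * R^2)\<rceil>"
 have n: "n \<ge> 1" unfolding n_def by (simp add: Suc_leI)
 hence k1: "k \<ge> 1" "k \<ge> n" by (auto simp: k_def)
 have "real (nat \<lceil>(C + 1) * (4 * R^2)\<rceil>) \<ge> (C + 1) * (4 * R^2)" by linarith
 hence k2: "real k \<ge> (C + 1) * (4 * R^2)" by (simp add: k_def)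
 have "real k * (4 * real k + 4 - 2 * real n) \<ge> real k * 1"
  by (rule mult_left_mono) (use k1 in linarith, simp)
 hence k3: "real k * (4 * real k + 4 - 2 * real n) \<ge> (C + 1) * (4 * R^2)" using k2 by linarith
 \<comment> \<open>Subtracting the value at radius \<open>2 * R\<close> costs at most half of the
   barrier at radius \<open>R\<close>; the minimum with 1 serves the points of the small
   ball.\<close>
 define \<theta> where "\<theta> = min 1 ((r / R) ^ (2 * k) / 2)"
 have th: "\<theta> > 0" using assms by (simp add: \<theta>_def)
 show ?thesis
 proof (intro exI[of _ \<theta>] conjI th allI impI ballI)
  fix S :: "'a set" and f a y x
  assume S: "closed S" and cf: "continuous_on S f" and f0: "\<forall>x\<in>S. f x \<ge> 0" and a: "a \<ge> 0"
   and fr: "\<forall>x\<in>S - interior S. f x \<ge> a" and fb: "\<forall>x\<in>S \<inter> cball y r. f x \<ge> a"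
   and lap: "\<forall>x\<in>interior S. \<exists>g l. jet2 f x g l \<and> l \<le> C * f x" and x: "x \<in> S \<inter> cball y R"
  show "f x \<ge> \<theta> * a"
  proof (cases "a = 0 \<or> dist y x \<le> r")
   case True
   have "\<theta> * a \<le> 1 * a" using a by (intro mult_right_mono) (auto simp: \<theta>_def)
   thus ?thesis using True f0 fb x by force
  next
   case False
   hence a0: "a > 0" and xr: "dist y x > r" using a by auto
   define A where "A = a * r ^ (2 * k)"
   have A0: "A > 0" using a0 assms by (simp add: A_def)
   define b where "b z = A * (1 / ((norm (z - y))^2) ^ k) - A / (2 * R) ^ (2 * k)" for z
   have b_le: "b z \<le> a" if "dist y z \<ge> r" for z
   proof -
    have "norm (z - y) \<ge> r" using that by (simp add: dist_norm norm_minus_commute)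
    hence "norm (z - y) ^ (2 * k) \<ge> r ^ (2 * k)" using assms by (intro power_mono) auto
    hence "A * (1 / norm (z - y) ^ (2 * k)) \<le> A * (1 / r ^ (2 * k))"
     using A0 assms by (intro mult_left_mono frac_le) auto
    also have "... = a" using assms by (simp add: A_def)
    finally have "A * (1 / norm (z - y) ^ (2 * k)) \<le> a" .
    moreover have "A / (2 * R) ^ (2 * k) \<ge> 0" using A0 assms by auto
    ultimately show ?thesis unfolding b_def by (simp add: power_mult[symmetric])
   qed
   define K where "K = S \<inter> cball y (2 * R) \<inter> - ball y r"
   have "0 \<le> f x - b x"
   proof (rule comparison_compact[of K "\<lambda>x. f x - b x"])
    show "compact K" unfolding K_def
     by (intro closed_Int_compact compact_Int_closed S) auto
    have "norm (z - y) \<noteq> 0" if "z \<in> K" for z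
     using that assms(1) unfolding K_def by auto
    thus "continuous_on K (\<lambda>x. f x - b x)" unfolding b_def
     by (intro continuous_intros continuous_on_subset[OF cf]) (auto simp: K_def)
    show "x \<in> K" using x xr assms by (auto simp: K_def)
    fix z assume z: "z \<in> K" "f z - b z < 0"
    have zS: "z \<in> S" "dist y z \<le> 2 * R" "dist y z \<ge> r" using z by (auto simp: K_def)
    have fzb: "f z < b z" "b z \<le> a" using b_le[of z] zS z by auto
    have "z \<in> interior S"
    proof (rule ccontr)
     assume "z \<notin> interior S"
     hence "f z \<ge> a" using fr zS by auto
     thus False using fzb by linarith
    qed
    moreover have "dist y z \<noteq> r"
    proof
     assume "dist y z = r"
     hence "f z \<ge> a" using fb zS by auto
     thus False using fzb by linarith
    qed
    moreover have "dist y z \<noteq> 2 * R"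
    proof
     assume "dist y z = 2 * R"
     hence "norm (z - y) = 2 * R" by (simp add: dist_norm norm_minus_commute)
     hence "b z = 0" unfolding b_def power_mult[symmetric] by (simp del: power_mult_distrib)
     moreover have "f z \<ge> 0" using f0 zS by auto
     ultimately show False using fzb by linarith
    qed
    ultimately have "z \<in> interior S \<inter> ball y (2 * R) \<inter> - cball y r" using zS by auto
    moreover have "interior S \<inter> ball y (2 * R) \<inter> - cball y r \<subseteq> interior K"
    proof (rule interior_maximal)
     show "interior S \<inter> ball y (2 * R) \<inter> - cball y r \<subseteq> K"
      unfolding K_def using interior_subset by fastforce
    qed (auto intro!: open_Int)
    ultimately have int: "z \<in> interior K" "z \<in> interior S" by auto
    then obtain g l where gl: "jet2 f z g l" "l \<le> C * f z" using lap by auto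
    define rho where "rho = (norm (z - y))^2"
    have nz: "norm (z - y) = dist y z" by (simp add: dist_norm norm_minus_commute)
    have rho: "rho > 0" "rho \<le> 4 * R^2"
    proof -
     have "norm (z - y) > 0" using nz zS assms by linarith
     thus "rho > 0" by (simp add: rho_def)
     have "rho \<le> (2 * R)^2" unfolding rho_def nz using zS assms by (intro power_mono) auto
     thus "rho \<le> 4 * R^2" by (simp add: power_mult_distrib)
    qed
    have P: "\<forall>\<^sub>F q in nhds rho. ((\<lambda>q. 1 / q ^ k) has_real_derivative (- real k / q ^ (k + 1))) (at q)"
    proof -
     have "\<forall>\<^sub>F q in nhds rho. q > (0::real)" using rho(1) eventually_nhds_in_open[of "{0<..}" rho] by simp
     thus ?thesis
      by eventually_elim (use has_real_derivative_inverse_power[of _ 1 k] in auto)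
    qed
    have P1: "((\<lambda>q. - real k / q ^ (k + 1)) has_real_derivative (real k * (k + 1) / rho ^ (k + 2))) (at rho)"
     using has_real_derivative_inverse_power[of rho "- real k" "k + 1"] rho by (simp add: mult_ac)
    note j = jet2_radial[where P="\<lambda>q. 1 / q ^ k" and x=z and c=y, folded rho_def, OF P P1]
    have jb: "jet2 b z (\<lambda>i. A * ((- real k / rho ^ (k + 1)) * (2 * ((z - y) \<bullet> i))) - 0)
      (A * (4 * (real k * (k + 1) / rho ^ (k + 2)) * rho + (2 * real DIM('a)) * (- real k / rho ^ (k + 1))) - 0)"
     unfolding b_def using jet2_diff[OF jet2_cmult[OF j, of A] jet2_const[of "A / (2 * R) ^ (2 * k)"]] by simp
    have "A * (4 * (real k * (k + 1) / rho ^ (k + 2)) * rho + (2 * real DIM('a)) * (- real k / rho ^ (k + 1))) - 0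
      = A * (real k * (4 * real k + 4 - 2 * real n)) / rho ^ (k + 1)"
    proof -
     have "4 * (real k * (k + 1) / rho ^ (k + 2)) * rho = 4 * (real k * (k + 1) * (1 / rho ^ (k + 1)))"
      using rho by simp
     moreover have "A * (T + 2 * D * (- real k / Y)) - 0 = A * (real k * (4 * real k + 4 - 2 * D)) / Y"
      if "T = 4 * (real k * (k + 1) * (1 / Y))" for T D Y :: real
      unfolding that by (simp add: diff_divide_distrib add_divide_distrib algebra_simps)
     ultimately show ?thesis unfolding n_def by blast
    qed
    also have "... \<ge> A * ((C + 1) * rho) / rho ^ (k + 1)"
    proof (intro divide_right_mono mult_left_mono)
     have "(C + 1) * rho \<le> (C + 1) * (4 * R^2)" using rho assms by (intro mult_left_mono) auto
     thus "(C + 1) * rho \<le> real k * (4 * real k + 4 - 2 * real n)" using k3 by linarith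
    qed (use A0 rho in auto)
    also have "A * ((C + 1) * rho) / rho ^ (k + 1) = (C + 1) * (A * (1 / rho ^ k))"
     using rho by (simp add: divide_simps)
    finally have lb: "(C + 1) * (A * (1 / rho ^ k)) \<le>
     A * (4 * (real k * (k + 1) / rho ^ (k + 2)) * rho + (2 * real DIM('a)) * (- real k / rho ^ (k + 1))) - 0" .
    have "C * f z \<le> C * b z" using z assms by (intro mult_left_mono) auto
    also have "... \<le> C * (A * (1 / rho ^ k))"
     unfolding b_def rho_def using assms A0 by (intro mult_left_mono) auto
    also have "... < (C + 1) * (A * (1 / rho ^ k))"
     using A0 rho by (intro mult_strict_right_mono) auto
    finally have "l < A * (4 * (real k * (k + 1) / rho ^ (k + 2)) * rho + (2 * real DIM('a)) * (- real k / rho ^ (k + 1))) - 0"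
     using lb gl(2) by linarith
    thus "z \<in> interior K \<and> (\<exists>g l. jet2 (\<lambda>x. f x - b x) z g l \<and> l < 0)"
     using int by (intro conjI exI, simp) (rule jet2_diff[OF gl(1) jb], linarith)
   qed
   moreover have "b x \<ge> \<theta> * a"
   proof -
    have R0: "R > 0" using assms by linarith
    have nx: "norm (x - y) \<le> R" "norm (x - y) > 0" using x xr assms by (auto simp: dist_norm norm_minus_commute)
    have "norm (x - y) ^ (2 * k) \<le> R ^ (2 * k)" using nx by (intro power_mono) auto
    hence "A * (1 / R ^ (2 * k)) \<le> A * (1 / norm (x - y) ^ (2 * k))"
     using A0 nx by (intro mult_left_mono frac_le) auto
    moreover have "A / (2 * R) ^ (2 * k) \<le> A / (2 * R ^ (2 * k))"
    proof (intro divide_left_mono)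
     have "(2::real) ^ 1 \<le> 2 ^ (2 * k)" using k1 by (intro power_increasing) auto
     thus "2 * R ^ (2 * k) \<le> (2 * R) ^ (2 * k)" using R0 by (simp add: power_mult_distrib)
    qed (use A0 R0 in auto)
    ultimately have "b x \<ge> A * (1 / R ^ (2 * k)) - A / (2 * R ^ (2 * k))"
     unfolding b_def by (simp add: power_mult[symmetric])
    also have "A * (1 / R ^ (2 * k)) - A / (2 * R ^ (2 * k)) = (r / R) ^ (2 * k) / 2 * a"
     using R0 by (simp add: A_def power_divide field_simps)
    also have "... \<ge> \<theta> * a" using a by (intro mult_right_mono) (auto simp: \<theta>_def)
    finally show ?thesis .
   qed
   ultimately show ?thesis by simp
  qed
 qed
qed

section \<open>Barriers for the overdetermined problem\<close>

lemma has_real_derivative_powr_diff: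
 assumes "q < (S::real)"
 shows "((\<lambda>q. a * (S - q) powr r) has_real_derivative - (a * r * (S - q) powr (r - 1))) (at q)"
proof -
 have "((\<lambda>q. (S - q) powr r) has_real_derivative (r * (S - q) powr (r - 1)) * (- 1)) (at q)"
  by (rule DERIV_chain2[OF has_real_derivative_powr]) (use assms in \<open>auto intro!: derivative_eq_intros\<close>)
 from DERIV_cmult[OF this, of a] show ?thesis by (simp add: mult_ac)
qed

text \<open>Of the potential only what the barriers use is kept: a Lipschitz bound on
  \<open>[0, 1]\<close>, the sign inside, linear decrease near 0, uniform monotonicity near 1 and
  superlinear growth above 1. \<open>G\<close> is the gradient together with its continuous
  extension to the closed epigraph.\<close>

locale overdetermined =
 fixes \<phi> :: "'a::euclidean_space \<Rightarrow> real" and D\<phi> :: "'a \<Rightarrow> 'a" and L :: real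
  and W' :: "real \<Rightarrow> real" and u :: "'a \<times> real \<Rightarrow> real" and G :: "'a \<times> real \<Rightarrow> 'a \<times> real"
  and c C0 \<gamma> \<kappa> eps0 s0 p cp :: real
 assumes phi_lipschitz: "L-lipschitz_on UNIV \<phi>"
  and D\<phi>: "\<And>x. (\<phi> has_derivative (\<lambda>h. D\<phi> x \<bullet> h)) (at x)" and D\<phi>_cont: "continuous_on UNIV D\<phi>"
  and u_C2: "C_k_on 2 {x. snd x > \<phi> (fst x)} u"
  and u_cont: "continuous_on {x. snd x \<ge> \<phi> (fst x)} u"
  and G_cont: "continuous_on {x. snd x \<ge> \<phi> (fst x)} G"
  and G_grad: "\<And>x b. snd x > \<phi> (fst x) \<Longrightarrow> b \<in> Basis \<Longrightarrow> partial_deriv b u x = G x \<bullet> b"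
  and u_eq: "\<And>x. snd x > \<phi> (fst x) \<Longrightarrow> laplacian u x = W' (u x)"
  and u_pos: "\<And>x. snd x > \<phi> (fst x) \<Longrightarrow> u x > 0"
  and u_bdry: "\<And>x. snd x = \<phi> (fst x) \<Longrightarrow> u x = 0"
  and u_normal: "\<And>x. snd x = \<phi> (fst x) \<Longrightarrow> has_outer_normal_derivative u c x
     ((1 / sqrt (1 + (norm (D\<phi> (fst x)))^2)) *\<^sub>R (D\<phi> (fst x), -1))"
  and W'_1: "W' 1 = 0" and W'_neg: "\<And>s. 0 < s \<Longrightarrow> s < 1 \<Longrightarrow> W' s < 0"
  and W'_lipschitz: "C0-lipschitz_on {0..1} W'"
  and \<gamma>: "0 < \<gamma>" "\<gamma> < 1" and \<kappa>: "\<kappa> > 0"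
  and W'_mono: "\<And>s r. \<gamma> \<le> s \<Longrightarrow> s \<le> r \<Longrightarrow> r \<le> 1 \<Longrightarrow> W' r - W' s \<ge> \<kappa> * (r - s)"
  and eps0: "eps0 > 0" and s0: "s0 > 0"
  and W'_0: "\<And>s. 0 \<le> s \<Longrightarrow> s \<le> s0 \<Longrightarrow> W' s \<le> - eps0 * s"
  and p: "p > 1" and cp: "cp > 0" and W'_big: "\<And>s. s > 1 \<Longrightarrow> W' s \<ge> cp * (s - 1) powr p"
begin

text \<open>Vertical height above the boundary. Because \<open>\<phi>\<close> is Lipschitz, it is
  comparable with the distance to the boundary, and it behaves simply under vertical shifts.\<close>

definition dd :: "'a \<times> real \<Rightarrow> real" where "dd x = snd x - \<phi> (fst x)"
definition Om :: "('a \<times> real) set" where "Om = {x. dd x > 0}"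
definition Cl :: "('a \<times> real) set" where "Cl = {x. dd x \<ge> 0}"

lemma L0: "L \<ge> 0" and C0: "C0 \<ge> 0"
 using phi_lipschitz W'_lipschitz by (auto dest: lipschitz_on_nonneg)

lemma lip: "\<bar>\<phi> x - \<phi> y\<bar> \<le> L * norm (x - y)"
 using lipschitz_onD[OF phi_lipschitz, of x y] by (simp add: dist_norm)

lemma W'_lip: "0 \<le> s \<Longrightarrow> s \<le> 1 \<Longrightarrow> 0 \<le> r \<Longrightarrow> r \<le> 1 \<Longrightarrow> \<bar>W' s - W' r\<bar> \<le> C0 * \<bar>s - r\<bar>"
 using lipschitz_onD[OF W'_lipschitz, of s r] by (simp add: dist_norm)

lemma phi_cont: "continuous_on S \<phi>"
 by (intro continuous_at_imp_continuous_on ballI has_derivative_continuous[OF D\<phi>])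

lemma dd_cont: "continuous_on S dd"
 unfolding dd_def by (intro continuous_intros continuous_on_compose2[OF phi_cont[of UNIV]]) auto

lemma Om_Cl: "Om \<subseteq> Cl" "x \<in> Om \<Longrightarrow> x \<in> Cl" by (auto simp: Om_def Cl_def)

lemma open_Om: "open Om"
 unfolding Om_def by (rule open_Collect_less) (auto intro: dd_cont)

lemma closed_Cl: "closed Cl"
 unfolding Cl_def by (rule closed_Collect_le) (auto intro: dd_cont)

lemma dd_add: "dd (x + (tau, s)) \<ge> dd x + s - L * norm tau"
 using lip[of "fst x + tau" "fst x"] by (simp add: dd_def)

lemma dd_up [simp]: "dd (x + (0, s)) = dd x + s"
 by (simp add: dd_def)

lemma dd_lip: "\<bar>dd x - dd y\<bar> \<le> (1 + L) * norm (x - y)"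
proof -
 have "\<bar>snd x - snd y\<bar> \<le> norm (x - y)" "norm (fst x - fst y) \<le> norm (x - y)"
  using norm_snd_le[of "snd (x - y)" "fst (x - y)"] norm_fst_le[of "fst (x - y)" "snd (x - y)"]
  by (simp_all del: fst_diff snd_diff) (simp_all only: fst_diff snd_diff real_norm_def)
 moreover from this have "L * norm (fst x - fst y) \<le> L * norm (x - y)"
  using L0 by (intro mult_left_mono)
 moreover have "(1 + L) * norm (x - y) = norm (x - y) + L * norm (x - y)"
  by (simp add: distrib_right)
 ultimately show ?thesis using lip[of "fst x" "fst y"] unfolding dd_def by linarith
qed

lemma Cl_interior: "interior Cl = Om"
proof
 show "interior Cl \<subseteq> Om"
 proof
  fix x assume x: "x \<in> interior Cl"
  then obtain e where e: "e > 0" "ball x e \<subseteq> Cl" using mem_interior by blast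
  have "x + (0, - e / 2) \<in> ball x e" using e by (simp add: dist_norm)
  hence "x + (0, - e / 2) \<in> Cl" using e by blast
  hence "dd x - e / 2 \<ge> 0" unfolding Cl_def mem_Collect_eq dd_up by linarith
  thus "x \<in> Om" using e by (simp add: Om_def)
 qed
 show "Om \<subseteq> interior Cl" by (rule interior_maximal[OF Om_Cl(1) open_Om])
qed

lemma uc: "continuous_on Cl u" and Gc: "continuous_on Cl G"
 using u_cont G_cont by (auto simp: Cl_def dd_def)

lemma u_nonneg: "x \<in> Cl \<Longrightarrow> u x \<ge> 0"
 using u_pos[of x] u_bdry[of x] by (cases "dd x = 0") (auto simp: Cl_def dd_def)

lemma u_zero: "dd x = 0 \<Longrightarrow> u x = 0" by (auto simp: dd_def intro: u_bdry)

lemma u_positive: "x \<in> Om \<Longrightarrow> u x > 0" by (auto simp: dd_def Om_def intro: u_pos)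

lemma jet_u: assumes "x \<in> Om" shows "jet2 u x (\<lambda>b. G x \<bullet> b) (W' (u x))"
proof -
 have Om: "Om = {x. snd x > \<phi> (fst x)}" by (auto simp: Om_def dd_def)
 have "jet2 u x (\<lambda>b. partial_deriv b u x) (laplacian u x)"
  by (rule jet2_C2[OF _ open_Om assms]) (use u_C2 Om in auto)
 thus ?thesis using u_eq[of x] G_grad[of x] assms unfolding Om by (auto intro: jet2_cong_grad)
qed

text \<open>Keller--Osserman: the barrier blows up on the boundary of a large ball.\<close>
lemma u_le_1: assumes x0: "x0 \<in> Cl" shows "u x0 \<le> 1"
proof (rule ccontr)
 assume neg: "\<not> u x0 \<le> 1"
 \<comment> \<open>The Laplacian of \<open>(R^2 - |y|^2) powr (- k)\<close> is of order
   \<open>powr (- k - 2)\<close>. This exponent gives \<open>k * p = k + 2\<close>, so the growth of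
   \<open>W'\<close> with power \<open>p\<close> matches it exactly.\<close>
 define k where "k = 2 / (p - 1)"
 define n where "n = real DIM('a \<times> real)"
 define Kc where "Kc = 4 * k * (k + 1) + 2 * n * k"
 have k: "k > 0" using p by (simp add: k_def)
 have n: "n \<ge> 0" by (simp add: n_def)
 have Kc: "Kc > 0" unfolding Kc_def using k n by (intro add_pos_nonneg) auto
 have kp: "k * p = k + 2" using p by (simp add: k_def field_simps)
 define C where "C = (2 * Kc / cp) powr (k / 2)"
 have Cpos: "C > 0" using Kc cp by (simp add: C_def)
 \<comment> \<open>So large that the barrier at the centre, \<open>1 + C * R powr (- k)\<close>,
   lies below \<open>u x0\<close>.\<close>
 define R where "R = (2 * C / (u x0 - 1)) powr (1 / k)"
 have R: "R > 0" using Cpos neg by (simp add: R_def)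
 have Rk: "C * R powr (- k) < u x0 - 1"
 proof -
  have "R powr (- k) = 1 / (R powr k)" by (rule powr_minus_divide)
  also have "R powr k = 2 * C / (u x0 - 1)"
   using Cpos neg k by (simp add: R_def powr_powr)
  finally have "C * R powr (- k) = (u x0 - 1) / 2" using Cpos neg by simp
  thus ?thesis using neg by simp
 qed
 define A where "A = (2 * Kc * R^2 / cp) powr (k / 2)"
 have A: "A > 0" using Kc cp R by (simp add: A_def)
 have Ap: "cp * A powr p = 2 * A * Kc * R^2"
 proof -
  have "A powr (p - 1) = 2 * Kc * R^2 / cp"
  proof -
   have "k / 2 * (p - 1) = 1" using p by (simp add: k_def)
   thus ?thesis using Kc cp R by (simp only: A_def powr_powr) simp
  qed
  hence "A powr p = A * (2 * Kc * R^2 / cp)" using A powr_add[of A 1 "p - 1"] by simp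
  thus ?thesis using cp by simp
 qed
 have A0: "A * (R^2) powr (- k) = C * R powr (- k)"
 proof -
  have R2: "R^2 = R powr 2" using R by (simp add: powr_numeral)
  have "A = C * (R^2) powr (k / 2)"
   unfolding A_def C_def using Kc cp R by (subst powr_mult[symmetric]) (auto simp: field_simps)
  also have "(R^2) powr (k / 2) = R powr k" unfolding R2 powr_powr by simp
  finally have "A * (R^2) powr (- k) = C * (R powr k * R powr (2 * (- k)))" 
   unfolding R2 powr_powr by simp
  also have "R powr k * R powr (2 * (- k)) = R powr (- k)" by (simp add: powr_add[symmetric])
  finally show ?thesis .
 qed
 have "compact (Cl \<inter> cball x0 R)" using closed_Cl by (simp add: closed_Int_compact)
 hence "bounded (u ` (Cl \<inter> cball x0 R))"
  by (intro compact_imp_bounded compact_continuous_image continuous_on_subset[OF uc]) auto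
 then obtain B where B: "\<And>y. y \<in> Cl \<inter> cball x0 R \<Longrightarrow> \<bar>u y\<bar> \<le> B" "B > 0"
  unfolding bounded_pos real_norm_def ball_simps by blast
 \<comment> \<open>Where \<open>R^2 - |y|^2 = eta\<close> the barrier is already above the bound
   \<open>B\<close> of \<open>u\<close>, so the comparison can take place on a slightly smaller ball
   on which the barrier is finite.\<close>
 define eta where "eta = min (R^2 / 2) ((A / B) powr (1 / k))"
 have eta: "eta > 0" "eta < R^2" "A * eta powr (- k) \<ge> B"
 proof -
  show "eta > 0" using R A B by (simp add: eta_def)
  show "eta < R^2" using R by (simp add: eta_def min_less_iff_disj)
  have "eta powr k \<le> ((A / B) powr (1 / k)) powr k"
   using k \<open>eta > 0\<close> by (intro powr_mono2) (auto simp: eta_def)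
  also have "... = A / B" using k A B by (simp add: powr_powr)
  finally have "B * eta powr k \<le> A" using B by (simp add: field_simps)
  thus "A * eta powr (- k) \<ge> B" using \<open>eta > 0\<close> by (simp add: powr_minus_divide field_simps)
 qed
 define R' where "R' = sqrt (R^2 - eta)"
 have R': "R'^2 = R^2 - eta" "R' \<ge> 0" "R' < R"
 proof -
  show 1: "R'^2 = R^2 - eta" "R' \<ge> 0" using eta by (auto simp: R'_def)
  show "R' < R" by (rule power_less_imp_less_base[of _ 2]) (use 1 R eta in auto)
 qed
 define U where "U y = 1 + A * (R^2 - (norm (y - x0))^2) powr (- k)" for y
 have "0 \<le> U x0 - u x0"
 proof (rule comparison_compact[of "Cl \<inter> cball x0 R'" "\<lambda>y. U y - u y"])
  show "compact (Cl \<inter> cball x0 R')" using closed_Cl by (simp add: closed_Int_compact)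
  show "x0 \<in> Cl \<inter> cball x0 R'" using x0 R' by auto
  have pos: "R^2 - (norm (y - x0))^2 > 0" if "y \<in> cball x0 R'" for y
  proof -
   have "(norm (y - x0))^2 \<le> R'^2" using that by (intro power_mono) (auto simp: dist_norm norm_minus_commute)
   thus ?thesis using R' eta by simp
  qed
  have nz: "\<forall>y\<in>Cl \<inter> cball x0 R'. R\<^sup>2 - (norm (y - x0))^2 \<noteq> 0" using pos by fastforce
  show "continuous_on (Cl \<inter> cball x0 R') (\<lambda>y. U y - u y)" unfolding U_def
   by (intro continuous_intros continuous_on_subset[OF uc]) (use nz in auto)
  fix y assume y: "y \<in> Cl \<inter> cball x0 R'" "U y - u y < 0"
  define Y where "Y = R^2 - (norm (y - x0))^2"
  have Y: "Y > 0" using pos y by (auto simp: Y_def)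
  have AY: "A * Y powr (- k) > 0" using A Y by simp
  have uy: "u y > 1 + A * Y powr (- k)" using y by (simp add: U_def Y_def)
  have "dd y \<noteq> 0" using uy AY u_zero[of y] by auto
  hence yO: "y \<in> Om" using y by (auto simp: Om_def Cl_def)
  have "norm (y - x0) \<noteq> R'"
  proof
   assume "norm (y - x0) = R'"
   hence "Y = eta" using R' by (simp add: Y_def)
   hence "u y > B" using uy eta by simp
   thus False using B(1)[of y] y R' by auto
  qed
  hence "y \<in> Om \<inter> ball x0 R'" using y yO by (auto simp: dist_norm norm_minus_commute)
  moreover have "Om \<inter> ball x0 R' \<subseteq> interior (Cl \<inter> cball x0 R')"
   by (rule interior_maximal) (use Om_Cl open_Om in auto)
  ultimately have int: "y \<in> interior (Cl \<inter> cball x0 R')" by blast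
  define rho where "rho = (norm (y - x0))^2"
  have P: "\<forall>\<^sub>F q in nhds rho. ((\<lambda>q. (R^2 - q) powr (- k)) has_real_derivative (k * (R^2 - q) powr (- k - 1))) (at q)"
  proof -
   have "\<forall>\<^sub>F q in nhds rho. q < R^2" using Y eventually_nhds_in_open[of "{..<R^2}" rho] by (simp add: Y_def rho_def)
   thus ?thesis by eventually_elim (use has_real_derivative_powr_diff[of _ "R^2" 1 "- k"] in auto)
  qed
  have P1: "((\<lambda>q. k * (R^2 - q) powr (- k - 1)) has_real_derivative (k * (k + 1) * Y powr (- k - 2))) (at rho)"
  proof -
   have "- k - 1 - 1 = - k - 2" by simp
   thus ?thesis using Y has_real_derivative_powr_diff[of rho "R^2" k "- k - 1"]
    unfolding Y_def rho_def by (simp add: algebra_simps)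
  qed
  note j = jet2_radial[where P="\<lambda>q. (R^2 - q) powr (- k)" and x=y and c=x0, folded rho_def, OF P P1]
  define lb where "lb = 0 + A * (4 * (k * (k + 1) * Y powr (- k - 2)) * rho + 2 * n * (k * (R^2 - rho) powr (- k - 1)))"
  have jU: "jet2 U y (\<lambda>b. 0 + A * (k * (R^2 - rho) powr (- k - 1) * (2 * ((y - x0) \<bullet> b)))) lb"
   unfolding U_def lb_def n_def using jet2_add[OF jet2_const[of 1] jet2_cmult[OF j, of A]] by simp
  have "lb = A * Y powr (- k - 2) * (4 * k * (k + 1) * rho + 2 * n * k * Y)"
  proof -
   have "(R^2 - rho) powr (- k - 1) = Y * Y powr (- k - 2)"
   proof -
    have "Y powr (1 + (- k - 2)) = Y powr 1 * Y powr (- k - 2)" by (rule powr_add)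
    moreover have "1 + (- k - 2) = - k - 1" by simp
    ultimately show ?thesis using Y by (simp only: Y_def rho_def) simp
   qed
   thus ?thesis unfolding lb_def by (simp add: algebra_simps)
  qed
  also have "... \<le> A * Y powr (- k - 2) * (Kc * R^2)"
  proof (rule mult_left_mono)
   have "rho \<le> R^2" "Y \<le> R^2" using Y by (auto simp: rho_def Y_def)
   hence "4 * k * (k + 1) * rho + 2 * n * k * Y \<le> 4 * k * (k + 1) * R^2 + 2 * n * k * R^2"
    using k n by (intro add_mono mult_left_mono) auto
   thus "4 * k * (k + 1) * rho + 2 * n * k * Y \<le> Kc * R^2" by (simp add: Kc_def algebra_simps)
  qed (use A in auto)
  finally have lb1: "lb \<le> A * Kc * R^2 * Y powr (- k - 2)" by (simp add: mult_ac)
  have "W' (u y) \<ge> cp * (u y - 1) powr p" using uy AY by (intro W'_big) linarith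
  moreover have "(u y - 1) powr p \<ge> (A * Y powr (- k)) powr p"
   using uy AY p by (intro powr_mono2) auto
  hence "cp * (u y - 1) powr p \<ge> cp * (A powr p * Y powr (- k - 2))"
  proof -
   have "(A * Y powr (- k)) powr p = A powr p * Y powr (- k - 2)"
    using A Y kp by (simp add: powr_mult powr_powr algebra_simps)
   thus ?thesis using cp \<open>(u y - 1) powr p \<ge> (A * Y powr (- k)) powr p\<close> by (simp add: mult_left_mono)
  qed
  moreover have "cp * (A powr p * Y powr (- k - 2)) = 2 * (A * Kc * R^2 * Y powr (- k - 2))"
   using Ap by (simp add: mult_ac)
  moreover have "A * Kc * R^2 * Y powr (- k - 2) > 0" using A Kc R Y by simp
  ultimately have "lb - W' (u y) < 0" using lb1 by linarith
  thus "y \<in> interior (Cl \<inter> cball x0 R') \<and> (\<exists>g l. jet2 (\<lambda>y. U y - u y) y g l \<and> l < 0)"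
   using int jet2_diff[OF jU jet_u[OF yO]] by blast
 qed
 thus False using Rk A0 by (simp add: U_def)
qed

lemma W'_le_0: "x \<in> Cl \<Longrightarrow> W' (u x) \<le> 0"
proof -
 assume x: "x \<in> Cl"
 have "W' 0 \<le> 0" using W'_0[of 0] s0 by simp
 moreover have "u x = 0 \<or> u x = 1 \<or> (0 < u x \<and> u x < 1)" using u_nonneg[OF x] u_le_1[OF x] by linarith
 ultimately show ?thesis using W'_1 W'_neg[of "u x"] by auto
qed


section \<open>Lower bounds of the solution away from the boundary\<close>

lemma ball_in_Om:
 assumes "dd x > (1 + L) * R" "y \<in> cball x R" shows "y \<in> Om"
proof -
 have "\<bar>dd x - dd y\<bar> \<le> (1 + L) * norm (x - y)" by (rule dd_lip)
 also have "... \<le> (1 + L) * R" using assms(2) L0 by (intro mult_left_mono) (auto simp: dist_norm)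
 finally show ?thesis using assms by (simp add: Om_def)
qed

text \<open>\<open>(R\<^sup>2 - r\<^sup>2)\<^sup>2\<close> is a strict subsolution of the linearization at \<open>0\<close> for large \<open>R\<close>; its multiples
  are swept upwards from \<open>0\<close>.\<close>
lemma deep_pos: "\<exists>a0>0. \<exists>D>0. \<forall>x. dd x \<ge> D \<longrightarrow> u x \<ge> a0"
proof -
 define n where "n = real DIM('a \<times> real)"
 \<comment> \<open>With \<open>Y = R^2 - r^2\<close> the Laplacian of \<open>Y^2\<close> is
   \<open>8 * R^2 - (8 + 4 * n) * Y\<close>. Adding \<open>eps0 * Y^2\<close> and completing the
   square shows that this radius makes the sum positive.\<close>
 define R where "R = 1 + (8 + 4 * n)^2 / (32 * eps0)"
 have R1: "R \<ge> 1" using eps0 by (simp add: R_def)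
 have R2: "R^2 > (8 + 4 * n)\<^sup>2 / (32 * eps0)"
 proof -
  have "R * 1 \<le> R * R" using R1 by (intro mult_left_mono) auto
  thus ?thesis by (simp add: R_def power2_eq_square[of "1 + _"])
 qed
 have key: "eps0 * Y^2 + 8 * R^2 - (8 + 4 * n) * Y > 0" for Y
 proof -
  have "eps0 * Y^2 - (8 + 4 * n) * Y + (8 + 4 * n)^2 / (4 * eps0) = eps0 * (Y - (8 + 4 * n) / (2 * eps0))^2"
   using eps0 by (simp add: power2_eq_square field_simps)
  hence "eps0 * Y^2 - (8 + 4 * n) * Y + (8 + 4 * n)^2 / (4 * eps0) \<ge> 0" using eps0 by simp
  moreover have "8 * ((8 + 4 * n)^2 / (32 * eps0)) = (8 + 4 * n)^2 / (4 * eps0)" by simp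
  ultimately show ?thesis using R2 by linarith
 qed
 have Dpos: "(1 + L) * R + 1 > 0" using L0 R1 by (intro add_nonneg_pos) auto
 have "\<forall>x0. (1 + L) * R + 1 \<le> dd x0 \<longrightarrow> s0 \<le> u x0"
 proof (intro allI impI)
  fix x0 assume x0: "(1 + L) * R + 1 \<le> dd x0"
  have sub: "y \<in> Om" if "y \<in> cball x0 R" for y using ball_in_Om[OF _ that] x0 by simp
  define \<Psi> where "\<Psi> y = (R^2 - (norm (y - x0))^2)^2" for y
  have cont: "continuous_on (cball x0 R) (\<lambda>y. \<Psi> y / u y)" unfolding \<Psi>_def
   by (intro continuous_intros continuous_on_subset[OF uc]) (use sub Om_Cl u_positive in fastforce)+
  \<comment> \<open>A maximum of \<open>\<Psi> / u\<close> is a point where the largest multiple of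
    \<open>\<Psi>\<close> below \<open>u\<close> touches \<open>u\<close>.\<close>
  obtain x where x: "x \<in> cball x0 R" "\<And>y. y \<in> cball x0 R \<Longrightarrow> \<Psi> y / u y \<le> \<Psi> x / u x"
   using continuous_attains_sup[OF _ _ cont] R1 by auto
  have x0b: "x0 \<in> cball x0 R" using R1 by simp
  have "\<Psi> x0 / u x0 > 0" using u_positive[OF sub[OF x0b]] R1 by (simp add: \<Psi>_def)
  hence "\<Psi> x / u x > 0" using x(2)[OF x0b] by linarith
  hence Psix: "\<Psi> x > 0" using u_positive[OF sub[OF x(1)]] by (simp add: zero_less_divide_iff)
  define m where "m = u x / \<Psi> x"
  have m: "m > 0" using Psix u_positive[OF sub[OF x(1)]] by (simp add: m_def)
  have um: "u y \<ge> m * \<Psi> y" if "y \<in> cball x0 R" for y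
   using x(2)[OF that] u_positive[OF sub[OF that]] u_positive[OF sub[OF x(1)]] Psix
   by (simp add: m_def field_simps)
  have ux: "u x = m * \<Psi> x" using Psix by (simp add: m_def)
  show "s0 \<le> u x0"
  proof (rule ccontr)
   assume "\<not> s0 \<le> u x0"
   \<comment> \<open>\<open>m * \<Psi>\<close> is largest at the centre, so all its values are below
     \<open>s0\<close> and the linear bound \<open>W'_0\<close> is available at the touching
     point.\<close>
   hence mR: "m * (R^2)^2 < s0" using um[OF x0b] by (simp add: \<Psi>_def)
   define Y where "Y = R^2 - (norm (x - x0))^2"
   have nx: "norm (x - x0) \<le> R" using x(1) by (simp add: dist_norm norm_minus_commute)
   have "(norm (x - x0))^2 \<le> R^2" using nx by (intro power_mono) auto
   hence Y: "Y > 0" "Y \<le> R^2" using Psix by (auto simp: \<Psi>_def Y_def less_le)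
   have "Y^2 \<le> (R^2)^2" using Y by (intro power_mono) auto
   hence "m * Y^2 \<le> s0" using mR m by (meson less_imp_le mult_left_mono order_trans)
   hence W: "W' (u x) \<le> - eps0 * (m * Y^2)" unfolding ux \<Psi>_def Y_def[symmetric]
    using m by (intro W'_0) auto
   have j: "jet2 \<Psi> x (\<lambda>b. (-2 * Y) * (2 * ((x - x0) \<bullet> b))) (4 * 2 * (norm (x - x0))^2 + 2 * n * (-2 * Y))"
    unfolding \<Psi>_def Y_def n_def
    by (rule jet2_radial[where P="\<lambda>q. (R^2 - q)^2" and ?P1.0="\<lambda>q. - 2 * (R^2 - q)"])
     (auto intro!: derivative_eq_intros always_eventually)
   have "x \<in> ball x0 R"
   proof -
    have "norm (x - x0) \<noteq> R" using Y by (auto simp: Y_def)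
    thus ?thesis using nx by (simp add: dist_norm norm_minus_commute)
   qed
   hence "\<forall>\<^sub>F y in nhds x. y \<in> ball x0 R" by (intro eventually_nhds_in_open) auto
   hence ev: "\<forall>\<^sub>F y in nhds x. u y - m * \<Psi> y \<ge> u x - m * \<Psi> x"
    by eventually_elim (use um ux in auto)
   have "0 \<le> W' (u x) - m * (4 * 2 * (norm (x - x0))^2 + 2 * n * (-2 * Y))"
    by (rule jet2_local_min(1)[OF jet2_diff[OF jet_u[OF sub[OF x(1)]] jet2_cmult[OF j]] ev])
   also have "... \<le> - m * (eps0 * Y^2 + 8 * R^2 - (8 + 4 * n) * Y)"
    using W by (simp add: Y_def algebra_simps)
   also have "... < 0" using key[of Y] m by simp
   finally show False by simp
  qed
 qed
 thus ?thesis using s0 Dpos by blast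
qed

text \<open>Deep inside \<open>u \<ge> a0\<close>, and between \<open>a1\<close> and
  \<open>1 - \<delta>\<close> the nonlinearity is at most \<open>- k0 < 0\<close>. Hence
  \<open>u\<close> plus a paraboloid of Laplacian below \<open>k0\<close> has no interior minimum
  where \<open>u < 1 - \<delta>\<close>, and on a large ball the paraboloid wins on the
  sphere.\<close>

lemma deep_limit: assumes "\<delta> > 0" shows "\<exists>D>0. \<forall>x. dd x \<ge> D \<longrightarrow> u x \<ge> 1 - \<delta>"
proof (cases "\<delta> < 1")
 case False
 have "1 - \<delta> \<le> u x" if "dd x \<ge> 1" for x
  using False u_nonneg[of x] that by (simp add: Cl_def)
 thus ?thesis by (intro exI[of _ 1]) simp
next
 case True
 obtain a0 D where a0: "a0 > 0" "D > 0" "\<And>x. dd x \<ge> D \<Longrightarrow> u x \<ge> a0" using deep_pos by blast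
 define a1 where "a1 = min a0 (1 - \<delta>)"
 have a1: "a1 > 0" "a1 \<le> a0" "a1 \<le> 1 - \<delta>" using a0 True by (auto simp: a1_def)
 have "continuous_on {a1..1 - \<delta>} W'"
  unfolding continuous_on_iff
 proof (intro ballI allI impI)
  fix x e :: real assume x: "x \<in> {a1..1 - \<delta>}" and e: "0 < e"
  show "\<exists>d>0. \<forall>x'\<in>{a1..1 - \<delta>}. dist x' x < d \<longrightarrow> dist (W' x') (W' x) < e"
  proof (intro exI[of _ "e / (C0 + 1)"] conjI ballI impI)
   show "e / (C0 + 1) > 0" using e C0 by simp
   fix x' assume x': "x' \<in> {a1..1 - \<delta>}" "dist x' x < e / (C0 + 1)"
   have "\<bar>W' x' - W' x\<bar> \<le> C0 * \<bar>x' - x\<bar>" using x x' a1 assms by (intro W'_lip) auto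
   also have "... \<le> (C0 + 1) * \<bar>x' - x\<bar>" by (intro mult_right_mono) auto
   also have "... < e" using x' C0 by (simp add: dist_real_def field_simps)
   finally show "dist (W' x') (W' x) < e" by (simp add: dist_real_def)
  qed
 qed
 then obtain sm where sm: "sm \<in> {a1..1 - \<delta>}" "\<And>s. s \<in> {a1..1 - \<delta>} \<Longrightarrow> W' s \<le> W' sm"
  using continuous_attains_sup[of "{a1..1 - \<delta>}" W'] a1 by auto
 define k0 where "k0 = - W' sm"
 have k0: "k0 > 0" using W'_neg[of sm] sm a1 assms by (auto simp: k0_def)
 define n where "n = real DIM('a \<times> real)"
 have n: "n > 0" by (simp add: n_def)
 \<comment> \<open>Laplacian \<open>2 * n * A\<close> below \<open>k0\<close>; the radius defined
   next makes the paraboloid gain at least 1 on the sphere.\<close>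
 define A where "A = k0 / (4 * n)"
 have A: "A > 0" "2 * n * A < k0" using k0 n by (auto simp: A_def)
 define R where "R = 1 + 1 / A"
 have R: "R \<ge> 1" "A * R^2 \<ge> 1"
 proof -
  show 1: "R \<ge> 1" using A by (simp add: R_def)
  have "A * (R * 1) \<le> A * (R * R)" using A 1 by (intro mult_left_mono) auto
  moreover have "A * R \<ge> 1" using A by (simp add: R_def distrib_left)
  ultimately show "A * R^2 \<ge> 1" by (simp add: power2_eq_square)
 qed
 show ?thesis
 proof (intro exI[of _ "D + (1 + L) * R"] conjI allI impI)
  show "0 < D + (1 + L) * R" using a0 L0 R by (intro add_pos_nonneg) auto
  fix x0 assume x0: "D + (1 + L) * R \<le> dd x0"
  have sub: "y \<in> Om" "u y \<ge> a0" if "y \<in> cball x0 R" for y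
  proof -
   show "y \<in> Om" using ball_in_Om[OF _ that] x0 a0 by simp
   have "\<bar>dd x0 - dd y\<bar> \<le> (1 + L) * norm (x0 - y)" by (rule dd_lip)
   also have "... \<le> (1 + L) * R" using that L0 by (intro mult_left_mono) (auto simp: dist_norm)
   finally show "u y \<ge> a0" using x0 by (intro a0(3)) linarith
  qed
  define f where "f y = u y + A * (norm (y - x0))^2 - (1 - \<delta>)" for y
  have "0 \<le> f x0"
  proof (rule comparison_compact[of "cball x0 R" f])
   show "continuous_on (cball x0 R) f" unfolding f_def
    by (intro continuous_intros continuous_on_subset[OF uc]) (use sub Om_Cl in auto)
   show "x0 \<in> cball x0 R" using R by simp
   fix x assume x: "x \<in> cball x0 R" "f x < 0"
   have nn: "A * (norm (x - x0))^2 \<ge> 0" using A by simp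
   have ux: "a0 \<le> u x" "u x < 1 - \<delta>" using sub[OF x(1)] x(2) nn unfolding f_def by linarith+
   have "norm (x - x0) \<noteq> R"
   proof
    assume "norm (x - x0) = R"
    thus False using x(2) R(2) ux a0 a1 assms by (simp add: f_def)
   qed
   hence "x \<in> ball x0 R" using x(1) by (simp add: dist_norm norm_minus_commute)
   hence int: "x \<in> interior (cball x0 R)" by simp
   have "W' (u x) \<le> - k0" using sm(2)[of "u x"] ux a1 by (simp add: k0_def)
   hence "W' (u x) + A * (2 * DIM('a \<times> real)) - 0 < 0" using A by (simp add: n_def mult_ac)
   moreover have "jet2 f x (\<lambda>b. G x \<bullet> b + A * (2 * ((x - x0) \<bullet> b)) - 0) (W' (u x) + A * (2 * DIM('a \<times> real)) - 0)"
    unfolding f_def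
    by (intro jet2_diff jet2_add jet2_cmult jet2_sqnorm jet2_const jet_u sub(1)[OF x(1)])
   ultimately show "x \<in> interior (cball x0 R) \<and> (\<exists>g l. jet2 f x g l \<and> l < 0)" using int by blast
  qed auto
  thus "1 - \<delta> \<le> u x0" by (simp add: f_def)
 qed
qed

text \<open>The barrier is a power of the quadratic form \<open>y\<^sub>n\<^sup>2 - \<Lambda>\<^sup>2 \<bar>y'\<bar>\<^sup>2\<close>, subharmonic in the cone where the form is
  positive.\<close>
lemma pos_height: assumes "s > 0" shows "\<exists>c0>0. \<forall>x. dd x \<ge> s \<longrightarrow> u x \<ge> c0"
proof -
 obtain a0 D where a0: "a0 > 0" "D > 0" "\<And>x. dd x \<ge> D \<Longrightarrow> u x \<ge> a0" using deep_pos by blast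
 define n where "n = real DIM('a \<times> real)"
 \<comment> \<open>The cone \<open>l \<ge> \<Lambda> * |y' - q'|\<close> is steeper than the
   boundary, so on its top \<open>l = H = \<Lambda> * D\<close> the height is at least
   \<open>H - L * H / \<Lambda> = D\<close>.\<close>
 define \<Lambda> where "\<Lambda> = L + 1"
 have Lam: "\<Lambda> \<ge> 1" using L0 by (simp add: \<Lambda>_def)
 define H where "H = \<Lambda> * D"
 have H: "H \<ge> D" "H > 0" using Lam a0 by (auto simp: H_def)
 \<comment> \<open>The quadratic form satisfies \<open>|grad Q|^2 \<ge> 4 * Q\<close>, and its
   Laplacian is at least \<open>- 2 * n * \<Lambda>^2\<close>. With this exponent the gradient term
   in the Laplacian of \<open>Q ^ m\<close> prevails.\<close>
 define m where "m = nat \<lceil>n * \<Lambda>^2\<rceil> + 2"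
 have m: "real m - 1 \<ge> n * \<Lambda>^2" "m \<ge> 2" unfolding m_def by linarith+
 define eps where "eps = a0 / (H^2) ^ m"
 have eps: "eps > 0" using a0 H by (simp add: eps_def)
 define c0 where "c0 = min a0 (eps * (s^2) ^ m)"
 show ?thesis
 proof (intro exI[of _ c0] conjI allI impI)
  show "c0 > 0" using a0 eps assms by (simp add: c0_def)
  fix x assume x: "s \<le> dd x"
  show "c0 \<le> u x"
  proof (cases "s \<ge> H")
   case True
   thus ?thesis using a0(3)[of x] x H by (simp add: c0_def)
  next
   case sH: False
   \<comment> \<open>The apex sits at depth \<open>s\<close> below \<open>x\<close>, still in the
     closed epigraph. Then \<open>Q x = s^2\<close>, a value that does not depend on
     \<open>x\<close>.\<close>
   define q where "q = x - (0, s)"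
   have ddq: "dd q \<ge> 0" using x by (simp add: q_def dd_def)
   define e where "e = (0 :: 'a, 1 :: real)"
   define l where "l y = y \<bullet> e - q \<bullet> e" for y
   have l_snd: "l y = snd y - snd q" for y by (simp add: l_def e_def inner_prod_def)
   define Q where "Q y = (1 + \<Lambda>^2) * (l y * l y) - \<Lambda>^2 * (norm (y - q))^2" for y
   have nsq: "(norm (y - q))^2 = (norm (fst y - fst q))^2 + (l y)^2" for y
    by (simp add: l_snd norm_prod_def)
   have Q: "Q y = (l y)^2 - (\<Lambda> * norm (fst y - fst q))^2" for y
    unfolding Q_def nsq by (simp add: power2_eq_square algebra_simps)
   define K where "K = {y. l y \<ge> \<Lambda> * norm (fst y - fst q)} \<inter> {y. l y \<le> H}"
   have cl: "continuous_on S l" for S unfolding l_def by (intro continuous_intros)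
   have ddK: "dd y \<ge> l y - L * norm (fst y - fst q)" for y
    using dd_add[of q "snd y - snd q" "fst y - fst q"] ddq by (cases y; cases q) (simp add: l_snd)
   have KCl: "K \<subseteq> Cl"
   proof
    fix y assume y: "y \<in> K"
    have "L * norm (fst y - fst q) \<le> \<Lambda> * norm (fst y - fst q)"
     by (intro mult_right_mono) (auto simp: \<Lambda>_def)
    thus "y \<in> Cl" using ddK[of y] y by (simp add: K_def Cl_def)
   qed
   have "0 \<le> u x - eps * Q x ^ m"
   proof (rule comparison_compact[of K "\<lambda>y. u y - eps * Q y ^ m"])
    have "closed K" unfolding K_def
     by (intro closed_Int closed_Collect_le continuous_intros cl)
    moreover have "K \<subseteq> cball q (2 * H)"
    proof
     fix y assume y: "y \<in> K"
     have "norm (fst y - fst q) \<le> \<Lambda> * norm (fst y - fst q)" using Lam by (simp add: mult_le_cancel_right1)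
     hence "norm (fst y - fst q) \<le> H" "l y \<ge> 0" "l y \<le> H" using y norm_ge_zero[of "fst y - fst q"]
      unfolding K_def Int_iff mem_Collect_eq by linarith+
     hence "(norm (fst y - fst q))^2 \<le> H^2" "(l y)^2 \<le> H^2" by (simp_all add: power_mono)
     hence "(norm (y - q))^2 \<le> 4 * H^2" unfolding nsq using zero_le_power2[of H] by linarith
     hence "(norm (y - q))^2 \<le> (2 * H)^2" by (simp add: power_mult_distrib)
     hence "norm (y - q) \<le> 2 * H" by (rule power2_le_imp_le) (use H in simp)
     thus "y \<in> cball q (2 * H)" by (simp add: dist_norm norm_minus_commute)
    qed
    ultimately show "compact K"
     by (simp add: compact_eq_bounded_closed bounded_subset[OF bounded_cball])
    show "continuous_on K (\<lambda>y. u y - eps * Q y ^ m)" unfolding Q_def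
     by (intro continuous_intros cl continuous_on_subset[OF uc KCl])
    show "x \<in> K" using sH assms by (simp add: K_def l_snd q_def)
    fix y assume y: "y \<in> K" "u y - eps * Q y ^ m < 0"
    have ly: "l y \<ge> \<Lambda> * norm (fst y - fst q)" "l y \<le> H" using y(1) by (auto simp: K_def)
    have Ln: "\<Lambda> * norm (fst y - fst q) \<ge> 0" using Lam by simp
    have Q0: "Q y \<ge> 0" unfolding Q using ly Ln by (simp add: power_mono)
    have ub: "u y < eps * Q y ^ m" using y by simp
    have yCl: "y \<in> Cl" using y KCl by blast
    have "Q y \<noteq> 0" using ub u_nonneg[OF yCl] m by (auto simp: zero_power)
    hence Qp: "Q y > 0" using Q0 by simp
    have lyn: "l y > \<Lambda> * norm (fst y - fst q)"
     using Qp ly Ln unfolding Q by (cases "l y = \<Lambda> * norm (fst y - fst q)") auto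
    have lyH: "l y < H"
    proof (rule ccontr)
     assume "\<not> l y < H"
     hence lH: "l y = H" using ly by simp
     have "L * norm (fst y - fst q) \<le> L * (H / \<Lambda>)"
      using ly lH Lam L0 by (intro mult_left_mono) (auto simp: field_simps)
     moreover have "H / \<Lambda> = D" using Lam by (simp add: H_def)
     moreover have "H - L * D = D" by (simp add: H_def \<Lambda>_def algebra_simps)
     ultimately have "u y \<ge> a0" using ddK[of y] lH by (intro a0(3)) simp
     moreover have "Q y \<le> H^2" unfolding Q using lH by simp
     hence "Q y ^ m \<le> (H^2) ^ m" using Q0 by (intro power_mono) auto
     hence "eps * Q y ^ m \<le> a0" using a0 H by (simp add: eps_def divide_le_eq mult_left_mono)
     ultimately show False using ub by linarith
    qed
    have "L * norm (fst y - fst q) \<le> \<Lambda> * norm (fst y - fst q)"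
     by (intro mult_right_mono) (auto simp: \<Lambda>_def)
    hence yO: "y \<in> Om" using ddK[of y] lyn by (simp add: Om_def)
    have "{y. \<Lambda> * norm (fst y - fst q) < l y} \<inter> {y. l y < H} \<subseteq> interior K"
     by (rule interior_maximal, force simp: K_def)
       (intro open_Int open_Collect_less continuous_intros cl)
    hence int: "y \<in> interior K" using lyn lyH by blast
    have jl: "jet2 l y (\<lambda>b. b \<bullet> e - 0) (0 - 0)" unfolding l_def
     by (intro jet2_diff jet2_inner jet2_const)
    have ee: "(\<Sum>b\<in>Basis. (b \<bullet> e) * (b \<bullet> e)) = 1"
    proof -
     have "(\<Sum>b\<in>Basis. (b \<bullet> e) * (b \<bullet> e)) = e \<bullet> e"
      by (subst euclidean_inner) (simp add: inner_commute)
     thus ?thesis by (simp add: e_def inner_prod_def)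
    qed
    define gq where "gq = (2 * (1 + \<Lambda>^2) * l y) *\<^sub>R e - (2 * \<Lambda>^2) *\<^sub>R (y - q)"
    have jQ: "jet2 Q y (\<lambda>b. gq \<bullet> b) (2 * (1 + \<Lambda>^2) - 2 * n * \<Lambda>^2)"
    proof -
     have "jet2 Q y (\<lambda>b. (1 + \<Lambda>^2) * ((b \<bullet> e - 0) * l y + l y * (b \<bullet> e - 0)) - \<Lambda>^2 * (2 * ((y - q) \<bullet> b)))
      ((1 + \<Lambda>^2) * ((0 - 0) * l y + 2 * (\<Sum>b\<in>Basis. (b \<bullet> e - 0) * (b \<bullet> e - 0)) + l y * (0 - 0))
       - \<Lambda>^2 * (2 * DIM('a \<times> real)))"
      unfolding Q_def by (intro jet2_diff jet2_cmult jet2_mult jl jet2_sqnorm)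
     also have "(1 + \<Lambda>^2) * ((0 - 0) * l y + 2 * (\<Sum>b\<in>Basis. (b \<bullet> e - 0) * (b \<bullet> e - 0)) + l y * (0 - 0))
       - \<Lambda>^2 * (2 * DIM('a \<times> real)) = 2 * (1 + \<Lambda>^2) - 2 * n * \<Lambda>^2"
      using ee by (simp add: n_def)
     finally show ?thesis
      by (rule jet2_cong_grad) (simp add: gq_def inner_simps inner_commute algebra_simps)
    qed
    have gsum: "(\<Sum>b\<in>Basis. (gq \<bullet> b)^2) \<ge> 4 * Q y"
    proof -
     have "(\<Sum>b\<in>Basis. (gq \<bullet> b)^2) = gq \<bullet> gq"
      by (subst euclidean_inner) (simp add: power2_eq_square)
     also have "... = (2 * (1 + \<Lambda>^2) * l y)^2 - 2 * (2 * (1 + \<Lambda>^2) * l y) * (2 * \<Lambda>^2) * l y + (2 * \<Lambda>^2)^2 * (norm (y - q))^2"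
     proof -
      have "e \<bullet> e = 1" "e \<bullet> (y - q) = l y" by (auto simp: e_def inner_prod_def l_snd)
      thus ?thesis unfolding gq_def power2_norm_eq_inner
       by (simp add: inner_diff_left inner_diff_right inner_commute power2_eq_square)
         (simp add: algebra_simps)?
     qed
     also have "... = 4 * (l y)^2 + 4 * \<Lambda>^2 * \<Lambda>^2 * (norm (fst y - fst q))^2"
      unfolding nsq by (simp add: power2_eq_square algebra_simps)
     also have "... \<ge> 4 * Q y"
     proof -
      have "4 * (X - B) \<le> 4 * X + A" if "A \<ge> 0" "B \<ge> 0" for A B X :: real using that by simp
      note gen = this
      show ?thesis unfolding Q by (rule gen) simp_all
     qed
     finally show ?thesis .
    qed
    have P: "((\<lambda>q. q ^ m) has_real_derivative (real m * q ^ (m - 1))) (at q)" for q :: real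
     using DERIV_pow[of m q] by simp
    have P1: "((\<lambda>q. real m * q ^ (m - 1)) has_real_derivative (real m * (real (m - 1) * Q y ^ (m - 2)))) (at (Q y))"
     using DERIV_cmult[OF DERIV_pow[of "m - 1" "Q y"], of "real m"] by (simp add: numeral_2_eq_2)
    define lQ where "lQ = real m * (real (m - 1) * Q y ^ (m - 2)) * (\<Sum>b\<in>Basis. (gq \<bullet> b)^2)
      + real m * Q y ^ (m - 1) * (2 * (1 + \<Lambda>^2) - 2 * n * \<Lambda>^2)"
    have jQm: "jet2 (\<lambda>y. Q y ^ m) y (\<lambda>b. real m * Q y ^ (m - 1) * (gq \<bullet> b)) lQ"
     unfolding lQ_def by (rule jet2_compose[OF jQ _ P1]) (use P in auto)
    have "lQ \<ge> real m * (real (m - 1) * Q y ^ (m - 2)) * (4 * Q y)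
      + real m * Q y ^ (m - 1) * (2 * (1 + \<Lambda>^2) - 2 * n * \<Lambda>^2)"
     unfolding lQ_def using gsum Q0 by (intro add_right_mono mult_left_mono) auto
    also have "Q y ^ (m - 2) * Q y = Q y ^ (m - 1)"
     using m power_minus_mult[of "m - 1" "Q y"] by (simp add: numeral_2_eq_2)
    hence "real m * (real (m - 1) * Q y ^ (m - 2)) * (4 * Q y)
      + real m * Q y ^ (m - 1) * (2 * (1 + \<Lambda>^2) - 2 * n * \<Lambda>^2)
     = real m * Q y ^ (m - 1) * (4 * (real m - 1) + 2 * (1 + \<Lambda>^2) - 2 * n * \<Lambda>^2)"
    proof -
     assume e: "Q y ^ (m - 2) * Q y = Q y ^ (m - 1)"
     have "real m * (real (m - 1) * Q y ^ (m - 2)) * (4 * Q y) = real m * (4 * real (m - 1)) * (Q y ^ (m - 2) * Q y)"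
      by (simp add: mult_ac)
     also have "... = real m * (4 * (real m - 1)) * Q y ^ (m - 1)"
      unfolding e using m by (simp add: of_nat_diff)
     finally show ?thesis by (simp add: algebra_simps)
    qed
    finally have lQ1: "lQ \<ge> real m * Q y ^ (m - 1) * (4 * (real m - 1) + 2 * (1 + \<Lambda>^2) - 2 * n * \<Lambda>^2)" .
    have "4 * (real m - 1) + 2 * (1 + \<Lambda>^2) - 2 * n * \<Lambda>^2 > 0"
    proof -
     have "n * \<Lambda>^2 \<ge> 0" "\<Lambda>^2 \<ge> 0" by (simp_all add: n_def)
     have "0 < 4 * (M - 1) + 2 * (1 + Y) - 2 * X" if "X \<ge> 0" "Y \<ge> 0" "M - 1 \<ge> X" for X Y M :: real
      using that by argo
     note gen = this
     show ?thesis unfolding mult.assoc by (rule gen) (use m(1) n_def in simp_all)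
    qed
    moreover have "real m * Q y ^ (m - 1) > 0" using Qp m by simp
    ultimately have "real m * Q y ^ (m - 1) * (4 * (real m - 1) + 2 * (1 + \<Lambda>^2) - 2 * n * \<Lambda>^2) > 0"
     by (rule mult_pos_pos[rotated])
    hence "lQ > 0" using lQ1 by linarith
    hence "W' (u y) - eps * lQ < 0" using W'_le_0[OF yCl] eps mult_pos_pos[of eps lQ] by linarith
    thus "y \<in> interior K \<and> (\<exists>g l. jet2 (\<lambda>y. u y - eps * Q y ^ m) y g l \<and> l < 0)"
     using int jet2_diff[OF jet_u[OF yO] jet2_cmult[OF jQm, of eps]] by blast
   qed
   moreover have "Q x = s^2" unfolding Q by (simp add: l_snd q_def)
   ultimately show ?thesis by (simp add: c0_def)
  qed
 qed
qed

end

section \<open>Reflection and the boundary gradient\<close>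

text \<open>Coupling by reflection: if \<open>x + (0, t)\<close> moves by \<open>y\<close> and
  \<open>x\<close> moves by \<open>refl y\<close>, the two points stay on one vertical line and
  their gap changes by \<open>2 * snd y\<close>. The Laplacian is invariant under the reflection,
  while second derivatives of functions of the gap are multiplied by 4.\<close>

definition refl :: "'a::real_vector \<times> real \<Rightarrow> 'a \<times> real" where "refl y = (fst y, - snd y)"

lemma linear_refl: "linear refl"
 by (rule linearI) (auto simp: refl_def)

lemma refl_0 [simp]: "refl 0 = 0" by (simp add: refl_def zero_prod_def)

lemma jet2_refl:
 fixes h :: "'a::euclidean_space \<times> real \<Rightarrow> real"
 assumes "jet2 h x (\<lambda>b. v \<bullet> b) l"
 shows "jet2 (\<lambda>y. h (x + refl y)) 0 (\<lambda>b. refl v \<bullet> b) l"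
proof -
 have 1: "jet2 (\<lambda>w. h (w + x)) (refl 0) (\<lambda>b. v \<bullet> b) l"
  using assms by (intro jet2_translate) simp
 define \<sigma> :: "'a \<times> real \<Rightarrow> real" where "\<sigma> b = (if snd b = 0 then 1 else - 1)" for b
 have "jet2 (\<lambda>y. h (refl y + x)) 0 (\<lambda>b. \<sigma> b * (v \<bullet> b)) l"
  by (rule jet2_reflect[OF 1 linear_refl]) (auto simp: \<sigma>_def refl_def Basis_prod_def)
 hence "jet2 (\<lambda>y. h (refl y + x)) 0 (\<lambda>b. refl v \<bullet> b) l"
  by (rule jet2_cong_grad) (auto simp: \<sigma>_def refl_def Basis_prod_def inner_prod_def)
 thus ?thesis by (simp add: add.commute)
qed

lemma jet2_shift:
 assumes "jet2 h x g l" shows "jet2 (\<lambda>y. h (x + y)) 0 g l"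
 using jet2_translate[of h 0 x g l] assms by (simp add: add.commute)

text \<open>A function of the gap \<open>t + 2 y\<^sub>n\<close> between the two points moved by \<open>y\<close> and by its reflection.\<close>
lemma jet2_gap:
 fixes P P1 :: "real \<Rightarrow> real"
 assumes "\<And>q. (P has_real_derivative P1 q) (at q)" "(P1 has_real_derivative P2) (at t)"
 shows "jet2 (\<lambda>y::'a::euclidean_space \<times> real. P (t + 2 * snd y)) 0 (\<lambda>b. (0, 2 * P1 t) \<bullet> b) (4 * P2)"
proof -
 have 1: "jet2 (\<lambda>y::'a \<times> real. y \<bullet> (0, 2) + t) 0 (\<lambda>b. b \<bullet> (0, 2) + 0) (0 + 0)"
  by (intro jet2_add jet2_inner jet2_const)
 have "jet2 (\<lambda>y::'a \<times> real. P (y \<bullet> (0, 2) + t)) 0 (\<lambda>b. P1 ((0::'a \<times> real) \<bullet> (0, 2) + t) * (b \<bullet> (0, 2) + 0))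
   (P2 * (\<Sum>b\<in>Basis. (b \<bullet> ((0::'a), 2::real) + 0)^2) + P1 ((0::'a \<times> real) \<bullet> (0, 2) + t) * (0 + 0))"
  by (rule jet2_compose[OF 1]) (use assms in auto)
 moreover have "(\<Sum>b\<in>Basis. (b \<bullet> ((0::'a), 2::real) + 0)^2) = 4"
 proof -
  have "(\<Sum>b\<in>Basis. (b \<bullet> ((0::'a), 2::real) + 0)^2) = ((0::'a), 2::real) \<bullet> (0, 2)"
   by (subst euclidean_inner) (simp add: power2_eq_square inner_commute)
  thus ?thesis by (simp add: inner_prod_def)
 qed
 ultimately have "jet2 (\<lambda>y::'a \<times> real. P (y \<bullet> (0, 2) + t)) 0 (\<lambda>b. P1 t * (b \<bullet> (0, 2))) (4 * P2)"
  by (simp add: mult.commute)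
 hence "jet2 (\<lambda>y::'a \<times> real. P (y \<bullet> (0, 2) + t)) 0 (\<lambda>b. (0, 2 * P1 t) \<bullet> b) (4 * P2)"
  by (rule jet2_cong_grad) (auto simp: inner_prod_def)
 thus ?thesis by (simp add: inner_prod_def add.commute mult.commute)
qed

section \<open>The gradient on the boundary\<close>

context overdetermined begin

lemma u_deriv: assumes "x \<in> Om" shows "(u has_derivative (\<lambda>h. G x \<bullet> h)) (at x)"
proof -
 have Om: "Om = {x. snd x > \<phi> (fst x)}" by (auto simp: Om_def dd_def)
 have "u differentiable (at x)"
  using u_C2 assms unfolding Om numeral_2_eq_2 C_k_on.simps by blast
 from has_derivative_grad[OF this] show ?thesis
  using assms G_grad[of x] by (simp add: grad_def euclidean_representation Om)
qed

lemma u_mvt: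
 assumes "x \<in> Cl" "s > 0" "\<And>r. 0 < r \<Longrightarrow> r \<le> s \<Longrightarrow> x + r *\<^sub>R v \<in> Om"
 shows "\<exists>r. 0 < r \<and> r < s \<and> u (x + s *\<^sub>R v) - u x = s * (G (x + r *\<^sub>R v) \<bullet> v)"
proof -
 have cont: "continuous_on {0..s} (\<lambda>r. u (x + r *\<^sub>R v))"
 proof (rule continuous_on_compose2[OF uc])
  show "(\<lambda>r. x + r *\<^sub>R v) ` {0..s} \<subseteq> Cl"
  proof (rule image_subsetI)
   fix r assume "r \<in> {0..s}"
   thus "x + r *\<^sub>R v \<in> Cl" using assms(1) assms(3)[of r] Om_Cl(2) by (cases "r = 0") auto
  qed
 qed (intro continuous_intros)
 have der: "((\<lambda>r. u (x + r *\<^sub>R v)) has_derivative (\<lambda>h. G (x + r *\<^sub>R v) \<bullet> (h *\<^sub>R v))) (at r)"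
  if "0 < r" "r < s" for r
 proof -
  have "((\<lambda>r. x + r *\<^sub>R v) has_derivative (\<lambda>h. h *\<^sub>R v)) (at r)" by (auto intro!: derivative_eq_intros)
  from has_derivative_compose[OF this u_deriv[OF assms(3)]] that show ?thesis by simp
 qed
 obtain r where "0 < r" "r < s" "u (x + s *\<^sub>R v) - u (x + 0 *\<^sub>R v) = G (x + r *\<^sub>R v) \<bullet> ((s - 0) *\<^sub>R v)"
  using mvt[OF assms(2) cont der] by blast
 thus ?thesis by (intro exI[of _ r]) simp
qed

lemma phi_line: "((\<lambda>s. \<phi> (x + s *\<^sub>R h)) has_real_derivative (D\<phi> (x + s *\<^sub>R h) \<bullet> h)) (at s)"
proof -
 have "((\<lambda>s. x + s *\<^sub>R h) has_derivative (\<lambda>s. s *\<^sub>R h)) (at s)" by (auto intro!: derivative_eq_intros)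
 from has_derivative_compose[OF this D\<phi>] show ?thesis
  by (simp add: has_field_derivative_def mult_commute_abs)
qed

lemma u_mvt_up:
 assumes "x \<in> Cl" "s > 0"
 shows "\<exists>r. 0 < r \<and> r < s \<and> u (x + (0, s)) - u x = s * (G (x + (0, r)) \<bullet> (0, 1))"
 using u_mvt[OF assms, of "(0, 1)"] assms by (auto simp: Om_def Cl_def)

text \<open>The passage from finite increments to derivatives: the mean value theorem supplies
  points \<open>x + r *\<^sub>R v\<close> with arbitrarily small \<open>r\<close>, and continuity of
  \<open>G\<close> up to the boundary does the rest.\<close>

lemma G_limit:
 assumes "x \<in> Cl" "\<delta> > 0" "\<And>s. 0 < s \<Longrightarrow> s < \<delta> \<Longrightarrow> \<exists>r. 0 < r \<and> r < s \<and> x + r *\<^sub>R v \<in> Cl \<and> G (x + r *\<^sub>R v) \<bullet> w \<ge> m"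
 shows "G x \<bullet> w \<ge> m"
proof (rule ccontr)
 assume neg: "\<not> G x \<bullet> w \<ge> m"
 have "continuous_on Cl (\<lambda>y. G y \<bullet> w)" by (intro continuous_intros Gc)
 then obtain d where d: "d > 0" "\<And>y. y \<in> Cl \<Longrightarrow> dist y x < d \<Longrightarrow> dist (G y \<bullet> w) (G x \<bullet> w) < m - G x \<bullet> w"
  using assms(1) neg unfolding continuous_on_iff by (metis diff_gt_0_iff_gt not_le)
 define s where "s = min (\<delta> / 2) (d / (norm v + 1))"
 have s: "0 < s" "s < \<delta>" "s \<le> d / (norm v + 1)"
  using assms(2) d(1) unfolding s_def by (auto intro!: divide_pos_pos add_nonneg_pos)
 obtain r where r: "0 < r" "r < s" "x + r *\<^sub>R v \<in> Cl" "G (x + r *\<^sub>R v) \<bullet> w \<ge> m" using assms(3)[OF s(1,2)] by blast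
 have "r * (norm v + 1) < d"
  using r(2) s(3) by (simp add: pos_le_divide_eq add_nonneg_pos less_divide_eq)
    (smt (verit) mult_strict_right_mono norm_ge_zero)
 hence "dist (x + r *\<^sub>R v) x < d" using r(1) by (simp add: dist_norm algebra_simps)
 from d(2)[OF r(3) this] r(4) show False by (simp add: dist_real_def)
qed

lemma D\<phi>_bound: "\<bar>D\<phi> x \<bullet> h\<bar> \<le> L * norm h"
proof -
 have "((\<lambda>s. \<phi> (x + s *\<^sub>R h)) has_real_derivative (D\<phi> x \<bullet> h)) (at 0)"
  using phi_line[of x h 0] by simp
 hence "((\<lambda>s. (\<phi> (x + s *\<^sub>R h) - \<phi> x) / s) \<longlongrightarrow> D\<phi> x \<bullet> h) (at 0)"
  by (simp add: has_field_derivative_iff)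
 hence t: "((\<lambda>s. \<bar>(\<phi> (x + s *\<^sub>R h) - \<phi> x) / s\<bar>) \<longlongrightarrow> \<bar>D\<phi> x \<bullet> h\<bar>) (at 0)" by (rule tendsto_rabs)
 show ?thesis
 proof (rule tendsto_upperbound[OF t])
  have "\<bar>(\<phi> (x + s *\<^sub>R h) - \<phi> x) / s\<bar> \<le> L * norm h" if "s \<noteq> 0" for s
   using lip[of "x + s *\<^sub>R h" x] that by (simp add: abs_divide divide_le_eq mult_ac)
  thus "\<forall>\<^sub>F s in at 0. \<bar>(\<phi> (x + s *\<^sub>R h) - \<phi> x) / s\<bar> \<le> L * norm h"
   by (auto simp: eventually_at_filter)
 qed simp
qed

lemma norm_D\<phi>: "norm (D\<phi> x) \<le> L"
proof (cases "D\<phi> x = 0")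
 case False
 have "norm (D\<phi> x) * norm (D\<phi> x) \<le> L * norm (D\<phi> x)"
  using D\<phi>_bound[of x "D\<phi> x"] by (simp add: power2_norm_eq_inner[symmetric] power2_eq_square)
 thus ?thesis using False by simp
qed (use L0 in auto)

text \<open>\<open>u\<close> vanishes along the boundary but is differentiable only inside. Its
  increments are therefore taken along the boundary curve lifted by \<open>r\<close>, and then
  \<open>r\<close> tends to 0. The opposite inequality results from replacing \<open>h\<close> by
  \<open>- h\<close>.\<close>

lemma bdry_tangential:
 assumes "dd x0 = 0" shows "G x0 \<bullet> (h, D\<phi> (fst x0) \<bullet> h) \<le> 0"
proof (rule ccontr)
 assume neg: "\<not> ?thesis"
 define \<alpha> where "\<alpha> = G x0 \<bullet> (h, D\<phi> (fst x0) \<bullet> h)"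
 have al: "\<alpha> > 0" using neg by (simp add: \<alpha>_def)
 define pt where "pt q = (fst x0 + fst q *\<^sub>R h, \<phi> (fst x0 + fst q *\<^sub>R h) + snd q)" for q :: "real \<times> real"
 have dpt: "dd (pt q) = snd q" for q by (simp add: pt_def dd_def)
 have x0pt: "pt (0, 0) = x0" using assms by (cases x0) (simp add: pt_def dd_def)
 have cpt: "continuous_on S pt" for S
  unfolding pt_def by (intro continuous_intros continuous_on_compose2[OF phi_cont[of UNIV]]) auto
 define Q where "Q = {q::real \<times> real. snd q \<ge> 0}"
 have ptQ: "pt ` Q \<subseteq> Cl" by (auto simp: Q_def Cl_def dpt)
 define F where "F q = G (pt q) \<bullet> (h, D\<phi> (fst x0 + fst q *\<^sub>R h) \<bullet> h)" for q
 have "continuous_on Q F" unfolding F_def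
  by (intro continuous_intros continuous_on_compose2[OF Gc cpt ptQ] continuous_on_compose2[OF D\<phi>_cont]) auto
 moreover have "(0, 0) \<in> Q" by (simp add: Q_def)
 ultimately obtain d where d: "d > 0" "\<And>q. q \<in> Q \<Longrightarrow> dist q (0,0) < d \<Longrightarrow> dist (F q) (F (0,0)) < \<alpha> / 2"
  using al unfolding continuous_on_iff by (metis half_gt_zero)
 have F0: "F (0,0) = \<alpha>" by (simp add: F_def x0pt \<alpha>_def)
 have Fge: "F q \<ge> \<alpha> / 2" if "q \<in> Q" "dist q (0,0) < d" for q
  using d(2)[OF that] unfolding F0 dist_real_def by linarith
 define \<sigma> where "\<sigma> = d / 2"
 have sg: "\<sigma> > 0" using d by (simp add: \<sigma>_def)
 have low: "u (pt (\<sigma>, r)) - u (pt (0, r)) \<ge> \<sigma> * (\<alpha> / 2)" if r: "0 < r" "r < d / 2" for r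
 proof -
  have "\<exists>s. 0 < s \<and> s < \<sigma> \<and> u (pt (\<sigma>, r)) - u (pt (0, r)) = (\<sigma> - 0) * F (s, r)"
  proof (rule MVT2)
   fix s assume "0 \<le> s" "s \<le> \<sigma>"
   have 1: "((\<lambda>s. fst x0 + s *\<^sub>R h) has_derivative (\<lambda>k. k *\<^sub>R h)) (at s)"
    by (auto intro!: derivative_eq_intros)
   have "((\<lambda>s. \<phi> (fst x0 + s *\<^sub>R h)) has_derivative (\<lambda>k. D\<phi> (fst x0 + s *\<^sub>R h) \<bullet> (k *\<^sub>R h))) (at s)"
    using has_derivative_compose[OF 1 D\<phi>] .
   hence "((\<lambda>s. \<phi> (fst x0 + s *\<^sub>R h) + r) has_derivative (\<lambda>k. D\<phi> (fst x0 + s *\<^sub>R h) \<bullet> (k *\<^sub>R h))) (at s)"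
    using has_derivative_add_const by blast
   from has_derivative_Pair[OF 1 this]
   have 2: "((\<lambda>s. pt (s, r)) has_derivative (\<lambda>k. k *\<^sub>R (h, D\<phi> (fst x0 + s *\<^sub>R h) \<bullet> h))) (at s)"
    by (simp add: pt_def)
   have "pt (s, r) \<in> Om" using r by (simp add: Om_def dpt)
   from has_derivative_compose[OF 2 u_deriv[OF this]]
   show "((\<lambda>s. u (pt (s, r))) has_real_derivative F (s, r)) (at s)"
    by (simp add: has_field_derivative_def F_def mult_commute_abs del: scaleR_Pair)
  qed (use sg in auto)
  then obtain s where s: "0 < s" "s < \<sigma>" "u (pt (\<sigma>, r)) - u (pt (0, r)) = \<sigma> * F (s, r)" by auto
  have "dist (s, r) (0, 0) \<le> dist s 0 + dist r 0"
   using sqrt_add_le_add_sqrt[of "s^2" "r^2"] by (simp add: dist_prod_def)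
  hence "dist (s, r) (0, 0) < d" using s r by (simp add: \<sigma>_def)
  hence "F (s, r) \<ge> \<alpha> / 2" using r by (intro Fge) (auto simp: Q_def)
  thus ?thesis unfolding s(3) using sg by (simp add: mult_left_mono)
 qed
 have "continuous_on {0..d} (\<lambda>r. u (pt (\<sigma>, r)) - u (pt (0, r)))"
  by (intro continuous_intros continuous_on_compose2[OF uc] continuous_on_compose2[OF cpt[of UNIV]])
   (auto simp: Cl_def dpt)
 hence lim: "((\<lambda>r. u (pt (\<sigma>, r)) - u (pt (0, r))) \<longlongrightarrow> u (pt (\<sigma>, 0)) - u (pt (0, 0))) (at 0 within {0..d})"
  using d by (auto simp: continuous_on_def)
 have "u (pt (\<sigma>, 0)) - u (pt (0, 0)) \<ge> \<sigma> * (\<alpha> / 2)"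
 proof (rule tendsto_lowerbound[OF lim])
  have "\<forall>\<^sub>F r in at 0 within {0..d}. r < d / 2 \<and> r > 0"
   unfolding eventually_at using d by (intro exI[of _ "d / 2"]) (auto simp: dist_real_def)
  thus "\<forall>\<^sub>F r in at 0 within {0..d}. \<sigma> * (\<alpha> / 2) \<le> u (pt (\<sigma>, r)) - u (pt (0, r))"
   by eventually_elim (use low in auto)
  show "at 0 within {0..d} \<noteq> bot" using d by (simp add: at_within_Icc_at_right trivial_limit_at_right_real)
 qed
 moreover have "u (pt (\<sigma>, 0)) = 0" "u (pt (0, 0)) = 0" by (rule u_zero, simp add: dpt)+
 ultimately show False using sg al mult_pos_pos[of \<sigma> "\<alpha> / 2"] by linarith
qed

lemma bdry_tangential_eq:
 assumes "dd x0 = 0" shows "G x0 = - (snd (G x0)) *\<^sub>R (D\<phi> (fst x0), -1)"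
proof -
 have "G x0 \<bullet> (h, D\<phi> (fst x0) \<bullet> h) = 0" for h
  using bdry_tangential[OF assms, of h] bdry_tangential[OF assms, of "-h"]
  by (simp add: inner_prod_def)
 hence "(fst (G x0) + snd (G x0) *\<^sub>R D\<phi> (fst x0)) \<bullet> h = 0" for h
  by (simp add: inner_prod_def inner_add_left)
 hence "fst (G x0) + snd (G x0) *\<^sub>R D\<phi> (fst x0) = 0" using inner_eq_zero_iff by blast
 thus ?thesis by (intro prod_eqI) (auto simp: eq_neg_iff_add_eq_0)
qed

text \<open>The prescribed datum is a one-sided limit of difference quotients. By the mean value
  theorem along the inner normal this limit is \<open>G x0 \<bullet> nu\<close>, and
  \<open>G x0\<close> is itself normal.\<close>

lemma bdry_normal:
 assumes "dd x0 = 0" shows "snd (G x0) * sqrt (1 + (norm (D\<phi> (fst x0)))^2) = - c"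
proof -
 define w where "w = sqrt (1 + (norm (D\<phi> (fst x0)))^2)"
 have w: "w > 0" "w^2 = 1 + (norm (D\<phi> (fst x0)))^2" by (auto simp: w_def add_pos_nonneg)
 define nu where "nu = (1 / w) *\<^sub>R (D\<phi> (fst x0), -1 :: real)"
 have "has_outer_normal_derivative u c x0 nu"
  unfolding nu_def w_def by (rule u_normal) (use assms in \<open>simp add: dd_def\<close>)
 hence "((\<lambda>t. u (x0 + t *\<^sub>R nu)) has_real_derivative c) (at_left 0)"
  unfolding has_outer_normal_derivative_def .
 hence lim: "((\<lambda>t. u (x0 + t *\<^sub>R nu) / t) \<longlongrightarrow> c) (at_left 0)"
  using u_zero[OF assms] by (simp add: has_field_derivative_iff)
 \<comment> \<open>The normal is transversal to the graph: the height has a nonzero derivative along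
   it, so nearby points of the inner ray are interior.\<close>
 have ev: "\<forall>\<^sub>F t in at_left 0. x0 + t *\<^sub>R nu \<in> Om"
 proof -
  have "((\<lambda>t. \<phi> (fst x0 + t *\<^sub>R fst nu)) has_real_derivative (D\<phi> (fst x0) \<bullet> fst nu)) (at 0)"
   using phi_line[of "fst x0" "fst nu" 0] by simp
  hence "((\<lambda>t. snd x0 + t * snd nu - \<phi> (fst x0 + t *\<^sub>R fst nu)) has_real_derivative (snd nu - D\<phi> (fst x0) \<bullet> fst nu)) (at 0)"
   by (auto intro!: derivative_eq_intros)
  moreover have "snd nu - D\<phi> (fst x0) \<bullet> fst nu < 0"
  proof -
   have "D\<phi> (fst x0) \<bullet> fst nu \<ge> 0" using w by (simp add: nu_def)
   moreover have "snd nu < 0" using w by (simp add: nu_def)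
   ultimately show ?thesis by simp
  qed
  ultimately obtain d where "d > 0" "\<And>h. 0 < h \<Longrightarrow> h < d \<Longrightarrow>
    snd x0 + 0 * snd nu - \<phi> (fst x0 + 0 *\<^sub>R fst nu) < snd x0 + (0 - h) * snd nu - \<phi> (fst x0 + (0 - h) *\<^sub>R fst nu)"
   using DERIV_neg_dec_left by blast
  note d = this
  have "dd (x0 + t *\<^sub>R nu) > dd x0" if "- d < t" "t < 0" for t
   using d(2)[of "- t"] that by (simp add: dd_def)
  thus ?thesis using d(1) unfolding eventually_at_left_field Om_def assms
   by (intro exI[of _ "- d"]) auto
 qed
 have lim2: "((\<lambda>t. u (x0 + t *\<^sub>R nu) / t) \<longlongrightarrow> G x0 \<bullet> nu) (at_left 0)"
 proof (rule tendstoI)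
  fix e :: real assume e: "e > 0"
  have x0: "x0 \<in> Cl" using assms by (simp add: Cl_def)
  have "continuous_on Cl (\<lambda>y. G y \<bullet> nu)" by (intro continuous_intros Gc)
  then obtain d where d: "d > 0" "\<And>y. y \<in> Cl \<Longrightarrow> dist y x0 < d \<Longrightarrow> dist (G y \<bullet> nu) (G x0 \<bullet> nu) < e"
   using x0 e unfolding continuous_on_iff by blast
  obtain t0 where t0: "t0 < 0" "\<And>t. t0 < t \<Longrightarrow> t < 0 \<Longrightarrow> x0 + t *\<^sub>R nu \<in> Om"
   using ev unfolding eventually_at_left_field by blast
  define t1 where "t1 = max t0 (- (d / (norm nu + 1)))"
  have t1: "t1 < 0" using t0 d unfolding t1_def by (auto intro!: divide_pos_pos add_nonneg_pos)
  have "dist (u (x0 + t *\<^sub>R nu) / t) (G x0 \<bullet> nu) < e" if t: "t1 < t" "t < 0" for t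
  proof -
   have "\<exists>r. 0 < r \<and> r < - t \<and> u (x0 + (- t) *\<^sub>R (- nu)) - u x0 = (- t) * (G (x0 + r *\<^sub>R (- nu)) \<bullet> (- nu))"
   proof (rule u_mvt[OF x0])
    fix r assume "0 < r" "r \<le> - t"
    thus "x0 + r *\<^sub>R - nu \<in> Om" using t0(2)[of "- r"] t unfolding t1_def by auto
   qed (use t in auto)
   then obtain r where r: "0 < r" "r < - t" "u (x0 + t *\<^sub>R nu) = t * (G (x0 + (- r) *\<^sub>R nu) \<bullet> nu)"
    using u_zero[OF assms] by auto
   have "r * (norm nu + 1) < d"
   proof -
    have "r < d / (norm nu + 1)" using r t unfolding t1_def by auto
    thus ?thesis by (simp add: less_divide_eq add_nonneg_pos)
   qed
   hence "dist (x0 + (- r) *\<^sub>R nu) x0 < d" using r(1) by (simp add: dist_norm algebra_simps)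
   moreover have "x0 + (- r) *\<^sub>R nu \<in> Cl" using t0(2)[of "- r"] r t Om_Cl unfolding t1_def by auto
   ultimately show ?thesis unfolding r(3) using d(2) t by simp
  qed
  thus "\<forall>\<^sub>F t in at_left 0. dist (u (x0 + t *\<^sub>R nu) / t) (G x0 \<bullet> nu) < e"
   unfolding eventually_at_left_field using t1 by (intro exI[of _ t1]) auto
 qed
 have "G x0 \<bullet> nu = c" by (rule tendsto_unique[OF _ lim2 lim]) simp
 moreover have "G x0 \<bullet> nu = - snd (G x0) * w"
 proof -
  have "G x0 \<bullet> nu = - (snd (G x0)) * ((D\<phi> (fst x0), -1) \<bullet> nu)"
   by (subst bdry_tangential_eq[OF assms]) (simp only: inner_scaleR_left)
  also have "(D\<phi> (fst x0), -1) \<bullet> nu = w^2 / w"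
   unfolding w(2) nu_def by (simp add: inner_prod_def power2_norm_eq_inner add_divide_distrib)
  finally show ?thesis using w by (simp add: power2_eq_square)
 qed
 ultimately show ?thesis unfolding w_def by simp
qed

end

text \<open>Turns an extremum of a doubled function in \<open>(x, t)\<close> into an extremum in
  \<open>y\<close> at 0 along the coupled motion.\<close>

lemma eventually_coupled:
 fixes x :: "'a::euclidean_space \<times> real"
 assumes "open T" "(x, t) \<in> T"
 shows "\<forall>\<^sub>F y in nhds 0. (x + refl y, t + 2 * snd y) \<in> T"
proof -
 define F where "F y = (x + (fst y, - snd y), t + 2 * snd y)" for y :: "'a \<times> real"
 have "isCont F 0" unfolding F_def by (intro continuous_intros)
 hence "(F \<longlongrightarrow> F 0) (nhds 0)" using tendsto_at_iff_tendsto_nhds[of F 0] by (simp add: isCont_def)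
 hence "((\<lambda>y. (x + refl y, t + 2 * snd y)) \<longlongrightarrow> (x, t)) (nhds 0)"
 proof -
  assume l: "(F \<longlongrightarrow> F 0) (nhds 0)"
  have "F = (\<lambda>y. (x + refl y, t + 2 * snd y))" "F 0 = (x, t)"
   by (auto simp: F_def refl_def zero_prod_def[symmetric])
  thus ?thesis using l by simp
 qed
 thus ?thesis using assms topological_tendstoD by blast
qed

section \<open>Nonvanishing normal derivative and an upper bound for vertical increments\<close>

context overdetermined begin

lemma Gn_nonneg_bdry: assumes "dd x = 0" shows "snd (G x) \<ge> 0"
proof -
 have x: "x \<in> Cl" using assms by (simp add: Cl_def)
 have "G x \<bullet> (0, 1) \<ge> 0"
 proof (rule G_limit[OF x zero_less_one, of "(0, 1)"])
  fix s :: real assume s: "0 < s"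
  obtain r where r: "0 < r" "r < s" "u (x + (0, s)) - u x = s * (G (x + (0, r)) \<bullet> (0, 1))"
   using u_mvt_up[OF x s] by blast
  have "x + (0, s) \<in> Om" using assms s by (simp add: Om_def)
  hence "s * (G (x + (0, r)) \<bullet> (0, 1)) > 0" using r(3) u_positive u_zero[OF assms] by fastforce
  hence "G (x + (0, r)) \<bullet> (0, 1) > 0" using s by (simp add: zero_less_mult_iff)
  moreover have "x + (0, r) \<in> Cl" using assms r by (simp add: Cl_def)
  ultimately show "\<exists>r>0. r < s \<and> x + r *\<^sub>R (0, 1) \<in> Cl \<and> 0 \<le> G (x + r *\<^sub>R (0, 1)) \<bullet> (0, 1)"
   using r by (intro exI[of _ r]) simp
 qed
 thus ?thesis by (simp add: inner_prod_def)
qed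

text \<open>Hopf's lemma at a point where a ball moved downwards first touches the boundary.\<close>
lemma c_nonzero: "c \<noteq> 0"
proof
 assume c: "c = 0"
 define y where "y = (0 :: 'a, \<phi> 0 + 3 + L)"
 have "continuous_on (cball 0 1) (\<lambda>z. dd (y + z))"
  by (intro continuous_on_compose2[OF dd_cont[of UNIV]] continuous_intros) auto
 then obtain z0 where z0: "z0 \<in> cball 0 1" "\<And>z. z \<in> cball 0 1 \<Longrightarrow> dd (y + z0) \<le> dd (y + z)"
  using continuous_attains_inf[of "cball (0 :: 'a \<times> real) 1"] by fastforce
 \<comment> \<open>Lowered by exactly its smallest height, the ball touches the boundary from inside
   at \<open>x0\<close>.\<close>
 define y' where "y' = y + (0, - dd (y + z0))"
 have dy': "dd (y' + z) = dd (y + z) - dd (y + z0)" for z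
  using dd_up[of "y + z" "- dd (y + z0)"] by (simp add: y'_def add_ac)
 have ball_Cl: "cball y' 1 \<subseteq> Cl"
 proof
  fix x assume "x \<in> cball y' 1"
  hence "x - y' \<in> cball 0 1" by (simp add: dist_norm norm_minus_commute)
  from z0(2)[OF this] dy'[of "x - y'"] show "x \<in> Cl" by (simp add: Cl_def)
 qed
 define x0 where "x0 = y' + z0"
 have dx0: "dd x0 = 0" by (simp add: x0_def dy')
 have ball_Om: "ball y' 1 \<subseteq> Om"
  unfolding Cl_interior[symmetric] by (rule interior_maximal[OF order_trans[OF ball_subset_cball ball_Cl]]) simp
 have nz0: "norm z0 = 1"
 proof -
  have "x0 \<notin> ball y' 1" using ball_Om dx0 by (auto simp: Om_def)
  thus ?thesis using z0(1) by (simp add: x0_def dist_norm)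
 qed
 have hb: "cball y' (1/2) \<subseteq> Om" using ball_Om by force
 have "continuous_on (cball y' (1/2)) u" using hb Om_Cl(1) by (intro continuous_on_subset[OF uc]) blast
 moreover have "cball y' (1/2) \<noteq> {}" by simp
 ultimately obtain xm where xm: "xm \<in> cball y' (1/2)" "\<And>x. x \<in> cball y' (1/2) \<Longrightarrow> u xm \<le> u x"
  using continuous_attains_inf[OF compact_cball, of y' "1/2" u] by blast
 define k where "k = DIM('a \<times> real)"
 have k: "k \<ge> 1" by (simp add: k_def)
 \<comment> \<open>The barrier \<open>eps * (|x|^(-2k) - 1)\<close> vanishes on the unit sphere and
   is below the minimum \<open>u xm\<close> on the sphere of radius 1/2. With \<open>k\<close> equal
   to the dimension it is subharmonic.\<close>
 define eps where "eps = u xm / 4 ^ k"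
 have eps: "eps > 0" using u_positive[of xm] xm(1) hb by (auto simp: eps_def)
 define b where "b x = eps / ((norm (x - y'))^2) ^ k - eps" for x
 have ub: "0 \<le> u x - b x" if "x \<in> cball y' 1 - ball y' (1/2)" for x
 proof (rule comparison_compact[OF _ _ _ that])
  show "compact (cball y' 1 - ball y' (1/2))" by (intro compact_diff) auto
  have nz: "norm (x - y') \<noteq> 0" if "x \<in> cball y' 1 - ball y' (1/2)" for x using that by auto
  show "continuous_on (cball y' 1 - ball y' (1/2)) (\<lambda>x. u x - b x)"
   unfolding b_def
   by (intro continuous_intros continuous_on_subset[OF uc]) (use ball_Cl nz in \<open>auto\<close>)
  fix z assume z: "z \<in> cball y' 1 - ball y' (1/2)" "u z - b z < 0"
  have nzz: "norm (z - y') \<ge> 1/2" "norm (z - y') \<le> 1" using z(1) by (auto simp: dist_norm norm_minus_commute)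
  have zC: "z \<in> Cl" using z(1) ball_Cl by auto
  have "norm (z - y') \<noteq> 1"
  proof
   assume "norm (z - y') = 1"
   thus False using z(2) u_nonneg[OF zC] by (simp add: b_def)
  qed
  moreover have "norm (z - y') \<noteq> 1/2"
  proof
   assume h: "norm (z - y') = 1/2"
   hence "u xm \<le> u z" by (intro xm(2)) (auto simp: dist_norm norm_minus_commute)
   moreover have "b z = eps * 4 ^ k - eps" unfolding b_def h by (simp add: power_divide)
   hence "b z < u xm" using eps by (simp add: eps_def)
   ultimately show False using z(2) by linarith
  qed
  ultimately have zin: "z \<in> ball y' 1 \<inter> - cball y' (1/2)" using nzz by (auto simp: dist_norm norm_minus_commute)
  have "ball y' 1 \<inter> - cball y' (1/2) \<subseteq> interior (cball y' 1 - ball y' (1/2))"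
   by (rule interior_maximal) auto
  hence int: "z \<in> interior (cball y' 1 - ball y' (1/2))" using zin by blast
  have zO: "z \<in> Om" using zin ball_Om by auto
  define rho where "rho = (norm (z - y'))^2"
  have "norm (z - y') > 0" using nzz by linarith
  hence rho: "rho > 0" by (simp add: rho_def)
  have P: "\<forall>\<^sub>F q in nhds rho. ((\<lambda>q. eps / q ^ k) has_real_derivative (- (eps * real k) / q ^ (k + 1))) (at q)"
  proof -
   have "\<forall>\<^sub>F q in nhds rho. q > (0::real)" using rho eventually_nhds_in_open[of "{0<..}" rho] by simp
   thus ?thesis by eventually_elim (rule has_real_derivative_inverse_power)
  qed
  have P1: "((\<lambda>q. - (eps * real k) / q ^ (k + 1)) has_real_derivative (- (- (eps * real k) * real (k + 1)) / rho ^ (k + 1 + 1))) (at rho)"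
   by (rule has_real_derivative_inverse_power[OF rho])
  note j = jet2_radial[where P="\<lambda>q. eps / q ^ k" and x=z and c=y', folded rho_def, OF P P1]
  define lb where "lb = 4 * (- (- (eps * real k) * real (k + 1)) / rho ^ (k + 1 + 1)) * rho + 2 * real DIM('a \<times> real) * (- (eps * real k) / rho ^ (k + 1))"
  have "4 * (- (- (E * K) * K1) / (r * Y)) * r + 2 * K * (- (E * K) / Y) = E * K * (4 * K1 - 2 * K) / Y"
   if "r \<noteq> 0" "Y \<noteq> 0" for E K K1 r Y :: real using that by (simp add: field_simps)
  from this[of rho "rho ^ (k + 1)" eps "real k" "real (k + 1)"]
  have "lb = eps * real k * (4 * real (k + 1) - 2 * real k) / rho ^ (k + 1)"
   using rho unfolding lb_def k_def[symmetric] by (simp only: power_add power_one_right) (simp add: mult_ac)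
  hence "lb > 0" using eps k rho by simp
  hence "W' (u z) - (lb - 0) < 0" using W'_le_0[OF zC] by simp
  moreover have "jet2 (\<lambda>x. u x - b x) z (\<lambda>i. G z \<bullet> i - ((- (eps * real k) / rho ^ (k + 1)) * (2 * ((z - y') \<bullet> i)) - 0)) (W' (u z) - (lb - 0))"
   unfolding b_def lb_def by (intro jet2_diff jet_u zO j jet2_const)
  ultimately show "z \<in> interior (cball y' 1 - ball y' (1/2)) \<and> (\<exists>g l. jet2 (\<lambda>x. u x - b x) z g l \<and> l < 0)"
   using int by blast
 qed
 have x0C: "x0 \<in> Cl" using dx0 by (simp add: Cl_def)
 have "G x0 \<bullet> (- z0) \<ge> eps"
 proof (rule G_limit[OF x0C, of "1/2" "- z0"])
  fix s :: real assume s: "0 < s" "s < 1/2"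
  have inO: "x0 + r *\<^sub>R (- z0) \<in> Om" if "0 < r" "r \<le> s" for r
  proof -
   have "x0 + r *\<^sub>R (- z0) - y' = (1 - r) *\<^sub>R z0" by (simp add: x0_def algebra_simps)
   hence "norm (x0 + r *\<^sub>R (- z0) - y') = 1 - r" using that s nz0 by simp
   thus ?thesis using ball_Om that by (auto simp: dist_norm norm_minus_commute)
  qed
  obtain r where r: "0 < r" "r < s" "u (x0 + s *\<^sub>R (- z0)) - u x0 = s * (G (x0 + r *\<^sub>R (- z0)) \<bullet> (- z0))"
   using u_mvt[OF x0C s(1) inO] by blast
  define x where "x = x0 + s *\<^sub>R (- z0)"
  have "x - y' = (1 - s) *\<^sub>R z0" by (simp add: x_def x0_def algebra_simps)
  hence nx: "norm (x - y') = 1 - s" using s nz0 by simp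
  have "x \<in> cball y' 1 - ball y' (1/2)" using nx s by (auto simp: dist_norm norm_minus_commute)
  from ub[OF this] have "b x \<le> u x" by simp
  moreover have "b x \<ge> eps * s"
  proof -
   have "(1 - s)\<^sup>2 ^ k \<le> (1 - s) ^ 1"
    unfolding power_mult[symmetric] using s k by (intro power_decreasing) auto
   hence "eps / (1 - s) \<le> eps / (1 - s)\<^sup>2 ^ k" using eps s by (intro divide_left_mono) auto
   moreover have "eps * (1 + s) \<le> eps / (1 - s)"
   proof -
    have "(1 + s) * (1 - s) \<le> 1" by (simp add: algebra_simps)
    hence "eps * ((1 + s) * (1 - s)) \<le> eps * 1" using eps by (intro mult_left_mono) auto
    thus ?thesis using s by (simp add: pos_le_divide_eq mult.assoc)
   qed
   ultimately show ?thesis by (simp add: b_def nx algebra_simps)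
  qed
  ultimately have "s * (G (x0 + r *\<^sub>R (- z0)) \<bullet> (- z0)) \<ge> s * eps"
   using r(3) u_zero[OF dx0] by (simp add: x_def mult.commute)
  hence "G (x0 + r *\<^sub>R (- z0)) \<bullet> (- z0) \<ge> eps" using s by (simp only: mult_le_cancel_left_pos)
  thus "\<exists>r>0. r < s \<and> x0 + r *\<^sub>R - z0 \<in> Cl \<and> eps \<le> G (x0 + r *\<^sub>R - z0) \<bullet> - z0"
   using r inO[of r] Om_Cl by (intro exI[of _ r]) auto
 qed simp
 moreover have "G x0 = 0"
 proof -
  have "sqrt (1 + (norm (D\<phi> (fst x0)))^2) > 0" by (simp add: add_pos_nonneg)
  hence "snd (G x0) = 0" using bdry_normal[OF dx0] c by simp
  thus ?thesis using bdry_tangential_eq[OF dx0] by (simp add: zero_prod_def)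
 qed
 ultimately show False using eps by simp
qed

definition c1 :: real where "c1 = \<bar>c\<bar> / sqrt (1 + L^2)"

lemma c1_pos: "c1 > 0" unfolding c1_def using c_nonzero by (simp add: add_pos_nonneg)

lemma Gn_bounds_bdry: assumes "dd x = 0" shows "snd (G x) \<ge> c1" "snd (G x) \<le> \<bar>c\<bar>"
proof -
 define w where "w = sqrt (1 + (norm (D\<phi> (fst x)))^2)"
 have w: "w \<ge> 1" "w > 0" by (auto simp: w_def add_pos_nonneg)
 have "snd (G x) * w = \<bar>c\<bar>"
  using bdry_normal[OF assms] Gn_nonneg_bdry[OF assms] w unfolding w_def[symmetric]
  by (metis abs_minus_cancel abs_of_nonneg less_imp_le mult_nonneg_nonneg)
 hence e2: "snd (G x) = \<bar>c\<bar> / w" using w by (simp add: field_simps)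
 have "(norm (D\<phi> (fst x)))^2 \<le> L^2" using norm_D\<phi> by (intro power_mono) auto
 hence "w \<le> sqrt (1 + L^2)" by (simp add: w_def)
 thus "snd (G x) \<ge> c1" unfolding e2 c1_def using w
  by (intro divide_left_mono mult_pos_pos) (auto simp: add_pos_nonneg)
 show "snd (G x) \<le> \<bar>c\<bar>" unfolding e2 using w by (simp add: divide_le_eq mult_le_cancel_left1)
qed

text \<open>On the boundary the gradient is normal, so its length is the modulus of the normal
  derivative, whatever the slope of the boundary at that point.\<close>

lemma G_norm_bdry: assumes "dd x = 0" shows "(norm (G x))^2 = c^2"
proof -
 have "(norm (G x))^2 = (snd (G x))^2 * (norm (D\<phi> (fst x), -1 :: real))^2"
  by (subst bdry_tangential_eq[OF assms]) (simp add: power_mult_distrib del: scaleR_Pair)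
 also have "(norm (D\<phi> (fst x), -1 :: real))^2 = (sqrt (1 + (norm (D\<phi> (fst x)))^2))^2"
  by (simp add: norm_prod_def add.commute)
 also have "(snd (G x))^2 * ... = (- c)^2"
  using bdry_normal[OF assms] by (metis power_mult_distrib)
 finally show ?thesis by simp
qed

text \<open>Large enough for both contradictions of the doubling argument: at boundary points
  \<open>2 * KU - 3 > |c|\<close> is required, at interior points
  \<open>8 * KU > C0 + 2 * DIM('a \<times> real)\<close>.\<close>

definition KU :: real where "KU = \<bar>c\<bar> + 3 + C0 + 2 * DIM('a \<times> real)"

lemma KU: "KU \<ge> 1" "KU \<ge> \<bar>c\<bar> + 3" "KU \<ge> C0 + 2 * DIM('a \<times> real)"
 using C0 by (auto simp: KU_def)

text \<open>Doubling of variables: at an interior maximum the upper point is moved by \<open>y\<close> and the lower one by the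
  reflection of \<open>y\<close>; on the boundary the lower point is moved upwards.\<close>
lemma upper_doubling:
 assumes a: "a > 0" and x0: "x0 \<in> Cl" and za: "\<And>x. x \<in> Cl \<Longrightarrow> x \<in> cball x0 1 \<Longrightarrow> 1 - u x \<le> a"
  and t0: "0 \<le> t0" "t0 \<le> 1"
 shows "u (x0 + (0, t0)) - u x0 \<le> a * (KU * (4 * t0 - t0^2))"
proof (rule ccontr)
 assume neg: "\<not> ?thesis"
 define S where "S = (Cl \<inter> cball x0 1) \<times> {0..1::real}"
 \<comment> \<open>\<open>4 * t - t^2\<close> has slope at least 2 on \<open>[0, 1]\<close> and
   second derivative -2; the slope is used at boundary points, the concavity inside. The squared
   distance keeps a positive maximum off the edge of the ball.\<close>
 define \<Phi> where "\<Phi> q = u (fst q + (0, snd q)) - u (fst q)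
   - a * (KU * (4 * snd q - (snd q)^2) + (norm (fst q - x0))^2)" for q
 have S: "compact S" unfolding S_def by (intro compact_Times closed_Int_compact closed_Cl) auto
 have cont: "continuous_on S \<Phi>" unfolding \<Phi>_def
  by (intro continuous_intros continuous_on_compose2[OF uc]) (auto simp: S_def Cl_def dd_def)
 have S0: "(x0, t0) \<in> S" using x0 t0 by (simp add: S_def)
 obtain q where q: "q \<in> S" "\<And>q'. q' \<in> S \<Longrightarrow> \<Phi> q' \<le> \<Phi> q"
  using continuous_attains_sup[OF S _ cont] S0 by blast
 obtain x t where xt: "q = (x, t)" by (cases q)
 have "\<Phi> (x0, t0) > 0" using neg by (simp add: \<Phi>_def)
 hence pos: "\<Phi> (x, t) > 0" using q(2)[OF S0] xt by simp
 have x: "x \<in> Cl" "x \<in> cball x0 1" and t: "0 \<le> t" "t \<le> 1" using q(1) xt by (auto simp: S_def)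
 define X where "X = x + (0, t)"
 have XC: "X \<in> Cl" using x t by (simp add: X_def Cl_def)
 have gap: "u X - u x \<le> a" using za[OF x] u_le_1[OF XC] by simp
 have \<Phi>x: "\<Phi> (x, t) = u X - u x - a * (KU * (4 * t - t^2) + (norm (x - x0))^2)" by (simp add: \<Phi>_def X_def)
 have psi0: "4 * t - t^2 \<ge> 0"
 proof -
  have "t * t \<le> t * 1" using t by (intro mult_left_mono) auto
  thus ?thesis using t by (simp add: power2_eq_square)
 qed
 have "a * (KU * (4 * t - t^2) + (norm (x - x0))^2) < a"
  using pos gap unfolding \<Phi>x by linarith
 hence gt1: "KU * (4 * t - t^2) + (norm (x - x0))^2 < 1" using a by simp
 have nx: "norm (x - x0) < 1"
 proof -
  have "KU * (4 * t - t^2) \<ge> 0" using KU psi0 by simp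
  hence "(norm (x - x0))^2 < 1^2" using gt1 by simp
  thus ?thesis by (rule power_less_imp_less_base) simp
 qed
 have t1: "t < 1"
 proof (rule ccontr)
  assume "\<not> t < 1"
  hence "KU * (4 * t - t^2) = KU * 3" using t by simp
  thus False using gt1 KU(1) zero_le_power2[of "norm (x - x0)"] by linarith
 qed
 have t00: "t > 0"
 proof (rule ccontr)
  assume "\<not> t > 0"
  hence "X = x" "t = 0" using t by (auto simp: X_def zero_prod_def[symmetric])
  moreover have "a * (norm (x - x0))^2 \<ge> 0" using a by simp
  ultimately show False using pos unfolding \<Phi>x by simp
 qed
 have gap0: "u X - u x > 0"
 proof -
  have "a * (KU * (4 * t - t^2) + (norm (x - x0))^2) \<ge> 0"
   using a KU psi0 by (intro mult_nonneg_nonneg add_nonneg_nonneg) auto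
  thus ?thesis using pos unfolding \<Phi>x by linarith
 qed
 show False
 proof (cases "dd x = 0")
  case True
  \<comment> \<open>On the boundary \<open>1 - u x = 1\<close>, so \<open>a\<close> is not small
    there and \<open>a * KU\<close> beats the bound \<open>|c|\<close> of the vertical
    derivative.\<close>
  have a1: "a \<ge> 1" using za[OF x] u_zero[OF True] by simp
  define \<delta> where "\<delta> = min t (1 - norm (x - x0))"
  have del: "\<delta> > 0" "\<delta> \<le> 1" using t00 nx t by (auto simp: \<delta>_def)
  have "G x \<bullet> (0, 1) \<ge> 2 * a * KU - 3 * a"
  proof (rule G_limit[OF x(1) del(1), of "(0, 1)"])
   fix s :: real assume s: "0 < s" "s < \<delta>"
   obtain r where r: "0 < r" "r < s" "u (x + (0, s)) - u x = s * (G (x + (0, r)) \<bullet> (0, 1))"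
    using u_mvt_up[OF x(1) s(1)] by blast
   have "norm (x + (0, s) - x0) \<le> norm (x - x0) + norm (0 :: 'a, s)"
    using norm_triangle_ineq[of "x - x0" "(0, s)"] by (simp add: algebra_simps)
   hence n1: "norm (x + (0, s) - x0) \<le> norm (x - x0) + s" using s by simp
   \<comment> \<open>The upper point \<open>X\<close> stays fixed: the lower point rises by
     \<open>s\<close> and the gap shrinks by \<open>s\<close>.\<close>
   have "(x + (0, s), t - s) \<in> S" using x s n1 t nx
    by (auto simp: S_def Cl_def \<delta>_def dist_norm norm_minus_commute)
   from q(2)[OF this] have "\<Phi> (x + (0, s), t - s) \<le> \<Phi> (x, t)" by (simp add: xt)
   moreover have "x + (0, s) + (0, t - s) = X" by (simp add: X_def)
   ultimately have 1: "a * (KU * (4 * t - t^2) + (norm (x - x0))^2)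
     \<le> a * (KU * (4 * (t - s) - (t - s)^2) + (norm (x + (0, s) - x0))^2) + s * (G (x + (0, r)) \<bullet> (0, 1))"
    unfolding \<Phi>_def fst_conv snd_conv r(3)[symmetric] X_def[symmetric] by simp
   have "(norm (x + (0, s) - x0))^2 \<le> (norm (x - x0) + s)^2" using n1 by (intro power_mono) auto
   also have "... \<le> (norm (x - x0))^2 + 3 * s"
   proof -
    have "norm (x - x0) * s \<le> 1 * s" "s * s \<le> 1 * s" using nx s del by (auto intro!: mult_right_mono)
    thus ?thesis by (simp add: power2_eq_square algebra_simps)
   qed
   finally have 2: "(norm (x + (0, s) - x0))^2 \<le> (norm (x - x0))^2 + 3 * s" .
   have "KU * (4 * (t - s) - (t - s)^2) \<le> KU * ((4 * t - t^2) - 2 * s)"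
   proof (rule mult_left_mono)
    have "t * s \<le> 1 * s" using t s by (intro mult_right_mono) auto
    moreover have "s * s \<ge> 0" by simp
    moreover have "4 * (t - s) - (t - s)^2 = 4 * t - t^2 - 4 * s + 2 * (t * s) - s * s"
     by (simp add: power2_eq_square algebra_simps)
    ultimately show "4 * (t - s) - (t - s)^2 \<le> (4 * t - t^2) - 2 * s" by argo
   qed (use KU in auto)
   hence "KU * (4 * (t - s) - (t - s)^2) + (norm (x + (0, s) - x0))^2
    \<le> KU * (4 * t - t^2) + (norm (x - x0))^2 - s * (2 * KU - 3)"
    using 2 by (simp add: algebra_simps)
   hence "a * (KU * (4 * (t - s) - (t - s)^2) + (norm (x + (0, s) - x0))^2)
    \<le> a * (KU * (4 * t - t^2) + (norm (x - x0))^2 - s * (2 * KU - 3))" using a by (intro mult_left_mono) auto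
   hence "a * (s * (2 * KU - 3)) \<le> s * (G (x + (0, r)) \<bullet> (0, 1))"
    using 1 by (simp add: right_diff_distrib)
   hence "s * (2 * a * KU - 3 * a) \<le> s * (G (x + (0, r)) \<bullet> (0, 1))" by (simp add: algebra_simps)
   hence "2 * a * KU - 3 * a \<le> G (x + (0, r)) \<bullet> (0, 1)" using s by (simp only: mult_le_cancel_left_pos)
   thus "\<exists>r>0. r < s \<and> x + r *\<^sub>R (0, 1) \<in> Cl \<and> 2 * a * KU - 3 * a \<le> G (x + r *\<^sub>R (0, 1)) \<bullet> (0, 1)"
    using r x(1) by (intro exI[of _ r]) (simp add: Cl_def)
  qed
  moreover have "2 * a * KU - 3 * a > \<bar>c\<bar>"
  proof -
   have "1 * (2 * KU - 3) \<le> a * (2 * KU - 3)" using a1 KU by (intro mult_right_mono) auto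
   thus ?thesis using KU(2) by (simp add: algebra_simps)
  qed
  ultimately show False using Gn_bounds_bdry(2)[OF True] by (simp add: inner_prod_def)
 next
  case False
  hence xO: "x \<in> Om" using x by (simp add: Om_def Cl_def)
  hence XO: "X \<in> Om" using t by (simp add: X_def Om_def)
  define f where "f y = u (x + refl y) - u (X + y)
    + a * (KU * (4 * (t + 2 * snd y) - (t + 2 * snd y)^2) + (norm (x + refl y - x0))^2)" for y
  have fPhi: "f y = - \<Phi> (x + refl y, t + 2 * snd y)" for y
  proof -
   have "x + refl y + (0, t + 2 * snd y) = X + y" by (simp add: X_def refl_def prod_eq_iff)
   thus ?thesis by (simp add: f_def \<Phi>_def)
  qed
  have "open ((Om \<inter> ball x0 1) \<times> {0<..<1::real})" by (intro open_Times open_Int open_Om) auto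
  moreover have "(x, t) \<in> (Om \<inter> ball x0 1) \<times> {0<..<1}"
   using xO nx t00 t1 by (simp add: dist_norm norm_minus_commute)
  ultimately have "\<forall>\<^sub>F y in nhds 0. (x + refl y, t + 2 * snd y) \<in> (Om \<inter> ball x0 1) \<times> {0<..<1}"
   by (rule eventually_coupled)
  hence ev: "\<forall>\<^sub>F y in nhds 0. f y \<ge> f 0"
  proof eventually_elim
   case (elim y)
   hence "(x + refl y, t + 2 * snd y) \<in> S" using Om_Cl unfolding S_def by auto
   from q(2)[OF this] show ?case by (simp add: fPhi xt)
  qed
  have jg: "jet2 (\<lambda>y::'a \<times> real. 4 * (t + 2 * snd y) - (t + 2 * snd y)^2) 0 (\<lambda>b. (0, 2 * (4 - 2 * t)) \<bullet> b) (4 * (-2))"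
   by (rule jet2_gap[where P="\<lambda>q. 4 * q - q^2" and ?P1.0="\<lambda>q. 4 - 2 * q"]) (auto intro!: derivative_eq_intros)
  have "jet2 (\<lambda>y. (norm (y - x0))^2) x (\<lambda>b. (2 *\<^sub>R (x - x0)) \<bullet> b) (2 * DIM('a \<times> real))"
   by (rule jet2_cong_grad[OF jet2_sqnorm]) simp
  note js = jet2_refl[OF this]
  have "0 \<le> W' (u x) - W' (u X) + a * (KU * (4 * (-2)) + 2 * DIM('a \<times> real))"
   by (rule jet2_local_min(1)[OF _ ev], unfold f_def,
     rule jet2_add[OF jet2_diff[OF jet2_refl[OF jet_u[OF xO]] jet2_shift[OF jet_u[OF XO]]]
      jet2_cmult[OF jet2_add[OF jet2_cmult[OF jg] js]]])
  moreover have "W' (u x) - W' (u X) \<le> C0 * a"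
  proof -
   have "\<bar>W' (u x) - W' (u X)\<bar> \<le> C0 * \<bar>u x - u X\<bar>"
    by (intro W'_lip u_nonneg u_le_1 x XC)
   also have "... \<le> C0 * a" using gap gap0 C0 by (intro mult_left_mono) auto
   finally show ?thesis by simp
  qed
  ultimately have "0 \<le> a * (C0 - 8 * KU + 2 * DIM('a \<times> real))" by (simp add: algebra_simps)
  hence "0 \<le> C0 - 8 * KU + 2 * DIM('a \<times> real)" using a by (simp add: zero_le_mult_iff)
  thus False using KU by linarith
 qed
qed

lemma upper_lip:
 assumes "x \<in> Cl" "0 \<le> t" "t \<le> 1" shows "u (x + (0, t)) - u x \<le> 4 * KU * t"
proof -
 have "u (x + (0, t)) - u x \<le> 1 * (KU * (4 * t - t^2))"
  by (rule upper_doubling) (use assms u_nonneg in auto)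
 also have "... \<le> KU * (4 * t)" using KU unfolding mult_1 by (intro mult_left_mono) auto
 finally show ?thesis by (simp add: mult_ac)
qed

end

section \<open>Sliding and two-sided bounds of the normal derivative\<close>

context overdetermined begin

lemma shift_Cl: assumes "x \<in> Cl" "s \<ge> L * norm tau" shows "x + (tau, s) \<in> Cl"
 using dd_add[of x s tau] assms by (simp add: Cl_def)

lemma jet_shift_diff:
 assumes "x \<in> Om" "s \<ge> L * norm tau"
 shows "jet2 (\<lambda>x. u (x + (tau, s)) - u x) x (\<lambda>b. G (x + (tau, s)) \<bullet> b - G x \<bullet> b) (W' (u (x + (tau, s))) - W' (u x))"
 using dd_add[of x s tau] assms
 by (intro jet2_diff jet2_translate jet_u) (auto simp: Om_def)

lemma shift_cont:
 assumes "s \<ge> L * norm tau" shows "continuous_on Cl (\<lambda>x. u (x + (tau, s)) - u x)"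
 by (intro continuous_intros continuous_on_compose2[OF uc] uc) (use assms shift_Cl in auto)

text \<open>Where the translate is below \<open>u\<close>, the hypothesis puts both values into
  \<open>[\<gamma>, 1]\<close>. There \<open>W'\<close> increases at rate \<open>\<kappa>\<close>,
  which is the zero-order term required for the comparison on an unbounded set.\<close>

lemma slide_region:
 assumes s: "s \<ge> L * norm tau"
  and h: "\<And>x. x \<in> Cl \<Longrightarrow> u (x + (tau, s)) \<ge> \<gamma> \<or> u (x + (tau, s)) \<ge> u x" and x: "x \<in> Cl"
 shows "u (x + (tau, s)) \<ge> u x"
proof -
 have "0 \<le> u (x + (tau, s)) - u x"
 proof (rule comparison_unbounded[OF closed_Cl shift_cont[OF s] _ \<kappa> _ x, of 1])
  fix x assume x: "x \<in> Cl"
  show "- 1 \<le> u (x + (tau, s)) - u x" using u_nonneg[OF shift_Cl[OF x s]] u_le_1[OF x] by simp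
  assume neg: "u (x + (tau, s)) - u x < 0"
  have "dd x \<noteq> 0" using u_zero[of x] u_nonneg[OF shift_Cl[OF x s]] neg by auto
  hence xO: "x \<in> Om" using x by (simp add: Om_def Cl_def)
  have "u (x + (tau, s)) \<ge> \<gamma>" using h[OF x] neg by auto
  hence "W' (u x) - W' (u (x + (tau, s))) \<ge> \<kappa> * (u x - u (x + (tau, s)))"
   using neg u_le_1[OF x] by (intro W'_mono) auto
  hence "W' (u (x + (tau, s))) - W' (u x) \<le> \<kappa> * (u (x + (tau, s)) - u x)" by (simp add: algebra_simps)
  thus "x \<in> interior Cl \<and> (\<exists>g l. jet2 (\<lambda>x. u (x + (tau, s)) - u x) x g l \<and> l \<le> \<kappa> * (u (x + (tau, s)) - u x))"
   using jet_shift_diff[OF xO s] xO unfolding Cl_interior by blast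
 qed
 thus ?thesis by simp
qed

lemma spread_Cl:
 assumes "1 \<le> M"
 obtains \<theta> where "\<theta> > 0" "\<And>f a y. continuous_on Cl f \<Longrightarrow>
   (\<forall>x\<in>Cl. f x \<ge> 0) \<Longrightarrow> a \<ge> 0 \<Longrightarrow> (\<forall>x\<in>Cl - interior Cl. f x \<ge> a) \<Longrightarrow>
   (\<forall>x\<in>Cl \<inter> cball y 1. f x \<ge> a) \<Longrightarrow>
   (\<forall>x\<in>interior Cl. \<exists>g l. jet2 f x g l \<and> l \<le> C0 * f x) \<Longrightarrow>
   (\<forall>x\<in>Cl \<inter> cball y M. f x \<ge> \<theta> * a)"
proof -
 obtain \<theta> where th: "\<theta> > 0" and sp: "\<forall>(S::('a\<times>real) set) f a y. closed S \<longrightarrow> continuous_on S f \<longrightarrow>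
   (\<forall>x\<in>S. f x \<ge> 0) \<longrightarrow> a \<ge> 0 \<longrightarrow> (\<forall>x\<in>S - interior S. f x \<ge> a) \<longrightarrow>
   (\<forall>x\<in>S \<inter> cball y 1. f x \<ge> a) \<longrightarrow>
   (\<forall>x\<in>interior S. \<exists>g l. jet2 f x g l \<and> l \<le> C0 * f x) \<longrightarrow>
   (\<forall>x\<in>S \<inter> cball y M. f x \<ge> \<theta> * a)"
  using spreading[where 'a="'a \<times> real", OF zero_less_one assms C0] by (elim exE conjE) (rule that)
 show ?thesis
 proof (rule that[OF th])
  fix f a y
  assume A: "continuous_on Cl f" "\<forall>x\<in>Cl. f x \<ge> 0" "a \<ge> 0" "\<forall>x\<in>Cl - interior Cl. f x \<ge> a"
   "\<forall>x\<in>Cl \<inter> cball y 1. f x \<ge> a" "\<forall>x\<in>interior Cl. \<exists>g l. jet2 f x g l \<and> l \<le> C0 * f x"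
  show "\<forall>x\<in>Cl \<inter> cball y M. f x \<ge> \<theta> * a"
   by (rule sp[THEN spec[of _ Cl], THEN spec[of _ f], THEN spec[of _ a], THEN spec[of _ y], THEN mp,
      OF closed_Cl, THEN mp, OF A(1), THEN mp, OF A(2), THEN mp, OF A(3), THEN mp, OF A(4),
      THEN mp, OF A(5), THEN mp, OF A(6)])
 qed
qed

text \<open>The epigraph offers no compactness in horizontal directions, so a pointwise strict
  inequality would not allow \<open>s\<close> to be lowered. Spreading gives the uniform gap
  \<open>\<theta> * c0\<close> at heights up to \<open>D\<close>, and by \<open>upper_lip\<close>
  lowering \<open>s\<close> by \<open>\<delta>\<close> costs no more than that. At larger heights
  the translate is at least \<open>\<gamma>\<close>, and \<open>slide_region\<close> closes the
  argument.\<close>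

lemma slide_step:
 assumes s: "s > L * norm tau" and P: "\<And>x. x \<in> Cl \<Longrightarrow> u (x + (tau, s)) \<ge> u x"
 shows "\<exists>\<delta>>0. \<forall>s'. s - \<delta> \<le> s' \<longrightarrow> s' \<le> s \<longrightarrow> (\<forall>x\<in>Cl. u (x + (tau, s')) \<ge> u x)"
proof -
 obtain D where D: "D > 0" "\<And>x. dd x \<ge> D \<Longrightarrow> u x \<ge> \<gamma>"
  using deep_limit[of "1 - \<gamma>"] \<gamma> by auto
 obtain c0 where c0: "c0 > 0" "\<And>x. dd x \<ge> s - L * norm tau \<Longrightarrow> u x \<ge> c0"
  using pos_height[of "s - L * norm tau"] s by auto
 \<comment> \<open>The ball of radius \<open>M\<close> will be centred at
   \<open>x + (0, - M)\<close>, so far down that the concentric unit ball misses \<open>Cl\<close>.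
   The bound \<open>c0\<close> then enters through the boundary alone, where \<open>u\<close>
   vanishes and the translate is at least \<open>c0\<close>.\<close>
 define M where "M = D + 2 + L"
 have M: "1 \<le> M" using D L0 by (simp add: M_def)
 define f where "f x = u (x + (tau, s)) - u x" for x
 obtain \<theta> where th: "\<theta> > 0" and sp: "\<And>f a y. continuous_on Cl f \<Longrightarrow>
   (\<forall>x\<in>Cl. f x \<ge> 0) \<Longrightarrow> a \<ge> 0 \<Longrightarrow> (\<forall>x\<in>Cl - interior Cl. f x \<ge> a) \<Longrightarrow>
   (\<forall>x\<in>Cl \<inter> cball y 1. f x \<ge> a) \<Longrightarrow>
   (\<forall>x\<in>interior Cl. \<exists>g l. jet2 f x g l \<and> l \<le> C0 * f x) \<Longrightarrow>
   (\<forall>x\<in>Cl \<inter> cball y M. f x \<ge> \<theta> * a)"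
  by (rule spread_Cl[OF M]) (rule that)
 have low: "f x \<ge> \<theta> * c0" if x: "x \<in> Cl" "dd x \<le> D" for x
 proof -
  have "\<forall>z\<in>Cl \<inter> cball (x + (0, - M)) M. f z \<ge> \<theta> * c0"
  proof (rule sp)
   show "continuous_on Cl f" unfolding f_def by (rule shift_cont) (use s in simp)
   show "\<forall>x\<in>Cl. 0 \<le> f x" using P by (simp add: f_def)
   show "\<forall>z\<in>Cl - interior Cl. c0 \<le> f z"
   proof
    fix z assume "z \<in> Cl - interior Cl"
    hence z: "dd z = 0" unfolding Cl_interior by (auto simp: Cl_def Om_def)
    have "c0 \<le> u (z + (tau, s))" using dd_add[of z s tau] z by (intro c0(2)) simp
    thus "c0 \<le> f z" using u_zero[OF z] by (simp add: f_def)
   qed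
   show "\<forall>z\<in>Cl \<inter> cball (x + (0, - M)) 1. c0 \<le> f z"
   proof
    fix z assume z: "z \<in> Cl \<inter> cball (x + (0, - M)) 1"
    have "\<bar>dd z - dd (x + (0, - M))\<bar> \<le> (1 + L) * norm (z - (x + (0, - M)))" by (rule dd_lip)
    also have "... \<le> (1 + L) * 1" using z L0 by (intro mult_left_mono) (auto simp: dist_norm norm_minus_commute)
    finally have "dd z \<le> dd x - M + 1 + L" by (simp add: abs_le_iff)
    thus "c0 \<le> f z" using z x by (simp add: Cl_def M_def)
   qed
   show "\<forall>z\<in>interior Cl. \<exists>g l. jet2 f z g l \<and> l \<le> C0 * f z"
   proof
    fix z assume "z \<in> interior Cl"
    hence z: "z \<in> Om" by (simp add: Cl_interior)
    have j: "jet2 f z (\<lambda>b. G (z + (tau, s)) \<bullet> b - G z \<bullet> b) (W' (u (z + (tau, s))) - W' (u z))"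
     unfolding f_def by (rule jet_shift_diff[OF z]) (use s in simp)
    have zC: "z \<in> Cl" "z + (tau, s) \<in> Cl" using Om_Cl z shift_Cl[of z tau s] s by auto
    have "\<bar>W' (u (z + (tau, s))) - W' (u z)\<bar> \<le> C0 * \<bar>u (z + (tau, s)) - u z\<bar>"
     by (intro W'_lip u_nonneg u_le_1 zC)
    hence "W' (u (z + (tau, s))) - W' (u z) \<le> C0 * f z" using P[OF zC(1)] by (simp add: f_def)
    thus "\<exists>g l. jet2 f z g l \<and> l \<le> C0 * f z" using j by blast
   qed
  qed (use c0 in auto)
  thus ?thesis using x M by (auto simp: dist_norm)
 qed
 define \<delta> where "\<delta> = Min {1, s - L * norm tau, \<theta> * c0 / (4 * KU)}"
 have del: "\<delta> > 0" "\<delta> \<le> 1" "\<delta> \<le> s - L * norm tau" "\<delta> \<le> \<theta> * c0 / (4 * KU)"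
  using s th c0 KU(1) by (auto simp: \<delta>_def)
 show ?thesis
 proof (intro exI[of _ \<delta>] conjI del(1) allI impI ballI)
  fix s' x assume s': "s - \<delta> \<le> s'" "s' \<le> s" and x: "x \<in> Cl"
  have Ls: "s' \<ge> L * norm tau" using s' del by linarith
  show "u x \<le> u (x + (tau, s'))"
  proof (rule slide_region[OF Ls _ x])
   fix x assume x: "x \<in> Cl"
   show "\<gamma> \<le> u (x + (tau, s')) \<or> u x \<le> u (x + (tau, s'))"
   proof (cases "dd x \<le> D")
    case True
    have "u (x + (tau, s') + (0, s - s')) - u (x + (tau, s')) \<le> 4 * KU * (s - s')"
     using s' del by (intro upper_lip shift_Cl x Ls) auto
    also have "... \<le> 4 * KU * (\<theta> * c0 / (4 * KU))"
     using s' del KU(1) by (intro mult_left_mono) auto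
    also have "... = \<theta> * c0" using KU(1) by simp
    also have "... \<le> u (x + (tau, s)) - u x" using low[OF x True] by (simp add: f_def)
    finally show ?thesis by (simp add: add.assoc)
   next
    case False
    hence "dd (x + (tau, s')) \<ge> D" using dd_add[of x s' tau] Ls by linarith
    thus ?thesis using D(2) by auto
   qed
  qed
 qed
qed

text \<open>Continuity method in \<open>s\<close>: the inequality holds for large \<open>s\<close>,
  survives decreasing limits, and by \<open>slide_step\<close> extends downwards as long as
  \<open>s > L * norm tau\<close>. The extreme value \<open>L * norm tau\<close> is again a
  limit.\<close>

lemma slide:
 assumes "s \<ge> L * norm tau" "x \<in> Cl"
 shows "u (x + (tau, s)) \<ge> u x"
proof -
 define P where "P s \<longleftrightarrow> (\<forall>x\<in>Cl. u (x + (tau, s)) \<ge> u x)" for s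
 have lim: "P m" if m: "m \<ge> L * norm tau" "\<And>s. s > m \<Longrightarrow> P s" for m
  unfolding P_def
 proof
  fix x assume x: "x \<in> Cl"
  have "continuous_on {m..m+1} (\<lambda>s. u (x + (tau, s)))"
   by (intro continuous_on_compose2[OF uc] continuous_intros image_subsetI shift_Cl[OF x]) (use m in auto)
  hence "((\<lambda>s. u (x + (tau, s))) \<longlongrightarrow> u (x + (tau, m))) (at m within {m..m+1})"
   by (auto simp: continuous_on_def)
  hence l: "((\<lambda>s. u (x + (tau, s))) \<longlongrightarrow> u (x + (tau, m))) (at_right m)"
   by (simp add: at_within_Icc_at_right)
  have "\<forall>\<^sub>F s in at_right m. u x \<le> u (x + (tau, s))"
   using m(2) x unfolding P_def eventually_at_right_field by (intro exI[of _ "m + 1"]) auto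
  from tendsto_lowerbound[OF l this] show "u x \<le> u (x + (tau, m))" by simp
 qed
 obtain D where D: "D > 0" "\<And>x. dd x \<ge> D \<Longrightarrow> u x \<ge> \<gamma>"
  using deep_limit[of "1 - \<gamma>"] \<gamma> by auto
 have big: "P s" if "s \<ge> L * norm tau + D" for s
  unfolding P_def
 proof
  fix x assume x: "x \<in> Cl"
  show "u x \<le> u (x + (tau, s))"
  proof (rule slide_region[OF _ _ x])
   fix z assume "z \<in> Cl"
   hence "dd (z + (tau, s)) \<ge> D" using dd_add[of z s tau] that by (simp add: Cl_def)
   thus "\<gamma> \<le> u (z + (tau, s)) \<or> u z \<le> u (z + (tau, s))" using D(2) by auto
  qed (use that D in simp)
 qed
 have all: "P s1" if s1: "s1 > L * norm tau" for s1
 proof (rule ccontr)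
  assume neg: "\<not> P s1"
  \<comment> \<open>The heights at which the inequality fails. At the supremum \<open>m\<close> it
    holds by the limit argument and just below \<open>m\<close> by \<open>slide_step\<close>, so
    failures cannot approach \<open>m\<close>.\<close>
  define B where "B = {s. s \<ge> s1 \<and> \<not> P s}"
  have B: "s1 \<in> B" "bdd_above B"
   using neg big by (auto simp: B_def intro!: bdd_aboveI[of _ "L * norm tau + D"]) (meson linear)
  define m where "m = Sup B"
  have m: "m \<ge> s1" unfolding m_def using B by (rule cSup_upper)
  have Pgt: "P s" if "s > m" for s
  proof (rule ccontr)
   assume "\<not> P s"
   hence "s \<in> B" using that m by (simp add: B_def)
   hence "s \<le> m" unfolding m_def using B(2) by (rule cSup_upper)
   thus False using that by simp
  qed
  have Pm: "P m" by (rule lim) (use m s1 in linarith, rule Pgt)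
  obtain \<delta> where d: "\<delta> > 0" "\<And>s'. m - \<delta> \<le> s' \<Longrightarrow> s' \<le> m \<Longrightarrow> P s'"
   using slide_step[of tau m] m s1 Pm unfolding P_def by auto
  obtain b where b: "b \<in> B" "m - \<delta> < b"
   using less_cSup_iff[of B "m - \<delta>"] B d(1) unfolding m_def by force
  have "b \<le> m" unfolding m_def using b(1) B(2) by (rule cSup_upper)
  hence "P b" using d(2) b by auto
  thus False using b by (simp add: B_def)
 qed
 have "P s" using all lim[of s] assms(1) by (cases "s = L * norm tau") auto
 thus ?thesis using assms by (simp add: P_def)
qed

section \<open>Harnack's inequality and the decay of \<open>1 - u\<close>\<close>

lemma u_mono_up: "x \<in> Cl \<Longrightarrow> s \<ge> 0 \<Longrightarrow> u (x + (0, s)) \<ge> u x"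
 by (rule slide) auto

text \<open>Since \<open>1 - u\<close> is monotone along a cone, one large value already makes it large on a ball, so
  spreading yields a Harnack inequality.\<close>
lemma harnack: assumes "rho \<ge> 0"
 shows "\<exists>C1>0. \<forall>x\<in>Cl. \<forall>y\<in>Cl. dist x y \<le> rho \<longrightarrow> 1 - u y \<le> C1 * (1 - u x)"
proof -
 define M where "M = rho + L + 1"
 have M: "1 \<le> M" using assms L0 by (simp add: M_def)
 obtain \<theta> where th: "\<theta> > 0" and sp: "\<And>f a y. continuous_on Cl f \<Longrightarrow>
   (\<forall>x\<in>Cl. f x \<ge> 0) \<Longrightarrow> a \<ge> 0 \<Longrightarrow> (\<forall>x\<in>Cl - interior Cl. f x \<ge> a) \<Longrightarrow>
   (\<forall>x\<in>Cl \<inter> cball y 1. f x \<ge> a) \<Longrightarrow>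
   (\<forall>x\<in>interior Cl. \<exists>g l. jet2 f x g l \<and> l \<le> C0 * f x) \<Longrightarrow>
   (\<forall>x\<in>Cl \<inter> cball y M. f x \<ge> \<theta> * a)"
  by (rule spread_Cl[OF M]) (rule that)
 show ?thesis
 proof (intro exI[of _ "1 / \<theta>"] conjI ballI impI)
  show "1 / \<theta> > 0" using th by simp
  fix x y assume x: "x \<in> Cl" and y: "y \<in> Cl" and xy: "dist x y \<le> rho"
  \<comment> \<open>For \<open>z\<close> within distance 1 of this point the vector
    \<open>y - z\<close> lies in the cone of monotonicity, hence
    \<open>1 - u z \<ge> 1 - u y\<close>.\<close>
  define y' where "y' = y + (0, - (L + 1))"
  have "\<forall>z\<in>Cl \<inter> cball y' M. 1 - u z \<ge> \<theta> * (1 - u y)"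
  proof (rule sp)
   show "continuous_on Cl (\<lambda>z. 1 - u z)" by (intro continuous_intros uc)
   show "\<forall>z\<in>Cl. 0 \<le> 1 - u z" "0 \<le> 1 - u y" using u_le_1 y by auto
   show "\<forall>z\<in>Cl - interior Cl. 1 - u y \<le> 1 - u z"
   proof
    fix z assume "z \<in> Cl - interior Cl"
    hence "dd z = 0" unfolding Cl_interior by (auto simp: Cl_def Om_def)
    thus "1 - u y \<le> 1 - u z" using u_zero u_nonneg[OF y] by simp
   qed
   show "\<forall>z\<in>Cl \<inter> cball y' 1. 1 - u y \<le> 1 - u z"
   proof
    fix z assume z: "z \<in> Cl \<inter> cball y' 1"
    define tau s where "tau = fst y - fst z" and "s = snd y - snd z"
    have nz: "norm (z - y') \<le> 1" using z by (simp add: dist_norm norm_minus_commute)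
    have "norm (fst (z - y')) \<le> 1" "\<bar>snd (z - y')\<bar> \<le> 1"
     using nz norm_fst_le[of "fst (z - y')" "snd (z - y')"] norm_snd_le[of "snd (z - y')" "fst (z - y')"]
     unfolding prod.collapse real_norm_def by linarith+
    moreover have "fst (z - y') = - tau" "snd (z - y') = L + 1 - s" by (auto simp: y'_def tau_def s_def)
    ultimately have "norm tau \<le> 1" "s \<ge> L" by auto
    hence "L * norm tau \<le> s" using mult_left_mono[of "norm tau" 1 L] L0 by simp
    hence "u (z + (tau, s)) \<ge> u z" using z by (intro slide) auto
    moreover have "z + (tau, s) = y" by (simp add: tau_def s_def prod_eq_iff)
    ultimately show "1 - u y \<le> 1 - u z" by simp
   qed
   show "\<forall>z\<in>interior Cl. \<exists>g l. jet2 (\<lambda>z. 1 - u z) z g l \<and> l \<le> C0 * (1 - u z)"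
   proof
    fix z assume "z \<in> interior Cl"
    hence z: "z \<in> Om" by (simp add: Cl_interior)
    have zC: "z \<in> Cl" using z Om_Cl by auto
    have "\<bar>W' (u z) - W' 1\<bar> \<le> C0 * \<bar>u z - 1\<bar>" using u_nonneg[OF zC] u_le_1[OF zC] by (intro W'_lip) auto
    hence "0 - W' (u z) \<le> C0 * (1 - u z)" using W'_1 u_le_1[OF zC] by simp
    thus "\<exists>g l. jet2 (\<lambda>z. 1 - u z) z g l \<and> l \<le> C0 * (1 - u z)"
     using jet2_diff[OF jet2_const[of 1] jet_u[OF z]] by blast
   qed
  qed
  moreover have "x \<in> cball y' M"
  proof -
   have "dist y' x \<le> dist y' y + dist y x" by (rule dist_triangle)
   moreover have "dist y' y = L + 1" using L0 by (simp add: y'_def dist_norm)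
   ultimately show ?thesis using xy by (simp add: M_def dist_commute)
  qed
  ultimately have "\<theta> * (1 - u y) \<le> 1 - u x" using x by auto
  thus "1 - u y \<le> 1 / \<theta> * (1 - u x)" using th by (simp add: field_simps)
 qed
qed

text \<open>Harnack's inequality between \<open>x\<close> and the boundary point below it, where
  \<open>1 - u\<close> equals 1.\<close>

lemma u_less_1: assumes "x \<in> Cl" shows "u x < 1"
proof -
 define y where "y = x + (0, - dd x)"
 have dy: "dd y = 0" unfolding y_def dd_up by simp
 have "dist x y = dd x" using assms by (simp add: y_def dist_norm Cl_def)
 moreover have "dd x \<ge> 0" "y \<in> Cl" using assms dy by (auto simp: Cl_def)
 moreover obtain C1 where "C1 > 0" "\<forall>x'\<in>Cl. \<forall>y\<in>Cl. dist x' y \<le> dd x \<longrightarrow> 1 - u y \<le> C1 * (1 - u x')"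
  using harnack[OF \<open>dd x \<ge> 0\<close>] by blast
 ultimately have "1 - u y \<le> C1 * (1 - u x)" "C1 > 0" using assms by auto
 hence "C1 * (1 - u x) > 0" using u_zero[OF dy] by simp
 thus ?thesis using \<open>C1 > 0\<close> by (simp add: zero_less_mult_iff)
qed

text \<open>On a ball well inside the cone above \<open>x\<close> sliding gives
  \<open>1 - u \<le> a\<close>, and there \<open>1 - u\<close> has Laplacian at least
  \<open>\<kappa> * (1 - u)\<close>. The paraboloid with value \<open>a / 2\<close> at the centre
  and \<open>3 * a / 2\<close> on the sphere lies above it as soon as
  \<open>2 * n / rho^2 < \<kappa> / 2\<close>.\<close>

lemma half_decay: "\<exists>T>0. \<forall>x\<in>Cl. 1 - u (x + (0, T)) \<le> (1 - u x) / 2"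
proof -
 obtain D where D: "D > 0" "\<And>x. dd x \<ge> D \<Longrightarrow> u x \<ge> \<gamma>"
  using deep_limit[of "1 - \<gamma>"] \<gamma> by auto
 define n where "n = real DIM('a \<times> real)"
 have n: "n > 0" by (simp add: n_def)
 define rho where "rho = 1 + 4 * n / \<kappa>"
 have rho: "rho \<ge> 1" "rho^2 > 4 * n / \<kappa>"
 proof -
  show 1: "rho \<ge> 1" using n \<kappa> by (simp add: rho_def)
  have "rho * 1 \<le> rho * rho" using 1 by (intro mult_left_mono) auto
  thus "rho^2 > 4 * n / \<kappa>" by (simp add: rho_def power2_eq_square)
 qed
 have rk: "2 * n / rho^2 < \<kappa> / 2" using rho \<kappa> by (simp add: field_simps)
 \<comment> \<open>Keeps the ball of radius \<open>rho\<close> both in the region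
   \<open>u \<ge> \<gamma>\<close> and in the cone of monotonicity above \<open>x\<close>.\<close>
 define T where "T = D + (1 + L) * rho"
 have T: "T > 0" using D L0 rho by (auto simp: T_def intro!: add_pos_nonneg)
 show ?thesis
 proof (intro exI[of _ T] conjI T ballI)
  fix x assume x: "x \<in> Cl"
  define cc where "cc = x + (0, T)"
  define a where "a = 1 - u x"
  have a: "a > 0" using u_less_1[OF x] by (simp add: a_def)
  have sub: "y \<in> Om" "u y \<ge> \<gamma>" "1 - u y \<le> a" if "y \<in> cball cc rho" for y
  proof -
   have "\<bar>dd cc - dd y\<bar> \<le> (1 + L) * norm (cc - y)" by (rule dd_lip)
   also have "... \<le> (1 + L) * rho" using that L0 by (intro mult_left_mono) (auto simp: dist_norm)
   finally have "dd y \<ge> D" using x by (simp add: cc_def T_def Cl_def)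
   thus "y \<in> Om" "u y \<ge> \<gamma>" using D by (auto simp: Om_def)
   define tau s where "tau = fst y - fst x" and "s = snd y - snd x"
   have nz: "norm (y - cc) \<le> rho" using that by (simp add: dist_norm norm_minus_commute)
   have "norm (fst (y - cc)) \<le> rho" "\<bar>snd (y - cc)\<bar> \<le> rho"
    using nz norm_fst_le[of "fst (y - cc)" "snd (y - cc)"] norm_snd_le[of "snd (y - cc)" "fst (y - cc)"]
    unfolding prod.collapse real_norm_def by linarith+
   moreover have "fst (y - cc) = tau" "snd (y - cc) = s - T" by (auto simp: cc_def tau_def s_def)
   ultimately have "norm tau \<le> rho" "s \<ge> T - rho" by auto
   moreover have "T - rho \<ge> L * rho" using D by (simp add: T_def algebra_simps)
   moreover have "L * norm tau \<le> L * rho" using \<open>norm tau \<le> rho\<close> L0 by (intro mult_left_mono)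
   ultimately have "u (x + (tau, s)) \<ge> u x" using x by (intro slide) auto
   moreover have "x + (tau, s) = y" by (simp add: tau_def s_def prod_eq_iff)
   ultimately show "1 - u y \<le> a" by (simp add: a_def)
  qed
  define f where "f y = a / rho^2 * (norm (y - cc))^2 + a / 2 - (1 - u y)" for y
  have "0 \<le> f cc"
  proof (rule comparison_compact[of "cball cc rho" f])
   show "continuous_on (cball cc rho) f" unfolding f_def
    by (intro continuous_intros continuous_on_subset[OF uc]) (use sub Om_Cl in auto)
   show "cc \<in> cball cc rho" using rho by simp
   fix y assume y: "y \<in> cball cc rho" "f y < 0"
   have nn: "a / rho^2 * (norm (y - cc))^2 \<ge> 0" using a by simp
   have "norm (y - cc) \<noteq> rho"
   proof
    assume "norm (y - cc) = rho"
    hence "f y = a + a / 2 - (1 - u y)" using rho by (simp add: f_def)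
    thus False using y(2) sub(3)[OF y(1)] a by simp
   qed
   hence "y \<in> ball cc rho" using y(1) by (simp add: dist_norm norm_minus_commute)
   hence int: "y \<in> interior (cball cc rho)" by simp
   have zy: "1 - u y > a / 2" using y(2) nn unfolding f_def by linarith
   have "W' 1 - W' (u y) \<ge> \<kappa> * (1 - u y)" using sub[OF y(1)] u_le_1 Om_Cl by (intro W'_mono) auto
   moreover have "\<kappa> * (1 - u y) \<ge> \<kappa> * (a / 2)" using zy \<kappa> by (intro mult_left_mono) auto
   ultimately have "W' (u y) \<le> - (\<kappa> / 2 * a)" using W'_1 by simp
   moreover have "2 * n / rho^2 * a < \<kappa> / 2 * a" using rk a by (intro mult_strict_right_mono)
   moreover have "a / rho^2 * (2 * DIM('a \<times> real)) = 2 * n / rho^2 * a" unfolding n_def by simp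
   ultimately have "a / rho^2 * (2 * DIM('a \<times> real)) + 0 - (0 - W' (u y)) < 0" by linarith
   moreover have "jet2 f y (\<lambda>b. a / rho^2 * (2 * ((y - cc) \<bullet> b)) + 0 - (0 - G y \<bullet> b)) (a / rho^2 * (2 * DIM('a \<times> real)) + 0 - (0 - W' (u y)))"
    unfolding f_def
    by (intro jet2_diff jet2_add jet2_cmult jet2_sqnorm jet2_const jet_u sub(1)[OF y(1)])
   ultimately show "y \<in> interior (cball cc rho) \<and> (\<exists>g l. jet2 f y g l \<and> l < 0)" using int by blast
  qed auto
  thus "1 - u (x + (0, T)) \<le> (1 - u x) / 2" by (simp add: f_def cc_def a_def)
 qed
qed

end

lemma norm_le_fst_snd: "norm (z :: 'a::real_normed_vector \<times> real) \<le> norm (fst z) + \<bar>snd z\<bar>"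
 using sqrt_add_le_add_sqrt[of "(norm (fst z))^2" "(snd z)^2"] by (simp add: norm_prod_def)

section \<open>Two-sided bounds of the vertical derivative by \<open>1 - u\<close>\<close>

context overdetermined begin

lemma directional_nonneg:
 assumes x: "x \<in> Om" and s: "s \<ge> L * norm tau" shows "G x \<bullet> (tau, s) \<ge> 0"
proof -
 have xC: "x \<in> Cl" using x Om_Cl by auto
 show ?thesis
 proof (rule G_limit[OF xC zero_less_one, of "(tau, s)"])
  fix r :: real assume r: "0 < r"
  have sc: "k * s \<ge> L * norm (k *\<^sub>R tau)" if "k \<ge> 0" for k
   using mult_left_mono[OF s that] that by (simp add: mult_ac)
  have inO: "x + k *\<^sub>R (tau, s) \<in> Om" if "0 < k" for k
  proof -
   have "dd (x + (k *\<^sub>R tau, k * s)) > 0"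
    using dd_add[of x "k * s" "k *\<^sub>R tau"] sc[OF less_imp_le[OF that]] x unfolding Om_def mem_Collect_eq by linarith
   thus ?thesis by (simp add: Om_def)
  qed
  obtain k where k: "0 < k" "k < r" "u (x + r *\<^sub>R (tau, s)) - u x = r * (G (x + k *\<^sub>R (tau, s)) \<bullet> (tau, s))"
   using u_mvt[OF xC r, of "(tau, s)"] inO by blast
  have "u (x + r *\<^sub>R (tau, s)) \<ge> u x" using slide[OF sc xC, of r] r by simp
  hence "r * (G (x + k *\<^sub>R (tau, s)) \<bullet> (tau, s)) \<ge> 0" using k(3) by simp
  hence "G (x + k *\<^sub>R (tau, s)) \<bullet> (tau, s) \<ge> 0" using r by (simp add: zero_le_mult_iff)
  thus "\<exists>k>0. k < r \<and> x + k *\<^sub>R (tau, s) \<in> Cl \<and> 0 \<le> G (x + k *\<^sub>R (tau, s)) \<bullet> (tau, s)"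
   using k inO[of k] Om_Cl by (intro exI[of _ k]) auto
 qed
qed

lemma Gn_nonneg: assumes "x \<in> Om" shows "snd (G x) \<ge> 0"
 using directional_nonneg[OF assms, of 0 1] by (simp add: inner_prod_def)

text \<open>The direction \<open>(- fst (G x), L * norm (fst (G x)))\<close> lies on the boundary of
  the cone of monotonicity and is the least favourable one.\<close>

lemma G_fst_bound: assumes "x \<in> Om" shows "norm (fst (G x)) \<le> L * snd (G x)"
proof (cases "fst (G x) = 0")
 case False
 have "G x \<bullet> (- fst (G x), L * norm (fst (G x))) \<ge> 0"
  by (rule directional_nonneg[OF assms]) simp
 hence "norm (fst (G x)) * norm (fst (G x)) \<le> (L * snd (G x)) * norm (fst (G x))"
  by (simp add: inner_prod_def power2_norm_eq_inner[symmetric] power2_eq_square mult_ac)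
 thus ?thesis using False by simp
qed (use Gn_nonneg[OF assms] L0 in auto)

lemma G_bound: assumes "x \<in> Om" shows "norm (G x) \<le> (1 + L) * snd (G x)"
proof -
 have "norm (G x) \<le> norm (fst (G x)) + \<bar>snd (G x)\<bar>" by (rule norm_le_fst_snd)
 thus ?thesis using G_fst_bound[OF assms] Gn_nonneg[OF assms] by (simp add: algebra_simps)
qed

text \<open>The gap function is convex here, so that the reflected coupling gives the good sign; since \<open>1 - u\<close>
 decreases upwards, the cross terms are favourable, too.\<close>
lemma lower_doubling:
 "\<exists>eps>0. \<exists>K>0. \<exists>T>0. \<forall>x\<in>Cl. \<forall>t\<in>{0..T}. u (x + (0, t)) - u x \<ge> eps * (exp (K * t) - 1) * (1 - u x)"
proof -
 obtain T where T: "T > 0" "\<And>x. x \<in> Cl \<Longrightarrow> 1 - u (x + (0, T)) \<le> (1 - u x) / 2"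
  using half_decay by blast
 \<comment> \<open>\<open>C0 \<le> K^2\<close> lets the convexity of \<open>exp (K * t)\<close>
   absorb the Lipschitz bound of \<open>W'\<close>.\<close>
 define K where "K = C0 + 1"
 have K: "K > 0" "C0 \<le> K^2"
 proof -
  show K0: "K > 0" using C0 by (simp add: K_def)
  have "K * 1 \<le> K * K" using C0 K0 by (intro mult_left_mono) (auto simp: K_def)
  thus "C0 \<le> K^2" by (simp add: K_def power2_eq_square)
 qed
 define n where "n = real DIM('a \<times> real)"
 have n: "n > 0" by (simp add: n_def)
 define psi where "psi t = exp (K * t) - 1" for t
 have psi_mono: "psi s \<le> psi t" if "s \<le> t" for s t using that K by (simp add: psi_def)
 have psiT: "psi T > 0" using T K by (simp add: psi_def)
 \<comment> \<open>First entry: with \<open>rho\<close> below,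
   \<open>mu * rho * (1 + L) \<le> K\<close>, so the vertical part dominates the cross term of the
   gradients. Second entry: the Laplacian of the localizing term is at most
   \<open>2 * K^2\<close>.\<close>
 define mu where "mu = min ((K / (1 + L))^2 / psi T) (K^2 / n)"
 have mu: "mu > 0" "mu * psi T \<le> (K / (1 + L))^2" "2 * n * mu \<le> 2 * K^2"
 proof -
  show "mu > 0" using K L0 psiT n by (simp add: mu_def)
  have "mu * psi T \<le> (K / (1 + L))^2 / psi T * psi T" using psiT by (intro mult_right_mono) (auto simp: mu_def)
  thus "mu * psi T \<le> (K / (1 + L))^2" using psiT by simp
  have "n * mu \<le> n * (K^2 / n)" using n by (intro mult_left_mono) (auto simp: mu_def)
  thus "2 * n * mu \<le> 2 * K^2" using n by simp
 qed
 \<comment> \<open>At distance \<open>rho\<close> from \<open>x0\<close> the factor \<open>B\<close>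
   is nonpositive, so a negative minimum of \<open>\<Phi>\<close> lies inside the ball.\<close>
 define rho where "rho = sqrt (psi T / mu)"
 have rho: "rho > 0" "mu * rho^2 = psi T" using psiT mu by (auto simp: rho_def)
 have murho: "mu * rho * (1 + L) \<le> K"
 proof -
  have "(mu * rho)^2 = mu * psi T" using rho(2) by (simp add: power2_eq_square mult_ac)
  hence "(mu * rho)^2 \<le> (K / (1 + L))^2" using mu by simp
  hence "mu * rho \<le> K / (1 + L)" by (rule power2_le_imp_le) (use K L0 in auto)
  thus ?thesis using L0 by (simp add: pos_le_divide_eq)
 qed
 define M where "M = K * exp (K * T) + mu * (2 * rho + 1)"
 have M: "M > 0" using K mu rho by (auto simp: M_def intro!: add_pos_pos mult_pos_pos)
 \<comment> \<open>First entry: at \<open>t = T\<close> the increment demanded is at most half of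
   \<open>1 - u x\<close>, which \<open>half_decay\<close> provides. Second entry: a minimum at a
   boundary point would force a vertical derivative of at most \<open>2 * eps * M\<close>, and this
   is less than \<open>c1\<close>.\<close>
 define eps where "eps = min (1 / (2 * psi T)) (c1 / (4 * M))"
 have eps: "eps > 0" "eps * psi T \<le> 1 / 2" "2 * eps * M < c1"
 proof -
  show "eps > 0" using psiT c1_pos M by (simp add: eps_def)
  have "eps * psi T \<le> 1 / (2 * psi T) * psi T" using psiT by (intro mult_right_mono) (auto simp: eps_def)
  thus "eps * psi T \<le> 1 / 2" using psiT by simp
  have "eps * M \<le> c1 / (4 * M) * M" using M by (intro mult_right_mono) (auto simp: eps_def)
  also have "... = c1 / 4" using M by simp
  finally show "2 * eps * M < c1" using c1_pos by simp
 qed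
 have main: "u (x0 + (0, t0)) - u x0 \<ge> eps * psi t0 * (1 - u x0)"
  if x0: "x0 \<in> Cl" and t0: "0 \<le> t0" "t0 \<le> T" for x0 t0
 proof (rule ccontr)
  assume neg: "\<not> ?thesis"
  define S where "S = (Cl \<inter> cball x0 rho) \<times> {0..T}"
  define B where "B q = psi (snd q) - mu * (norm (fst q - x0))^2" for q
  define \<Phi> where "\<Phi> q = u (fst q + (0, snd q)) - u (fst q) - eps * (B q * (1 - u (fst q)))" for q
  have S: "compact S" unfolding S_def by (intro compact_Times closed_Int_compact closed_Cl) auto
  have cont: "continuous_on S \<Phi>" unfolding \<Phi>_def B_def psi_def
   by (intro continuous_intros continuous_on_compose2[OF uc]) (auto simp: S_def Cl_def dd_def)
  have S0: "(x0, t0) \<in> S" using x0 t0 rho by (simp add: S_def)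
  obtain q where q: "q \<in> S" "\<And>q'. q' \<in> S \<Longrightarrow> \<Phi> q \<le> \<Phi> q'"
   using continuous_attains_inf[OF S _ cont] S0 by blast
  obtain x t where xt: "q = (x, t)" by (cases q)
  have "\<Phi> (x0, t0) < 0" using neg by (simp add: \<Phi>_def B_def mult_ac)
  hence pos: "\<Phi> (x, t) < 0" using q(2)[OF S0] xt by simp
  have x: "x \<in> Cl" "x \<in> cball x0 rho" and t: "0 \<le> t" "t \<le> T" using q(1) xt by (auto simp: S_def)
  define X where "X = x + (0, t)"
  have XC: "X \<in> Cl" using x t by (simp add: X_def Cl_def)
  have z: "1 - u x > 0" using u_less_1[OF x(1)] by simp
  have up: "u X \<ge> u x" unfolding X_def by (rule u_mono_up[OF x(1) t(1)])
  have \<Phi>x: "\<Phi> (x, t) = u X - u x - eps * (B (x, t) * (1 - u x))" by (simp add: \<Phi>_def X_def)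
  have "eps * (B (x, t) * (1 - u x)) > 0" using pos up unfolding \<Phi>x by linarith
  hence B0: "B (x, t) > 0" using eps z by (simp add: zero_less_mult_iff)
  have Bpsi: "B (x', t') \<le> psi t'" for x' t' using mu by (simp add: B_def)
  have nx: "norm (x - x0) < rho"
  proof -
   have "mu * (norm (x - x0))^2 < psi T" using B0 psi_mono[OF t(2)] by (simp add: B_def)
   hence "(norm (x - x0))^2 < rho^2" using mu rho by (metis mult_less_cancel_left_pos)
   thus ?thesis by (rule power_less_imp_less_base) (use rho in simp)
  qed
  have t00: "t > 0"
  proof (rule ccontr)
   assume "\<not> t > 0"
   hence "psi t = 0" using t by (simp add: psi_def)
   thus False using Bpsi[of x t] B0 by simp
  qed
  have tT: "t < T"
  proof (rule ccontr)
   assume "\<not> t < T"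
   hence tT: "t = T" using t by simp
   have "eps * B (x, t) \<le> eps * psi T" using Bpsi[of x t] eps(1) tT by (intro mult_left_mono) auto
   hence "eps * B (x, t) \<le> 1 / 2" using eps(2) by linarith
   hence "eps * B (x, t) * (1 - u x) \<le> 1 / 2 * (1 - u x)" using z by (intro mult_right_mono) auto
   moreover have "1 - u X \<le> (1 - u x) / 2" using T(2)[OF x(1)] by (simp add: X_def tT)
   moreover have False if "Q \<le> 1 / 2 * (1 - a)" "1 - b \<le> (1 - a) / 2" "b - a - Q < 0" for Q a b :: real
    using that by argo
   ultimately show False using pos unfolding \<Phi>x mult.assoc by blast
  qed
  show False
  proof (cases "dd x = 0")
   case True
   have ux: "u x = 0" by (rule u_zero[OF True])
   define \<delta> where "\<delta> = Min {1, t, rho - norm (x - x0)}"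
   have del: "\<delta> > 0" "\<delta> \<le> 1" "\<delta> \<le> t" "\<delta> \<le> rho - norm (x - x0)" using t00 nx by (auto simp: \<delta>_def)
   have "G x \<bullet> (0, - 1) \<ge> - (2 * eps * M)"
   proof (rule G_limit[OF x(1) del(1), of "(0, 1)"])
    fix s :: real assume s: "0 < s" "s < \<delta>"
    obtain r where r: "0 < r" "r < s" "u (x + (0, s)) - u x = s * (G (x + (0, r)) \<bullet> (0, 1))"
     using u_mvt_up[OF x(1) s(1)] by blast
    define us where "us = u (x + (0, s))"
    have us: "us \<ge> 0" unfolding us_def using x s by (intro u_nonneg) (simp add: Cl_def)
    have "norm (x + (0, s) - x0) \<le> norm (x - x0) + norm (0 :: 'a, s)"
     using norm_triangle_ineq[of "x - x0" "(0, s)"] by (simp add: algebra_simps)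
    hence n1: "norm (x + (0, s) - x0) \<le> norm (x - x0) + s" using s by simp
    have "(x + (0, s), t - s) \<in> S" using x s n1 t del
     by (auto simp: S_def Cl_def dist_norm norm_minus_commute)
    from q(2)[OF this] have "\<Phi> (x, t) \<le> \<Phi> (x + (0, s), t - s)" by (simp add: xt)
    moreover have "x + (0, s) + (0, t - s) = X" by (simp add: X_def)
    ultimately have 1: "- eps * B (x, t) \<le> - us - eps * (B (x + (0, s), t - s) * (1 - us))"
     unfolding \<Phi>_def fst_conv snd_conv us_def[symmetric] X_def[symmetric] ux by simp
    define B' where "B' = B (x + (0, s), t - s)"
    have "psi (t - s) \<le> psi T" using t s by (intro psi_mono) simp
    hence "B' \<le> psi T" unfolding B'_def using Bpsi[of "x + (0, s)" "t - s"] by linarith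
    hence "eps * B' \<le> eps * psi T" using eps(1) by (intro mult_left_mono) auto
    hence "eps * B' \<le> 1 / 2" using eps(2) by linarith
    hence 2: "eps * B' * us \<le> 1 / 2 * us" using us by (intro mult_right_mono) auto
    have "B (x, t) - B' \<le> s * M"
    proof -
     have "(norm (x + (0, s) - x0))^2 \<le> (norm (x - x0) + s)^2" using n1 by (intro power_mono) auto
     also have "... \<le> (norm (x - x0))^2 + s * (2 * rho + 1)"
     proof -
      have "norm (x - x0) * s \<le> rho * s" "s * s \<le> 1 * s" using nx s del by (auto intro!: mult_right_mono)
      thus ?thesis by (simp add: power2_eq_square algebra_simps)
     qed
     finally have "mu * (norm (x + (0, s) - x0))^2 \<le> mu * ((norm (x - x0))^2 + s * (2 * rho + 1))"
      using mu by (intro mult_left_mono) auto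
     moreover have "psi t - psi (t - s) \<le> s * (K * exp (K * T))"
     proof -
      have "1 + - (K * s) \<le> exp (- (K * s))" by (rule exp_ge_add_one_self)
      hence "exp (K * t) * (1 - exp (- (K * s))) \<le> exp (K * t) * (K * s)" by (intro mult_left_mono) auto
      also have "... \<le> exp (K * T) * (K * s)" using t K s by (intro mult_right_mono) auto
      finally show ?thesis
       by (simp add: psi_def right_diff_distrib exp_add[symmetric] mult_ac) (simp add: exp_diff exp_minus field_simps)?
     qed
     ultimately show ?thesis by (simp add: B_def B'_def M_def algebra_simps)
    qed
    hence "eps * (B (x, t) - B') \<le> eps * (s * M)" using eps by (intro mult_left_mono) auto
    hence "us \<le> 2 * (eps * (s * M))" using 1 2 by (simp add: B'_def[symmetric] algebra_simps)
    hence "s * (G (x + (0, r)) \<bullet> (0, 1)) \<le> s * (2 * eps * M)" using r(3) ux by (simp add: us_def mult_ac)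
    hence "G (x + (0, r)) \<bullet> (0, 1) \<le> 2 * eps * M" using s by (simp only: mult_le_cancel_left_pos)
    thus "\<exists>r>0. r < s \<and> x + r *\<^sub>R (0, 1) \<in> Cl \<and> - (2 * eps * M) \<le> G (x + r *\<^sub>R (0, 1)) \<bullet> (0, - 1)"
     using r x(1) by (intro exI[of _ r]) (simp add: Cl_def inner_prod_def)
   qed
   thus False using Gn_bounds_bdry(1)[OF True] eps(3) by (simp add: inner_prod_def)
  next
   case False
   hence xO: "x \<in> Om" using x by (simp add: Om_def Cl_def)
   hence XO: "X \<in> Om" using t by (simp add: X_def Om_def)
   define f where "f y = u (X + y) - u (x + refl y)
     - eps * (((exp (K * (t + 2 * snd y)) - 1) - mu * (norm (x + refl y - x0))^2) * (1 - u (x + refl y)))" for y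
   have fPhi: "f y = \<Phi> (x + refl y, t + 2 * snd y)" for y
   proof -
    have "x + refl y + (0, t + 2 * snd y) = X + y" by (simp add: X_def refl_def prod_eq_iff)
    thus ?thesis by (simp add: f_def \<Phi>_def B_def psi_def)
   qed
   have "open ((Om \<inter> ball x0 rho) \<times> {0<..<T})" by (intro open_Times open_Int open_Om) auto
   moreover have "(x, t) \<in> (Om \<inter> ball x0 rho) \<times> {0<..<T}"
    using xO nx t00 tT by (simp add: dist_norm norm_minus_commute)
   ultimately have "\<forall>\<^sub>F y in nhds 0. (x + refl y, t + 2 * snd y) \<in> (Om \<inter> ball x0 rho) \<times> {0<..<T}"
    by (rule eventually_coupled)
   hence ev: "\<forall>\<^sub>F y in nhds 0. f y \<ge> f 0"
   proof eventually_elim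
    case (elim y)
    hence "(x + refl y, t + 2 * snd y) \<in> S" using Om_Cl unfolding S_def by auto
    from q(2)[OF this] show ?case by (simp add: fPhi xt)
   qed
   define E where "E = exp (K * t)"
   have jg: "jet2 (\<lambda>y::'a \<times> real. exp (K * (t + 2 * snd y)) - 1) 0 (\<lambda>b. (0, 2 * (K * E)) \<bullet> b) (4 * (K^2 * E))"
    unfolding E_def
    by (rule jet2_gap[where P="\<lambda>q. exp (K * q) - 1" and ?P1.0="\<lambda>q. K * exp (K * q)"])
     (auto intro!: derivative_eq_intros simp: power2_eq_square)
   have "jet2 (\<lambda>y. (norm (y - x0))^2) x (\<lambda>b. (2 *\<^sub>R (x - x0)) \<bullet> b) (2 * DIM('a \<times> real))"
    by (rule jet2_cong_grad[OF jet2_sqnorm]) simp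
   note js = jet2_refl[OF this]
   have "jet2 (\<lambda>y. 1 - u y) x (\<lambda>b. (- G x) \<bullet> b) (0 - W' (u x))"
    by (rule jet2_cong_grad[OF jet2_diff[OF jet2_const jet_u[OF xO]]]) simp
   note jz = jet2_refl[OF this]
   define V where "V = (0, 2 * (K * E)) - mu *\<^sub>R refl (2 *\<^sub>R (x - x0))"
   define Bl where "Bl = 4 * (K^2 * E) - mu * (2 * DIM('a \<times> real))"
   have jB: "jet2 (\<lambda>y::'a \<times> real. (exp (K * (t + 2 * snd y)) - 1) - mu * (norm (x + refl y - x0))^2) 0 (\<lambda>b. V \<bullet> b) Bl"
    unfolding Bl_def
    by (rule jet2_cong_grad[OF jet2_diff[OF jg jet2_cmult[OF js]]]) (simp add: V_def inner_diff_left)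
   have jBz: "jet2 (\<lambda>y::'a \<times> real. ((exp (K * (t + 2 * snd y)) - 1) - mu * (norm (x + refl y - x0))^2) * (1 - u (x + refl y))) 0
     (\<lambda>b. V \<bullet> b * (1 - u x) + B (x, t) * (refl (- G x) \<bullet> b))
     (Bl * (1 - u x) + 2 * (V \<bullet> refl (- G x)) + B (x, t) * (0 - W' (u x)))"
   proof -
    have "(\<Sum>b\<in>Basis. V \<bullet> b * (refl (- G x) \<bullet> b)) = V \<bullet> refl (- G x)" by (subst euclidean_inner) simp
    thus ?thesis using jet2_mult[OF jB jz] by (simp add: B_def psi_def)
   qed
   have "0 \<le> W' (u X) - W' (u x) - eps * (Bl * (1 - u x) + 2 * (V \<bullet> refl (- G x)) + B (x, t) * (0 - W' (u x)))"
    by (rule jet2_local_min(1)[OF _ ev], unfold f_def,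
      rule jet2_diff[OF jet2_diff[OF jet2_shift[OF jet_u[OF XO]] jet2_refl[OF jet_u[OF xO]]] jet2_cmult[OF jBz]])
   moreover have "V \<bullet> refl (- G x) \<ge> 0"
   proof -
    have e1: "V \<bullet> refl (- G x) = 2 * K * E * snd (G x) + 2 * mu * ((x - x0) \<bullet> G x)"
     by (simp add: V_def refl_def inner_prod_def algebra_simps)
    have "\<bar>(x - x0) \<bullet> G x\<bar> \<le> norm (x - x0) * norm (G x)" by (rule Cauchy_Schwarz_ineq2)
    also have "... \<le> rho * ((1 + L) * snd (G x))"
     using nx G_bound[OF xO] rho by (intro mult_mono) auto
    finally have "mu * \<bar>(x - x0) \<bullet> G x\<bar> \<le> mu * (rho * ((1 + L) * snd (G x)))" using mu by (intro mult_left_mono) auto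
    also have "... = (mu * rho * (1 + L)) * snd (G x)" by (simp add: mult_ac)
    also have "... \<le> K * snd (G x)" using murho Gn_nonneg[OF xO] by (intro mult_right_mono)
    finally have "mu * \<bar>(x - x0) \<bullet> G x\<bar> \<le> K * snd (G x)" .
    moreover have "mu * - \<bar>(x - x0) \<bullet> G x\<bar> \<le> mu * ((x - x0) \<bullet> G x)" using mu by (intro mult_left_mono) auto
    moreover have "K * snd (G x) * 1 \<le> K * snd (G x) * E"
     using K t00 Gn_nonneg[OF xO] by (intro mult_left_mono) (auto simp: E_def)
    ultimately show ?thesis unfolding e1 by (simp add: mult_ac)
   qed
   hence "eps * (2 * (V \<bullet> refl (- G x))) \<ge> 0" using eps by simp
   moreover have "eps * (B (x, t) * (0 - W' (u x))) \<ge> 0"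
    using eps B0 W'_le_0[OF x(1)] by (intro mult_nonneg_nonneg) auto
   moreover have "W' (u X) - W' (u x) < eps * (1 - u x) * (K^2 * (E - 1)) + eps * (1 - u x) * K^2"
   proof -
    have "\<bar>W' (u X) - W' (u x)\<bar> \<le> C0 * \<bar>u X - u x\<bar>" by (intro W'_lip u_nonneg u_le_1 x XC)
    hence "W' (u X) - W' (u x) \<le> C0 * (u X - u x)" using up by simp
    also have "... \<le> K^2 * (eps * (B (x, t) * (1 - u x)))"
     using pos up K C0 unfolding \<Phi>x by (intro mult_mono) auto
    also have "... \<le> K^2 * (eps * ((E - 1) * (1 - u x)))"
     using Bpsi[of x t] eps z by (intro mult_left_mono mult_right_mono) (auto simp: psi_def E_def)
    also have "... < K^2 * (eps * ((E - 1) * (1 - u x))) + eps * (1 - u x) * K^2"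
     using eps z K by simp
    finally show ?thesis by (simp add: mult_ac)
   qed
   moreover have "eps * (Bl * (1 - u x)) \<ge> eps * (1 - u x) * (K^2 * (E - 1)) + eps * (1 - u x) * K^2"
   proof -
    have "E \<ge> 1" using K t00 by (simp add: E_def)
    hence "K^2 * 1 \<le> K^2 * E" by (intro mult_left_mono) auto
    moreover have "mu * (2 * DIM('a \<times> real)) \<le> 2 * K^2" using mu(3) unfolding n_def by (simp add: mult_ac)
    moreover have "q \<le> 4 * q - m" if "p * 1 \<le> q" "m \<le> 2 * p" "0 \<le> p" for p q m :: real using that by argo
    ultimately have "Bl \<ge> K^2 * E" unfolding Bl_def using zero_le_power2[of K] by blast
    hence "Bl \<ge> K^2 * (E - 1) + K^2" by (simp add: right_diff_distrib)
    hence "eps * (1 - u x) * Bl \<ge> eps * (1 - u x) * (K^2 * (E - 1) + K^2)" using eps z by (intro mult_left_mono) auto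
    thus ?thesis by (simp add: algebra_simps)
   qed
   ultimately show False unfolding distrib_left[of eps] by linarith
  qed
 qed
 show ?thesis
  by (intro exI[of _ eps] exI[of _ K] exI[of _ T] conjI eps(1) K(1) T(1) ballI)
    (use main in \<open>simp add: psi_def\<close>)
qed

lemma Gn_lower: "\<exists>k0>0. \<forall>x\<in>Om. snd (G x) \<ge> k0 * (1 - u x)"
proof -
 obtain eps K T where h: "eps > 0" "K > 0" "T > 0"
  "\<And>x t. x \<in> Cl \<Longrightarrow> t \<in> {0..T} \<Longrightarrow> u (x + (0, t)) - u x \<ge> eps * (exp (K * t) - 1) * (1 - u x)"
  using lower_doubling by blast
 show ?thesis
 proof (intro exI[of _ "eps * K"] conjI ballI)
  show "eps * K > 0" using h by simp
  fix x assume xO: "x \<in> Om"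
  have x: "x \<in> Cl" using xO Om_Cl by auto
  have "G x \<bullet> (0, 1) \<ge> eps * K * (1 - u x)"
  proof (rule G_limit[OF x h(3), of "(0, 1)"])
   fix s assume s: "0 < s" "s < T"
   obtain r where r: "0 < r" "r < s" "u (x + (0, s)) - u x = s * (G (x + (0, r)) \<bullet> (0, 1))"
    using u_mvt_up[OF x s(1)] by blast
   have "K * s \<le> exp (K * s) - 1" using exp_ge_add_one_self[of "K * s"] by linarith
   hence "eps * (K * s) * (1 - u x) \<le> eps * (exp (K * s) - 1) * (1 - u x)"
    using h(1) u_le_1[OF x] by (intro mult_right_mono mult_left_mono) auto
   also have "... \<le> s * (G (x + (0, r)) \<bullet> (0, 1))" using h(4)[OF x, of s] s r(3) by simp
   finally have "s * (eps * K * (1 - u x)) \<le> s * (G (x + (0, r)) \<bullet> (0, 1))" by (simp add: mult_ac)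
   hence "eps * K * (1 - u x) \<le> G (x + (0, r)) \<bullet> (0, 1)" using s by (simp only: mult_le_cancel_left_pos)
   thus "\<exists>r>0. r < s \<and> x + r *\<^sub>R (0, 1) \<in> Cl \<and> eps * K * (1 - u x) \<le> G (x + r *\<^sub>R (0, 1)) \<bullet> (0, 1)"
    using r x by (intro exI[of _ r]) (simp add: Cl_def)
  qed
  thus "snd (G x) \<ge> eps * K * (1 - u x)" by (simp add: inner_prod_def)
 qed
qed

text \<open>The doubling bound is proportional to a bound of \<open>1 - u\<close> on a unit ball;
  Harnack's inequality replaces it by the value at the centre.\<close>

lemma Gn_upper: "\<exists>k1>0. \<forall>x\<in>Om. snd (G x) \<le> k1 * (1 - u x)"
proof -
 obtain C1 where C1: "C1 > 0" "\<And>x y. x \<in> Cl \<Longrightarrow> y \<in> Cl \<Longrightarrow> dist x y \<le> 1 \<Longrightarrow> 1 - u y \<le> C1 * (1 - u x)"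
  using harnack[of 1] by auto
 show ?thesis
 proof (intro exI[of _ "4 * KU * C1"] conjI ballI)
  show "4 * KU * C1 > 0" using KU(1) C1 by simp
  fix x assume xO: "x \<in> Om"
  have x: "x \<in> Cl" using xO Om_Cl by auto
  have "G x \<bullet> (0, -1) \<ge> - (4 * KU * C1 * (1 - u x))"
  proof (rule G_limit[OF x zero_less_one, of "(0, 1)"])
   fix s :: real assume s: "0 < s" "s < 1"
   obtain r where r: "0 < r" "r < s" "u (x + (0, s)) - u x = s * (G (x + (0, r)) \<bullet> (0, 1))"
    using u_mvt_up[OF x s(1)] by blast
   have "s * (G (x + (0, r)) \<bullet> (0, 1)) \<le> (C1 * (1 - u x)) * (KU * (4 * s - s^2))"
    unfolding r(3)[symmetric]
    by (rule upper_doubling) (use C1 x u_less_1[OF x] s in auto)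
   also have "... \<le> (C1 * (1 - u x)) * (KU * (4 * s))"
    using C1 u_le_1[OF x] KU(1) by (intro mult_left_mono) auto
   finally have "s * (G (x + (0, r)) \<bullet> (0, 1)) \<le> s * (4 * KU * C1 * (1 - u x))" by (simp add: mult_ac)
   hence "G (x + (0, r)) \<bullet> (0, 1) \<le> 4 * KU * C1 * (1 - u x)" using s by (simp only: mult_le_cancel_left_pos)
   thus "\<exists>r>0. r < s \<and> x + r *\<^sub>R (0, 1) \<in> Cl \<and> - (4 * KU * C1 * (1 - u x)) \<le> G (x + r *\<^sub>R (0, 1)) \<bullet> (0, - 1)"
    using r x by (intro exI[of _ r]) (simp add: Cl_def inner_prod_def)
  qed
  thus "snd (G x) \<le> 4 * KU * C1 * (1 - u x)" by (simp add: inner_prod_def)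
 qed
qed

end

section \<open>Poincare inequalities on a weighted half-cylinder\<close>

text \<open>The factor 2 makes this a probability density, so averages over \<open>t\<close> need no
  normalization. As \<open>t \<le> 0\<close> carries no mass, all functions may take arbitrary
  values there.\<close>

definition expw :: "real \<Rightarrow> real" where
 "expw t = indicator {0<..} t * (2 * exp (- 2 * t))"

lemma expw_nonneg [simp]: "expw t \<ge> 0" by (simp add: expw_def)

lemma expw_measurable [measurable]: "expw \<in> borel_measurable borel"
 unfolding expw_def by measurable

definition expm :: "real measure" where "expm = density lborel (\<lambda>t. ennreal (expw t))"

definition strip :: "('a::euclidean_space \<times> real) measure" where
 "strip = density lborel (\<lambda>z. ennreal (expw (snd z)))"

lemma sets_expm [simp, measurable_cong]: "sets expm = sets borel" by (simp add: expm_def)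
lemma sets_strip [simp, measurable_cong]: "sets strip = sets borel" by (simp add: strip_def)
lemma space_strip [simp]: "space strip = UNIV" by (simp add: strip_def)
lemma space_expm [simp]: "space expm = UNIV" by (simp add: expm_def)

lemma fst_snd_borel [measurable]:
 "fst \<in> measurable (borel :: ('a::euclidean_space \<times> real) measure) borel"
 "snd \<in> measurable (borel :: ('a::euclidean_space \<times> real) measure) borel"
 by (intro borel_measurable_continuous_onI continuous_intros)+

lemma nn_expm:
 "g \<in> borel_measurable borel \<Longrightarrow> (\<integral>\<^sup>+t. g t \<partial>expm) = (\<integral>\<^sup>+t. ennreal (expw t) * g t \<partial>lborel)"
 unfolding expm_def by (subst nn_integral_density) auto

lemma exp_tail:
 assumes "c > 0"
 shows "(\<integral>\<^sup>+t. ennreal (indicator {s..} t * (c * exp (- c * t))) \<partial>lborel) = ennreal (exp (- c * s))"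
proof -
 have "(\<integral>\<^sup>+t. ennreal (c * exp (- c * t)) * indicator {s..} t \<partial>lborel) = ennreal (0 - (- exp (- c * s)))"
 proof (rule nn_integral_FTC_atLeast)
  show "((\<lambda>t. - exp (- c * t)) \<longlongrightarrow> 0) at_top"
  proof -
   have "filterlim (\<lambda>t. - (c * t)) at_bot at_top"
    using assms by (auto simp: filterlim_uminus_at_bot intro!: filterlim_tendsto_pos_mult_at_top[OF tendsto_const] filterlim_ident)
   hence "((\<lambda>t. exp (- (c * t))) \<longlongrightarrow> 0) at_top" by (rule filterlim_compose[OF exp_at_bot])
   from tendsto_minus[OF this] show ?thesis by simp
  qed
 qed (use assms in \<open>auto intro!: derivative_eq_intros\<close>)
 moreover have "ennreal (indicator {s..} t * (c * exp (- c * t))) = ennreal (c * exp (- c * t)) * indicator {s..} t" for t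
  by (auto split: split_indicator)
 ultimately show ?thesis by simp
qed

lemma emeasure_expm_UNIV [simp]: "emeasure expm UNIV = 1"
proof -
 have "emeasure expm UNIV = (\<integral>\<^sup>+t. 1 \<partial>expm)" by simp
 also have "... = (\<integral>\<^sup>+t. ennreal (expw t) \<partial>lborel)" by (subst nn_expm) auto
 also have "... = (\<integral>\<^sup>+t. ennreal (indicator {0..} t * (2 * exp (- 2 * t))) \<partial>lborel)"
 proof (rule nn_integral_cong_AE)
  have "AE t in lborel. t \<noteq> (0::real)" by (rule AE_lborel_singleton)
  thus "AE t in lborel. ennreal (expw t) = ennreal (indicator {0..} t * (2 * exp (- 2 * t)))"
   by eventually_elim (auto simp: expw_def split: split_indicator)
 qed
 also have "... = 1" by (subst exp_tail) auto
 finally show ?thesis .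
qed

interpretation expm: finite_measure expm
 by standard (simp add: emeasure_expm_UNIV)

lemma nn_expm_const [simp]: "(\<integral>\<^sup>+t. c \<partial>expm) = c"
 using emeasure_expm_UNIV by simp

lemma AE_expm: "AE t in expm. t > 0"
 unfolding expm_def by (subst AE_density) (auto simp: expw_def split: split_indicator)

lemma measurable_prod_borel:
 fixes f :: "'a::euclidean_space \<times> real \<Rightarrow> 'b"
 shows "f \<in> measurable borel M \<Longrightarrow> f \<in> measurable (borel \<Otimes>\<^sub>M borel) M"
 by (simp add: borel_prod)

lemma nn_strip:
 fixes g :: "'a::euclidean_space \<times> real \<Rightarrow> ennreal"
 assumes g: "g \<in> borel_measurable borel"
 shows "(\<integral>\<^sup>+z. g z \<partial>strip) = (\<integral>\<^sup>+x. \<integral>\<^sup>+t. g (x, t) \<partial>expm \<partial>lborel)"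
  "(\<integral>\<^sup>+z. g z \<partial>strip) = (\<integral>\<^sup>+t. \<integral>\<^sup>+x. g (x, t) \<partial>lborel \<partial>expm)"
proof -
 note [measurable] = measurable_prod_borel[OF g]
 have "(\<integral>\<^sup>+z. g z \<partial>strip) = (\<integral>\<^sup>+z. ennreal (expw (snd z)) * g z \<partial>(lborel \<Otimes>\<^sub>M lborel))"
  unfolding strip_def lborel_prod[symmetric]
  by (subst nn_integral_density) auto
 also have "... = (\<integral>\<^sup>+x. \<integral>\<^sup>+t. ennreal (expw t) * g (x, t) \<partial>lborel \<partial>lborel)"
  by (subst lborel.nn_integral_fst[symmetric]) auto
 also have "... = (\<integral>\<^sup>+x. \<integral>\<^sup>+t. g (x, t) \<partial>expm \<partial>lborel)"
  by (intro nn_integral_cong, subst nn_expm) auto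
 finally show *: "(\<integral>\<^sup>+z. g z \<partial>strip) = (\<integral>\<^sup>+x. \<integral>\<^sup>+t. g (x, t) \<partial>expm \<partial>lborel)" .
 interpret p: pair_sigma_finite lborel expm ..
 show "(\<integral>\<^sup>+z. g z \<partial>strip) = (\<integral>\<^sup>+t. \<integral>\<^sup>+x. g (x, t) \<partial>lborel \<partial>expm)"
  unfolding * by (rule p.Fubini'[symmetric]) simp
qed

lemma AE_strip: "AE z in strip. snd z > 0"
 unfolding strip_def by (subst AE_density) (auto simp: expw_def split: split_indicator)

lemma nn_lborel_translate:
 fixes g :: "'a::euclidean_space \<Rightarrow> ennreal"
 assumes "g \<in> borel_measurable borel"
 shows "(\<integral>\<^sup>+x. g (x + a) \<partial>lborel) = (\<integral>\<^sup>+x. g x \<partial>lborel)"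
proof -
 have "(\<integral>\<^sup>+x. g x \<partial>lborel) = (\<integral>\<^sup>+x. g x \<partial>(distr lborel borel ((+) a)))" by (simp add: lborel_distr_plus)
 also have "... = (\<integral>\<^sup>+x. g (a + x) \<partial>lborel)" using assms by (subst nn_integral_distr) auto
 finally show ?thesis by (simp add: add.commute)
qed

lemma shift_measurable [measurable]:
 fixes f :: "'a::euclidean_space \<times> real \<Rightarrow> 'b::topological_space"
 assumes "f \<in> borel_measurable borel"
 shows "(\<lambda>z. f (fst z + xi, snd z)) \<in> borel_measurable borel"
 by (rule measurable_compose[OF _ assms]) (intro borel_measurable_continuous_onI continuous_intros)

lemma nn_strip_translate:
 fixes g :: "'a::euclidean_space \<times> real \<Rightarrow> ennreal"
 assumes g: "g \<in> borel_measurable borel"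
 shows "(\<integral>\<^sup>+z. g (fst z + a, snd z) \<partial>strip) = (\<integral>\<^sup>+z. g z \<partial>strip)"
proof -
 note [measurable] = measurable_prod_borel[OF g]
 have "(\<integral>\<^sup>+z. g (fst z + a, snd z) \<partial>strip) = (\<integral>\<^sup>+t. \<integral>\<^sup>+x. g (x + a, t) \<partial>lborel \<partial>expm)"
  by (subst nn_strip(2)) (use g in measurable)
 also have "... = (\<integral>\<^sup>+t. \<integral>\<^sup>+x. g (x, t) \<partial>lborel \<partial>expm)"
  by (intro nn_integral_cong nn_lborel_translate[of "\<lambda>x. g (x, _)"]) simp
 also have "... = (\<integral>\<^sup>+z. g z \<partial>strip)" by (subst nn_strip(2)) (use g in auto)
 finally show ?thesis .
qed

section \<open>One-dimensional inequalities\<close>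

lemma cauchy_schwarz_increment:
 fixes g g' p :: "real \<Rightarrow> real"
 assumes ab: "a < b" and g: "\<And>t. t \<in> {a..b} \<Longrightarrow> (g has_real_derivative g' t) (at t)"
  and g': "continuous_on {a..b} g'" and p: "continuous_on {a..b} p" "\<And>t. t \<in> {a..b} \<Longrightarrow> p t > 0"
 shows "ennreal ((g b - g a)^2) \<le>
   ennreal (integral {a..b} p) * (\<integral>\<^sup>+t. ennreal (indicator {a..b} t * ((g' t)^2 / p t)) \<partial>lborel)"
proof -
 define h where "h t = (g' t)^2 / p t" for t
 have hc: "continuous_on {a..b} h" unfolding h_def using p(2) by (intro continuous_intros g' p) force
 have i: "h integrable_on {a..b}" "g' integrable_on {a..b}" "p integrable_on {a..b}"
  by (intro integrable_continuous_interval hc g' p)+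
 define P where "P = integral {a..b} p"
 \<comment> \<open>The minimizer of the integral of \<open>(g' - m * p)^2 / p\<close>. The weight
   \<open>p\<close> is kept general: it will be \<open>exp\<close> in the variable \<open>t\<close>
   and constant along horizontal segments.\<close>
 define m where "m = (g b - g a) / P"
 have Ppos: "P > 0" unfolding P_def
 proof -
  obtain t0 where t0: "t0 \<in> {a..b}" "\<And>t. t \<in> {a..b} \<Longrightarrow> p t0 \<le> p t"
   using continuous_attains_inf[of "{a..b}" p] p(1) ab by auto
  have "0 < p t0 * (b - a)" using p(2)[OF t0(1)] ab by simp
  also have "... = integral {a..b} (\<lambda>_. p t0)" using ab by simp
  also have "... \<le> integral {a..b} p" using t0 by (intro integral_le i) auto
  finally show "integral {a..b} p > 0" .
 qed
 have ftc: "integral {a..b} g' = g b - g a"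
 proof (rule integral_unique, rule fundamental_theorem_of_calculus)
  show "a \<le> b" using ab by simp
  fix t assume "t \<in> {a..b}"
  from g[OF this] show "(g has_vector_derivative g' t) (at t within {a..b})"
   by (simp add: has_real_derivative_iff_has_vector_derivative has_vector_derivative_at_within)
 qed
 have "0 \<le> integral {a..b} (\<lambda>t. h t - 2 * m * g' t + m^2 * p t)"
 proof (rule integral_nonneg)
  show "(\<lambda>t. h t - 2 * m * g' t + m^2 * p t) integrable_on {a..b}"
   by (intro integrable_add integrable_diff integrable_on_mult_right i)
  fix t assume t: "t \<in> {a..b}"
  have "h t - 2 * m * g' t + m^2 * p t = (g' t - m * p t)^2 / p t"
   using p(2)[OF t] by (simp add: h_def power2_eq_square field_simps)
  thus "0 \<le> h t - 2 * m * g' t + m^2 * p t" using p(2)[OF t] by simp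
 qed
 also have "... = integral {a..b} h - 2 * m * (g b - g a) + m^2 * P"
  unfolding ftc[symmetric] P_def
  by (subst integral_add integral_diff, (intro integrable_add integrable_diff integrable_on_mult_right i)+)+ simp
 also have "... = integral {a..b} h - (g b - g a)^2 / P"
  using Ppos by (simp add: m_def power2_eq_square field_simps)
 finally have le: "(g b - g a)^2 \<le> P * integral {a..b} h" using Ppos by (simp add: field_simps)
 have h0: "indicator {a..b} t * h t \<ge> 0" for t using p(2)[of t] by (auto simp: h_def split: split_indicator)
 have "(\<integral>\<^sup>+t. ennreal (indicator {a..b} t * h t) \<partial>lborel) = ennreal (integral {a..b} h)"
 proof (rule nn_integral_has_integral_lborel)
  show "(\<lambda>t. indicator {a..b} t * h t) \<in> borel_measurable borel"
   using borel_measurable_continuous_on_indicator[OF _ hc] by (simp add: mult.commute)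
  have "(h has_integral integral {a..b} h) {a..b}" using i(1) by (rule integrable_integral)
  hence "((\<lambda>t. if t \<in> {a..b} then h t else 0) has_integral integral {a..b} h) UNIV"
   by (simp only: has_integral_restrict_UNIV)
  moreover have "(\<lambda>t. if t \<in> {a..b} then h t else 0) = (\<lambda>t. indicator {a..b} t * h t)" by (auto simp: indicator_def)
  ultimately show "((\<lambda>t. indicator {a..b} t * h t) has_integral integral {a..b} h) UNIV" by simp
 qed (rule h0)
 hence "ennreal (integral {a..b} p) * (\<integral>\<^sup>+t. ennreal (indicator {a..b} t * h t) \<partial>lborel) = ennreal (P * integral {a..b} h)"
  using Ppos by (simp add: P_def ennreal_mult' less_imp_le)
 thus ?thesis using le unfolding h_def by (simp add: ennreal_leI)
qed

text \<open>Poincare's inequality for the exponential measure, with two points instead of a mean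
  value. The weight \<open>exp\<close> bounds \<open>(g b - g a)^2\<close> by \<open>exp b\<close>
  times the integral of \<open>g'^2 / exp\<close> over \<open>[a, b]\<close>. After exchanging the
  integrals, \<open>2 * exp (- 2 * t) * exp t\<close> is integrated over \<open>t \<ge> s\<close>,
  which gives \<open>2 * exp (- s)\<close>, and together with \<open>1 / exp s\<close> the weight
  \<open>2 * exp (- 2 * s)\<close> reappears.\<close>

lemma transverse_1d:
 fixes g g' :: "real \<Rightarrow> real"
 assumes g: "\<And>t. t > 0 \<Longrightarrow> (g has_real_derivative g' t) (at t)" and g': "continuous_on {0<..} g'"
  and [measurable]: "g \<in> borel_measurable borel" "g' \<in> borel_measurable borel"
 shows "(\<integral>\<^sup>+t. \<integral>\<^sup>+r. ennreal ((g t - g r)^2) \<partial>expm \<partial>expm) \<le> 4 * (\<integral>\<^sup>+s. ennreal ((g' s)^2) \<partial>expm)"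
proof -
 let ?q = "\<lambda>s t. ennreal (indicator {s..} t * exp t * ((g' s)^2 / exp s)) * indicator {0<..} s"
 define k where "k a b = (\<integral>\<^sup>+s. ennreal (indicator {a..b} s * exp b * ((g' s)^2 / exp s)) * indicator {0<..} s \<partial>lborel)" for a b :: real
 have kmeas0: "(\<lambda>p. k (fst p) (snd p)) \<in> borel_measurable (borel \<Otimes>\<^sub>M borel)"
 proof -
  have [measurable]: "(\<lambda>(p::real \<times> real, s::real). indicator {fst p..snd p} s :: real) \<in> borel_measurable ((borel \<Otimes>\<^sub>M borel) \<Otimes>\<^sub>M borel)"
   unfolding indicator_def atLeastAtMost_iff split_beta by measurable
  show ?thesis unfolding k_def by measurable
 qed
 have kmeas [measurable]: "(\<lambda>x. k (a x) (b x)) \<in> borel_measurable N"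
  if [measurable]: "a \<in> borel_measurable N" "b \<in> borel_measurable N" for a b and N :: "'b measure"
  using measurable_compose[OF measurable_Pair[OF that] kmeas0] by simp
 have inc: "ennreal ((g b - g a)^2) \<le> k a b" if "0 < a" "a < b" for a b
 proof -
  have "ennreal ((g b - g a)^2) \<le> ennreal (integral {a..b} exp) * (\<integral>\<^sup>+s. ennreal (indicator {a..b} s * ((g' s)^2 / exp s)) \<partial>lborel)"
   by (rule cauchy_schwarz_increment) (use that g in \<open>auto intro!: continuous_intros continuous_on_subset[OF g']\<close>)
  also have "integral {a..b} exp = exp b - exp a"
  proof (rule integral_unique, rule fundamental_theorem_of_calculus)
   show "a \<le> b" using that by simp
   fix x :: real show "(exp has_vector_derivative exp x) (at x within {a..b})"
    using DERIV_exp[of x] by (simp add: has_real_derivative_iff_has_vector_derivative has_vector_derivative_at_within)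
  qed
  also have "ennreal (exp b - exp a) * (\<integral>\<^sup>+s. ennreal (indicator {a..b} s * ((g' s)^2 / exp s)) \<partial>lborel)
    \<le> ennreal (exp b) * (\<integral>\<^sup>+s. ennreal (indicator {a..b} s * ((g' s)^2 / exp s)) \<partial>lborel)"
   by (intro mult_right_mono ennreal_leI) auto
  also have "... = k a b" unfolding k_def using that
   by (subst nn_integral_cmult[symmetric])
     (auto intro!: nn_integral_cong simp: ennreal_mult''[symmetric] split: split_indicator)
  finally show ?thesis .
 qed
 have "(\<integral>\<^sup>+t. \<integral>\<^sup>+r. ennreal ((g t - g r)^2) \<partial>expm \<partial>expm) \<le> (\<integral>\<^sup>+t. \<integral>\<^sup>+r. k r t + k t r \<partial>expm \<partial>expm)"
 proof (rule nn_integral_mono_AE, use AE_expm in eventually_elim)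
  fix t :: real assume t: "t > 0"
  show "(\<integral>\<^sup>+r. ennreal ((g t - g r)^2) \<partial>expm) \<le> (\<integral>\<^sup>+r. k r t + k t r \<partial>expm)"
  proof (rule nn_integral_mono_AE, use AE_expm in eventually_elim)
   fix r :: real assume r: "r > 0"
   consider "r < t" | "r = t" | "t < r" by linarith
   thus "ennreal ((g t - g r)^2) \<le> k r t + k t r"
   proof cases
    case 1 thus ?thesis using inc[OF r 1] by (simp add: add_increasing2)
   next
    case 3 thus ?thesis using inc[OF t 3] by (simp add: add_increasing power2_commute)
   qed simp
  qed
 qed
 also have "... = (\<integral>\<^sup>+t. \<integral>\<^sup>+r. k r t \<partial>expm \<partial>expm) + (\<integral>\<^sup>+t. \<integral>\<^sup>+r. k t r \<partial>expm \<partial>expm)"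
 proof -
  have 1: "(\<integral>\<^sup>+r. k r t + k t r \<partial>expm) = (\<integral>\<^sup>+r. k r t \<partial>expm) + (\<integral>\<^sup>+r. k t r \<partial>expm)" for t
   by (rule nn_integral_add) measurable
  show ?thesis unfolding 1 by (rule nn_integral_add) measurable
 qed
 also have "(\<integral>\<^sup>+t. \<integral>\<^sup>+r. k t r \<partial>expm \<partial>expm) = (\<integral>\<^sup>+t. \<integral>\<^sup>+r. k r t \<partial>expm \<partial>expm)"
 proof -
  interpret p: pair_sigma_finite expm expm ..
  show ?thesis using p.Fubini'[of "\<lambda>t r. k r t"] by simp
 qed
 also have "(\<integral>\<^sup>+t. \<integral>\<^sup>+r. k r t \<partial>expm \<partial>expm) \<le> 2 * (\<integral>\<^sup>+s. ennreal ((g' s)^2) \<partial>expm)"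
 proof -
  have "(\<integral>\<^sup>+r. k r t \<partial>expm) \<le> (\<integral>\<^sup>+s. ?q s t \<partial>lborel)" for t
  proof -
   have "k r t \<le> (\<integral>\<^sup>+s. ?q s t \<partial>lborel)" for r
    unfolding k_def by (intro nn_integral_mono) (auto split: split_indicator)
   hence "(\<integral>\<^sup>+r. k r t \<partial>expm) \<le> (\<integral>\<^sup>+r. (\<integral>\<^sup>+s. ?q s t \<partial>lborel) \<partial>expm)"
    by (intro nn_integral_mono)
   thus ?thesis by simp
  qed
  hence "(\<integral>\<^sup>+t. \<integral>\<^sup>+r. k r t \<partial>expm \<partial>expm) \<le> (\<integral>\<^sup>+t. \<integral>\<^sup>+s. ?q s t \<partial>lborel \<partial>expm)"
   by (intro nn_integral_mono)
  also have "... = (\<integral>\<^sup>+s. \<integral>\<^sup>+t. ?q s t \<partial>expm \<partial>lborel)"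
  proof -
   interpret p: pair_sigma_finite lborel expm ..
   have [measurable]: "(\<lambda>(s::real, t). indicator {s..} t :: real) \<in> borel_measurable (borel \<Otimes>\<^sub>M borel)"
    unfolding indicator_def atLeast_iff split_beta by measurable
   show ?thesis by (rule p.Fubini') measurable
  qed
  also have "... \<le> (\<integral>\<^sup>+s. ennreal (expw s) * (2 * ennreal ((g' s)^2)) \<partial>lborel)"
  proof (rule nn_integral_mono)
   fix s :: real
   show "(\<integral>\<^sup>+t. ?q s t \<partial>expm) \<le> ennreal (expw s) * (2 * ennreal ((g' s)^2))"
   proof (cases "s > 0")
    case True
    have "(\<integral>\<^sup>+t. ?q s t \<partial>expm)
      = (\<integral>\<^sup>+t. ennreal (2 * ((g' s)^2 / exp s)) * ennreal (indicator {s..} t * (1 * exp (- 1 * t))) \<partial>lborel)"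
     by (subst nn_expm, measurable)
       (use True in \<open>auto intro!: nn_integral_cong simp: expw_def ennreal_mult[symmetric] exp_minus field_simps exp_add[symmetric] split: split_indicator\<close>)
    also have "... = ennreal (2 * ((g' s)^2 / exp s)) * ennreal (exp (- 1 * s))"
     by (subst nn_integral_cmult, measurable) (subst exp_tail, auto)
    also have "... = ennreal (expw s) * (1 * ennreal ((g' s)^2))"
     using True by (auto simp: expw_def ennreal_mult[symmetric] exp_minus exp_add[symmetric] field_simps)
    also have "... \<le> ennreal (expw s) * (2 * ennreal ((g' s)^2))"
     by (intro mult_left_mono mult_right_mono) auto
    finally show ?thesis .
   qed simp
  qed
  also have "... = (\<integral>\<^sup>+s. 2 * ennreal ((g' s)^2) \<partial>expm)" by (subst nn_expm) auto
  also have "... = 2 * (\<integral>\<^sup>+s. ennreal ((g' s)^2) \<partial>expm)" by (subst nn_integral_cmult) auto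
  finally show ?thesis .
 qed
 finally have "(\<integral>\<^sup>+t. \<integral>\<^sup>+r. ennreal ((g t - g r)^2) \<partial>expm \<partial>expm) \<le> 2 * (\<integral>\<^sup>+s. ennreal ((g' s)^2) \<partial>expm) + 2 * (\<integral>\<^sup>+s. ennreal ((g' s)^2) \<partial>expm)"
  by (metis add_mono)
 thus ?thesis by (simp add: distrib_right[symmetric])
qed

text \<open>Nothing is asked at \<open>t = 0\<close>: solutions have no trace there a priori, and
  test functions do not have to vanish there. Measurability refers to the whole space because the
  integrals do.\<close>

definition C1_strip :: "('a::euclidean_space \<times> real \<Rightarrow> real) \<Rightarrow> ('a \<times> real \<Rightarrow> 'a \<times> real) \<Rightarrow> bool" where
 "C1_strip f Df \<longleftrightarrow> (\<forall>z. snd z > 0 \<longrightarrow> (f has_derivative (\<lambda>h. Df z \<bullet> h)) (at z)) \<and>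
   continuous_on {z. snd z > 0} Df \<and> f \<in> borel_measurable borel \<and> Df \<in> borel_measurable borel"

lemma C1_stripD:
 assumes "C1_strip f Df"
 shows "snd z > 0 \<Longrightarrow> (f has_derivative (\<lambda>h. Df z \<bullet> h)) (at z)" "continuous_on {z. snd z > 0} Df"
  "f \<in> borel_measurable borel" "Df \<in> borel_measurable borel"
 using assms unfolding C1_strip_def by blast+

lemma nn_expm_affine:
 assumes "h \<in> borel_measurable borel"
 shows "(\<integral>\<^sup>+r. c + k * h r \<partial>expm) = c + k * (\<integral>\<^sup>+r. h r \<partial>expm)"
proof -
 have "(\<integral>\<^sup>+r. c + k * h r \<partial>expm) = (\<integral>\<^sup>+r. c \<partial>expm) + (\<integral>\<^sup>+r. k * h r \<partial>expm)"
  by (rule nn_integral_add) (use assms in auto)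
 also have "(\<integral>\<^sup>+r. k * h r \<partial>expm) = k * (\<integral>\<^sup>+r. h r \<partial>expm)"
  by (rule nn_integral_cmult) (use assms in auto)
 finally show ?thesis by simp
qed

lemma pair_compose_measurable:
 fixes f :: "'a::euclidean_space \<times> real \<Rightarrow> 'b"
 assumes "f \<in> measurable borel M" "a \<in> measurable N borel" "b \<in> measurable N borel"
 shows "(\<lambda>x. f (a x, b x)) \<in> measurable N M"
 using measurable_compose[OF measurable_Pair[OF assms(2,3)] measurable_prod_borel[OF assms(1)]] .

lemma C1_strip_line:
 assumes "C1_strip f Df" "snd (z + s *\<^sub>R v) > 0"
 shows "((\<lambda>s. f (z + s *\<^sub>R v)) has_real_derivative (Df (z + s *\<^sub>R v) \<bullet> v)) (at s)"
proof -
 have "((\<lambda>s. z + s *\<^sub>R v) has_derivative (\<lambda>h. h *\<^sub>R v)) (at s)" by (auto intro!: derivative_eq_intros)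
 from has_derivative_compose[OF this C1_stripD(1)[OF assms]]
 show ?thesis by (simp add: has_field_derivative_def mult_commute_abs)
qed

lemma sigma_finite_strip: "sigma_finite_measure (strip :: ('a::euclidean_space \<times> real) measure)"
 unfolding strip_def
 by (subst sigma_finite_measure.sigma_finite_iff_density_finite[OF lborel.sigma_finite_measure_axioms]) auto

lemma pair_measurable_of_borel:
 fixes g :: "'a::euclidean_space \<times> 'b::euclidean_space \<Rightarrow> 'c::topological_space"
 assumes "g \<in> borel_measurable borel" shows "g \<in> borel_measurable (borel \<Otimes>\<^sub>M borel)"
 using assms by (simp add: borel_prod)

text \<open>The increment is integrated along the horizontal segment. Convexity of \<open>K\<close>
  keeps the segment over \<open>K\<close>, and by translation invariance in \<open>x'\<close> each
  of its points contributes the same energy.\<close>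

lemma displacement:
 fixes f :: "'a::euclidean_space \<times> real \<Rightarrow> real"
 assumes f: "C1_strip f Df" and K: "convex K" "K \<in> sets borel"
 shows "(\<integral>\<^sup>+z. indicator K (fst z) * indicator K (fst z + xi) * ennreal ((f (fst z + xi, snd z) - f z)^2) \<partial>strip)
  \<le> ennreal ((norm xi)^2) * (\<integral>\<^sup>+z. indicator K (fst z) * ennreal ((norm (Df z))^2) \<partial>strip)"
proof -
 note [measurable] = C1_stripD(3,4)[OF f] K(2)
 define E where "E z = indicator K (fst z) * ennreal ((norm (Df z))^2)" for z
 have [measurable]: "E \<in> borel_measurable borel" unfolding E_def by measurable
 interpret p: pair_sigma_finite lborel "strip :: ('a \<times> real) measure"
  using sigma_finite_strip by (simp add: pair_sigma_finite_def lborel.sigma_finite_measure_axioms)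
 have [measurable]: "(\<lambda>q. E (fst (snd q) + fst q *\<^sub>R xi, snd (snd q))) \<in> borel_measurable (borel \<Otimes>\<^sub>M borel)"
 proof (rule pair_measurable_of_borel)
  show "(\<lambda>q. E (fst (snd q) + fst q *\<^sub>R xi, snd (snd q))) \<in> borel_measurable (borel :: (real \<times> 'a \<times> real) measure)"
   by (rule measurable_compose[where f="\<lambda>q. (fst (snd q) + fst q *\<^sub>R xi, snd (snd q))" and g=E and N=borel])
     (intro borel_measurable_continuous_onI continuous_intros, measurable)
 qed
 define F where "F \<theta> z = indicator {0..1} \<theta> * E (fst z + \<theta> *\<^sub>R xi, snd z)" for \<theta> :: real and z
 have [measurable]: "(\<lambda>(\<theta>, z). F \<theta> z) \<in> borel_measurable (borel \<Otimes>\<^sub>M borel)"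
  unfolding F_def split_beta by measurable
 have "(\<integral>\<^sup>+z. indicator K (fst z) * indicator K (fst z + xi) * ennreal ((f (fst z + xi, snd z) - f z)^2) \<partial>strip)
  \<le> (\<integral>\<^sup>+z. ennreal ((norm xi)^2) * (\<integral>\<^sup>+\<theta>. F \<theta> z \<partial>lborel) \<partial>strip)"
 proof (rule nn_integral_mono_AE, use AE_strip in eventually_elim)
  fix z :: "'a \<times> real" assume z: "snd z > 0"
  show "indicator K (fst z) * indicator K (fst z + xi) * ennreal ((f (fst z + xi, snd z) - f z)^2)
    \<le> ennreal ((norm xi)^2) * (\<integral>\<^sup>+\<theta>. F \<theta> z \<partial>lborel)"
  proof (cases "fst z \<in> K \<and> fst z + xi \<in> K")
   case True
   have inK: "fst z + \<theta> *\<^sub>R xi \<in> K" if "0 \<le> \<theta>" "\<theta> \<le> 1" for \<theta>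
   proof -
    have "(1 - \<theta>) *\<^sub>R fst z + \<theta> *\<^sub>R (fst z + xi) \<in> K" using K(1) True that by (intro convexD_alt) auto
    thus ?thesis by (simp add: algebra_simps)
   qed
   define g where "g \<theta> = f (z + \<theta> *\<^sub>R (xi, 0))" for \<theta>
   define g' where "g' \<theta> = Df (z + \<theta> *\<^sub>R (xi, 0)) \<bullet> (xi, 0)" for \<theta>
   have "ennreal ((g 1 - g 0)^2) \<le> ennreal (integral {0..1::real} (\<lambda>_. 1)) *
     (\<integral>\<^sup>+t. ennreal (indicator {0..1} t * ((g' t)^2 / 1)) \<partial>lborel)"
   proof (rule cauchy_schwarz_increment[where p="\<lambda>_. 1"])
    show "(g has_real_derivative g' t) (at t)" for t
     unfolding g_def g'_def by (rule C1_strip_line[OF f]) (use z in simp)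
    show "continuous_on {0..1} g'" unfolding g'_def
     by (intro continuous_intros continuous_on_compose2[OF C1_stripD(2)[OF f]]) (use z in auto)
   qed auto
   hence "ennreal ((f (fst z + xi, snd z) - f z)^2) \<le> (\<integral>\<^sup>+t. ennreal (indicator {0..1} t * (g' t)^2) \<partial>lborel)"
    by (cases z) (simp add: g_def)
   also have "... \<le> (\<integral>\<^sup>+t. ennreal ((norm xi)^2) * F t z \<partial>lborel)"
   proof (rule nn_integral_mono)
    fix t :: real
    have zz: "z + t *\<^sub>R (xi, 0) = (fst z + t *\<^sub>R xi, snd z)" by (cases z) simp
    have "\<bar>g' t\<bar> \<le> \<bar>norm (Df (z + t *\<^sub>R (xi, 0))) * norm (xi, 0 :: real)\<bar>"
     unfolding g'_def using Cauchy_Schwarz_ineq2[of "Df (z + t *\<^sub>R (xi, 0))" "(xi, 0)"]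
     by (simp only: abs_mult abs_norm_cancel)
    hence "(g' t)^2 \<le> (norm (Df (z + t *\<^sub>R (xi, 0))) * norm (xi, 0 :: real))^2"
     by (rule abs_le_square_iff[THEN iffD1])
    hence le: "(g' t)^2 \<le> (norm xi)^2 * (norm (Df (fst z + t *\<^sub>R xi, snd z)))^2"
     unfolding zz by (simp add: power_mult_distrib mult.commute)
    show "ennreal (indicator {0..1} t * (g' t)^2) \<le> ennreal ((norm xi)^2) * F t z"
    proof (cases "t \<in> {0..1}")
     case True
     thus ?thesis using inK[of t] le
      by (simp add: F_def E_def ennreal_mult[symmetric] ennreal_leI)
    qed simp
   qed
   also have "... = ennreal ((norm xi)^2) * (\<integral>\<^sup>+t. F t z \<partial>lborel)"
    by (rule nn_integral_cmult) measurable
   finally show ?thesis using True by simp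
  qed (auto split: split_indicator)
 qed
 also have "... = ennreal ((norm xi)^2) * (\<integral>\<^sup>+z. (\<integral>\<^sup>+\<theta>. F \<theta> z \<partial>lborel) \<partial>strip)"
  by (rule nn_integral_cmult) measurable
 also have "(\<integral>\<^sup>+z. (\<integral>\<^sup>+\<theta>. F \<theta> z \<partial>lborel) \<partial>strip) = (\<integral>\<^sup>+\<theta>. (\<integral>\<^sup>+z. F \<theta> z \<partial>strip) \<partial>lborel)"
  by (rule p.Fubini') measurable
 also have "... = (\<integral>\<^sup>+\<theta>. indicator {0..1} \<theta> * (\<integral>\<^sup>+z. E z \<partial>strip) \<partial>(lborel :: real measure))"
 proof (rule nn_integral_cong)
  fix \<theta> :: real
  have "(\<integral>\<^sup>+z. F \<theta> z \<partial>strip) = indicator {0..1} \<theta> * (\<integral>\<^sup>+z. E (fst z + \<theta> *\<^sub>R xi, snd z) \<partial>strip)"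
   unfolding F_def by (rule nn_integral_cmult) measurable
  thus "(\<integral>\<^sup>+z. F \<theta> z \<partial>strip) = indicator {0..1} \<theta> * (\<integral>\<^sup>+z. E z \<partial>strip)"
   by (simp add: nn_strip_translate)
 qed
 also have "... = (\<integral>\<^sup>+z. E z \<partial>strip)"
  by (subst nn_integral_multc) auto
 finally show ?thesis by (simp add: E_def)
qed

lemma transverse:
 fixes f :: "'a::euclidean_space \<times> real \<Rightarrow> real"
 assumes f: "C1_strip f Df" and K: "K \<in> sets borel"
 shows "(\<integral>\<^sup>+z. indicator K (fst z) * (\<integral>\<^sup>+r. ennreal ((f z - f (fst z, r))^2) \<partial>expm) \<partial>strip)
  \<le> 4 * (\<integral>\<^sup>+z. indicator K (fst z) * ennreal ((norm (Df z))^2) \<partial>strip)"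
proof -
 note [measurable] = C1_stripD(3,4)[OF f] K
 have mE: "(\<lambda>z. indicator K (fst z) * ennreal ((norm (Df z))^2)) \<in> borel_measurable borel" by measurable
 note [measurable] = pair_compose_measurable[OF C1_stripD(3)[OF f]] pair_compose_measurable[OF C1_stripD(4)[OF f]]
 have m1: "(\<lambda>z. indicator K (fst z) * (\<integral>\<^sup>+r. ennreal ((f z - f (fst z, r))^2) \<partial>expm)) \<in> borel_measurable borel"
  by measurable
 have "(\<integral>\<^sup>+z. indicator K (fst z) * (\<integral>\<^sup>+r. ennreal ((f z - f (fst z, r))^2) \<partial>expm) \<partial>strip)
   = (\<integral>\<^sup>+x. indicator K x * (\<integral>\<^sup>+t. \<integral>\<^sup>+r. ennreal ((f (x, t) - f (x, r))^2) \<partial>expm \<partial>expm) \<partial>lborel)"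
  unfolding nn_strip(1)[OF m1] by (intro nn_integral_cong) (simp, rule nn_integral_cmult, measurable)
 also have "... \<le> (\<integral>\<^sup>+x. indicator K x * (4 * (\<integral>\<^sup>+t. ennreal ((norm (Df (x, t)))^2) \<partial>expm)) \<partial>lborel)"
 proof (intro nn_integral_mono mult_left_mono)
  fix x :: 'a
  have "(\<integral>\<^sup>+t. \<integral>\<^sup>+r. ennreal ((f (x, t) - f (x, r))^2) \<partial>expm \<partial>expm) \<le> 4 * (\<integral>\<^sup>+s. ennreal ((Df (x, s) \<bullet> (0, 1))^2) \<partial>expm)"
  proof (rule transverse_1d)
   fix t :: real assume "t > 0"
   thus "((\<lambda>t. f (x, t)) has_real_derivative Df (x, t) \<bullet> (0, 1)) (at t)"
    using C1_strip_line[OF f, of "(x, 0)" t "(0, 1)"] by simp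
  next
   show "continuous_on {0<..} (\<lambda>s. Df (x, s) \<bullet> (0, 1))"
    by (intro continuous_intros continuous_on_compose2[OF C1_stripD(2)[OF f]]) auto
  qed measurable
  also have "... \<le> 4 * (\<integral>\<^sup>+s. ennreal ((norm (Df (x, s)))^2) \<partial>expm)"
  proof (intro mult_left_mono nn_integral_mono ennreal_leI)
   fix s :: real
   have "\<bar>Df (x, s) \<bullet> (0, 1)\<bar> \<le> norm (Df (x, s)) * norm (0 :: 'a, 1 :: real)" by (rule Cauchy_Schwarz_ineq2)
   hence "\<bar>Df (x, s) \<bullet> (0, 1)\<bar> \<le> \<bar>norm (Df (x, s))\<bar>" by simp
   thus "(Df (x, s) \<bullet> (0, 1))^2 \<le> (norm (Df (x, s)))^2" by (simp only: abs_le_square_iff)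
  qed auto
  finally show "(\<integral>\<^sup>+t. \<integral>\<^sup>+r. ennreal ((f (x, t) - f (x, r))^2) \<partial>expm \<partial>expm) \<le> 4 * (\<integral>\<^sup>+s. ennreal ((norm (Df (x, s)))^2) \<partial>expm)" .
 qed auto
 also have "... = (\<integral>\<^sup>+x. 4 * (\<integral>\<^sup>+t. indicator K x * ennreal ((norm (Df (x, t)))^2) \<partial>expm) \<partial>lborel)"
 proof (rule nn_integral_cong)
  fix x :: 'a
  have "(\<integral>\<^sup>+t. indicator K x * ennreal ((norm (Df (x, t)))^2) \<partial>expm) = indicator K x * (\<integral>\<^sup>+t. ennreal ((norm (Df (x, t)))^2) \<partial>expm)"
   by (rule nn_integral_cmult) measurable
  thus "indicator K x * (4 * (\<integral>\<^sup>+t. ennreal ((norm (Df (x, t)))^2) \<partial>expm)) = 4 * (\<integral>\<^sup>+t. indicator K x * ennreal ((norm (Df (x, t)))^2) \<partial>expm)"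
   by (simp add: mult.left_commute)
 qed
 also have "... = 4 * (\<integral>\<^sup>+x. (\<integral>\<^sup>+t. indicator K x * ennreal ((norm (Df (x, t)))^2) \<partial>expm) \<partial>lborel)"
  by (rule nn_integral_cmult) measurable
 also have "(\<integral>\<^sup>+x. (\<integral>\<^sup>+t. indicator K x * ennreal ((norm (Df (x, t)))^2) \<partial>expm) \<partial>lborel) = (\<integral>\<^sup>+z. indicator K (fst z) * ennreal ((norm (Df z))^2) \<partial>strip)"
  unfolding nn_strip(1)[OF mE] by simp
 finally show ?thesis .
qed

text \<open>The way from \<open>z\<close> to \<open>(fst z + xi, r)\<close> leads through the corner
  \<open>(fst z + xi, snd z)\<close>. The vertical leg has a fixed cost however short
  \<open>xi\<close> is; \<open>l \<ge> 1\<close> allows it to be included in a multiple of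
  \<open>l^2\<close>, since then \<open>2 * l^2 + 8 \<le> 10 * l^2\<close>.\<close>

lemma two_point:
 fixes f :: "'a::euclidean_space \<times> real \<Rightarrow> real"
 assumes f: "C1_strip f Df" and K: "convex K" "K \<in> sets borel" and xi: "norm xi \<le> l" and l: "l \<ge> 1"
 shows "(\<integral>\<^sup>+z. indicator K (fst z) * indicator K (fst z + xi) * (\<integral>\<^sup>+r. ennreal ((f z - f (fst z + xi, r))^2) \<partial>expm) \<partial>strip)
  \<le> ennreal (10 * l^2) * (\<integral>\<^sup>+z. indicator K (fst z) * ennreal ((norm (Df z))^2) \<partial>strip)"
proof -
 let ?b = "\<lambda>z. f (fst z + xi, snd z)" and ?c = "\<lambda>z r. f (fst z + xi, r)"
 note [measurable] = C1_stripD(3,4)[OF f] K(2) pair_compose_measurable[OF C1_stripD(3)[OF f]]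
 define E where "E = (\<integral>\<^sup>+z. indicator K (fst z) * ennreal ((norm (Df z))^2) \<partial>strip)"
 define A where "A z = indicator K (fst z) * indicator K (fst z + xi) * ennreal ((?b z - f z)^2)" for z
 define B where "B z = indicator K (fst z) * (\<integral>\<^sup>+r. ennreal ((f z - f (fst z, r))^2) \<partial>expm)" for z
 have [measurable]: "A \<in> borel_measurable borel" "B \<in> borel_measurable borel" unfolding A_def B_def by measurable
 have sq: "(a - c)^2 \<le> 2 * (b - a)^2 + 2 * (b - c)^2" for a b c :: real
 proof -
  have "0 \<le> ((b - a) + (b - c))^2" by simp
  thus ?thesis by (simp add: power2_eq_square algebra_simps)
 qed
 have "(\<integral>\<^sup>+z. indicator K (fst z) * indicator K (fst z + xi) * (\<integral>\<^sup>+r. ennreal ((f z - ?c z r)^2) \<partial>expm) \<partial>strip)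
   \<le> (\<integral>\<^sup>+z. 2 * A z + 2 * B (fst z + xi, snd z) \<partial>strip)"
 proof (rule nn_integral_mono)
  fix z :: "'a \<times> real"
  have "(\<integral>\<^sup>+r. ennreal ((f z - ?c z r)^2) \<partial>expm)
   \<le> (\<integral>\<^sup>+r. ennreal (2 * (?b z - f z)^2) + 2 * ennreal ((?b z - ?c z r)^2) \<partial>expm)"
  proof (rule nn_integral_mono)
   fix r
   have "ennreal ((f z - ?c z r)^2) \<le> ennreal (2 * (?b z - f z)^2 + 2 * (?b z - ?c z r)^2)"
    by (intro ennreal_leI sq)
   also have "... = ennreal (2 * (?b z - f z)^2) + 2 * ennreal ((?b z - ?c z r)^2)"
    by (simp add: ennreal_mult)
   finally show "ennreal ((f z - ?c z r)^2) \<le> ennreal (2 * (?b z - f z)^2) + 2 * ennreal ((?b z - ?c z r)^2)" .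
  qed
  also have "... = ennreal (2 * (?b z - f z)^2) + 2 * (\<integral>\<^sup>+r. ennreal ((?b z - ?c z r)^2) \<partial>expm)"
   by (rule nn_expm_affine) measurable
  finally show "indicator K (fst z) * indicator K (fst z + xi) * (\<integral>\<^sup>+r. ennreal ((f z - ?c z r)^2) \<partial>expm)
    \<le> 2 * A z + 2 * B (fst z + xi, snd z)"
   by (auto simp: A_def B_def ennreal_mult split: split_indicator)
 qed
 also have "... = 2 * (\<integral>\<^sup>+z. A z \<partial>strip) + 2 * (\<integral>\<^sup>+z. B (fst z + xi, snd z) \<partial>strip)"
 proof -
  have [measurable]: "(\<lambda>z. B (fst z + xi, snd z)) \<in> borel_measurable borel" by (rule shift_measurable) measurable
  have "(\<integral>\<^sup>+z. 2 * A z + 2 * B (fst z + xi, snd z) \<partial>strip) = (\<integral>\<^sup>+z. 2 * A z \<partial>strip) + (\<integral>\<^sup>+z. 2 * B (fst z + xi, snd z) \<partial>strip)"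
   by (rule nn_integral_add) auto
  also have "(\<integral>\<^sup>+z. 2 * A z \<partial>strip) = 2 * (\<integral>\<^sup>+z. A z \<partial>strip)" by (rule nn_integral_cmult) auto
  also have "(\<integral>\<^sup>+z. 2 * B (fst z + xi, snd z) \<partial>strip) = 2 * (\<integral>\<^sup>+z. B (fst z + xi, snd z) \<partial>strip)" by (rule nn_integral_cmult) auto
  finally show ?thesis .
 qed
 also have "(\<integral>\<^sup>+z. B (fst z + xi, snd z) \<partial>strip) = (\<integral>\<^sup>+z. B z \<partial>strip)" by (rule nn_strip_translate) auto
 also have "2 * (\<integral>\<^sup>+z. A z \<partial>strip) + 2 * (\<integral>\<^sup>+z. B z \<partial>strip) \<le> 2 * (ennreal (l^2) * E) + 2 * (4 * E)"
 proof (intro add_mono mult_left_mono)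
  have "(\<integral>\<^sup>+z. A z \<partial>strip) \<le> ennreal ((norm xi)^2) * E" unfolding A_def E_def by (rule displacement[OF f K])
  also have "... \<le> ennreal (l^2) * E" using xi by (intro mult_right_mono ennreal_leI power_mono) auto
  finally show "(\<integral>\<^sup>+z. A z \<partial>strip) \<le> ennreal (l^2) * E" .
  show "(\<integral>\<^sup>+z. B z \<partial>strip) \<le> 4 * E" unfolding B_def E_def by (rule transverse[OF f K(2)])
 qed auto
 also have "... = ennreal (2 * l^2 + 8) * E"
  by (simp add: ennreal_plus ennreal_mult distrib_right mult.assoc[symmetric])
 also have "... \<le> ennreal (10 * l^2) * E"
 proof (intro mult_right_mono ennreal_leI)
  have "1^2 \<le> l^2" using l by (intro power_mono) auto
  thus "2 * l^2 + 8 \<le> 10 * l^2" by simp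
 qed auto
 finally show ?thesis unfolding E_def .
qed

text \<open>A function supported in a set of small measure vanishes at most points of every ball of radius \<open>l\<close>, so
  that the two-point inequality controls the function itself.\<close>
lemma faber_krahn:
 fixes f :: "'a::euclidean_space \<times> real \<Rightarrow> real"
 assumes f: "C1_strip f Df" and A: "A \<in> sets borel" "\<And>z. z \<notin> A \<Longrightarrow> f z = 0"
  and l: "l \<ge> 1" and small: "2 * emeasure strip A \<le> emeasure lborel (ball (0 :: 'a) l)"
 shows "(\<integral>\<^sup>+z. ennreal ((f z)^2) \<partial>strip) \<le> ennreal (20 * l^2) * (\<integral>\<^sup>+z. ennreal ((norm (Df z))^2) \<partial>strip)"
proof -
 let ?f = "\<lambda>z xi. \<integral>\<^sup>+r. ennreal ((f z - f (fst z + xi, r))^2) \<partial>expm"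
 let ?n = "\<lambda>z xi. \<integral>\<^sup>+r. indicator (- A) (fst z + xi, r) \<partial>expm :: ennreal"
 have iA: "(indicator A :: _ \<Rightarrow> ennreal) \<in> borel_measurable borel" "(indicator (- A) :: _ \<Rightarrow> ennreal) \<in> borel_measurable borel"
  using A(1) by auto
 note [measurable] = C1_stripD(3,4)[OF f] A(1) iA pair_compose_measurable[OF C1_stripD(3)[OF f]]
  pair_compose_measurable[OF iA(1)] pair_compose_measurable[OF iA(2)]
 define E where "E = (\<integral>\<^sup>+z. ennreal ((norm (Df z))^2) \<partial>strip)"
 define v where "v = unit_ball_vol (real DIM('a)) * l ^ DIM('a)"
 have v: "v > 0" unfolding v_def using l by (intro mult_pos_pos) auto
 have V: "emeasure lborel (ball (0 :: 'a) l) = ennreal v" unfolding v_def using l by (subst emeasure_ball) auto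
 have mA: "emeasure strip A \<le> ennreal (v / 2)"
 proof -
  have "2 * emeasure strip A \<le> ennreal v" using small V by simp
  hence "emeasure strip A < \<infinity>" by (auto simp: ennreal_mult_eq_top_iff top_unique less_top[symmetric])
  then obtain a where a: "emeasure strip A = ennreal a" "a \<ge> 0" by (cases "emeasure strip A") auto
  have "ennreal (2 * a) \<le> ennreal v" using \<open>2 * emeasure strip A \<le> ennreal v\<close> a by (simp add: ennreal_mult)
  thus ?thesis using a v by (simp add: ennreal_le_iff)
 qed
 interpret p: pair_sigma_finite lborel "strip :: ('a \<times> real) measure"
  using sigma_finite_strip by (simp add: pair_sigma_finite_def lborel.sigma_finite_measure_axioms)
 define B where "B = ball (0 :: 'a) l"
 have [measurable]: "B \<in> sets borel" by (simp add: B_def)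
 \<comment> \<open>For every \<open>z\<close>, at least half of the displacements in the ball lead
   to zeros of \<open>f\<close>, counted with the average over \<open>r\<close>.\<close>
 have inner: "ennreal (v / 2) \<le> (\<integral>\<^sup>+xi. indicator B xi * ?n z xi \<partial>lborel)" (is "_ \<le> ?I") for z :: "'a \<times> real"
 proof -
  have "ennreal v = (\<integral>\<^sup>+xi. indicator B xi \<partial>lborel)" using V by (simp add: B_def)
  also have "... = (\<integral>\<^sup>+xi. indicator B xi * (\<integral>\<^sup>+r. indicator (- A) (fst z + xi, r) + indicator A (fst z + xi, r) \<partial>expm) \<partial>lborel)"
  proof (rule nn_integral_cong)
   fix xi :: 'a
   have "indicator (- A) q + indicator A q = (1 :: ennreal)" for q by (auto split: split_indicator)
   thus "indicator B xi = indicator B xi * (\<integral>\<^sup>+r. indicator (- A) (fst z + xi, r) + indicator A (fst z + xi, r) \<partial>expm)" by simp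
  qed
  also have "... = (\<integral>\<^sup>+xi. indicator B xi * ?n z xi + indicator B xi * (\<integral>\<^sup>+r. indicator A (fst z + xi, r) \<partial>expm) \<partial>lborel)"
  proof (rule nn_integral_cong)
   fix xi :: 'a
   have "(\<integral>\<^sup>+r. indicator (- A) (fst z + xi, r) + indicator A (fst z + xi, r) \<partial>expm)
    = ?n z xi + (\<integral>\<^sup>+r. (indicator A (fst z + xi, r) :: ennreal) \<partial>expm)"
    by (rule nn_integral_add) measurable
   thus "indicator B xi * (\<integral>\<^sup>+r. indicator (- A) (fst z + xi, r) + indicator A (fst z + xi, r) \<partial>expm)
    = indicator B xi * ?n z xi + indicator B xi * (\<integral>\<^sup>+r. (indicator A (fst z + xi, r) :: ennreal) \<partial>expm)"
    by (simp add: distrib_left)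
  qed
  also have "... = ?I + (\<integral>\<^sup>+xi. indicator B xi * (\<integral>\<^sup>+r. indicator A (fst z + xi, r) \<partial>expm) \<partial>lborel)"
   by (rule nn_integral_add) measurable
  also have "... \<le> ?I + ennreal (v / 2)"
  proof (rule add_left_mono)
   have "(\<integral>\<^sup>+xi. indicator B xi * (\<integral>\<^sup>+r. indicator A (fst z + xi, r) \<partial>expm) \<partial>lborel) \<le> (\<integral>\<^sup>+xi. (\<integral>\<^sup>+r. indicator A (xi + fst z, r) \<partial>expm) \<partial>lborel)"
    by (intro nn_integral_mono) (auto simp: add.commute split: split_indicator)
   also have "... = (\<integral>\<^sup>+xi. (\<integral>\<^sup>+r. indicator A (xi, r) \<partial>expm) \<partial>lborel)"
    by (rule nn_lborel_translate[of "\<lambda>xi. \<integral>\<^sup>+r. indicator A (xi, r) \<partial>expm"]) measurable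
   also have "... = (\<integral>\<^sup>+z. indicator A z \<partial>strip)" by (rule nn_strip(1)[symmetric]) measurable
   also have "... = emeasure strip A" by simp
   finally show "(\<integral>\<^sup>+xi. indicator B xi * (\<integral>\<^sup>+r. indicator A (fst z + xi, r) \<partial>expm) \<partial>lborel) \<le> ennreal (v / 2)" using mA by simp
  qed
  finally have le: "ennreal v \<le> ?I + ennreal (v / 2)" .
  have "ennreal (v / 2) + ennreal (v / 2) = ennreal v" using v by (subst ennreal_plus[symmetric]) auto
  hence "ennreal (v / 2) + ennreal (v / 2) \<le> ennreal (v / 2) + ?I" using le by (simp add: add.commute)
  thus ?thesis by (subst (asm) ennreal_add_left_cancel_le) auto
 qed
 have "ennreal (v / 2) * (\<integral>\<^sup>+z. ennreal ((f z)^2) \<partial>strip) = (\<integral>\<^sup>+z. ennreal ((f z)^2) * ennreal (v / 2) \<partial>strip)"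
 proof -
  have "(\<integral>\<^sup>+z. ennreal ((f z)^2) * ennreal (v / 2) \<partial>strip) = (\<integral>\<^sup>+z. ennreal ((f z)^2) \<partial>strip) * ennreal (v / 2)"
   by (rule nn_integral_multc) measurable
  thus ?thesis by (simp add: mult.commute)
 qed
 also have "... \<le> (\<integral>\<^sup>+z. \<integral>\<^sup>+xi. indicator B xi * ?f z xi \<partial>lborel \<partial>strip)"
 proof (rule nn_integral_mono)
  fix z :: "'a \<times> real"
  have "ennreal ((f z)^2) * ennreal (v / 2) \<le> ennreal ((f z)^2) * (\<integral>\<^sup>+xi. indicator B xi * ?n z xi \<partial>lborel)"
   by (intro mult_left_mono inner) auto
  also have "... = (\<integral>\<^sup>+xi. ennreal ((f z)^2) * (indicator B xi * ?n z xi) \<partial>lborel)"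
   by (rule nn_integral_cmult[symmetric]) measurable
  also have "... \<le> (\<integral>\<^sup>+xi. indicator B xi * ?f z xi \<partial>lborel)"
  proof (rule nn_integral_mono)
   fix xi :: 'a
   have "ennreal ((f z)^2) * ?n z xi = (\<integral>\<^sup>+r. ennreal ((f z)^2) * indicator (- A) (fst z + xi, r) \<partial>expm)"
    by (rule nn_integral_cmult[symmetric]) measurable
   also have "... \<le> ?f z xi"
    by (intro nn_integral_mono) (auto simp: A(2) split: split_indicator)
   finally show "ennreal ((f z)^2) * (indicator B xi * ?n z xi)
    \<le> indicator B xi * ?f z xi"
    by (auto split: split_indicator)
  qed
  finally show "ennreal ((f z)^2) * ennreal (v / 2) \<le> (\<integral>\<^sup>+xi. indicator B xi * ?f z xi \<partial>lborel)" .
 qed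
 also have "... = (\<integral>\<^sup>+xi. \<integral>\<^sup>+z. indicator B xi * ?f z xi \<partial>strip \<partial>lborel)"
  by (rule p.Fubini') measurable
 also have "... \<le> (\<integral>\<^sup>+xi. indicator B xi * (ennreal (10 * l^2) * E) \<partial>lborel)"
 proof (rule nn_integral_mono)
  fix xi :: 'a
  show "(\<integral>\<^sup>+z. indicator B xi * ?f z xi \<partial>strip) \<le> indicator B xi * (ennreal (10 * l^2) * E)"
  proof (cases "xi \<in> B")
   case True
   thus ?thesis using two_point[OF f convex_UNIV _ _ l, of xi] by (simp add: E_def B_def)
  qed simp
 qed
 also have "... = (\<integral>\<^sup>+xi. indicator B xi \<partial>lborel) * (ennreal (10 * l^2) * E)" by (rule nn_integral_multc) measurable
 also have "... = ennreal v * (ennreal (10 * l^2) * E)" using V by (simp add: B_def)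
 also have "... = ennreal (v / 2) * (ennreal (20 * l^2) * E)"
 proof -
  have "ennreal v * ennreal (10 * l^2) = ennreal (v / 2) * ennreal (20 * l^2)"
   using v by (simp add: ennreal_mult[symmetric])
  thus ?thesis by (simp add: mult.assoc[symmetric])
 qed
 finally have "ennreal (v / 2) * (\<integral>\<^sup>+z. ennreal ((f z)^2) \<partial>strip) \<le> ennreal (v / 2) * (ennreal (20 * l^2) * E)" .
 thus ?thesis using v unfolding E_def by (subst (asm) ennreal_mult_le_mult_iff) auto
qed

text \<open>Poincare's inequality on a ball in two-point form. Two points over the ball of radius
  \<open>R\<close> differ horizontally by less than \<open>2 * R\<close>, which explains the volume
  factor and the constant \<open>40 = 10 * 2^2\<close>.\<close>

lemma ball_pairs:
 fixes f :: "'a::euclidean_space \<times> real \<Rightarrow> real"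
 assumes f: "C1_strip f Df" and R: "R \<ge> 1"
 shows "(\<integral>\<^sup>+z. indicator (ball 0 R) (fst z) * (\<integral>\<^sup>+y. indicator (ball 0 R) (fst y) * ennreal ((f z - f y)^2) \<partial>strip) \<partial>strip)
  \<le> emeasure lborel (ball (0 :: 'a) (2 * R)) * (ennreal (40 * R^2) * (\<integral>\<^sup>+z. indicator (ball 0 R) (fst z) * ennreal ((norm (Df z))^2) \<partial>strip))"
proof -
 note [measurable] = C1_stripD(3,4)[OF f] pair_compose_measurable[OF C1_stripD(3)[OF f]]
 define K where "K = ball (0 :: 'a) R"
 define D where "D = ball (0 :: 'a) (2 * R)"
 have [measurable]: "K \<in> sets borel" "D \<in> sets borel" by (auto simp: K_def D_def)
 define E where "E = (\<integral>\<^sup>+z. indicator K (fst z) * ennreal ((norm (Df z))^2) \<partial>strip)"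
 interpret p: pair_sigma_finite lborel "strip :: ('a \<times> real) measure"
  using sigma_finite_strip by (simp add: pair_sigma_finite_def lborel.sigma_finite_measure_axioms)
 define I where "I z xi = (\<integral>\<^sup>+r. ennreal ((f z - f (fst z + xi, r))^2) \<partial>expm)" for z xi
 let ?J = "\<lambda>z xi. indicator D xi * (indicator K (fst z) * indicator K (fst z + xi) * I z xi)"
 have "(\<integral>\<^sup>+z. indicator K (fst z) * (\<integral>\<^sup>+y. indicator K (fst y) * ennreal ((f z - f y)^2) \<partial>strip) \<partial>strip)
   = (\<integral>\<^sup>+z. \<integral>\<^sup>+xi. ?J z xi \<partial>lborel \<partial>strip)"
 proof (rule nn_integral_cong)
  fix z :: "'a \<times> real"
  have "(\<integral>\<^sup>+y. indicator K (fst y) * ennreal ((f z - f y)^2) \<partial>strip) = (\<integral>\<^sup>+x. \<integral>\<^sup>+r. indicator K x * ennreal ((f z - f (x, r))^2) \<partial>expm \<partial>lborel)"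
  proof -
   have "(\<lambda>y. indicator K (fst y) * ennreal ((f z - f y)^2)) \<in> borel_measurable borel" by measurable
   from nn_strip(1)[OF this] show ?thesis by simp
  qed
  also have "... = (\<integral>\<^sup>+x. indicator K x * (\<integral>\<^sup>+r. ennreal ((f z - f (x, r))^2) \<partial>expm) \<partial>lborel)"
   by (intro nn_integral_cong nn_integral_cmult) measurable
  also have "... = (\<integral>\<^sup>+xi. indicator K (xi + fst z) * (\<integral>\<^sup>+r. ennreal ((f z - f (xi + fst z, r))^2) \<partial>expm) \<partial>lborel)"
   by (rule nn_lborel_translate[symmetric, of "\<lambda>x. indicator K x * (\<integral>\<^sup>+r. ennreal ((f z - f (x, r))^2) \<partial>expm)"]) measurable
  also have "... = (\<integral>\<^sup>+xi. indicator K (fst z + xi) * I z xi \<partial>lborel)" by (simp add: I_def add.commute)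
  finally have "indicator K (fst z) * (\<integral>\<^sup>+y. indicator K (fst y) * ennreal ((f z - f y)^2) \<partial>strip)
   = (\<integral>\<^sup>+xi. indicator K (fst z) * (indicator K (fst z + xi) * I z xi) \<partial>lborel)"
   by (subst nn_integral_cmult) (auto simp: I_def)
  also have "... = (\<integral>\<^sup>+xi. ?J z xi \<partial>lborel)"
  proof (rule nn_integral_cong)
   fix xi :: 'a
   have "xi \<in> D" if "fst z \<in> K" "fst z + xi \<in> K"
    using that norm_triangle_ineq4[of "fst z + xi" "fst z"] by (simp add: K_def D_def)
   thus "indicator K (fst z) * (indicator K (fst z + xi) * I z xi) = ?J z xi"
    by (auto split: split_indicator)
  qed
  finally show "indicator K (fst z) * (\<integral>\<^sup>+y. indicator K (fst y) * ennreal ((f z - f y)^2) \<partial>strip)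
   = (\<integral>\<^sup>+xi. ?J z xi \<partial>lborel)" .
 qed
 also have "... = (\<integral>\<^sup>+xi. \<integral>\<^sup>+z. ?J z xi \<partial>strip \<partial>lborel)"
  unfolding I_def by (rule p.Fubini') measurable
 also have "... \<le> (\<integral>\<^sup>+xi. indicator D xi * (ennreal (40 * R^2) * E) \<partial>lborel)"
 proof (rule nn_integral_mono)
  fix xi :: 'a
  show "(\<integral>\<^sup>+z. ?J z xi \<partial>strip) \<le> indicator D xi * (ennreal (40 * R^2) * E)"
  proof (cases "xi \<in> D")
   case True
   have "ennreal (10 * (2 * R)^2) = ennreal (40 * R^2)" by (simp add: power_mult_distrib)
   thus ?thesis using two_point[OF f, of K xi "2 * R"] True R
    by (simp add: E_def I_def K_def D_def)
  qed simp
 qed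
 also have "... = emeasure lborel D * (ennreal (40 * R^2) * E)" by (subst nn_integral_multc) auto
 finally show ?thesis unfolding K_def D_def E_def .
qed

section \<open>A Liouville theorem\<close>

lemma emeasure_cylinder:
 fixes B :: "'a::euclidean_space set"
 assumes [measurable]: "B \<in> sets borel"
 shows "emeasure strip {z. fst z \<in> B} = emeasure lborel B"
proof -
 have m: "{z::'a \<times> real. fst z \<in> B} \<in> sets borel"
  using measurable_sets[OF fst_snd_borel(1) assms] by (simp add: vimage_def)
 hence "emeasure strip {z. fst z \<in> B} = (\<integral>\<^sup>+z. indicator {z. fst z \<in> B} z \<partial>strip)" by simp
 also have "... = (\<integral>\<^sup>+x. \<integral>\<^sup>+t. indicator {z. fst z \<in> B} (x, t) \<partial>expm \<partial>lborel)"
  by (rule nn_strip(1)) (use m in simp)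
 also have "... = (\<integral>\<^sup>+x. indicator B x \<partial>lborel)"
 proof (rule nn_integral_cong)
  fix x :: 'a
  have "indicator {z. fst z \<in> B} (x, t) = (indicator B x :: ennreal)" for t :: real by (auto split: split_indicator)
  thus "(\<integral>\<^sup>+t. indicator {z. fst z \<in> B} (x, t) \<partial>expm) = (indicator B x :: ennreal)" by simp
 qed
 finally show ?thesis by simp
qed

lemma cylinder_ball:
 assumes "R \<ge> 0"
 shows "emeasure strip {z :: 'a::euclidean_space \<times> real. norm (fst z) < R} = ennreal (unit_ball_vol (real DIM('a)) * R ^ DIM('a))"
 using emeasure_cylinder[of "ball (0::'a) R"] assms by (simp add: emeasure_ball)

lemma cylinder_measurable [measurable]: "{z :: 'a::euclidean_space \<times> real. norm (fst z) < R} \<in> sets borel"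
 by (intro borel_open open_Collect_less continuous_intros)

lemma integrable_strip:
 fixes g :: "'a::euclidean_space \<times> real \<Rightarrow> real"
 assumes g: "g \<in> borel_measurable borel" "\<And>z. snd z > 0 \<Longrightarrow> \<bar>g z\<bar> \<le> C" "\<And>z. snd z > 0 \<Longrightarrow> norm (fst z) \<ge> R \<Longrightarrow> g z = 0"
  and R: "R \<ge> 0"
 shows "integrable strip g"
proof (rule Bochner_Integration.integrable_bound)
 show "integrable strip (\<lambda>z. indicator {z :: 'a \<times> real. norm (fst z) < R} z * \<bar>C\<bar>)"
  by (intro integrable_mult_left integrable_real_indicator) (auto simp: cylinder_ball[OF R])
 show "g \<in> borel_measurable strip" using g by simp
 show "AE z in strip. norm (g z) \<le> norm (indicator {z :: 'a \<times> real. norm (fst z) < R} z * \<bar>C\<bar>)"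
  using AE_strip
 proof eventually_elim
  case (elim z)
  have "C \<ge> 0" using g(2)[OF elim] by linarith
  thus ?case using g(2,3)[OF elim] by (auto split: split_indicator)
 qed
qed

section \<open>Test functions\<close>

lemma deriv_max_power:
 assumes "n \<ge> 2"
 shows "((\<lambda>y. (max 0 y) ^ n) has_real_derivative (real n * (max 0 y) ^ (n - 1))) (at (y::real))"
proof -
 consider "y > 0" | "y < 0" | "y = 0" by linarith
 thus ?thesis
 proof cases
  case 1
  have "((\<lambda>y. y ^ n) has_real_derivative (real n * (max 0 y) ^ (n - 1))) (at y)"
   using DERIV_pow[of n y] 1 by simp
  moreover have "\<forall>\<^sub>F x in nhds y. x ^ n = (max 0 x) ^ n"
   using eventually_nhds_in_open[of "{0<..}" y] 1 by (auto elim!: eventually_mono)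
  ultimately show ?thesis by (subst (asm) DERIV_cong_ev) auto
 next
  case 2
  have "((\<lambda>y. 0) has_real_derivative (real n * (max 0 y) ^ (n - 1))) (at y)"
   using 2 assms by (auto simp: max_def power_0_left)
  moreover have "\<forall>\<^sub>F x in nhds y. 0 = (max 0 x) ^ n"
   using eventually_nhds_in_open[of "{..<0}" y] 2 assms by (auto elim!: eventually_mono simp: max_def power_0_left)
  ultimately show ?thesis by (subst (asm) DERIV_cong_ev) auto
 next
  case 3
  have "((\<lambda>h. (max 0 (0 + h) ^ n - max 0 (0::real) ^ n) / h) \<longlongrightarrow> 0) (at 0)"
  proof (rule Lim_null_comparison)
   show "\<forall>\<^sub>F h in at (0::real). norm ((max 0 (0 + h) ^ n - max 0 (0::real) ^ n) / h) \<le> \<bar>h\<bar>"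
    unfolding eventually_at
   proof (intro exI[of _ 1] conjI ballI impI)
    fix h :: real assume h: "h \<noteq> 0 \<and> dist h 0 < 1"
    have "\<bar>h\<bar> ^ n \<le> \<bar>h\<bar> ^ 2" using h assms by (intro power_decreasing) auto
    moreover have "\<bar>max 0 h\<bar> ^ n \<le> \<bar>h\<bar> ^ n" by (intro power_mono) auto
    ultimately have "\<bar>max 0 h ^ n\<bar> \<le> \<bar>h\<bar> * \<bar>h\<bar>" by (simp add: power_abs power2_eq_square)
    thus "norm ((max 0 (0 + h) ^ n - max 0 (0::real) ^ n) / h) \<le> \<bar>h\<bar>"
     using h assms by (simp add: power_0_left abs_divide divide_le_eq)
   qed simp
   show "((\<lambda>h::real. \<bar>h\<bar>) \<longlongrightarrow> 0) (at 0)" by (rule tendsto_rabs_zero) simp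
  qed
  thus ?thesis using 3 assms by (simp add: DERIV_def power_0_left)
 qed
qed

lemma C1_strip_compose:
 fixes w :: "'a::euclidean_space \<times> real \<Rightarrow> real" and rho :: "'a \<Rightarrow> real"
 assumes w: "C1_strip w Dw"
  and rho: "\<And>x. (rho has_derivative (\<lambda>h. Drho x \<bullet> h)) (at x)" "continuous_on UNIV Drho"
  and P: "\<And>y. y \<in> I \<Longrightarrow> (P has_real_derivative P' y) (at y)" "continuous_on I P'"
  and wI: "\<And>z. snd z > 0 \<Longrightarrow> w z \<in> I" and m: "P \<in> borel_measurable borel" "P' \<in> borel_measurable borel"
 shows "C1_strip (\<lambda>z. rho (fst z) * P (w z)) (\<lambda>z. (rho (fst z) * P' (w z)) *\<^sub>R Dw z + P (w z) *\<^sub>R (Drho (fst z), 0))"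
proof -
 note [measurable] = C1_stripD(3,4)[OF w] m
 have rhoc: "continuous_on UNIV rho"
  by (intro continuous_at_imp_continuous_on ballI has_derivative_continuous[OF rho(1)])
 have wc: "continuous_on {z. snd z > 0} w"
  by (intro continuous_at_imp_continuous_on ballI has_derivative_continuous[OF C1_stripD(1)[OF w]]) auto
 have Pc: "continuous_on I P"
  by (intro continuous_at_imp_continuous_on ballI DERIV_isCont[OF P(1)])
 have [measurable]: "rho \<in> borel_measurable borel" "Drho \<in> borel_measurable borel"
  by (intro borel_measurable_continuous_onI rhoc rho(2))+
 show ?thesis unfolding C1_strip_def
 proof (intro conjI allI impI)
  fix z :: "'a \<times> real" assume z: "snd z > 0"
  have 1: "((\<lambda>z. rho (fst z)) has_derivative (\<lambda>h. Drho (fst z) \<bullet> fst h)) (at z)"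
   by (rule has_derivative_compose[OF _ rho(1)]) (auto intro!: derivative_eq_intros)
  have 2: "((\<lambda>z. P (w z)) has_derivative (\<lambda>h. P' (w z) * (Dw z \<bullet> h))) (at z)"
   using has_derivative_compose[OF C1_stripD(1)[OF w z], of P] P(1)[OF wI[OF z]]
   by (simp add: has_field_derivative_def)
  have "(\<lambda>h. rho (fst z) * (P' (w z) * (Dw z \<bullet> h)) + (Drho (fst z) \<bullet> fst h) * P (w z)) = 
   (\<lambda>h. ((rho (fst z) * P' (w z)) *\<^sub>R Dw z + P (w z) *\<^sub>R (Drho (fst z), 0)) \<bullet> h)"
   by (auto simp: inner_add_left inner_prod_def algebra_simps)
  thus "((\<lambda>z. rho (fst z) * P (w z)) has_derivative (\<lambda>h. ((rho (fst z) * P' (w z)) *\<^sub>R Dw z + P (w z) *\<^sub>R (Drho (fst z), 0)) \<bullet> h)) (at z)"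
   using has_derivative_mult[OF 1 2] by simp
 next
  show "continuous_on {z. 0 < snd z} (\<lambda>z. (rho (fst z) * P' (w z)) *\<^sub>R Dw z + P (w z) *\<^sub>R (Drho (fst z), 0 :: real))"
   by (intro continuous_intros continuous_on_compose2[OF rhoc] continuous_on_compose2[OF rho(2)]
     continuous_on_compose2[OF P(2) wc] continuous_on_compose2[OF Pc wc] C1_stripD(2)[OF w]) (use wI in auto)
  show "(\<lambda>z. rho (fst z) * P (w z)) \<in> borel_measurable borel" by measurable
  have "(\<lambda>z. (Drho (fst z), 0 :: real)) \<in> borel_measurable (borel :: ('a \<times> real) measure)"
   by (rule measurable_compose[of fst _ borel "\<lambda>x. (Drho x, 0)"])
     (auto intro!: borel_measurable_continuous_onI continuous_intros rho(2))
  thus "(\<lambda>z. (rho (fst z) * P' (w z)) *\<^sub>R Dw z + P (w z) *\<^sub>R (Drho (fst z), 0)) \<in> borel_measurable borel" by measurable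
 qed
qed

text \<open>Not a plateau: for \<open>norm x \<le> s\<close> it is only bounded below by 1, which is
  all that is used there. The square of the positive part is continuously differentiable with an
  explicit gradient.\<close>

definition cutoff :: "real \<Rightarrow> real \<Rightarrow> 'a::euclidean_space \<Rightarrow> real" where
 "cutoff s S x = (max 0 (S^2 - (norm x)^2) / (S^2 - s^2))^2"
definition Dcutoff :: "real \<Rightarrow> real \<Rightarrow> 'a::euclidean_space \<Rightarrow> 'a" where
 "Dcutoff s S x = (- 4 * max 0 (S^2 - (norm x)^2) / (S^2 - s^2)^2) *\<^sub>R x"

lemma cutoff_props:
 fixes x :: "'a::euclidean_space"
 assumes "0 < s" "s < S"
 shows "(cutoff s S has_derivative (\<lambda>h. Dcutoff s S x \<bullet> h)) (at x)" "continuous_on UNIV (Dcutoff s S :: 'a \<Rightarrow> 'a)"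
  "norm x \<le> s \<Longrightarrow> cutoff s S x \<ge> 1" "cutoff s S x \<ge> 0"
  "norm x \<ge> S \<Longrightarrow> cutoff s S x = 0" "norm x \<ge> S \<Longrightarrow> Dcutoff s S x = 0"
  "norm (Dcutoff s S x) \<le> 4 * S ^ 3 / (S^2 - s^2)^2" "cutoff s S x \<le> (S^2 / (S^2 - s^2))^2"
proof -
 define d where "d = S^2 - s^2"
 have "s^2 < S^2" using assms by (intro power_strict_mono) auto
 hence d: "d > 0" by (simp add: d_def)
 have 1: "((\<lambda>y::real. (max 0 y)^2) has_real_derivative (2 * max 0 y)) (at y)" for y
  using deriv_max_power[of 2 y] by simp
 have 2: "((\<lambda>x::'a. S^2 - (norm x)^2) has_derivative (\<lambda>h. - 2 * (x \<bullet> h))) (at x)"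
  unfolding power2_norm_eq_inner by (auto intro!: derivative_eq_intros simp: inner_commute)
 have 3: "((\<lambda>x::'a. (max 0 (S^2 - (norm x)^2))^2) has_derivative (\<lambda>h. (2 * max 0 (S^2 - (norm x)^2)) * (- 2 * (x \<bullet> h)))) (at x)"
  using has_derivative_compose[OF 2 1[unfolded has_field_derivative_def]] by simp
 have "((\<lambda>x::'a. (1 / d^2) * (max 0 (S^2 - (norm x)^2))^2) has_derivative
   (\<lambda>h. (1 / d^2) * ((2 * max 0 (S^2 - (norm x)^2)) * (- 2 * (x \<bullet> h))))) (at x)"
  by (rule has_derivative_mult_right[OF 3])
 moreover have "(\<lambda>x::'a. (1 / d^2) * (max 0 (S^2 - (norm x)^2))^2) = cutoff s S"
  by (auto simp: cutoff_def d_def power_divide)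
 moreover have "(\<lambda>h. (1 / d^2) * ((2 * max 0 (S^2 - (norm x)^2)) * (- 2 * (x \<bullet> h)))) = (\<lambda>h. Dcutoff s S x \<bullet> h)"
  by (auto simp: Dcutoff_def d_def)
 ultimately show "(cutoff s S has_derivative (\<lambda>h. Dcutoff s S x \<bullet> h)) (at x)" by simp
 show "continuous_on UNIV (Dcutoff s S :: 'a \<Rightarrow> 'a)"
  unfolding Dcutoff_def using d unfolding d_def by (intro continuous_intros) auto
 show "cutoff s S x \<ge> 1" if "norm x \<le> s"
 proof -
  have "(norm x)^2 \<le> s^2" using that by (intro power_mono) auto
  hence "1 \<le> max 0 (S^2 - (norm x)^2) / d" using d by (simp add: d_def le_divide_eq)
  hence "1^2 \<le> (max 0 (S^2 - (norm x)^2) / d)^2" by (intro power_mono) auto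
  thus ?thesis by (simp add: cutoff_def d_def)
 qed
 show "cutoff s S x \<ge> 0" by (simp add: cutoff_def)
 have z: "max 0 (S^2 - (norm x)^2) = 0" if "norm x \<ge> S"
 proof -
  have "S^2 \<le> (norm x)^2" using that assms by (intro power_mono) auto
  thus ?thesis by simp
 qed
 show "norm x \<ge> S \<Longrightarrow> cutoff s S x = 0" "norm x \<ge> S \<Longrightarrow> Dcutoff s S x = 0"
  using z by (auto simp: cutoff_def Dcutoff_def)
 have mle: "max 0 (S^2 - (norm x)^2) \<le> S^2" by simp
 show "norm (Dcutoff s S x) \<le> 4 * S ^ 3 / (S^2 - s^2)^2"
 proof (cases "norm x \<ge> S")
  case True
  thus ?thesis using z assms by (simp add: Dcutoff_def)
 next
  case False
  have "4 * max 0 (S^2 - (norm x)^2) * norm x \<le> 4 * S^2 * S"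
   using mle False assms by (intro mult_mono) auto
  hence "4 * max 0 (S^2 - (norm x)^2) * norm x / d^2 \<le> 4 * S ^ 3 / d^2"
   by (intro divide_right_mono) (auto simp: power2_eq_square power3_eq_cube)
  thus ?thesis by (simp add: Dcutoff_def d_def abs_mult)
 qed
 show "cutoff s S x \<le> (S^2 / (S^2 - s^2))^2"
  unfolding cutoff_def d_def[symmetric] using mle d by (intro power_mono divide_right_mono) auto
qed

text \<open>\<open>J\<close> need not be a linear function of \<open>Dw\<close>; only coercivity and
  growth along the given solution are recorded, so differences of nonlinear fluxes fit. The test
  functions need not vanish at \<open>t = 0\<close>, hence \<open>weak\<close> contains the no-flux
  condition.\<close>

locale strip_solution =
 fixes w :: "'a::euclidean_space \<times> real \<Rightarrow> real" and Dw J :: "'a \<times> real \<Rightarrow> 'a \<times> real" and lam Lam Bd :: real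
 assumes C1: "C1_strip w Dw" and bound: "\<And>z. snd z > 0 \<Longrightarrow> \<bar>w z\<bar> \<le> Bd" "\<And>z. snd z > 0 \<Longrightarrow> norm (Dw z) \<le> Bd"
  and lam: "lam > 0" and Lam: "Lam \<ge> 0" and J_meas: "J \<in> borel_measurable borel"
  and ell: "\<And>z. snd z > 0 \<Longrightarrow> lam * (norm (Dw z))^2 \<le> J z \<bullet> Dw z" "\<And>z. snd z > 0 \<Longrightarrow> norm (J z) \<le> Lam * norm (Dw z)"
  and weak: "\<And>eta Deta R C. C1_strip eta Deta \<Longrightarrow> (\<And>z. snd z > 0 \<Longrightarrow> norm (fst z) \<ge> R \<Longrightarrow> eta z = 0 \<and> Deta z = 0) \<Longrightarrow>
    (\<And>z. snd z > 0 \<Longrightarrow> \<bar>eta z\<bar> \<le> C \<and> norm (Deta z) \<le> C) \<Longrightarrow> (LINT z|strip. J z \<bullet> Deta z) = 0"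
begin

lemma Bd: "Bd \<ge> 0"
 using bound(1)[of "(0, 1)"] by simp

text \<open>The test function is \<open>rho^2\<close> times \<open>P\<close> of \<open>w\<close>.
  The condition \<open>(P y)^2 \<le> \<Theta> y * P' y\<close> is what absorbs the cross term. It
  covers the cube of the positive part of \<open>y - k'\<close>, with a third of its fourth power as
  \<open>\<Theta>\<close>, as well as \<open>1 / (M + \<delta> - y)\<close> with
  \<open>\<Theta> = 1\<close>. Since the latter is singular, everything is required only on a set
  \<open>I\<close> containing the values of \<open>w\<close>.\<close>

lemma caccioppoli:
 assumes rho: "\<And>x. (rho has_derivative (\<lambda>h. Drho x \<bullet> h)) (at x)" "continuous_on UNIV Drho"
  "\<And>x. norm x \<ge> R \<Longrightarrow> rho x = 0 \<and> Drho x = 0" "\<And>x. \<bar>rho x\<bar> \<le> Crho" "\<And>x. norm (Drho x) \<le> Crho" and R: "R \<ge> 0"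
  and P: "\<And>y. y \<in> I \<Longrightarrow> (P has_real_derivative P' y) (at y)" "continuous_on I P'"
  and wI: "\<And>z. snd z > 0 \<Longrightarrow> w z \<in> I"
  and m: "P \<in> borel_measurable borel" "P' \<in> borel_measurable borel" "\<Theta> \<in> borel_measurable borel"
  and PP: "\<And>y. y \<in> I \<Longrightarrow> P' y \<ge> 0" "\<And>y. y \<in> I \<Longrightarrow> \<Theta> y \<ge> 0" "\<And>y. y \<in> I \<Longrightarrow> (P y)^2 \<le> \<Theta> y * P' y"
  and bd: "\<And>z. snd z > 0 \<Longrightarrow> \<bar>P (w z)\<bar> \<le> CP" "\<And>z. snd z > 0 \<Longrightarrow> \<bar>P' (w z)\<bar> \<le> CP" "\<And>z. snd z > 0 \<Longrightarrow> \<bar>\<Theta> (w z)\<bar> \<le> CP"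
 shows "(\<integral>\<^sup>+z. ennreal ((rho (fst z))^2 * P' (w z) * (norm (Dw z))^2) \<partial>strip)
  \<le> ennreal (4 * Lam^2 / lam^2) * (\<integral>\<^sup>+z. ennreal (\<Theta> (w z) * (norm (Drho (fst z)))^2) \<partial>strip)"
proof -
 note [measurable] = C1_stripD(3,4)[OF C1] m J_meas
 have rhoc: "continuous_on UNIV rho"
  by (intro continuous_at_imp_continuous_on ballI has_derivative_continuous[OF rho(1)])
 have [measurable]: "rho \<in> borel_measurable borel" "Drho \<in> borel_measurable borel"
  by (intro borel_measurable_continuous_onI rhoc rho(2))+
 have Crho: "Crho \<ge> 0" using rho(4)[of 0] by linarith
 have CP: "CP \<ge> 0" using bd(1)[of "(0,1)"] by simp
 define D2 where "D2 x = (2 * rho x) *\<^sub>R Drho x" for x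
 have rho2: "((\<lambda>x. (rho x)^2) has_derivative (\<lambda>h. D2 x \<bullet> h)) (at x)" for x
  unfolding power2_eq_square D2_def using has_derivative_mult[OF rho(1)[of x] rho(1)[of x]]
  by (simp add: algebra_simps)
 have rho2c: "continuous_on UNIV D2" unfolding D2_def by (intro continuous_intros rhoc rho(2))
 define Deta where "Deta z = ((rho (fst z))^2 * P' (w z)) *\<^sub>R Dw z + P (w z) *\<^sub>R (D2 (fst z), 0)" for z
 have C1eta: "C1_strip (\<lambda>z. (rho (fst z))^2 * P (w z)) Deta"
  unfolding Deta_def by (rule C1_strip_compose[OF C1 rho2 rho2c P wI m(1,2)])
 note [measurable] = C1_stripD(4)[OF C1eta]
 have sqrho: "(rho x)^2 \<le> Crho^2" for x using rho(4)[of x] Crho by (metis abs_ge_zero power2_abs power_mono)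
 have Db: "norm (Deta z) \<le> Crho^2 * CP * Bd + CP * (2 * Crho * Crho)" if z: "snd z > 0" for z
 proof -
  have "norm (Deta z) \<le> norm (((rho (fst z))^2 * P' (w z)) *\<^sub>R Dw z) + norm (P (w z) *\<^sub>R (D2 (fst z), 0 :: real))"
   unfolding Deta_def by (rule norm_triangle_ineq)
  also have "norm (((rho (fst z))^2 * P' (w z)) *\<^sub>R Dw z) = (rho (fst z))^2 * \<bar>P' (w z)\<bar> * norm (Dw z)" by (simp add: abs_mult)
  also have "... \<le> Crho^2 * CP * Bd"
   using sqrho bd(2)[OF z] bound(2)[OF z] CP by (intro mult_mono) auto
  also have "norm (P (w z) *\<^sub>R (D2 (fst z), 0 :: real)) = \<bar>P (w z)\<bar> * (2 * \<bar>rho (fst z)\<bar> * norm (Drho (fst z)))"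
   by (simp add: D2_def abs_mult del: scaleR_Pair)
  also have "... \<le> CP * (2 * Crho * Crho)"
   using bd(1)[OF z] rho(4,5)[of "fst z"] Crho CP by (intro mult_mono) auto
  finally show ?thesis by simp
 qed
 have weak0: "(LINT z|strip. J z \<bullet> Deta z) = 0"
 proof (rule weak[OF C1eta])
  fix z :: "'a \<times> real" assume z: "snd z > 0"
  show "(rho (fst z))^2 * P (w z) = 0 \<and> Deta z = 0" if "norm (fst z) \<ge> R"
   using rho(3)[OF that] by (simp add: Deta_def D2_def zero_prod_def)
  have "\<bar>(rho (fst z))^2 * P (w z)\<bar> \<le> Crho^2 * CP"
   unfolding abs_mult using sqrho bd(1)[OF z] by (intro mult_mono) auto
  thus "\<bar>(rho (fst z))^2 * P (w z)\<bar> \<le> Crho^2 * CP + (Crho^2 * CP * Bd + CP * (2 * Crho * Crho)) \<and>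
    norm (Deta z) \<le> Crho^2 * CP + (Crho^2 * CP * Bd + CP * (2 * Crho * Crho))"
   using Db[OF z] Crho CP Bd by (smt (verit) mult_nonneg_nonneg zero_le_power2)
 qed
 define a where "a z = (rho (fst z))^2 * P' (w z) * (norm (Dw z))^2" for z
 define b where "b z = \<Theta> (w z) * (norm (Drho (fst z)))^2" for z
 have [measurable]: "a \<in> borel_measurable borel" "b \<in> borel_measurable borel" unfolding a_def b_def by measurable
 have a0: "a z \<ge> 0" "b z \<ge> 0" if "snd z > 0" for z using PP(1,2)[OF wI[OF that]] by (auto simp: a_def b_def)
 have ia: "integrable strip a"
 proof (rule integrable_strip[OF _ _ _ R, of _ "Crho^2 * CP * Bd^2"])
  fix z :: "'a \<times> real" assume z: "snd z > 0"
  have "(norm (Dw z))^2 \<le> Bd^2" using bound(2)[OF z] by (intro power_mono) auto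
  thus "\<bar>a z\<bar> \<le> Crho^2 * CP * Bd^2" unfolding a_def abs_mult
   using sqrho bd(2)[OF z] CP by (intro mult_mono) auto
  show "a z = 0" if "norm (fst z) \<ge> R" using rho(3)[OF that] by (simp add: a_def)
 qed simp
 have ib: "integrable strip b"
 proof (rule integrable_strip[OF _ _ _ R, of _ "CP * Crho^2"])
  fix z :: "'a \<times> real" assume z: "snd z > 0"
  have "(norm (Drho (fst z)))^2 \<le> Crho^2" using rho(5) by (intro power_mono) auto
  thus "\<bar>b z\<bar> \<le> CP * Crho^2" unfolding b_def abs_mult
   using bd(3)[OF z] CP by (intro mult_mono) auto
  show "b z = 0" if "norm (fst z) \<ge> R" using rho(3)[OF that] by (simp add: b_def)
 qed simp
 have it: "integrable strip (\<lambda>z. J z \<bullet> Deta z)"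
 proof (rule integrable_strip[OF _ _ _ R, of _ "(Lam * Bd) * (Crho^2 * CP * Bd + CP * (2 * Crho * Crho))"])
  fix z :: "'a \<times> real" assume z: "snd z > 0"
  have "\<bar>J z \<bullet> Deta z\<bar> \<le> norm (J z) * norm (Deta z)" by (rule Cauchy_Schwarz_ineq2)
  also have "... \<le> (Lam * Bd) * (Crho^2 * CP * Bd + CP * (2 * Crho * Crho))"
  proof (intro mult_mono Db[OF z])
   show "norm (J z) \<le> Lam * Bd" using ell(2)[OF z] bound(2)[OF z] Lam by (meson mult_left_mono order_trans)
  qed (use Lam Bd in auto)
  finally show "\<bar>J z \<bullet> Deta z\<bar> \<le> (Lam * Bd) * (Crho^2 * CP * Bd + CP * (2 * Crho * Crho))" .
  show "J z \<bullet> Deta z = 0" if "norm (fst z) \<ge> R" using rho(3)[OF that] by (simp add: Deta_def D2_def zero_prod_def[symmetric])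
 qed measurable
 have pw: "lam / 2 * a z \<le> J z \<bullet> Deta z + 2 * Lam^2 / lam * b z" if z: "snd z > 0" for z
 proof -
  define r where "r = rho (fst z)"
  define X where "X = norm (Dw z)"
  define Y where "Y = norm (Drho (fst z))"
  define pp where "pp = P' (w z)"
  note PPz = PP[OF wI[OF z]]
  have "J z \<bullet> Deta z = r^2 * pp * (J z \<bullet> Dw z) + 2 * r * P (w z) * (J z \<bullet> (Drho (fst z), 0))"
   by (simp add: Deta_def D2_def r_def pp_def inner_add_right inner_prod_def algebra_simps)
  moreover have "r^2 * pp * (J z \<bullet> Dw z) \<ge> r^2 * pp * (lam * X^2)"
   using ell(1)[OF z] PPz by (intro mult_left_mono) (auto simp: X_def pp_def)
  moreover have "\<bar>2 * r * P (w z) * (J z \<bullet> (Drho (fst z), 0))\<bar> \<le> lam / 2 * (r^2 * pp * X^2) + 2 * Lam^2 / lam * b z"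
  proof -
   have "\<bar>J z \<bullet> (Drho (fst z), 0)\<bar> \<le> norm (J z) * norm (Drho (fst z), 0 :: real)" by (rule Cauchy_Schwarz_ineq2)
   also have "... \<le> Lam * X * Y" using ell(2)[OF z] by (simp add: X_def Y_def mult_right_mono)
   finally have 1: "\<bar>J z \<bullet> (Drho (fst z), 0)\<bar> \<le> Lam * X * Y" .
   \<comment> \<open>Young's inequality in squared form: the square of the cross term is at most
     \<open>4 * U * V \<le> (U + V)^2\<close>. Here \<open>U\<close> is half of the coercive term
     and \<open>V\<close> goes to the right-hand side.\<close>
   define U where "U = lam / 2 * (r^2 * pp * X^2)"
   define V where "V = 2 * Lam^2 / lam * b z"
   have UV: "U \<ge> 0" "V \<ge> 0" using lam PPz a0[OF z] by (auto simp: U_def V_def pp_def)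
   have "(2 * r * P (w z) * (J z \<bullet> (Drho (fst z), 0)))^2 \<le> (2 * r * P (w z) * (Lam * X * Y))^2"
    unfolding power_mult_distrib[of "2 * r * P (w z)"] using 1
    by (intro mult_left_mono) (metis abs_le_square_iff abs_of_nonneg abs_ge_zero order_trans abs_ge_self, simp)
   also have "... = 4 * Lam^2 * r^2 * X^2 * Y^2 * (P (w z))^2" by (simp add: power_mult_distrib)
   also have "... \<le> 4 * Lam^2 * r^2 * X^2 * Y^2 * (\<Theta> (w z) * pp)"
    using PPz by (intro mult_left_mono) (auto simp: pp_def)
   also have "... = 4 * U * V" using lam by (simp add: U_def V_def b_def Y_def power2_eq_square field_simps)
   also have "... \<le> (U + V)^2"
   proof -
    have "0 \<le> (U - V)^2" by simp
    thus ?thesis by (simp add: power2_eq_square algebra_simps)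
   qed
   finally have "\<bar>2 * r * P (w z) * (J z \<bullet> (Drho (fst z), 0))\<bar> \<le> \<bar>U + V\<bar>" by (simp only: abs_le_square_iff)
   thus ?thesis using UV by (simp add: U_def V_def)
  qed
  moreover have az: "a z = r^2 * pp * X^2" by (simp add: a_def r_def pp_def X_def)
  moreover have "H \<le> T + V" if "T = B + E" "C \<le> B" "\<bar>E\<bar> \<le> H + V" "C = H + H" for T B C E H V :: real
   using that by linarith
  moreover have "r^2 * pp * (lam * X^2) = lam / 2 * (r^2 * pp * X^2) + lam / 2 * (r^2 * pp * X^2)" by (simp add: field_simps)
  ultimately show ?thesis unfolding az by blast
 qed
 have "(LINT z|strip. lam / 2 * a z) \<le> (LINT z|strip. J z \<bullet> Deta z + 2 * Lam^2 / lam * b z)"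
  by (rule integral_mono_AE) (use ia ib it AE_strip pw in \<open>auto elim!: eventually_mono\<close>)
 also have "... = 2 * Lam^2 / lam * (LINT z|strip. b z)"
  using it ib weak0 by (subst Bochner_Integration.integral_add) auto
 finally have "lam / 2 * (LINT z|strip. a z) \<le> 2 * Lam^2 / lam * (LINT z|strip. b z)" by simp
 hence le: "(LINT z|strip. a z) \<le> 4 * Lam^2 / lam^2 * (LINT z|strip. b z)"
  using lam by (simp add: field_simps power2_eq_square)
 have ea: "(\<integral>\<^sup>+z. ennreal (a z) \<partial>strip) = ennreal (LINT z|strip. a z)"
  by (rule nn_integral_eq_integral[OF ia]) (use AE_strip a0 in \<open>auto elim!: eventually_mono\<close>)
 have eb: "(\<integral>\<^sup>+z. ennreal (b z) \<partial>strip) = ennreal (LINT z|strip. b z)"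
  by (rule nn_integral_eq_integral[OF ib]) (use AE_strip a0 in \<open>auto elim!: eventually_mono\<close>)
 have "ennreal (LINT z|strip. a z) \<le> ennreal (4 * Lam^2 / lam^2) * ennreal (LINT z|strip. b z)"
  using le by (subst ennreal_mult'[symmetric]) (auto intro: ennreal_leI)
 thus ?thesis using ea eb by (simp add: a_def b_def)
qed

end

section \<open>De Giorgi's iteration\<close>

lemma power_bracket:
 fixes x :: real assumes "x \<ge> 1"
 shows "\<exists>n. 16 ^ n \<le> x \<and> x < 16 ^ Suc n"
proof -
 define n where "n = (LEAST n. x < 16 ^ Suc n)"
 obtain m where "x < 16 ^ m" using real_arch_pow[of 16 x] by auto
 also have "(16::real) ^ m \<le> 16 ^ Suc m" by simp
 finally have "x < 16 ^ Suc n" unfolding n_def by (rule LeastI)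
 moreover have "16 ^ n \<le> x"
 proof (cases n)
  case (Suc k)
  hence "k < (LEAST n. x < 16 ^ Suc n)" by (simp add: n_def)
  hence "\<not> x < 16 ^ Suc k" by (rule not_less_Least)
  thus ?thesis using Suc by simp
 qed (use assms in simp)
 ultimately show ?thesis by blast
qed

context strip_solution begin

text \<open>The fourth power appears because the Faber-Krahn inequality is applied to the square of
  the positive part, which is continuously differentiable, in contrast to the positive part
  itself.\<close>

definition excess :: "real \<Rightarrow> real \<Rightarrow> ennreal" where
 "excess k S = (\<integral>\<^sup>+z. indicator (ball 0 S) (fst z) * ennreal ((max 0 (w z - k)) ^ 4) \<partial>strip)"

lemma w_measurable [measurable]: "w \<in> borel_measurable borel" "Dw \<in> borel_measurable borel"
 using C1_stripD(3,4)[OF C1] .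

abbreviation over :: "real \<Rightarrow> real \<Rightarrow> ('a \<times> real) set" where
 "over R k \<equiv> {z. norm (fst z) < R \<and> w z > k}"
abbreviation under :: "real \<Rightarrow> real \<Rightarrow> ('a \<times> real) set" where
 "under R k \<equiv> {z. norm (fst z) < R \<and> w z \<le> k}"

lemma superlevel_measurable: "over R k \<in> sets borel"
proof -
 have "over R k = {z. norm (fst z) < R} \<inter> {z \<in> space borel. w z > k}" by auto
 also have "... \<in> sets borel" by (intro sets.Int cylinder_measurable) measurable
 finally show ?thesis .
qed

text \<open>960 is \<open>20 * 3 * 16\<close>: the constant of the Faber-Krahn inequality, the
  gradient of the truncated square, and the squared gradient of the cutoff.\<close>

definition Cst :: real where "Cst = 960 * (4 * Lam^2 / lam^2 + 2)"

lemma Cst: "Cst \<ge> 1" unfolding Cst_def by (simp add: add_increasing)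

text \<open>Caccioppoli's inequality for the test function \<open>\<rho>\<^sup>2 (w - k')\<^sub>+\<^sup>3\<close> and the Faber--Krahn inequality for
  \<open>\<rho> (w - k')\<^sub>+\<^sup>2\<close>.\<close>
lemma energy_step:
 assumes sS: "0 < s" "s < S" and kk: "k < k'" and l: "l \<ge> 1"
  and small: "2 * excess k S \<le> ennreal ((k' - k) ^ 4) * emeasure lborel (ball (0 :: 'a) l)"
 shows "excess k' s \<le> ennreal (Cst * l^2 * (S ^ 6 / (S^2 - s^2) ^ 4)) * excess k S"
proof -
 let ?B = "\<bar>Bd\<bar> + \<bar>k'\<bar>" and ?p = "\<lambda>y. max 0 (y - k')"
 let ?C = "?B ^ 3 + 3 * ?B ^ 2 + ?B ^ 4" and ?T = "\<lambda>z. (cutoff s S (fst z))^2 * (real 3 * ?p (w z) ^ (3 - 1)) * (norm (Dw z))^2"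
 note cp = cutoff_props[OF sS]
 define q where "q = S^2 - s^2"
 have "s^2 < S^2" using sS by (intro power_strict_mono) auto
 hence q: "q > 0" by (simp add: q_def)
 have rc: "continuous_on UNIV (cutoff s S :: 'a \<Rightarrow> real)"
  by (intro continuous_at_imp_continuous_on ballI has_derivative_continuous[OF cp(1)])
 have [measurable]: "(cutoff s S :: 'a \<Rightarrow> real) \<in> borel_measurable borel" "(Dcutoff s S :: 'a \<Rightarrow> 'a) \<in> borel_measurable borel"
  by (intro borel_measurable_continuous_onI rc cp(2))+
 define m where "m z = ?p (w z)" for z
 have [measurable]: "m \<in> borel_measurable borel" unfolding m_def by measurable
 have der: "((\<lambda>y. ?p y ^ n) has_real_derivative (real n * ?p y ^ (n - 1))) (at y)" if "n \<ge> 2" for n y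
 proof -
  have "((\<lambda>y. y - k') has_real_derivative 1) (at y)" by (auto intro!: derivative_eq_intros)
  from DERIV_chain2[where f="\<lambda>y. max 0 y ^ n" and g="\<lambda>y. y - k'", OF deriv_max_power[OF that] this]
  show ?thesis by simp
 qed
 define f where "f z = cutoff s S (fst z) * ?p (w z) ^ 2" for z
 define Df where "Df z = (cutoff s S (fst z) * (real 2 * ?p (w z) ^ (2 - 1))) *\<^sub>R Dw z + (?p (w z) ^ 2) *\<^sub>R (Dcutoff s S (fst z), 0)" for z
 have C1f: "C1_strip f Df" unfolding f_def Df_def
  by (rule C1_strip_compose[where I=UNIV, OF C1 cp(1,2) der]) (auto intro!: continuous_intros)
 define A where "A = {z. norm (fst z) < S \<and> w z > k'}"
 have Am: "A \<in> sets borel" unfolding A_def by (rule superlevel_measurable)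
 have fA: "f z = 0" if "z \<notin> A" for z using that cp(5)[of "fst z"] by (auto simp: A_def f_def not_less)
 \<comment> \<open>Chebyshev's inequality: a small excess at the lower level \<open>k\<close> makes
   the support of \<open>f\<close> small, as the Faber-Krahn inequality demands.\<close>
 have cheb: "ennreal ((k' - k) ^ 4) * emeasure strip A \<le> excess k S"
 proof -
  have "ennreal ((k' - k) ^ 4) * emeasure strip A = (\<integral>\<^sup>+z. ennreal ((k' - k) ^ 4) * indicator A z \<partial>strip)"
   using Am by (subst nn_integral_cmult_indicator) auto
  also have "... \<le> excess k S" unfolding excess_def
  proof (rule nn_integral_mono)
   fix z :: "'a \<times> real"
   show "ennreal ((k' - k) ^ 4) * indicator A z \<le> indicator (ball 0 S) (fst z) * ennreal ((max 0 (w z - k)) ^ 4)"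
   proof (cases "z \<in> A")
    case True
    hence "(k' - k) ^ 4 \<le> (max 0 (w z - k)) ^ 4" using kk by (intro power_mono) (auto simp: A_def)
    thus ?thesis using True by (auto simp: A_def intro: ennreal_leI)
   qed simp
  qed
  finally show ?thesis .
 qed
 have "ennreal ((k' - k) ^ 4) * (2 * emeasure strip A) \<le> ennreal ((k' - k) ^ 4) * emeasure lborel (ball (0 :: 'a) l)"
 proof -
  have "ennreal ((k' - k) ^ 4) * (2 * emeasure strip A) = 2 * (ennreal ((k' - k) ^ 4) * emeasure strip A)" by (simp add: mult.left_commute)
  also have "... \<le> 2 * excess k S" using cheb by (intro mult_left_mono) auto
  finally show ?thesis using small by simp
 qed
 hence smallA: "2 * emeasure strip A \<le> emeasure lborel (ball (0 :: 'a) l)"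
  using kk by (subst (asm) ennreal_mult_le_mult_iff) auto
 define B where "B = (\<integral>\<^sup>+z. ennreal (m z ^ 4 * (norm (Dcutoff s S (fst z)))^2) \<partial>strip)"
 have cac: "(\<integral>\<^sup>+z. ennreal (?T z) \<partial>strip)
  \<le> ennreal (4 * Lam^2 / lam^2) * (\<integral>\<^sup>+z. ennreal (?p (w z) ^ 4 / 3 * (norm (Dcutoff s S (fst z)))^2) \<partial>strip)"
 proof (rule caccioppoli[where I=UNIV and R=S and P="\<lambda>y. ?p y ^ 3" and P'="\<lambda>y. real 3 * ?p y ^ (3 - 1)"
    and \<Theta>="\<lambda>y. ?p y ^ 4 / 3" and Crho="(S^2 / q)^2 + 4 * S ^ 3 / q^2"
    and CP="?C"])
  show "(cutoff s S has_derivative (\<lambda>h. Dcutoff s S x \<bullet> h)) (at x)" for x :: 'a by (rule cp(1))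
  show "continuous_on UNIV (Dcutoff s S :: 'a \<Rightarrow> 'a)" by (rule cp(2))
  show "norm x \<ge> S \<Longrightarrow> cutoff s S x = 0 \<and> Dcutoff s S x = 0" for x :: 'a using cp(5,6) by auto
  show "\<bar>cutoff s S x\<bar> \<le> (S^2 / q)^2 + 4 * S ^ 3 / q^2" for x :: 'a
   using cp(4)[of x] cp(8)[of x] sS unfolding q_def[symmetric] by (simp add: add_increasing2)
  show "norm (Dcutoff s S x) \<le> (S^2 / q)^2 + 4 * S ^ 3 / q^2" for x :: 'a
   using cp(7)[of x] unfolding q_def[symmetric] by (simp add: add_increasing)
  show "S \<ge> 0" using sS by simp
  show "((\<lambda>y. ?p y ^ 3) has_real_derivative (real 3 * ?p y ^ (3 - 1))) (at y)" for y by (rule der) simp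
  fix y :: real
  have "?p y ^ 4 * ?p y ^ 2 = (?p y ^ 3)^2" by (simp only: power_add[symmetric] power_mult[symmetric]) simp
  thus "(?p y ^ 3)^2 \<le> ?p y ^ 4 / 3 * (real 3 * ?p y ^ (3 - 1))" by simp
 next
  fix z :: "'a \<times> real" assume z: "snd z > 0"
  have mb: "?p (w z) \<le> \<bar>Bd\<bar> + \<bar>k'\<bar>" using bound(1)[OF z] by auto
  have pb: "?p (w z) ^ n \<le> ?B ^ n" for n using mb by (intro power_mono) auto
  have nn: "?B ^ n \<ge> 0" for n by simp
  have zp: "?p (w z) ^ n \<ge> 0" for n by simp
  show "\<bar>?p (w z) ^ 3\<bar> \<le> ?C"
   using pb[of 3] nn[of 2] nn[of 4] zp[of 3] by linarith
  show "\<bar>real 3 * ?p (w z) ^ (3 - 1)\<bar> \<le> ?C"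
  proof -
   have "real 3 * ?p (w z) ^ (3 - 1) = 3 * ?p (w z) ^ 2" by simp
   thus ?thesis using pb[of 2] nn[of 3] nn[of 4] zp[of 2] by linarith
  qed
  show "\<bar>?p (w z) ^ 4 / 3\<bar> \<le> ?C"
   using pb[of 4] nn[of 3] nn[of 2] nn[of 4] zp[of 4] by linarith
 qed (auto intro!: continuous_intros)
 have "(\<integral>\<^sup>+z. ennreal ((norm (Df z))^2) \<partial>strip) \<le> (\<integral>\<^sup>+z. ennreal (8 / 3) * ennreal (?T z)
    + 2 * ennreal (m z ^ 4 * (norm (Dcutoff s S (fst z)))^2) \<partial>strip)"
 proof (rule nn_integral_mono)
  fix z :: "'a \<times> real"
  define X where "X = (cutoff s S (fst z) * (real 2 * ?p (w z) ^ (2 - 1))) *\<^sub>R Dw z"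
  define Y where "Y = (?p (w z) ^ 2) *\<^sub>R (Dcutoff s S (fst z), 0 :: real)"
  \<comment> \<open>Twice this square has the factor 8, whereas the Caccioppoli integrand carries
    the derivative \<open>3 * (m z)^2\<close> of the cube; hence the ratio
    \<open>8 / 3\<close>.\<close>
  have nX: "(norm X)^2 = 4 * ((cutoff s S (fst z))^2 * (m z)^2 * (norm (Dw z))^2)"
   by (simp add: X_def m_def power_mult_distrib)
  have nY: "(norm Y)^2 = m z ^ 4 * (norm (Dcutoff s S (fst z)))^2"
   by (simp add: Y_def m_def power_mult_distrib power_mult[symmetric] del: scaleR_Pair)
  have "norm (Df z) \<le> norm X + norm Y" unfolding Df_def X_def[symmetric] Y_def[symmetric] by (rule norm_triangle_ineq)
  hence "(norm (Df z))^2 \<le> (norm X + norm Y)^2" by (intro power_mono) auto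
  also have "... \<le> 2 * (norm X)^2 + 2 * (norm Y)^2"
  proof -
   have "0 \<le> (norm X - norm Y)^2" by simp
   thus ?thesis by (simp add: power2_eq_square algebra_simps)
  qed
  also have "... = 8 / 3 * (?T z) + 2 * (m z ^ 4 * (norm (Dcutoff s S (fst z)))^2)"
   unfolding nX nY by (simp add: m_def)
  finally have "ennreal ((norm (Df z))^2) \<le> ennreal (8 / 3 * (?T z) + 2 * (m z ^ 4 * (norm (Dcutoff s S (fst z)))^2))"
   by (rule ennreal_leI)
  also have "... = ennreal (8 / 3) * ennreal (?T z)
    + 2 * ennreal (m z ^ 4 * (norm (Dcutoff s S (fst z)))^2)"
  proof -
   have gen: "ennreal (8 / 3 * a + 2 * b) = ennreal (8 / 3) * ennreal a + 2 * ennreal b" if "a \<ge> 0" "b \<ge> 0" for a b :: real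
   proof -
    have "ennreal (8 / 3 * a + 2 * b) = ennreal (8 / 3 * a) + ennreal (2 * b)" by (rule ennreal_plus) (use that in auto)
    also have "ennreal (8 / 3 * a) = ennreal (8 / 3) * ennreal a" by (rule ennreal_mult) (use that in auto)
    also have "ennreal (2 * b) = 2 * ennreal b" using that by (simp add: ennreal_mult)
    finally show ?thesis .
   qed
   show ?thesis by (rule gen) auto
  qed
  finally show "ennreal ((norm (Df z))^2) \<le> ennreal (8 / 3) * ennreal (?T z)
    + 2 * ennreal (m z ^ 4 * (norm (Dcutoff s S (fst z)))^2)" .
 qed
 also have "... = ennreal (8 / 3) * (\<integral>\<^sup>+z. ennreal (?T z) \<partial>strip) + 2 * B"
  unfolding B_def by (subst nn_integral_add, measurable, subst nn_integral_cmult, measurable, subst nn_integral_cmult, measurable)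
 also have "... \<le> ennreal (8 / 3) * (ennreal (4 * Lam^2 / lam^2) * B) + 2 * B"
 proof (intro add_right_mono mult_left_mono order_trans[OF cac])
  show "(\<integral>\<^sup>+z. ennreal (?p (w z) ^ 4 / 3 * (norm (Dcutoff s S (fst z)))^2) \<partial>strip) \<le> B"
   unfolding B_def m_def
  proof (intro nn_integral_mono ennreal_leI mult_right_mono)
   fix z :: "'a \<times> real"
   have "?p (w z) ^ 4 \<ge> 0" by simp
   thus "?p (w z) ^ 4 / 3 \<le> ?p (w z) ^ 4" by linarith
  qed auto
 qed auto
 also have "... \<le> ennreal (3 * (4 * Lam^2 / lam^2 + 2)) * B"
 proof -
  have "ennreal (8 / 3) * (ennreal (4 * Lam^2 / lam^2) * B) + 2 * B = ennreal (8 / 3 * (4 * Lam^2 / lam^2) + 2) * B"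
  proof -
   have gen: "ennreal (8 / 3) * (ennreal a * B) + 2 * B = ennreal (8 / 3 * a + 2) * B" if "a \<ge> 0" for a
   proof -
    have "ennreal (8 / 3 * a + 2) = ennreal (8 / 3 * a) + ennreal 2" by (rule ennreal_plus) (use that in auto)
    also have "ennreal (8 / 3 * a) = ennreal (8 / 3) * ennreal a" by (rule ennreal_mult) (use that in auto)
    finally show ?thesis by (simp add: distrib_right mult.assoc)
   qed
   show ?thesis by (rule gen) simp
  qed
  also have "... \<le> ennreal (3 * (4 * Lam^2 / lam^2 + 2)) * B"
  proof (intro mult_right_mono ennreal_leI)
   have "4 * Lam^2 / lam^2 \<ge> 0" by simp
   thus "8 / 3 * (4 * Lam^2 / lam^2) + 2 \<le> 3 * (4 * Lam^2 / lam^2 + 2)" by argo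
  qed auto
  finally show ?thesis .
 qed
 finally have DfB: "(\<integral>\<^sup>+z. ennreal ((norm (Df z))^2) \<partial>strip) \<le> ennreal (3 * (4 * Lam^2 / lam^2 + 2)) * B" .
 have Bex: "B \<le> ennreal (16 * S ^ 6 / q ^ 4) * excess k S"
 proof -
  have "B \<le> (\<integral>\<^sup>+z. ennreal (16 * S ^ 6 / q ^ 4) * (indicator (ball 0 S) (fst z) * ennreal ((max 0 (w z - k)) ^ 4)) \<partial>strip)"
   unfolding B_def
  proof (rule nn_integral_mono)
   fix z :: "'a \<times> real"
   show "ennreal (m z ^ 4 * (norm (Dcutoff s S (fst z)))^2) \<le> ennreal (16 * S ^ 6 / q ^ 4) * (indicator (ball 0 S) (fst z) * ennreal ((max 0 (w z - k)) ^ 4))"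
   proof (cases "norm (fst z) < S")
    case True
    have "(norm (Dcutoff s S (fst z)))^2 \<le> (4 * S ^ 3 / q^2)^2"
     using cp(7)[of "fst z"] unfolding q_def[symmetric] by (intro power_mono) auto
    also have "... = 16 * S ^ 6 / q ^ 4" by (simp add: power_divide power_mult_distrib power_mult[symmetric])
    finally have 1: "(norm (Dcutoff s S (fst z)))^2 \<le> 16 * S ^ 6 / q ^ 4" .
    have "m z ^ 4 \<le> (max 0 (w z - k)) ^ 4" unfolding m_def using kk by (intro power_mono) auto
    hence "m z ^ 4 * (norm (Dcutoff s S (fst z)))^2 \<le> (max 0 (w z - k)) ^ 4 * (16 * S ^ 6 / q ^ 4)"
     using 1 by (intro mult_mono) auto
    thus ?thesis using True sS by (simp add: ennreal_mult[symmetric] mult.commute ennreal_leI)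
   next
    case False
    thus ?thesis using cp(6)[of "fst z"] by simp
   qed
  qed
  also have "... = ennreal (16 * S ^ 6 / q ^ 4) * excess k S" unfolding excess_def
  proof (rule nn_integral_cmult)
   have [measurable]: "ball (0::'a) S \<in> sets borel" by simp
   have "(\<lambda>z. indicator (ball 0 S) (fst z) * ennreal ((max 0 (w z - k)) ^ 4)) \<in> borel_measurable borel" by measurable
   thus "(\<lambda>z. indicator (ball 0 S) (fst z) * ennreal ((max 0 (w z - k)) ^ 4)) \<in> borel_measurable strip" by simp
  qed
  finally show ?thesis .
 qed
 have "excess k' s \<le> (\<integral>\<^sup>+z. ennreal ((f z)^2) \<partial>strip)" unfolding excess_def
 proof (rule nn_integral_mono)
  fix z :: "'a \<times> real"
  show "indicator (ball 0 s) (fst z) * ennreal ((?p (w z)) ^ 4) \<le> ennreal ((f z)^2)"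
  proof (cases "norm (fst z) < s")
   case True
   have "1^2 \<le> (cutoff s S (fst z))^2" using cp(3)[of "fst z"] True by (intro power_mono) auto
   hence "1 * ?p (w z) ^ 4 \<le> (cutoff s S (fst z))^2 * ?p (w z) ^ 4" by (intro mult_right_mono) auto
   thus ?thesis using True by (simp add: f_def power_mult_distrib power_mult[symmetric] ennreal_leI)
  qed simp
 qed
 also have "... \<le> ennreal (20 * l^2) * (\<integral>\<^sup>+z. ennreal ((norm (Df z))^2) \<partial>strip)"
  by (rule faber_krahn[OF C1f Am fA l smallA])
 also have "... \<le> ennreal (20 * l^2) * (ennreal (3 * (4 * Lam^2 / lam^2 + 2)) * (ennreal (16 * S ^ 6 / q ^ 4) * excess k S))"
  by (intro mult_left_mono order_trans[OF DfB] Bex) auto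
 also have "... = ennreal (Cst * l^2 * (S ^ 6 / q ^ 4)) * excess k S"
 proof -
  have "20 * a * (3 * b) * (16 * c / d) = 960 * b * a * (c / d)" for a b c d :: real by simp
  hence "20 * l^2 * (3 * (4 * Lam^2 / lam^2 + 2)) * (16 * S ^ 6 / q ^ 4) = Cst * l^2 * (S ^ 6 / q ^ 4)"
   unfolding Cst_def by metis
  moreover have "ennreal (20 * l^2) * (ennreal (3 * (4 * Lam^2 / lam^2 + 2)) * (ennreal (16 * S ^ 6 / q ^ 4) * excess k S))
   = ennreal (20 * l^2 * (3 * (4 * Lam^2 / lam^2 + 2)) * (16 * S ^ 6 / q ^ 4)) * excess k S"
   by (subst (1 2) ennreal_mult) (simp_all add: mult.assoc)
  ultimately show ?thesis by (simp only:)
 qed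
 finally show ?thesis unfolding q_def .
qed


lemma excess_mono:
 assumes "k \<le> k'" "s \<le> S" shows "excess k' s \<le> excess k S"
 unfolding excess_def
proof (rule nn_integral_mono)
 fix z :: "'a \<times> real"
 have "max 0 (w z - k') ^ 4 \<le> max 0 (w z - k) ^ 4" using assms by (intro power_mono) auto
 thus "indicator (ball 0 s) (fst z) * ennreal (max 0 (w z - k') ^ 4) \<le> indicator (ball 0 S) (fst z) * ennreal (max 0 (w z - k) ^ 4)"
  using assms by (auto simp: indicator_def intro: ennreal_leI)
qed

text \<open>From almost everywhere to everywhere: by continuity of \<open>w\<close> the superlevel
  set in \<open>t > 0\<close> is open, and a nonempty open set is not negligible.\<close>

lemma excess_zero:
 assumes ex: "\<And>R. R > 0 \<Longrightarrow> excess k R = 0" and z: "snd z > 0" shows "w z \<le> k"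
proof (rule ccontr)
 assume wz: "\<not> w z \<le> k"
 define R where "R = norm (fst z) + 1"
 have R: "R > 0" by (simp add: R_def add_nonneg_pos)
 define U where "U = {y. snd y > 0 \<and> norm (fst y) < R} \<inter> {y. snd y > 0 \<and> w y > k}"
 have "continuous_on {y. snd y > 0} w"
  by (intro continuous_at_imp_continuous_on ballI) (auto intro!: has_derivative_continuous[OF C1_stripD(1)[OF C1]])
 moreover have op: "open {y :: 'a \<times> real. snd y > 0}" by (intro open_Collect_less continuous_intros)
 ultimately have "open (w -` {k<..} \<inter> {y. snd y > 0})" by (intro continuous_on_open_vimage[THEN iffD1, rule_format]) auto
 moreover have "w -` {k<..} \<inter> {y. snd y > 0} = {y. snd y > 0 \<and> w y > k}" by auto
 moreover have "open {y :: 'a \<times> real. snd y > 0 \<and> norm (fst y) < R}" by (intro open_Collect_conj open_Collect_less continuous_intros)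
 ultimately have U: "open U" unfolding U_def by (intro open_Int) auto
 have zU: "z \<in> U" using z wz by (simp add: U_def R_def)
 have [measurable]: "ball (0::'a) R \<in> sets borel" by simp
 have "(\<lambda>z. indicator (ball 0 R) (fst z) * ennreal (max 0 (w z - k) ^ 4)) \<in> borel_measurable borel" by measurable
 hence m: "(\<lambda>z. indicator (ball 0 R) (fst z) * ennreal (max 0 (w z - k) ^ 4)) \<in> borel_measurable strip" by simp
 have "AE z in strip. indicator (ball 0 R) (fst z) * ennreal (max 0 (w z - k) ^ 4) = 0"
  using ex[OF R] unfolding excess_def by (subst (asm) nn_integral_0_iff_AE[OF m])
 hence "AE y in strip. y \<notin> U"
  by eventually_elim (auto simp: U_def ennreal_eq_0_iff)
 hence "AE y in lborel. expw (snd y) > 0 \<longrightarrow> y \<notin> U"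
  unfolding strip_def by (subst (asm) AE_density) auto
 hence "AE y in lborel. y \<notin> U"
  by eventually_elim (auto simp: U_def expw_def)
 hence "U \<in> null_sets lborel" using U by (subst (asm) AE_iff_null_sets[symmetric]) auto
 hence "negligible U" using negligible_iff_null_sets null_sets_completionI by blast
 thus False using open_not_negligible[OF U] zU by blast
qed

definition bv :: real where "bv = unit_ball_vol (real DIM('a))"

lemma bv: "bv > 0" unfolding bv_def by simp

lemma emeasure_ball_bv: "r \<ge> 0 \<Longrightarrow> emeasure lborel (ball (0 :: 'a) r) = ennreal (bv * r ^ DIM('a))"
 unfolding bv_def by (simp add: emeasure_ball)

text \<open>As \<open>a^2 - b^2 \<ge> (a - b) * a\<close>, the quotient is at most
  \<open>a^2 / (a - b) ^ 4\<close>, and consecutive radii differ by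
  \<open>R / 2 ^ (j + 2)\<close>.\<close>

lemma de_giorgi_ratio:
 fixes R :: real
 assumes R: "R > 0"
 defines "S \<equiv> \<lambda>j. R * (1 / 2 + (1 / 2) ^ Suc j)"
 shows "S j ^ 6 / ((S j)^2 - (S (Suc j))^2) ^ 4 \<le> 256 * 16 ^ j / R^2"
proof -
 define a where "a = S j" define b where "b = S (Suc j)"
 have ab: "a - b = R * (1 / 2) ^ Suc (Suc j)" by (simp add: a_def b_def S_def algebra_simps)
 have "a > 0" "b > 0" unfolding a_def b_def S_def using R by (auto intro!: mult_pos_pos add_pos_pos)
 have pj: "(1 / 2 :: real) ^ j \<le> 1" by (intro power_le_one) auto
 have aR: "a \<le> R"
 proof -
  have "1 / 2 + (1 / 2 :: real) ^ Suc j \<le> 1" using pj by simp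
  hence "R * (1 / 2 + (1 / 2) ^ Suc j) \<le> R * 1" using R by (intro mult_left_mono) auto
  thus ?thesis by (simp add: a_def S_def)
 qed
 have d: "a - b > 0" unfolding ab using R by simp
 have "a^2 - b^2 = (a - b) * (a + b)" by (simp add: power2_eq_square algebra_simps)
 moreover have "(a - b) * a \<le> (a - b) * (a + b)" using d \<open>b > 0\<close> by (intro mult_left_mono) auto
 ultimately have "((a - b) * a) ^ 4 \<le> (a^2 - b^2) ^ 4" using d \<open>a > 0\<close> by (intro power_mono) auto
 moreover have "b^2 < a^2" using d \<open>b > 0\<close> by (intro power_strict_mono) auto
 ultimately have "a ^ 6 / (a^2 - b^2) ^ 4 \<le> a ^ 6 / ((a - b) * a) ^ 4" using d \<open>a > 0\<close>
  by (intro divide_left_mono) (auto intro!: mult_pos_pos zero_less_power)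
 also have "... = a^2 / (a - b) ^ 4"
 proof -
  have "a ^ 6 / (x * a) ^ 4 = a^2 / x ^ 4" for x using \<open>a > 0\<close> by (simp add: power_mult_distrib eval_nat_numeral)
  thus ?thesis .
 qed
 also have "... \<le> R^2 / (a - b) ^ 4" using aR \<open>a > 0\<close> d by (intro divide_right_mono power_mono) auto
 also have "(a - b) ^ 4 = R ^ 4 / (256 * 16 ^ j)"
 proof -
  have "((1 / 2 :: real) ^ j) ^ 4 = 1 / 16 ^ j" by (simp add: power_divide power_mult[symmetric] mult.commute[of j 4]) (simp add: power_mult)
  have "(R * (1 / 2 * (1 / 2 * y))) ^ 4 = R ^ 4 * y ^ 4 / 256" for y
   by (simp add: power_mult_distrib power_divide)
  from this[of "(1 / 2) ^ j"] \<open>((1 / 2 :: real) ^ j) ^ 4 = 1 / 16 ^ j\<close>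
  show ?thesis unfolding ab power_Suc by (simp only:) simp
 qed
 also have "R^2 / (R ^ 4 / (256 * 16 ^ j)) = 256 * 16 ^ j / R^2" using R by (simp add: field_simps power_add[symmetric])
 finally show ?thesis by (simp add: a_def b_def)
qed

text \<open>The Faber--Krahn inequality needs a length \<open>l \<ge> 1\<close>, so the iteration has to stop after about
  \<open>log\<^sub>1\<^sub>6 R\<close> steps. The factor \<open>\<theta> = 16\<^sup>-\<^sup>N\<^sup>-\<^sup>1\<close> per step is chosen such that what is left then is of order
  \<open>1 / R\<close>, although the initial excess is of order \<open>R\<^sup>N\<close>.\<close>
lemma de_giorgi:
 "\<exists>nu>0. \<forall>k \<delta>. \<delta> > 0 \<longrightarrow> (\<forall>z. snd z > 0 \<longrightarrow> w z \<le> k + \<delta>) \<longrightarrow>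
   (\<forall>R0. \<exists>R\<ge>R0. emeasure strip (over R k) \<le> ennreal (nu * R ^ DIM('a))) \<longrightarrow>
   (\<forall>z. snd z > 0 \<longrightarrow> w z \<le> k + \<delta> / 2)"
proof -
 define N where "N = DIM('a)"
 define \<theta> :: real where "\<theta> = (1 / 16) ^ Suc N"
 have \<theta>: "\<theta> > 0" by (simp add: \<theta>_def)
 \<comment> \<open>Scale of the lengths \<open>l j\<close>: with
   \<open>256 * Cst * e^2 = \<theta>\<close> and the ratio of the radii estimated above, one
   application of \<open>energy_step\<close> multiplies the excess by at most
   \<open>\<theta>\<close>.\<close>
 define e where "e = sqrt (\<theta> / (256 * Cst))"
 have e: "e > 0" and e2: "256 * Cst * e^2 = \<theta>" using Cst \<theta> by (simp_all add: e_def)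
 \<comment> \<open>Makes the smallness condition of \<open>energy_step\<close> an equality for the
   inductive bound: 256 is the fourth power of the 4 in the level steps, and the remaining 2 is the
   factor in that condition.\<close>
 define nu where "nu = bv * e ^ N / 512"
 have nu: "nu > 0" using bv e by (simp add: nu_def)
 have "w z \<le> k + \<delta> / 2"
  if \<delta>: "\<delta> > 0" and wk: "\<And>z. snd z > 0 \<Longrightarrow> w z \<le> k + \<delta>"
   and meas: "\<And>R0. \<exists>R\<ge>R0. emeasure strip (over R k) \<le> ennreal (nu * R ^ N)"
   and z: "snd z > 0" for k \<delta> z
 proof -
  have main: "excess (k + \<delta> / 2) (R / 2) \<le> ennreal (\<delta> ^ 4 * nu / e ^ Suc N / R)"
   if R: "R > 0" "e * R \<ge> 1" and mR: "emeasure strip (over R k) \<le> ennreal (nu * R ^ N)" for R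
  proof -
   \<comment> \<open>Radii decrease from \<open>R\<close> towards \<open>R / 2\<close> and levels
     increase from \<open>k\<close> towards \<open>k + \<delta> / 2\<close>. With lengths shrinking
     by 16, the admissible excess loses a factor 16 through the level gap and \<open>16 ^ N\<close>
     through the ball; together this is exactly \<open>\<theta>\<close>.\<close>
   define S where "S j = R * (1 / 2 + (1 / 2) ^ Suc j)" for j
   define K where "K j = k + \<delta> / 2 - \<delta> / 2 * (1 / 2) ^ j" for j
   define l where "l j = e * R * (1 / 16) ^ j" for j
   \<comment> \<open>The last index with \<open>l n \<ge> 1\<close>, hence the last step in which
     the Faber-Krahn inequality may be used.\<close>
   obtain n where n: "16 ^ n \<le> e * R" "e * R < 16 ^ Suc n" using power_bracket[OF R(2)] by blast
   have claim: "excess (K j) (S j) \<le> ennreal (\<delta> ^ 4 * nu * R ^ N * \<theta> ^ j)" if "j \<le> Suc n" for j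
    using that
   proof (induction j)
    case 0
    have "excess (K 0) (S 0) = excess k R" by (simp add: K_def S_def)
    also have "... \<le> (\<integral>\<^sup>+z. ennreal (\<delta> ^ 4) * indicator (over R k) z \<partial>strip)"
     unfolding excess_def
    proof (rule nn_integral_mono_AE, use AE_strip in eventually_elim)
     fix z :: "'a \<times> real" assume "snd z > 0"
     hence "max 0 (w z - k) ^ 4 \<le> \<delta> ^ 4" using wk[of z] \<delta> by (intro power_mono) auto
     thus "indicator (ball 0 R) (fst z) * ennreal (max 0 (w z - k) ^ 4) \<le> ennreal (\<delta> ^ 4) * indicator (over R k) z"
      by (auto simp: indicator_def intro: ennreal_leI)
    qed
    also have "... = ennreal (\<delta> ^ 4) * emeasure strip (over R k)"
     using superlevel_measurable by (subst nn_integral_cmult_indicator) auto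
    also have "... \<le> ennreal (\<delta> ^ 4) * ennreal (nu * R ^ N)" using mR by (intro mult_left_mono) auto
    also have "... = ennreal (\<delta> ^ 4 * nu * R ^ N * \<theta> ^ 0)" using nu R by (simp add: ennreal_mult'[symmetric] mult.assoc)
    finally show ?case .
   next
    case (Suc j)
    hence IH: "excess (K j) (S j) \<le> ennreal (\<delta> ^ 4 * nu * R ^ N * \<theta> ^ j)" and jn: "j \<le> n" by auto
    have "(16::real) ^ j \<le> 16 ^ n" using jn by (intro power_increasing) auto
    hence "16 ^ j \<le> e * R" using n(1) by (rule order_trans)
    hence l1: "l j \<ge> 1" by (simp add: l_def power_divide)
    have Kd: "K (Suc j) - K j = \<delta> / 4 * (1 / 2) ^ j" by (simp add: K_def)
    have KK: "K j < K (Suc j)" using Kd \<delta> by (metis diff_gt_0_iff_gt divide_pos_pos mult_pos_pos zero_less_numeral zero_less_power zero_less_one)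
    have S0: "0 < S (Suc j)" unfolding S_def using R by (auto intro!: mult_pos_pos add_pos_pos)
    have SS: "S (Suc j) < S j" unfolding S_def using R by (intro mult_strict_left_mono) auto
    have pw: "((1 / 2) ^ j) ^ 4 * ((1 / 16) ^ j) ^ N = \<theta> ^ j"
    proof -
     have "((1 / 2 :: real) ^ j) ^ 4 = (1 / 16) ^ j" by (simp add: power_divide power_mult[symmetric] mult.commute[of j 4]) (simp add: power_mult)
     moreover have "\<theta> ^ j = ((1 / 16) ^ j) ^ Suc N" unfolding \<theta>_def by (simp only: power_mult[symmetric] mult.commute)
     ultimately show ?thesis by simp
    qed
    have sm: "2 * excess (K j) (S j) \<le> ennreal ((K (Suc j) - K j) ^ 4) * emeasure lborel (ball (0 :: 'a) (l j))"
    proof -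
     have "(K (Suc j) - K j) ^ 4 * (bv * l j ^ N) = \<delta> ^ 4 / 256 * (bv * (e ^ N * R ^ N)) * (((1 / 2) ^ j) ^ 4 * ((1 / 16) ^ j) ^ N)"
      unfolding Kd l_def by (simp only: power_mult_distrib power_divide) simp
     also have "... = 2 * (\<delta> ^ 4 * nu * R ^ N * \<theta> ^ j)" unfolding pw nu_def by simp
     finally have eq: "(K (Suc j) - K j) ^ 4 * (bv * l j ^ N) = 2 * (\<delta> ^ 4 * nu * R ^ N * \<theta> ^ j)" .
     have "2 * excess (K j) (S j) \<le> 2 * ennreal (\<delta> ^ 4 * nu * R ^ N * \<theta> ^ j)" using IH by (intro mult_left_mono) auto
     also have "... = ennreal (2 * (\<delta> ^ 4 * nu * R ^ N * \<theta> ^ j))"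
     proof -
      have "\<delta> ^ 4 * nu * R ^ N * \<theta> ^ j \<ge> 0" using nu R \<theta> by simp
      thus ?thesis by (simp add: ennreal_mult)
     qed
     also have "... = ennreal ((K (Suc j) - K j) ^ 4) * ennreal (bv * l j ^ N)"
      unfolding eq[symmetric] using bv l1 by (intro ennreal_mult) auto
     also have "ennreal (bv * l j ^ N) = emeasure lborel (ball (0 :: 'a) (l j))"
      using l1 unfolding N_def by (intro emeasure_ball_bv[symmetric]) auto
     finally show ?thesis .
    qed
    have fac: "Cst * (l j)^2 * (S j ^ 6 / ((S j)^2 - (S (Suc j))^2) ^ 4) \<le> \<theta>"
    proof -
     have "Cst * (l j)^2 * (S j ^ 6 / ((S j)^2 - (S (Suc j))^2) ^ 4) \<le> Cst * (l j)^2 * (256 * 16 ^ j / R^2)"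
      using de_giorgi_ratio[OF R(1), of j] Cst unfolding S_def by (intro mult_left_mono) auto
     also have "... = 256 * Cst * e^2 * ((1 / 16) ^ j * ((1 / 16) ^ j * 16 ^ j))"
      using R by (simp add: l_def power_mult_distrib power2_eq_square)
     also have "(1 / 16) ^ j * (16 :: real) ^ j = 1" by (simp add: power_mult_distrib[symmetric])
     also have "256 * Cst * e^2 * ((1 / 16) ^ j * 1) \<le> \<theta> * 1" unfolding e2 using \<theta> by (intro mult_left_mono) (auto intro!: power_le_one)
     finally show ?thesis by simp
    qed
    have "excess (K (Suc j)) (S (Suc j)) \<le> ennreal (Cst * (l j)^2 * (S j ^ 6 / ((S j)^2 - (S (Suc j))^2) ^ 4)) * excess (K j) (S j)"
     by (rule energy_step[OF S0 SS KK l1 sm])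
    also have "... \<le> ennreal \<theta> * ennreal (\<delta> ^ 4 * nu * R ^ N * \<theta> ^ j)"
     using IH fac by (intro mult_mono ennreal_leI) auto
    also have "... = ennreal (\<theta> * (\<delta> ^ 4 * nu * R ^ N * \<theta> ^ j))" using \<theta> by (intro ennreal_mult'[symmetric]) auto
    also have "\<theta> * (\<delta> ^ 4 * nu * R ^ N * \<theta> ^ j) = \<delta> ^ 4 * nu * R ^ N * \<theta> ^ Suc j" by simp
    finally show ?case .
   qed
   have "excess (k + \<delta> / 2) (R / 2) \<le> excess (K (Suc n)) (S (Suc n))"
    using \<delta> R by (intro excess_mono) (auto simp: K_def S_def algebra_simps)
   also have "... \<le> ennreal (\<delta> ^ 4 * nu * R ^ N * \<theta> ^ Suc n)" by (rule claim) simp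
   also have "... \<le> ennreal (\<delta> ^ 4 * nu / e ^ Suc N / R)"
   proof (rule ennreal_leI)
    \<comment> \<open>Since \<open>e * R < 16 ^ Suc n\<close>, the accumulated factor is at most
      \<open>(e * R)\<close> to the power \<open>- (N + 1)\<close>, one power of \<open>R\<close>
      better than the initial volume \<open>R ^ N\<close>.\<close>
    have "\<theta> ^ Suc n = 1 / (16 ^ Suc n) ^ Suc N"
     unfolding \<theta>_def by (simp only: power_mult[symmetric] mult.commute power_divide power_one)
    also have "... \<le> 1 / (e * R) ^ Suc N" using n(2) e R by (intro divide_left_mono power_mono mult_pos_pos zero_less_power) auto
    finally have "\<theta> ^ Suc n \<le> 1 / (e * R) ^ Suc N" .
    hence "\<delta> ^ 4 * nu * R ^ N * \<theta> ^ Suc n \<le> \<delta> ^ 4 * nu * R ^ N * (1 / (e * R) ^ Suc N)" using nu R by (intro mult_left_mono) auto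
    also have "... = \<delta> ^ 4 * nu / e ^ Suc N / R" using R e by (simp add: power_mult_distrib)
    finally show "\<delta> ^ 4 * nu * R ^ N * \<theta> ^ Suc n \<le> \<delta> ^ 4 * nu / e ^ Suc N / R" .
   qed
   finally show ?thesis .
  qed
  define C where "C = \<delta> ^ 4 * nu / e ^ Suc N"
  have C: "C > 0" using \<delta> nu e by (simp add: C_def)
  show ?thesis
  proof (rule excess_zero[OF _ z])
   fix r :: real assume r: "r > 0"
   have le: "excess (k + \<delta> / 2) r \<le> ennreal x" if x: "x > 0" for x
   proof -
    obtain R where R: "R \<ge> max (2 * r) (max (1 / e) (C / x))" and mR: "emeasure strip (over R k) \<le> ennreal (nu * R ^ N)"
     using meas by blast
    have R': "R > 0" "e * R \<ge> 1" "r \<le> R / 2" "C / R \<le> x"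
     using R r e x C by (auto simp: field_simps)
    have "excess (k + \<delta> / 2) r \<le> excess (k + \<delta> / 2) (R / 2)" using R' by (intro excess_mono) auto
    also have "... \<le> ennreal (C / R)" unfolding C_def by (rule main[OF R'(1,2) mR])
    also have "... \<le> ennreal x" by (rule ennreal_leI) fact
    finally show ?thesis .
   qed
   have "excess (k + \<delta> / 2) r \<le> 0"
   proof (rule ennreal_le_epsilon)
    fix x :: real assume "x > 0"
    from le[OF this] show "excess (k + \<delta> / 2) r \<le> 0 + ennreal x" by (simp only: add_0)
   qed
   thus "excess (k + \<delta> / 2) r = 0" by simp
  qed
 qed
 thus ?thesis using nu unfolding N_def by (intro exI[of _ nu]) blast
qed


section \<open>Logarithmic estimate and improvement of the supremum\<close>

lemma sublevel_measurable: "under R k \<in> sets borel"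
proof -
 have "under R k = {z. norm (fst z) < R} - over R k" by auto
 also have "... \<in> sets borel" by (intro sets.Diff superlevel_measurable cylinder_measurable)
 finally show ?thesis .
qed

text \<open>Caccioppoli's inequality with \<open>P y = 1 / (M + \<delta> - y)\<close>. Because
  \<open>P' = P^2\<close>, the right-hand side is the energy of the cutoff alone, volume over
  \<open>R^2\<close>, and \<open>\<delta>\<close> disappears.\<close>

lemma log_energy:
 assumes wM: "\<And>z. snd z > 0 \<Longrightarrow> w z \<le> M" and \<delta>: "\<delta> > 0" and R: "R > 0"
 shows "(\<integral>\<^sup>+z. indicator (ball 0 R) (fst z) * ennreal ((norm ((1 / (M + \<delta> - w z)) *\<^sub>R Dw z))^2) \<partial>strip)
  \<le> ennreal (4 * Lam^2 / lam^2 * (16 * (bv * 2 ^ DIM('a) * R ^ DIM('a)) / R^2))"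
proof -
 have s: "0 < R" "R < 2 * R" using R by auto
 note cp = cutoff_props[OF s]
 have sd: "(2 * R)^2 - R^2 = 3 * R^2" by (simp add: power2_eq_square)
 have Db: "norm (Dcutoff R (2 * R) x) \<le> 4 / R" for x :: 'a
 proof -
  have "norm (Dcutoff R (2 * R) x) \<le> 4 * (2 * R) ^ 3 / (3 * R^2)^2" using cp(7)[of x] unfolding sd .
  also have "... = 32 / 9 / R" using R by (simp add: field_simps eval_nat_numeral)
  also have "... \<le> 4 / R" using R by (intro divide_right_mono) auto
  finally show ?thesis .
 qed
 have cb: "cutoff R (2 * R) x \<le> 16 / 9" for x :: 'a
 proof -
  have "cutoff R (2 * R) x \<le> ((2 * R)^2 / (3 * R^2))^2" using cp(8)[of x] unfolding sd .
  also have "(2 * R)^2 / (3 * R^2) = 4 / 3" using R by (simp add: power2_eq_square)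
  finally show ?thesis by (simp add: power2_eq_square)
 qed
 have rc: "continuous_on UNIV (cutoff R (2 * R) :: 'a \<Rightarrow> real)"
  by (intro continuous_at_imp_continuous_on ballI has_derivative_continuous[OF cp(1)])
 have [measurable]: "(cutoff R (2 * R) :: 'a \<Rightarrow> real) \<in> borel_measurable borel" "(Dcutoff R (2 * R) :: 'a \<Rightarrow> 'a) \<in> borel_measurable borel"
  by (intro borel_measurable_continuous_onI rc cp(2))+
 have gap: "M + \<delta> - w z \<ge> \<delta>" if "snd z > 0" for z using wM[OF that] by simp
 have "(\<integral>\<^sup>+z. indicator (ball 0 R) (fst z) * ennreal ((norm ((1 / (M + \<delta> - w z)) *\<^sub>R Dw z))^2) \<partial>strip)
  \<le> (\<integral>\<^sup>+z. ennreal ((cutoff R (2 * R) (fst z))^2 * (1 / (M + \<delta> - w z)^2) * (norm (Dw z))^2) \<partial>strip)"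
 proof (rule nn_integral_mono)
  fix z :: "'a \<times> real"
  show "indicator (ball 0 R) (fst z) * ennreal ((norm ((1 / (M + \<delta> - w z)) *\<^sub>R Dw z))^2)
   \<le> ennreal ((cutoff R (2 * R) (fst z))^2 * (1 / (M + \<delta> - w z)^2) * (norm (Dw z))^2)"
  proof (cases "norm (fst z) < R")
   case True
   have "1^2 \<le> (cutoff R (2 * R) (fst z))^2" using cp(3)[of "fst z"] True by (intro power_mono) auto
   hence "1 * (1 / (M + \<delta> - w z)^2 * (norm (Dw z))^2) \<le> (cutoff R (2 * R) (fst z))^2 * (1 / (M + \<delta> - w z)^2 * (norm (Dw z))^2)"
    by (intro mult_right_mono) auto
   thus ?thesis using True by (simp add: power_divide ennreal_leI)
  qed simp
 qed
 also have "... \<le> ennreal (4 * Lam^2 / lam^2) * (\<integral>\<^sup>+z. ennreal (1 * (norm (Dcutoff R (2 * R) (fst z) :: 'a))^2) \<partial>strip)"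
 proof (rule caccioppoli[where rho="cutoff R (2 * R)" and Drho="Dcutoff R (2 * R)" and I="{..<M + \<delta>}" and R="2 * R" and Crho="16 / 9 + 4 / R" and P="\<lambda>y. 1 / (M + \<delta> - y)" and P'="\<lambda>y. 1 / (M + \<delta> - y)^2" and \<Theta>="\<lambda>y. 1"
   and CP="1 / \<delta> + 1 / \<delta>^2 + 1"])
  show "(cutoff R (2 * R) has_derivative (\<lambda>h. Dcutoff R (2 * R) x \<bullet> h)) (at x)" for x :: 'a by (rule cp(1))
  show "continuous_on UNIV (Dcutoff R (2 * R) :: 'a \<Rightarrow> 'a)" by (rule cp(2))
  show "norm x \<ge> 2 * R \<Longrightarrow> cutoff R (2 * R) x = 0 \<and> Dcutoff R (2 * R) x = 0" for x :: 'a using cp(5,6) by auto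
  show "\<bar>cutoff R (2 * R) x\<bar> \<le> 16 / 9 + 4 / R" for x :: 'a using cp(4)[of x] cb[of x] R by (simp add: add_increasing2)
  show "norm (Dcutoff R (2 * R) x) \<le> 16 / 9 + 4 / R" for x :: 'a using Db[of x] by simp
  show "2 * R \<ge> 0" using R by simp
  show "((\<lambda>y. 1 / (M + \<delta> - y)) has_real_derivative 1 / (M + \<delta> - y)^2) (at y)" if "y \<in> {..<M + \<delta>}" for y
   using that by (auto intro!: derivative_eq_intros simp: power2_eq_square)
  show "continuous_on {..<M + \<delta>} (\<lambda>y. 1 / (M + \<delta> - y)^2)" by (auto intro!: continuous_intros)
  show "(1 / (M + \<delta> - y))^2 \<le> 1 * (1 / (M + \<delta> - y)^2)" for y by (simp add: power_divide)
 next
  fix z :: "'a \<times> real" assume z: "snd z > 0"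
  have g: "M + \<delta> - w z \<ge> \<delta>" by (rule gap[OF z])
  show "w z \<in> {..<M + \<delta>}" using g \<delta> by simp
  have 1: "1 / (M + \<delta> - w z) \<le> 1 / \<delta>" using g \<delta> by (intro divide_left_mono) auto
  have 2: "1 / (M + \<delta> - w z)^2 \<le> 1 / \<delta>^2" using g \<delta> by (intro divide_left_mono power_mono) auto
  have 3: "1 / \<delta> > 0" "1 / \<delta>^2 > 0" "1 / (M + \<delta> - w z) > 0" "1 / (M + \<delta> - w z)^2 > 0" using \<delta> g by auto
  show "\<bar>1 / (M + \<delta> - w z)\<bar> \<le> 1 / \<delta> + 1 / \<delta>^2 + 1" using 1 3 by linarith
  show "\<bar>1 / (M + \<delta> - w z)^2\<bar> \<le> 1 / \<delta> + 1 / \<delta>^2 + 1" using 2 3 by linarith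
  show "\<bar>1\<bar> \<le> 1 / \<delta> + 1 / \<delta>^2 + 1" using 3 by linarith
 qed auto
 also have "... \<le> ennreal (4 * Lam^2 / lam^2) * (\<integral>\<^sup>+z. ennreal (16 / R^2) * indicator {z :: 'a \<times> real. norm (fst z) < 2 * R} z \<partial>strip)"
 proof (intro mult_left_mono nn_integral_mono)
  fix z :: "'a \<times> real"
  show "ennreal (1 * (norm (Dcutoff R (2 * R) (fst z)))^2) \<le> ennreal (16 / R^2) * indicator {z. norm (fst z) < 2 * R} z"
  proof (cases "norm (fst z) < 2 * R")
   case True
   have "(norm (Dcutoff R (2 * R) (fst z)))^2 \<le> (4 / R)^2" using Db[of "fst z"] by (intro power_mono) auto
   thus ?thesis using True by (simp add: power_divide ennreal_leI)
  next
   case False thus ?thesis using cp(6)[of "fst z"] by simp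
  qed
 qed auto
 also have "... = ennreal (4 * Lam^2 / lam^2) * (ennreal (16 / R^2) * ennreal (bv * (2 * R) ^ DIM('a)))"
  using R cylinder_measurable cylinder_ball[where 'a='a, of "2 * R"] by (simp add: nn_integral_cmult_indicator bv_def)
 also have "... = ennreal (4 * Lam^2 / lam^2 * (16 * (bv * 2 ^ DIM('a) * R ^ DIM('a)) / R^2))"
 proof -
  have "ennreal (a * (16 * b / c)) = ennreal a * (ennreal (16 / c) * ennreal b)" if "a \<ge> 0" "b \<ge> 0" "c \<ge> 0" for a b c :: real
  proof -
   have "ennreal (a * (16 / c * b)) = ennreal a * ennreal (16 / c * b)" by (rule ennreal_mult) (use that in auto)
   also have "ennreal (16 / c * b) = ennreal (16 / c) * ennreal b" by (rule ennreal_mult) (use that in auto)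
   finally show ?thesis by (simp only: times_divide_eq_left)
  qed
  from this[of "4 * Lam^2 / lam^2" "bv * 2 ^ DIM('a) * R ^ DIM('a)" "R^2"] show ?thesis using bv R
   by (simp only: power_mult_distrib mult.assoc) simp
 qed
 finally show ?thesis .
qed

text \<open>The energy of \<open>- ln (M + \<delta> - w)\<close> on a ball does not depend on \<open>\<delta>\<close>, but this function is at least
  \<open>Q\<close> larger on \<open>{w > M - \<delta>}\<close> than on \<open>{w \<le> mid}\<close>.\<close>
lemma log_lemma:
 assumes wM: "\<And>z. snd z > 0 \<Longrightarrow> w z \<le> M" and mM: "mid < M" and nu: "nu > 0"
 shows "\<exists>\<delta>>0. \<forall>R\<ge>1. ennreal (bv * R ^ DIM('a) / 2) \<le> emeasure strip (under R mid) \<longrightarrow>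
  emeasure strip (over R (M - \<delta>)) \<le> ennreal (nu * R ^ DIM('a))"
proof -
 define N where "N = DIM('a)"
 define K where "K = 4 * Lam^2 / lam^2"
 have K: "K \<ge> 0" by (simp add: K_def)
 \<comment> \<open>Collects the constants of \<open>ball_pairs\<close> and
   \<open>log_energy\<close>. The separation \<open>Q\<close> is then chosen with
   \<open>A \<le> nu * Q^2\<close>, which turns the energy bound into the measure bound with
   \<open>nu\<close>.\<close>
 define A where "A = 1280 * 4 ^ N * K * bv"
 have A: "A \<ge> 0" using K bv by (simp add: A_def)
 define Q where "Q = A / nu + 1"
 have Q1: "Q \<ge> 1" using A nu by (simp add: Q_def)
 have QA: "A \<le> nu * Q^2"
 proof -
  have "A \<le> nu * Q" using nu by (simp add: Q_def field_simps)
  also have "nu * Q \<le> nu * Q^2" using nu Q1 by (intro mult_left_mono) (auto simp: power2_eq_square)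
  finally show ?thesis .
 qed
 \<comment> \<open>\<open>2 * \<delta> = (M - mid) * exp (- Q)\<close>, so on the upper set the
   logarithm of \<open>M + \<delta> - w\<close> is at most \<open>ln (M - mid) - Q\<close>.\<close>
 define \<delta> where "\<delta> = (M - mid) * exp (- Q) / 2"
 have \<delta>: "\<delta> > 0" using mM by (simp add: \<delta>_def)
 have "emeasure strip (over R (M - \<delta>)) \<le> ennreal (nu * R ^ N)"
  if R: "R \<ge> 1" and lo: "ennreal (bv * R ^ N / 2) \<le> emeasure strip (under R mid)" for R
 proof -
  define f where "f z = - ln (M + \<delta> - w z)" for z
  have C1f: "C1_strip (\<lambda>z. 1 * (- ln (M + \<delta> - w z))) (\<lambda>z. (1 * (1 / (M + \<delta> - w z))) *\<^sub>R Dw z + (- ln (M + \<delta> - w z)) *\<^sub>R (0, 0))"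
  proof (rule C1_strip_compose[where rho="\<lambda>_. 1" and Drho="\<lambda>_. 0" and I="{..<M + \<delta>}" and P="\<lambda>y. - ln (M + \<delta> - y)" and P'="\<lambda>y. 1 / (M + \<delta> - y)", OF C1])
   show "((\<lambda>x. 1) has_derivative (\<lambda>h. 0 \<bullet> h)) (at x)" for x :: 'a by simp
   show "((\<lambda>y. - ln (M + \<delta> - y)) has_real_derivative 1 / (M + \<delta> - y)) (at y)" if "y \<in> {..<M + \<delta>}" for y
    using that by (auto intro!: derivative_eq_intros)
   show "continuous_on {..<M + \<delta>} (\<lambda>y. 1 / (M + \<delta> - y))" by (auto intro!: continuous_intros)
   show "w z \<in> {..<M + \<delta>}" if "snd z > 0" for z using wM[OF that] \<delta> by simp
  qed auto
  moreover have "f = (\<lambda>z. - ln (M + \<delta> - w z))" by (simp add: f_def fun_eq_iff)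
  ultimately have C1f: "C1_strip f (\<lambda>z. (1 / (M + \<delta> - w z)) *\<^sub>R Dw z)" by (simp add: zero_prod_def[symmetric])
  have fm[measurable]: "f \<in> borel_measurable borel" using C1_stripD(3)[OF C1f] .
  define hi where "hi = over R (M - \<delta>)"
  define low where "low = under R mid"
  have him: "hi \<in> sets borel" unfolding hi_def by (rule superlevel_measurable)
  have lom: "low \<in> sets borel" unfolding low_def by (rule sublevel_measurable)
  have diff: "(f z - f y)^2 \<ge> Q^2" if "z \<in> hi" "y \<in> low" "snd z > 0" "snd y > 0" for z y
  proof -
   have z: "M + \<delta> - w z < 2 * \<delta>" "M + \<delta> - w z > 0" using that wM[of z] \<delta> by (auto simp: hi_def)
   have y: "M + \<delta> - w y \<ge> M - mid" using that \<delta> by (auto simp: low_def)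
   have "ln (M + \<delta> - w z) \<le> ln (2 * \<delta>)" using z by (intro ln_mono) auto
   also have "... = ln (M - mid) - Q" using mM by (simp add: \<delta>_def ln_mult)
   also have "... \<le> ln (M + \<delta> - w y) - Q" using y mM by (intro diff_right_mono ln_mono) auto
   finally have "Q \<le> f z - f y" by (simp add: f_def)
   thus ?thesis using Q1 by (intro power_mono) auto
  qed
  have "ennreal (Q^2) * (emeasure strip low * emeasure strip hi) = (\<integral>\<^sup>+z. ennreal (Q^2) * emeasure strip low * indicator hi z \<partial>strip)"
   using him by (subst nn_integral_cmult_indicator) (auto simp: mult.assoc)
  also have "... \<le> (\<integral>\<^sup>+z. indicator (ball 0 R) (fst z) * (\<integral>\<^sup>+y. indicator (ball 0 R) (fst y) * ennreal ((f z - f y)^2) \<partial>strip) \<partial>strip)"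
  proof (rule nn_integral_mono_AE, use AE_strip in eventually_elim)
   fix z :: "'a \<times> real" assume z: "snd z > 0"
   show "ennreal (Q^2) * emeasure strip low * indicator hi z \<le> indicator (ball 0 R) (fst z) * (\<integral>\<^sup>+y. indicator (ball 0 R) (fst y) * ennreal ((f z - f y)^2) \<partial>strip)"
   proof (cases "z \<in> hi")
    case True
    have "ennreal (Q^2) * emeasure strip low = (\<integral>\<^sup>+y. ennreal (Q^2) * indicator low y \<partial>strip)"
     using lom by (subst nn_integral_cmult_indicator) auto
    also have "... \<le> (\<integral>\<^sup>+y. indicator (ball 0 R) (fst y) * ennreal ((f z - f y)^2) \<partial>strip)"
    proof (rule nn_integral_mono_AE, use AE_strip in eventually_elim)
     fix y :: "'a \<times> real" assume y: "snd y > 0"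
     show "ennreal (Q^2) * indicator low y \<le> indicator (ball 0 R) (fst y) * ennreal ((f z - f y)^2)"
      using diff[OF True _ z y] by (auto simp: indicator_def low_def intro: ennreal_leI)
    qed
    finally show ?thesis using True by (simp add: hi_def)
   qed simp
  qed
  also have "... \<le> emeasure lborel (ball (0 :: 'a) (2 * R)) * (ennreal (40 * R^2) * (\<integral>\<^sup>+z. indicator (ball 0 R) (fst z) * ennreal ((norm ((1 / (M + \<delta> - w z)) *\<^sub>R Dw z))^2) \<partial>strip))"
   by (rule ball_pairs[OF C1f R])
  also have "... \<le> emeasure lborel (ball (0 :: 'a) (2 * R)) * (ennreal (40 * R^2) * ennreal (K * (16 * (bv * 2 ^ N * R ^ N) / R^2)))"
   unfolding K_def N_def using R by (intro mult_left_mono log_energy[OF wM \<delta>]) auto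
  also have "emeasure lborel (ball (0 :: 'a) (2 * R)) = ennreal (bv * 2 ^ N * R ^ N)"
   using R emeasure_ball_bv[of "2 * R"] by (simp add: N_def power_mult_distrib mult.assoc)
  also have "ennreal (bv * 2 ^ N * R ^ N) * (ennreal (40 * R^2) * ennreal (K * (16 * (bv * 2 ^ N * R ^ N) / R^2)))
   = ennreal (bv * 2 ^ N * R ^ N * (40 * R^2 * (K * (16 * (bv * 2 ^ N * R ^ N) / R^2))))"
   using bv K R by (simp add: ennreal_mult[symmetric])
  also have "bv * 2 ^ N * R ^ N * (40 * R^2 * (K * (16 * (bv * 2 ^ N * R ^ N) / R^2))) = A * R ^ N * (bv * R ^ N / 2)"
  proof -
   have "(2::real) ^ N * 2 ^ N = 4 ^ N" by (simp add: power_mult_distrib[symmetric])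
   hence A': "A = 1280 * (2 ^ N * 2 ^ N) * K * bv" by (simp add: A_def)
   have "b * t * r * (40 * s * (K * (16 * (b * t * r) / s))) = 1280 * (t * t) * K * b * r * (b * r / 2)" if "s \<noteq> 0" for b t r s :: real
    using that by simp
   from this[of "R^2" bv "2 ^ N" "R ^ N"] show ?thesis unfolding A' using R by simp
  qed
  also have "... = ennreal (A * R ^ N) * ennreal (bv * R ^ N / 2)" using A R bv by (intro ennreal_mult) auto
  finally have 1: "ennreal (Q^2) * (emeasure strip low * emeasure strip hi) \<le> ennreal (A * R ^ N) * ennreal (bv * R ^ N / 2)" .
  have "ennreal (bv * R ^ N / 2) * (ennreal (Q^2) * emeasure strip hi) \<le> emeasure strip low * (ennreal (Q^2) * emeasure strip hi)"
   using lo unfolding low_def by (intro mult_right_mono) auto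
  also have "... = ennreal (Q^2) * (emeasure strip low * emeasure strip hi)" by (simp only: mult.left_commute)
  also note 1
  also have "ennreal (A * R ^ N) * ennreal (bv * R ^ N / 2) = ennreal (bv * R ^ N / 2) * ennreal (A * R ^ N)" by (rule mult.commute)
  also have "... \<le> ennreal (bv * R ^ N / 2) * ennreal (Q^2 * (nu * R ^ N))"
  proof (intro mult_left_mono ennreal_leI)
   have "A * R ^ N \<le> nu * Q^2 * R ^ N" using QA R by (intro mult_right_mono) auto
   thus "A * R ^ N \<le> Q^2 * (nu * R ^ N)" by (simp only: ac_simps)
  qed auto
  finally have "ennreal (bv * R ^ N / 2) * (ennreal (Q^2) * emeasure strip hi) \<le> ennreal (bv * R ^ N / 2) * ennreal (Q^2 * (nu * R ^ N))" .
  hence "ennreal (Q^2) * emeasure strip hi \<le> ennreal (Q^2 * (nu * R ^ N))"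
   using bv R by (subst (asm) ennreal_mult_le_mult_iff) auto
  also have "... = ennreal (Q^2) * ennreal (nu * R ^ N)" using nu R by (intro ennreal_mult) auto
  finally have "emeasure strip hi \<le> ennreal (nu * R ^ N)" using Q1 by (subst (asm) ennreal_mult_le_mult_iff) auto
  thus ?thesis by (simp add: hi_def)
 qed
 thus ?thesis using \<delta> unfolding N_def by blast
qed

text \<open>If \<open>w\<close> is low on half of arbitrarily large cylinders, the logarithmic lemma
  makes the set close to the supremum as thin as \<open>de_giorgi\<close> demands. The order of the
  choices matters: \<open>nu\<close> comes from the iteration, then \<open>\<delta>\<close> is
  chosen for this \<open>nu\<close>, uniformly in \<open>R\<close>.\<close>

lemma sup_lowered:
 assumes wM: "\<And>z. snd z > 0 \<Longrightarrow> w z \<le> M" and mM: "mid < M"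
  and low: "\<And>R0. \<exists>R\<ge>R0. ennreal (bv * R ^ DIM('a) / 2) \<le> emeasure strip (under R mid)"
 shows "\<exists>\<delta>>0. \<forall>z. snd z > 0 \<longrightarrow> w z \<le> M - \<delta>"
proof -
 obtain nu where nu: "nu > 0" and dg: "\<And>k \<delta>. \<delta> > 0 \<Longrightarrow> (\<forall>z. snd z > 0 \<longrightarrow> w z \<le> k + \<delta>) \<Longrightarrow>
   (\<forall>R0. \<exists>R\<ge>R0. emeasure strip (over R k) \<le> ennreal (nu * R ^ DIM('a))) \<Longrightarrow>
   (\<forall>z. snd z > 0 \<longrightarrow> w z \<le> k + \<delta> / 2)"
  using de_giorgi by blast
 obtain \<delta> where \<delta>: "\<delta> > 0" and lg: "\<And>R. R \<ge> 1 \<Longrightarrow> ennreal (bv * R ^ DIM('a) / 2) \<le> emeasure strip (under R mid) \<Longrightarrow>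
  emeasure strip (over R (M - \<delta>)) \<le> ennreal (nu * R ^ DIM('a))"
  using log_lemma[OF wM mM nu] by blast
 have "\<forall>z. snd z > 0 \<longrightarrow> w z \<le> (M - \<delta>) + \<delta> / 2"
 proof (rule dg[OF \<delta>])
  show "\<forall>z. snd z > 0 \<longrightarrow> w z \<le> M - \<delta> + \<delta>" using wM by simp
  show "\<forall>R0. \<exists>R\<ge>R0. emeasure strip (over R (M - \<delta>)) \<le> ennreal (nu * R ^ DIM('a))"
  proof
   fix R0
   obtain R where R: "R \<ge> max R0 1" "ennreal (bv * R ^ DIM('a) / 2) \<le> emeasure strip (under R mid)"
    using low by blast
   show "\<exists>R\<ge>R0. emeasure strip (over R (M - \<delta>)) \<le> ennreal (nu * R ^ DIM('a))"
    using lg[OF _ R(2)] R(1) by (intro exI[of _ R]) auto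
  qed
 qed
 moreover have "M - \<delta> + \<delta> / 2 = M - \<delta> / 2" by (simp add: field_simps)
 ultimately show ?thesis using \<delta> by (intro exI[of _ "\<delta> / 2"]) simp
qed

lemma strip_solution_uminus: "strip_solution (\<lambda>z. - w z) (\<lambda>z. - Dw z) (\<lambda>z. - J z) lam Lam Bd"
proof
 show "C1_strip (\<lambda>z. - w z) (\<lambda>z. - Dw z)"
  unfolding C1_strip_def
 proof (intro conjI allI impI)
  fix z :: "'a \<times> real" assume "snd z > 0"
  from has_derivative_minus[OF C1_stripD(1)[OF C1 this]]
  show "((\<lambda>z. - w z) has_derivative (\<lambda>h. - Dw z \<bullet> h)) (at z)" by simp
 next
  show "continuous_on {z. snd z > 0} (\<lambda>z. - Dw z)" by (intro continuous_on_minus C1_stripD(2)[OF C1])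
 qed measurable
 show "(\<lambda>z. - J z) \<in> borel_measurable borel" using J_meas by measurable
 fix eta :: "'a \<times> real \<Rightarrow> real" and Deta R C
 assume "C1_strip eta Deta" "\<And>z. snd z > 0 \<Longrightarrow> norm (fst z) \<ge> R \<Longrightarrow> eta z = 0 \<and> Deta z = 0"
  "\<And>z. snd z > 0 \<Longrightarrow> \<bar>eta z\<bar> \<le> C \<and> norm (Deta z) \<le> C"
 hence "(LINT z|strip. J z \<bullet> Deta z) = 0" by (rule weak)
 thus "(LINT z|strip. - J z \<bullet> Deta z) = 0" by simp
qed (use bound lam Lam ell in auto)

text \<open>Each large cylinder is at least half filled by \<open>w \<le> mid\<close> or by
  \<open>w \<ge> mid\<close>, so one of the two alternatives occurs for arbitrarily large radii.
  Accordingly the supremum could be lowered or, with \<open>- w\<close> for \<open>w\<close>, the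
  infimum raised.\<close>

theorem liouville: "\<exists>C. \<forall>z. snd z > 0 \<longrightarrow> w z = C"
proof (rule ccontr)
 assume nc: "\<nexists>C. \<forall>z. snd z > 0 \<longrightarrow> w z = C"
 define X where "X = w ` {z. snd z > 0}"
 define M where "M = Sup X" define m where "m = Inf X"
 have "(0, 1) \<in> {z :: 'a \<times> real. snd z > 0}" by simp
 hence X0: "X \<noteq> {}" unfolding X_def by blast
 have Xb: "bdd_above X" "bdd_below X"
  unfolding X_def using bound(1) by (auto intro!: bdd_aboveI2[where M=Bd] bdd_belowI2[where m="- Bd"] simp: abs_le_iff) (metis minus_le_iff)
 have wM: "w z \<le> M" if "snd z > 0" for z unfolding M_def using that Xb by (intro cSup_upper) (auto simp: X_def)
 have wm: "m \<le> w z" if "snd z > 0" for z unfolding m_def using that Xb by (intro cInf_lower) (auto simp: X_def)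
 have mM: "m < M"
 proof (rule ccontr)
  assume "\<not> m < M"
  hence "\<forall>z. snd z > 0 \<longrightarrow> w z = M" using wM wm by (meson antisym not_less order_trans)
  thus False using nc by blast
 qed
 define mid where "mid = (m + M) / 2"
 interpret neg: strip_solution "\<lambda>z. - w z" "\<lambda>z. - Dw z" "\<lambda>z. - J z" lam Lam Bd by (rule strip_solution_uminus)
 have half: "ennreal (bv * R ^ DIM('a) / 2) \<le> emeasure strip (under R mid) \<or>
  ennreal (bv * R ^ DIM('a) / 2) \<le> emeasure strip (neg.under R (- mid))" if "R \<ge> 1" for R
 proof (rule ccontr)
  assume "\<not> ?thesis"
  hence lt: "emeasure strip (under R mid) < ennreal (bv * R ^ DIM('a) / 2)"
   "emeasure strip (neg.under R (- mid)) < ennreal (bv * R ^ DIM('a) / 2)" by auto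
  have 1: "under R mid \<in> sets borel" by (rule sublevel_measurable)
  have 2: "neg.under R (- mid) \<in> sets borel" by (rule neg.sublevel_measurable)
  have "ennreal (bv * R ^ DIM('a)) = emeasure strip {z :: 'a \<times> real. norm (fst z) < R}"
   using that by (simp add: cylinder_ball bv_def)
  also have "{z :: 'a \<times> real. norm (fst z) < R} = under R mid \<union> neg.under R (- mid)" by auto
  also have "emeasure strip ... \<le> emeasure strip (under R mid) + emeasure strip (neg.under R (- mid))"
   using 1 2 by (intro emeasure_subadditive) auto
  also have "... < ennreal (bv * R ^ DIM('a) / 2 + bv * R ^ DIM('a) / 2)"
   using lt by (rule add_mono_ennreal)
  also have "... = ennreal (bv * R ^ DIM('a))" by (simp only: field_sum_of_halves)
  finally show False by simp
 qed
 show False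
 proof (cases "\<forall>R0. \<exists>R\<ge>R0. ennreal (bv * R ^ DIM('a) / 2) \<le> emeasure strip (under R mid)")
  case True
  then obtain \<delta> where \<delta>: "\<delta> > 0" "\<And>z. snd z > 0 \<Longrightarrow> w z \<le> M - \<delta>"
   using sup_lowered[OF wM, where mid=mid] mM unfolding mid_def by (auto simp: field_simps)
  have "M \<le> M - \<delta>" unfolding M_def using X0 \<delta>(2) by (intro cSup_least) (auto simp: X_def M_def)
  thus False using \<delta>(1) by simp
 next
  case False
  then obtain R0 where R0: "\<And>R. R \<ge> R0 \<Longrightarrow> \<not> ennreal (bv * R ^ DIM('a) / 2) \<le> emeasure strip (under R mid)" by blast
  have un: "\<exists>R\<ge>R1. ennreal (bv * R ^ DIM('a) / 2) \<le> emeasure strip (neg.under R (- mid))" for R1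
   using half[of "max R1 (max R0 1)"] R0[of "max R1 (max R0 1)"] by (intro exI[of _ "max R1 (max R0 1)"]) auto
  have "\<exists>\<delta>>0. \<forall>z. snd z > 0 \<longrightarrow> - w z \<le> - m - \<delta>"
  proof (rule neg.sup_lowered[where mid="- mid"])
   show "- w z \<le> - m" if "snd z > 0" for z using wm[OF that] by simp
   show "- mid < - m" using mM by (simp add: mid_def)
   show "\<exists>R\<ge>R0. ennreal (neg.bv * R ^ DIM('a) / 2) \<le> emeasure strip (neg.under R (- mid))" for R0
    using un[of R0] unfolding neg.bv_def bv_def .
  qed
  then obtain \<delta> where \<delta>: "\<delta> > 0" "\<And>z. snd z > 0 \<Longrightarrow> - w z \<le> - m - \<delta>" by blast
  have "m + \<delta> \<le> w z" if "snd z > 0" for z using \<delta>(2)[OF that] by linarith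
  hence "m + \<delta> \<le> Inf X" using X0 by (intro cInf_greatest) (auto simp: X_def)
  hence "m + \<delta> \<le> m" by (simp only: m_def)
  thus False using \<delta>(1) by simp
 qed
qed

end

section \<open>Divergence-free fields without flux through the bottom\<close>

lemma lborel_integral_translate:
 fixes f :: "'b::euclidean_space \<Rightarrow> real"
 assumes "f \<in> borel_measurable borel"
 shows "(LINT x|lborel. f (x + a)) = (LINT x|lborel. f x)"
proof -
 have "(LINT x|lborel. f x) = (LINT x|distr lborel borel ((+) a). f x)" by (simp only: lborel_distr_plus)
 also have "... = (LINT x|lborel. f (a + x))" using assms by (intro integral_distr) auto
 finally show ?thesis by (simp add: add.commute)
qed

lemma integrable_continuous_compact_support:
 fixes f :: "'b::euclidean_space \<Rightarrow> real"
 assumes "continuous_on UNIV f" "\<And>z. norm z \<ge> R \<Longrightarrow> f z = 0"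
 shows "integrable lborel f"
proof -
 have "integrable lborel (\<lambda>z. indicator (cball 0 R) z *\<^sub>R f z)"
  by (rule borel_integrable_compact) (auto intro: continuous_on_subset[OF assms(1)])
 also have "(\<lambda>z. indicator (cball 0 R) z *\<^sub>R f z) = f"
  by (rule ext) (use assms(2) in \<open>auto simp: indicator_def not_le less_imp_le\<close>)
 finally show ?thesis .
qed

text \<open>\<open>X (z + b) - X z\<close> is the integral of \<open>X'\<close> along the segment
  from \<open>z\<close> to \<open>z + b\<close>. Integrating over \<open>z\<close>, the left side
  vanishes by translation invariance, and by Fubini the right side is the integral of
  \<open>X'\<close>.\<close>

lemma integral_derivative_compact:
 fixes X X' :: "'b::euclidean_space \<Rightarrow> real"
 assumes der: "\<And>z. ((\<lambda>s. X (z + s *\<^sub>R b)) has_real_derivative X' z) (at 0)"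
  and cX: "continuous_on UNIV X" and cX': "continuous_on UNIV X'"
  and supp: "\<And>z. norm z \<ge> R \<Longrightarrow> X z = 0" "\<And>z. norm z \<ge> R \<Longrightarrow> X' z = 0"
 shows "(LINT z|lborel. X' z) = 0"
proof -
 have bm: "X \<in> borel_measurable borel" "X' \<in> borel_measurable borel"
  using cX cX' by (auto intro: borel_measurable_continuous_onI)
 have iX: "integrable lborel X" by (rule integrable_continuous_compact_support[OF cX supp(1)])
 have der': "((\<lambda>s. X (z + s *\<^sub>R b)) has_real_derivative X' (z + s *\<^sub>R b)) (at s)" for z s
 proof -
  have "((\<lambda>r. X ((z + s *\<^sub>R b) + r *\<^sub>R b)) has_real_derivative X' (z + s *\<^sub>R b)) (at (s - s))" using der[of "z + s *\<^sub>R b"] by simp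
  hence "((\<lambda>r. X ((z + s *\<^sub>R b) + (r - s) *\<^sub>R b)) has_real_derivative X' (z + s *\<^sub>R b)) (at s)"
   using DERIV_shift[of "\<lambda>r. X ((z + s *\<^sub>R b) + r *\<^sub>R b)" _ s "- s"] by simp
  thus ?thesis by (simp add: algebra_simps)
 qed
 define g where "g z s = indicator {0..1::real} s *\<^sub>R X' (z + s *\<^sub>R b)" for z s
 have g0: "X' (z + s *\<^sub>R b) = 0" if "s \<in> {0..1}" "norm z > R + norm b" for z s
 proof (rule supp(2))
  have "norm z = norm ((z + s *\<^sub>R b) - s *\<^sub>R b)" by simp
  also have "... \<le> norm (z + s *\<^sub>R b) + norm (s *\<^sub>R b)" by (rule norm_triangle_ineq4)
  also have "norm (s *\<^sub>R b) \<le> 1 * norm b" unfolding norm_scaleR using that by (intro mult_right_mono) auto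
  finally show "norm (z + s *\<^sub>R b) \<ge> R" using that by simp
 qed
 have "integrable lborel (\<lambda>y. indicator (cball 0 (R + norm b) \<times> {0..1}) y *\<^sub>R X' (fst y + snd y *\<^sub>R b))"
  by (rule borel_integrable_compact) (auto intro!: compact_Times continuous_intros continuous_on_compose2[OF cX'])
 also have "(\<lambda>y. indicator (cball 0 (R + norm b) \<times> {0..1}) y *\<^sub>R X' (fst y + snd y *\<^sub>R b)) = case_prod g"
  by (rule ext) (auto simp: g_def indicator_def not_le split: prod.splits intro!: g0[symmetric] g0)
 finally have ig: "integrable (lborel \<Otimes>\<^sub>M lborel) (case_prod g)" by (simp only: lborel_prod)
 have fub: "(LINT s|lborel. LINT z|lborel. g z s) = (LINT z|lborel. LINT s|lborel. g z s)"
  by (rule lborel_pair.Fubini_integral[OF ig])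
 have "(LINT z|lborel. g z s) = indicator {0..1} s *\<^sub>R (LINT z|lborel. X' z)" for s
  unfolding g_def using lborel_integral_translate[OF bm(2), of "s *\<^sub>R b"] by simp
 hence "(LINT s|lborel. LINT z|lborel. g z s) = (LINT z|lborel. X' z)" by simp
 moreover have "(LINT s|lborel. g z s) = X (z + b) - X z" for z
 proof -
  have "(LINT s|lborel. indicator {0..1} s *\<^sub>R X' (z + s *\<^sub>R b)) = X (z + 1 *\<^sub>R b) - X (z + 0 *\<^sub>R b)"
   by (rule integral_FTC_atLeastAtMost)
    (auto intro!: continuous_intros continuous_on_compose2[OF cX'] has_vector_derivative_at_within der'[unfolded has_real_derivative_iff_has_vector_derivative])
  thus ?thesis by (simp add: g_def)
 qed
 moreover have "(LINT z|lborel. X (z + b) - X z) = 0"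
 proof -
  have "integrable lborel (\<lambda>z. X (z + b))"
  proof -
   have "integrable (distr lborel borel ((+) b)) X" using iX by (simp only: lborel_distr_plus)
   hence "integrable lborel (\<lambda>z. X (b + z))" by (subst (asm) integrable_distr_eq) (use bm in auto)
   thus ?thesis by (simp add: add.commute)
  qed
  thus ?thesis using iX lborel_integral_translate[OF bm(1), of b] by simp
 qed
 ultimately show ?thesis using fub by simp
qed

text \<open>A continuously differentiable step from 0 on \<open>s \<le> 1\<close> to 1 on
  \<open>s \<ge> 2\<close>, made of squares of positive parts.\<close>

definition ramp :: "real \<Rightarrow> real" where
 "ramp s = 1 - (max 0 (1 - (max 0 (s - 1))^2))^2"

definition ramp' :: "real \<Rightarrow> real" where
 "ramp' s = 4 * (max 0 (1 - (max 0 (s - 1))^2) * max 0 (s - 1))"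

lemma ramp_props:
 "(ramp has_real_derivative ramp' s) (at s)" "continuous_on UNIV ramp'" "continuous_on UNIV ramp"
 "s \<le> 1 \<Longrightarrow> ramp s = 0" "s \<ge> 2 \<Longrightarrow> ramp s = 1" "0 \<le> ramp s" "ramp s \<le> 1"
 "s \<le> 1 \<Longrightarrow> ramp' s = 0" "s \<ge> 2 \<Longrightarrow> ramp' s = 0" "0 \<le> ramp' s" "ramp' s \<le> 4"
proof -
 show der: "(ramp has_real_derivative ramp' s) (at s)" for s
 proof -
  have sq: "((\<lambda>y. (max 0 y)^2) has_real_derivative 2 * max 0 y) (at (y::real))" for y
   using deriv_max_power[of 2 y] by simp
  have "((\<lambda>s. s - 1) has_real_derivative 1) (at s)" by (auto intro!: derivative_eq_intros)
  from DERIV_chain2[where f="\<lambda>y. (max 0 y)^2", OF sq this]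
  have "((\<lambda>s. 1 - (max 0 (s - 1))^2) has_real_derivative 0 - 2 * max 0 (s - 1) * 1) (at s)"
   by (intro DERIV_diff DERIV_const)
  from DERIV_chain2[where f="\<lambda>y. (max 0 y)^2", OF sq this]
  have "((\<lambda>s. 1 - (max 0 (1 - (max 0 (s - 1))^2))^2) has_real_derivative
   0 - 2 * max 0 (1 - (max 0 (s - 1))^2) * (0 - 2 * max 0 (s - 1) * 1)) (at s)"
   by (intro DERIV_diff DERIV_const)
  thus ?thesis unfolding ramp_def[abs_def] ramp'_def by (simp add: mult.assoc)
 qed
 show "continuous_on UNIV ramp'" unfolding ramp'_def by (intro continuous_intros)
 show "continuous_on UNIV ramp" unfolding ramp_def by (intro continuous_intros)
 show "s \<le> 1 \<Longrightarrow> ramp s = 0" "s \<le> 1 \<Longrightarrow> ramp' s = 0" by (simp_all add: ramp_def ramp'_def)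
 have two: "(max 0 (s - 1))^2 \<ge> 1" if "s \<ge> 2"
 proof -
  have "1^2 \<le> (max 0 (s - 1))^2" using that by (intro power_mono) auto
  thus ?thesis by simp
 qed
 show "s \<ge> 2 \<Longrightarrow> ramp s = 1" "s \<ge> 2 \<Longrightarrow> ramp' s = 0" using two by (simp_all add: ramp_def ramp'_def max_absorb1)
 define y where "y = max 0 (1 - (max 0 (s - 1))^2)"
 have y: "0 \<le> y" "y \<le> 1" by (auto simp: y_def)
 have "y^2 \<le> 1" using y by (intro power_le_one) auto
 thus "0 \<le> ramp s" "ramp s \<le> 1" unfolding ramp_def y_def[symmetric] by auto
 show "0 \<le> ramp' s" unfolding ramp'_def by simp
 show "ramp' s \<le> 4"
 proof (cases "s \<ge> 2")
  case True thus ?thesis using two by (simp add: ramp'_def max_absorb1)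
 next
  case False
  hence "y * max 0 (s - 1) \<le> 1 * 1" using y by (intro mult_mono) auto
  thus ?thesis unfolding ramp'_def y_def[symmetric] by simp
 qed
qed

text \<open>A cutoff in \<open>t\<close>: 1 on \<open>[2 / m, m]\<close> and 0 outside
  \<open>[1 / m, 2 * m]\<close>. Its derivative has size \<open>m\<close> only in a bottom layer of
  width \<open>2 / m\<close>, where the flux is small, and size \<open>1 / m\<close> at the
  top.\<close>

definition bump :: "real \<Rightarrow> real \<Rightarrow> real" where "bump m t = ramp (m * t) * (1 - ramp (t / m))"
definition bump' :: "real \<Rightarrow> real \<Rightarrow> real" where
 "bump' m t = m * ramp' (m * t) * (1 - ramp (t / m)) - ramp (m * t) * (ramp' (t / m) / m)"

lemma bump_props:
 assumes m: "m \<ge> 1"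
 shows "(bump m has_real_derivative bump' m t) (at t)" "continuous_on UNIV (bump m)" "continuous_on UNIV (bump' m)"
  "t \<le> 1 / m \<Longrightarrow> bump m t = 0" "t \<le> 1 / m \<Longrightarrow> bump' m t = 0" "t \<ge> 2 * m \<Longrightarrow> bump m t = 0" "t \<ge> 2 * m \<Longrightarrow> bump' m t = 0"
  "0 \<le> bump m t" "bump m t \<le> 1" "t > 0 \<Longrightarrow> \<bar>bump' m t\<bar> \<le> 4 * m * indicator {0<..<2 / m} t + 4 / m"
  "2 / m \<le> t \<Longrightarrow> t \<le> m \<Longrightarrow> bump m t = 1"
proof -
 note rp = ramp_props
 have m0: "m > 0" using m by simp
 show "(bump m has_real_derivative bump' m t) (at t)"
 proof -
  have "((\<lambda>t. m * t) has_real_derivative m) (at t)" "((\<lambda>t. t / m) has_real_derivative 1 / m) (at t)"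
   using m0 by (auto intro!: derivative_eq_intros)
  from DERIV_chain2[OF rp(1) this(1)] DERIV_chain2[OF rp(1) this(2)]
  show ?thesis unfolding bump_def[abs_def] bump'_def by (auto intro!: derivative_eq_intros)
 qed
 have c: "continuous_on UNIV (\<lambda>t. ramp (f t))" "continuous_on UNIV (\<lambda>t. ramp' (f t))" if "continuous_on UNIV f" for f :: "real \<Rightarrow> real"
  using continuous_on_compose2[OF rp(3) that] continuous_on_compose2[OF rp(2) that] by auto
 show "continuous_on UNIV (bump m)" "continuous_on UNIV (bump' m)"
  unfolding bump_def bump'_def using m0 by (auto intro!: continuous_intros c)
 show "t \<le> 1 / m \<Longrightarrow> bump m t = 0" "t \<le> 1 / m \<Longrightarrow> bump' m t = 0"
  using m0 rp(4)[of "m * t"] rp(8)[of "m * t"] by (auto simp: bump_def bump'_def field_simps)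
 show "t \<ge> 2 * m \<Longrightarrow> bump m t = 0" "t \<ge> 2 * m \<Longrightarrow> bump' m t = 0"
  using m0 rp(5)[of "t / m"] rp(9)[of "t / m"] by (auto simp: bump_def bump'_def field_simps)
 show "0 \<le> bump m t" "bump m t \<le> 1"
  unfolding bump_def using rp(6,7)[of "m * t"] rp(6,7)[of "t / m"] by (auto intro!: mult_le_one)
 show "2 / m \<le> t \<Longrightarrow> t \<le> m \<Longrightarrow> bump m t = 1"
  using m0 rp(5)[of "m * t"] rp(4)[of "t / m"] by (auto simp: bump_def field_simps)
 assume t: "t > 0"
 have "\<bar>bump' m t\<bar> \<le> \<bar>m * ramp' (m * t) * (1 - ramp (t / m))\<bar> + \<bar>ramp (m * t) * (ramp' (t / m) / m)\<bar>"
  unfolding bump'_def by (rule abs_triangle_ineq4)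
 also have "\<bar>m * ramp' (m * t) * (1 - ramp (t / m))\<bar> \<le> 4 * m * indicator {0<..<2 / m} t"
 proof (cases "t < 2 / m")
  case True
  have "m * ramp' (m * t) * (1 - ramp (t / m)) \<le> m * 4 * 1"
   using rp(6,7)[of "t / m"] rp(10,11)[of "m * t"] m0 by (intro mult_mono) auto
  moreover have "m * ramp' (m * t) * (1 - ramp (t / m)) \<ge> 0" using rp(6,7)[of "t / m"] rp(10)[of "m * t"] m0 by auto
  ultimately show ?thesis using True t by simp
 next
  case False
  hence "ramp' (m * t) = 0" using m0 by (intro rp(9)) (simp add: field_simps)
  thus ?thesis using m0 by (auto simp: indicator_def)
 qed
 also have "\<bar>ramp (m * t) * (ramp' (t / m) / m)\<bar> \<le> 4 / m"
 proof -
  have "ramp (m * t) * (ramp' (t / m) / m) \<le> 1 * (4 / m)"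
   using rp(6,7)[of "m * t"] rp(10,11)[of "t / m"] m0 by (intro mult_mono divide_right_mono) auto
  moreover have "ramp (m * t) * (ramp' (t / m) / m) \<ge> 0" using rp(6)[of "m * t"] rp(10)[of "t / m"] m0 by auto
  ultimately show ?thesis by simp
 qed
 finally show "\<bar>bump' m t\<bar> \<le> 4 * m * indicator {0<..<2 / m} t + 4 / m" by simp
qed

lemma continuous_on_extend_zero:
 fixes f :: "'a::euclidean_space \<times> real \<Rightarrow> real"
 assumes "continuous_on {z. snd z > 0} f" "e > 0" "\<And>z. snd z < e \<Longrightarrow> f z = 0"
 shows "continuous_on UNIV f"
proof -
 have "continuous_on ({z. snd z > 0} \<union> {z. snd z < e}) f"
 proof (rule continuous_on_open_Un)
  show "open {z :: 'a \<times> real. snd z > 0}" "open {z :: 'a \<times> real. snd z < e}"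
   by (intro open_Collect_less continuous_intros)+
  show "continuous_on {z. snd z < e} f"
   using continuous_on_cong[of "{z. snd z < e}" "{z. snd z < e}" f "\<lambda>_. 0"] assms(3) by simp
 qed fact
 moreover have "{z :: 'a \<times> real. snd z > 0} \<union> {z. snd z < e} = UNIV" using assms(2) by force
 ultimately show ?thesis by simp
qed

lemma integrable_half_cylinder:
 "integrable lborel (\<lambda>z :: 'a::euclidean_space \<times> real. indicator {z. norm (fst z) < R} z * expw (snd z))"
proof -
 have "emeasure strip {z :: 'a \<times> real. norm (fst z) < R} < \<infinity>"
 proof (cases "R \<ge> 0")
  case False
  hence "\<not> norm (fst z) < R" for z :: "'a \<times> real" using norm_ge_zero[of "fst z"] by linarith
  thus ?thesis by simp
 qed (simp add: cylinder_ball)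
 hence "integrable strip (indicator {z :: 'a \<times> real. norm (fst z) < R} :: _ \<Rightarrow> real)"
  using cylinder_measurable by (intro integrable_real_indicator) auto
 hence "integrable lborel (\<lambda>z :: 'a \<times> real. expw (snd z) *\<^sub>R (indicator {z. norm (fst z) < R} z :: real))"
  unfolding strip_def
  by (subst (asm) integrable_density) auto
 thus ?thesis by (simp add: mult.commute)
qed

text \<open>The cutoff removes a neighbourhood of \<open>t = 0\<close>, so the divergence theorem is
  applied only to functions with compact support in the open half-space. The price is the term with
  \<open>bump'\<close>.\<close>

lemma bump_identity:
 fixes A :: "'a::euclidean_space \<times> real \<Rightarrow> 'a \<times> real"
 assumes der: "\<And>z b. snd z > 0 \<Longrightarrow> b \<in> Basis \<Longrightarrow> ((\<lambda>s. A (z + s *\<^sub>R b) \<bullet> b) has_real_derivative D b z) (at 0)"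
  and cA: "continuous_on {z. snd z > 0} A" and cD: "\<And>b. b \<in> Basis \<Longrightarrow> continuous_on {z. snd z > 0} (D b)"
  and div: "\<And>z. snd z > 0 \<Longrightarrow> (\<Sum>b\<in>Basis. D b z) = 0"
  and eta: "C1_strip eta Deta" and supp: "\<And>z. snd z > 0 \<Longrightarrow> norm (fst z) \<ge> R \<Longrightarrow> eta z = 0 \<and> Deta z = 0"
  and m: "m \<ge> 1"
 shows "(LINT z|lborel. bump m (snd z) * (indicator {z. snd z > 0} z * (A z \<bullet> Deta z)))
  = - (LINT z|lborel. bump' m (snd z) * (indicator {z. snd z > 0} z * (eta z * snd (A z))))"
  "integrable lborel (\<lambda>z. bump' m (snd z) * (indicator {z. snd z > 0} z * (eta z * snd (A z))))"
proof -
 define P where "P = {z :: 'a \<times> real. snd z > 0}"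
 have oP: "open P" unfolding P_def by (intro open_Collect_less continuous_intros)
 note bp = bump_props[OF m]
 have m0: "m > 0" "1 / m > 0" using m by auto
 have ceta: "continuous_on P eta"
  by (intro continuous_at_imp_continuous_on ballI) (auto simp: P_def intro!: has_derivative_continuous[OF C1_stripD(1)[OF eta]])
 have cDeta: "continuous_on P Deta" unfolding P_def by (rule C1_stripD(2)[OF eta])
 have cb: "continuous_on S (\<lambda>z. bump m (snd z))" "continuous_on S (\<lambda>z. bump' m (snd z))" for S :: "('a \<times> real) set"
  by (auto intro!: continuous_on_compose2[OF bp(2)] continuous_on_compose2[OF bp(3)] continuous_intros)
 define X where "X b z = indicator P z * (bump m (snd z) * (eta z * (A z \<bullet> b)))" for b z
 define X' where "X' b z = indicator P z * (bump' m (snd z) * (b \<bullet> (0, 1)) * (eta z * (A z \<bullet> b))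
   + bump m (snd z) * ((Deta z \<bullet> b) * (A z \<bullet> b) + eta z * D b z))" for b z
 define U where "U z = bump m (snd z) * (indicator P z * (A z \<bullet> Deta z))" for z
 define V where "V z = bump' m (snd z) * (indicator P z * (eta z * snd (A z)))" for z
 have far: "f z = 0" if "norm z \<ge> \<bar>R\<bar> + 2 * m" and f: "\<And>z. \<not> snd z > 0 \<Longrightarrow> f z = 0" "\<And>z. snd z > 0 \<Longrightarrow> norm (fst z) \<ge> R \<Longrightarrow> f z = 0" "\<And>z. snd z \<ge> 2 * m \<Longrightarrow> f z = 0"
  for f :: "'a \<times> real \<Rightarrow> real" and z
 proof (rule ccontr)
  assume nz: "f z \<noteq> 0"
  have s: "snd z > 0" using f(1) nz by blast
  moreover have "\<not> norm (fst z) \<ge> R" using f(2)[OF s] nz by blast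
  moreover have "\<not> snd z \<ge> 2 * m" using f(3) nz by blast
  moreover have "norm z \<le> norm (fst z) + norm (snd z)" by (metis norm_Pair_le prod.collapse)
  ultimately show False using that(1) by (simp add: abs_if split: if_splits)
 qed
 have ext: "continuous_on UNIV f" if "continuous_on P f" "\<And>z. snd z \<le> 1 / m \<Longrightarrow> f z = 0" for f :: "'a \<times> real \<Rightarrow> real"
  by (rule continuous_on_extend_zero[OF _ m0(2)]) (use that in \<open>auto simp: P_def\<close>)
 have cP: "continuous_on P (\<lambda>z. indicator P z * f z)" "continuous_on P (\<lambda>z. g z * (indicator P z * f z))" if "continuous_on P f" "continuous_on P g" for f g :: "'a \<times> real \<Rightarrow> real"
 proof -
  have "continuous_on P (\<lambda>z. g z * f z)" using that by (intro continuous_intros)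
  thus "continuous_on P (\<lambda>z. indicator P z * f z)" "continuous_on P (\<lambda>z. g z * (indicator P z * f z))"
   using that by (auto cong: continuous_on_cong_simp)
 qed
 have cAP: "continuous_on P A" using cA unfolding P_def .
 have cX: "continuous_on UNIV (X b)" for b
  unfolding X_def by (rule ext) (auto simp: bp intro!: cP continuous_intros cb ceta cAP)
 have cX': "continuous_on UNIV (X' b)" if "b \<in> Basis" for b
  unfolding X'_def by (rule ext) (use cD[OF that] in \<open>auto simp: bp P_def[symmetric] intro!: cP continuous_intros cb ceta cDeta cAP\<close>)
 have cU: "continuous_on UNIV U"
  unfolding U_def by (rule ext) (auto simp: bp intro!: cP continuous_intros cb ceta cDeta cAP)
 have cV: "continuous_on UNIV V"
  unfolding V_def by (rule ext) (auto simp: bp intro!: cP continuous_intros cb ceta cAP)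
 have X0: "norm z \<ge> \<bar>R\<bar> + 2 * m \<Longrightarrow> X b z = 0" for b z
  by (rule far[where f="X b"]) (auto simp: X_def P_def bp supp)
 have X'0: "norm z \<ge> \<bar>R\<bar> + 2 * m \<Longrightarrow> X' b z = 0" for b z
  by (rule far[where f="X' b"]) (auto simp: X'_def P_def bp supp)
 have U0: "norm z \<ge> \<bar>R\<bar> + 2 * m \<Longrightarrow> U z = 0" for z
  by (rule far[where f=U]) (auto simp: U_def P_def bp supp)
 have V0: "norm z \<ge> \<bar>R\<bar> + 2 * m \<Longrightarrow> V z = 0" for z
  by (rule far[where f=V]) (auto simp: V_def P_def bp supp)
 have derX: "((\<lambda>s. X b (z + s *\<^sub>R b)) has_real_derivative X' b z) (at 0)" if b: "b \<in> Basis" for b z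
 proof (cases "snd z > 0")
  case True
  have 1: "((\<lambda>s. eta (z + s *\<^sub>R b)) has_real_derivative Deta z \<bullet> b) (at 0)"
   using C1_strip_line[OF eta, of z 0 b] True by simp
  have l: "((\<lambda>s. snd (z + s *\<^sub>R b)) has_real_derivative (b \<bullet> (0, 1))) (at 0)"
   by (cases b) (auto intro!: derivative_eq_intros)
  have 2: "((\<lambda>s. bump m (snd (z + s *\<^sub>R b))) has_real_derivative bump' m (snd z) * (b \<bullet> (0, 1))) (at 0)"
   using DERIV_chain2[where f="bump m" and g="\<lambda>s. snd (z + s *\<^sub>R b)", OF _ l] bp(1)[of "snd z"] by simp
  have "((\<lambda>s. bump m (snd (z + s *\<^sub>R b)) * (eta (z + s *\<^sub>R b) * (A (z + s *\<^sub>R b) \<bullet> b))) has_real_derivative X' b z) (at 0)"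
   by (rule DERIV_cong[OF DERIV_mult[OF 2 DERIV_mult[OF 1 der[OF True b]]]]) (use True in \<open>simp add: X'_def P_def algebra_simps\<close>)
  moreover have "open ((\<lambda>s. z + s *\<^sub>R b) -` P)" by (intro open_vimage oP continuous_intros)
  ultimately show ?thesis
   by (rule has_field_derivative_transform_within_open) (use True in \<open>auto simp: X_def P_def\<close>)
 next
  case False
  have "open ((\<lambda>s. z + s *\<^sub>R b) -` {y. snd y < 1 / m})" by (intro open_vimage open_Collect_less continuous_intros)
  from has_field_derivative_transform_within_open[OF DERIV_const[of 0] this, of 0 "\<lambda>s. X b (z + s *\<^sub>R b)"]
  have "((\<lambda>s. X b (z + s *\<^sub>R b)) has_real_derivative 0) (at 0)"
   using False m0 by (auto simp: X_def bp)
  moreover have "X' b z = 0" using False by (simp add: X'_def P_def)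
  ultimately show ?thesis by simp
 qed
 have int0: "(LINT z|lborel. X' b z) = 0" if "b \<in> Basis" for b
  by (rule integral_derivative_compact[OF derX[OF that] cX cX'[OF that] X0 X'0])
 have iX': "integrable lborel (X' b)" if "b \<in> Basis" for b by (rule integrable_continuous_compact_support[OF cX'[OF that] X'0])
 have iU: "integrable lborel U" by (rule integrable_continuous_compact_support[OF cU U0])
 have iV: "integrable lborel V" by (rule integrable_continuous_compact_support[OF cV V0])
 have "(\<Sum>b\<in>Basis. X' b z) = U z + V z" for z
 proof (cases "z \<in> P")
  case True
  have "(\<Sum>b\<in>Basis. X' b z) = (\<Sum>b\<in>Basis. bump' m (snd z) * eta z * ((b \<bullet> (0, 1)) * (A z \<bullet> b)) + bump m (snd z) * ((Deta z \<bullet> b) * (A z \<bullet> b)) + bump m (snd z) * eta z * D b z)"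
   using True by (intro sum.cong) (auto simp: X'_def algebra_simps)
  also have "... = bump' m (snd z) * eta z * (\<Sum>b\<in>Basis. ((0, 1) \<bullet> b) * (A z \<bullet> b)) + bump m (snd z) * (\<Sum>b\<in>Basis. (Deta z \<bullet> b) * (A z \<bullet> b)) + bump m (snd z) * eta z * (\<Sum>b\<in>Basis. D b z)"
   by (simp only: sum.distrib sum_distrib_left inner_commute)
  also have "(\<Sum>b\<in>Basis. D b z) = 0" using True by (intro div) (simp add: P_def)
  also have "(\<Sum>b\<in>Basis. ((0, 1) \<bullet> b) * (A z \<bullet> b)) = (0, 1) \<bullet> A z" by (rule euclidean_inner[symmetric])
  also have "(\<Sum>b\<in>Basis. (Deta z \<bullet> b) * (A z \<bullet> b)) = Deta z \<bullet> A z" by (rule euclidean_inner[symmetric])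
  finally show ?thesis using True by (simp add: U_def V_def inner_prod_def inner_commute)
 qed (simp add: X'_def U_def V_def)
 hence "(LINT z|lborel. U z + V z) = (LINT z|lborel. (\<Sum>b\<in>Basis. X' b z))" by simp
 also have "... = (\<Sum>b\<in>Basis. LINT z|lborel. X' b z)" by (rule Bochner_Integration.integral_sum) (rule iX')
 also have "... = 0" by (rule sum.neutral) (use int0 in auto)
 finally have "(LINT z|lborel. U z) + (LINT z|lborel. V z) = 0" using iU iV by simp
 hence "(LINT z|lborel. U z) = - (LINT z|lborel. V z)" by simp
 thus "(LINT z|lborel. bump m (snd z) * (indicator {z. snd z > 0} z * (A z \<bullet> Deta z)))
  = - (LINT z|lborel. bump' m (snd z) * (indicator {z. snd z > 0} z * (eta z * snd (A z))))"
  unfolding U_def V_def P_def .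
 show "integrable lborel (\<lambda>z. bump' m (snd z) * (indicator {z. snd z > 0} z * (eta z * snd (A z))))"
  using iV unfolding V_def P_def .
qed

text \<open>Let \<open>m\<close> tend to infinity in \<open>bump_identity\<close>. The term of size
  \<open>4 / m\<close> disappears by the integrable bound on \<open>A\<close>. In the bottom layer a
  derivative of size \<open>4 * m\<close> meets a thickness \<open>2 / m\<close> and, by
  \<open>bot\<close>, a normal component of size \<open>\<delta>\<close>.\<close>

lemma divergence_free_weak:
 fixes A :: "'a::euclidean_space \<times> real \<Rightarrow> 'a \<times> real"
 assumes der: "\<And>z b. snd z > 0 \<Longrightarrow> b \<in> Basis \<Longrightarrow> ((\<lambda>s. A (z + s *\<^sub>R b) \<bullet> b) has_real_derivative D b z) (at 0)"
  and cA: "continuous_on {z. snd z > 0} A" and cD: "\<And>b. b \<in> Basis \<Longrightarrow> continuous_on {z. snd z > 0} (D b)"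
  and div: "\<And>z. snd z > 0 \<Longrightarrow> (\<Sum>b\<in>Basis. D b z) = 0"
  and bnd: "\<And>z. snd z > 0 \<Longrightarrow> norm (A z) \<le> CA * expw (snd z)"
  and bot: "\<And>R \<delta>. \<delta> > 0 \<Longrightarrow> \<exists>eps>0. \<forall>z. norm (fst z) \<le> R \<longrightarrow> 0 < snd z \<longrightarrow> snd z < eps \<longrightarrow> \<bar>snd (A z)\<bar> \<le> \<delta>"
  and eta: "C1_strip eta Deta" and supp: "\<And>z. snd z > 0 \<Longrightarrow> norm (fst z) \<ge> R \<Longrightarrow> eta z = 0 \<and> Deta z = 0"
  and bd: "\<And>z. snd z > 0 \<Longrightarrow> \<bar>eta z\<bar> \<le> C \<and> norm (Deta z) \<le> C"
 shows "(LINT z|lborel. indicator {z. snd z > 0} z * (A z \<bullet> Deta z)) = 0"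
proof -
 define P where "P = {z :: 'a \<times> real. snd z > 0}"
 define K where "K z = indicator P z * (A z \<bullet> Deta z)" for z
 define I where "I = (LINT z|lborel. K z)"
 define G where "G z = indicator {z. norm (fst z) < R} z * expw (snd z)" for z :: "'a \<times> real"
 have iG: "integrable lborel G" unfolding G_def by (rule integrable_half_cylinder)
 have C: "C \<ge> 0" using bd[of "(0, 1)"] by (auto intro: order_trans[OF abs_ge_zero])
 have e0: "expw t \<ge> 0" for t by (simp add: expw_def)
 have CA: "CA \<ge> 0"
 proof -
  have "0 \<le> CA * expw 1" using bnd[of "(0, 1)"] by (auto intro: order_trans[OF norm_ge_zero])
  thus ?thesis by (simp add: expw_def zero_le_mult_iff)
 qed
 have G0: "G z \<ge> 0" for z by (simp add: G_def e0)
 have Pm: "P \<in> sets borel" unfolding P_def by measurable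
 have Am: "(\<lambda>z. if z \<in> P then A z else 0) \<in> borel_measurable borel"
  by (rule borel_measurable_continuous_on_if[OF Pm]) (use cA in \<open>auto simp: P_def\<close>)
 have etam[measurable]: "eta \<in> borel_measurable borel" "Deta \<in> borel_measurable borel" using C1_stripD(3,4)[OF eta] .
 have "(\<lambda>z. (if z \<in> P then A z else 0) \<bullet> Deta z) \<in> borel_measurable borel" using Am by measurable
 also have "(\<lambda>z. (if z \<in> P then A z else 0) \<bullet> Deta z) = K" by (rule ext) (auto simp: K_def)
 finally have Km[measurable]: "K \<in> borel_measurable borel" .
 have bm: "(\<lambda>z :: 'a \<times> real. bump m (snd z)) \<in> borel_measurable borel" if "m \<ge> 1" for m
  by (intro borel_measurable_continuous_onI continuous_on_compose2[OF bump_props(2)[OF that]] continuous_intros) auto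
 have KG: "\<bar>K z\<bar> \<le> CA * C * G z" for z
 proof (cases "z \<in> P \<and> norm (fst z) < R")
  case True
  hence s: "snd z > 0" by (simp add: P_def)
  have "\<bar>A z \<bullet> Deta z\<bar> \<le> norm (A z) * norm (Deta z)" by (rule Cauchy_Schwarz_ineq2)
  also have "... \<le> (CA * expw (snd z)) * C" using bnd[OF s] bd[OF s] CA e0 by (intro mult_mono) auto
  also have "... = CA * C * expw (snd z)" by simp
  finally show ?thesis using True by (simp add: K_def G_def)
 next
  case False
  hence "\<not> snd z > 0 \<or> Deta z = 0" using supp[of z] unfolding P_def by force
  hence "K z = 0" by (auto simp: K_def P_def)
  thus ?thesis using CA C G0 by simp
 qed
 have lim: "(\<lambda>m. LINT z|lborel. bump (real (Suc m)) (snd z) * K z) \<longlonglongrightarrow> I"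
  unfolding I_def
 proof (rule integral_dominated_convergence[where w="\<lambda>z. CA * C * G z"])
  show "integrable lborel (\<lambda>z. CA * C * G z)" using iG by simp
  show "(\<lambda>z. bump (real (Suc m)) (snd z) * K z) \<in> borel_measurable lborel" for m
   using bm[of "real (Suc m)"] by measurable
  show "AE z in lborel. (\<lambda>m. bump (real (Suc m)) (snd z) * K z) \<longlonglongrightarrow> K z"
  proof (rule AE_I2)
   fix z
   show "(\<lambda>m. bump (real (Suc m)) (snd z) * K z) \<longlonglongrightarrow> K z"
   proof (cases "snd z > 0")
    case True
    obtain M :: nat where M: "real M > max (snd z) (2 / snd z)" using reals_Archimedean2 by blast
    have "eventually (\<lambda>m. bump (real (Suc m)) (snd z) * K z = K z) sequentially"
     using eventually_ge_at_top[of M]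
    proof eventually_elim
     case (elim m)
     hence "real (Suc m) > max (snd z) (2 / snd z)" using M by linarith
     hence "bump (real (Suc m)) (snd z) = 1" using True by (intro bump_props(11)) (auto simp: field_simps)
     thus ?case by simp
    qed
    thus ?thesis by (rule tendsto_eventually)
   qed (simp add: K_def P_def)
  qed
  show "AE z in lborel. norm (bump (real (Suc m)) (snd z) * K z) \<le> CA * C * G z" for m
  proof (rule AE_I2)
   fix z
   have "\<bar>bump (real (Suc m)) (snd z)\<bar> * \<bar>K z\<bar> \<le> 1 * \<bar>K z\<bar>" using bump_props(8,9)[of "real (Suc m)" "snd z"] by (intro mult_right_mono) auto
   thus "norm (bump (real (Suc m)) (snd z) * K z) \<le> CA * C * G z" using KG[of z] by (simp only: real_norm_def abs_mult)
  qed
 qed simp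
 define V where "V = measure lborel (ball (0 :: 'a) R)"
 have smallI: "\<bar>I\<bar> \<le> 8 * C * V * \<delta>" if \<delta>: "\<delta> > 0" for \<delta>
 proof -
  obtain eps where eps: "eps > 0" "\<And>z. norm (fst z) \<le> R \<Longrightarrow> 0 < snd z \<Longrightarrow> snd z < eps \<Longrightarrow> \<bar>snd (A z)\<bar> \<le> \<delta>" using bot[OF \<delta>, of R] by blast
  define g where "g = (LINT z|lborel. G z)"
  have est: "\<bar>LINT z|lborel. bump m (snd z) * K z\<bar> \<le> 8 * C * V * \<delta> + 4 * C * CA * g / m" if m: "m \<ge> 1" "2 / m \<le> eps" for m
  proof -
   define S where "S = ball (0 :: 'a) R \<times> {0<..<2 / m}"
   have Sem: "emeasure lborel S = ennreal (V * (2 / m))"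
   proof -
    have "emeasure lborel S = emeasure lborel (ball (0 :: 'a) R) * emeasure lborel {0<..<2 / m}"
     unfolding S_def lborel_prod[symmetric] by (rule lborel.emeasure_pair_measure_Times) auto
    also have "emeasure lborel (ball (0 :: 'a) R) = ennreal V" unfolding V_def by (rule emeasure_eq_ennreal_measure) (use emeasure_bounded_finite[OF bounded_ball, of "0 :: 'a" R] in \<open>simp add: less_top\<close>)
    also have "emeasure lborel {0<..<2 / m} = ennreal (2 / m)" using m by simp
    also have "ennreal V * ennreal (2 / m) = ennreal (V * (2 / m))" using m by (intro ennreal_mult[symmetric]) (auto simp: V_def)
    finally show ?thesis .
   qed
   have Sb: "S \<in> sets borel"
   proof -
    have "open S" unfolding S_def by (intro open_Times) auto
    thus ?thesis by simp
   qed
   have iS: "integrable lborel (indicator S :: _ \<Rightarrow> real)" using Sem Sb by (intro integrable_real_indicator) auto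
   have mS: "measure lborel S = V * (2 / m)" unfolding measure_def Sem using m by (simp add: V_def)
   have "\<bar>LINT z|lborel. bump m (snd z) * K z\<bar> = \<bar>LINT z|lborel. bump' m (snd z) * (indicator P z * (eta z * snd (A z)))\<bar>"
    using bump_identity(1)[OF der cA cD div eta supp m(1)] unfolding K_def P_def by (simp only: abs_minus_cancel)
   also have "... \<le> (LINT z|lborel. 4 * m * C * \<delta> * indicator S z + 4 * C * CA / m * G z)"
   proof (rule integral_abs_bound_integral)
    show "integrable lborel (\<lambda>z. bump' m (snd z) * (indicator P z * (eta z * snd (A z))))"
     unfolding P_def by (rule bump_identity(2)[OF der cA cD div eta supp m(1)])
    show "integrable lborel (\<lambda>z. 4 * m * C * \<delta> * indicator S z + 4 * C * CA / m * G z)" using iS iG by simp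
    fix z :: "'a \<times> real"
    show "\<bar>bump' m (snd z) * (indicator P z * (eta z * snd (A z)))\<bar> \<le> 4 * m * C * \<delta> * indicator S z + 4 * C * CA / m * G z"
    proof (cases "z \<in> P \<and> norm (fst z) < R")
     case True
     hence s: "snd z > 0" and r: "norm (fst z) < R" by (auto simp: P_def)
     have "\<bar>eta z * snd (A z)\<bar> \<le> C * \<bar>snd (A z)\<bar>" unfolding abs_mult using bd[OF s] by (intro mult_right_mono) auto
     hence "\<bar>bump' m (snd z)\<bar> * \<bar>eta z * snd (A z)\<bar> \<le> (4 * m * indicator {0<..<2 / m} (snd z) + 4 / m) * (C * \<bar>snd (A z)\<bar>)"
      using bump_props(10)[OF m(1) s] m by (intro mult_mono) auto
     also have "... = 4 * m * C * (indicator {0<..<2 / m} (snd z) * \<bar>snd (A z)\<bar>) + 4 * C / m * \<bar>snd (A z)\<bar>" by (simp add: algebra_simps)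
     also have "... \<le> 4 * m * C * (\<delta> * indicator S z) + 4 * C / m * (CA * G z)"
     proof (intro add_mono mult_left_mono)
      show "indicator {0<..<2 / m} (snd z) * \<bar>snd (A z)\<bar> \<le> \<delta> * indicator S z"
       using eps(2)[of z] r s m by (cases z) (auto simp: S_def indicator_def)
      have "\<bar>snd (A z)\<bar> \<le> norm (A z)" using norm_snd_le[of "snd (A z)" "fst (A z)"] by simp
      thus "\<bar>snd (A z)\<bar> \<le> CA * G z" using bnd[OF s] r by (simp add: G_def)
     qed (use m C in auto)
     finally show ?thesis using True by (simp add: abs_mult mult.assoc)
    next
     case False
     hence "\<not> snd z > 0 \<or> eta z = 0" using supp[of z] unfolding P_def by force
     hence "indicator P z * (eta z * snd (A z)) = 0" by (auto simp: P_def)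
     moreover have "4 * m * C * \<delta> * indicator S z \<ge> 0" "4 * C * CA / m * G z \<ge> 0" using m C CA \<delta> G0 by auto
     ultimately show ?thesis by (simp only: mult_zero_right abs_zero)
    qed
   qed
   also have "... = 4 * m * C * \<delta> * (V * (2 / m)) + 4 * C * CA / m * g"
    using iS iG Sb unfolding g_def mS[symmetric] by simp
   also have "... = 8 * C * V * \<delta> + 4 * C * CA * g / m" using m by simp
   finally show ?thesis .
  qed
  obtain M :: nat where M: "real M > 2 / eps" using reals_Archimedean2 by blast
  have ev: "eventually (\<lambda>m. \<bar>LINT z|lborel. bump (real (Suc m)) (snd z) * K z\<bar> \<le> 8 * C * V * \<delta> + 4 * C * CA * g * inverse (real (Suc m))) sequentially"
   using eventually_ge_at_top[of M]
  proof eventually_elim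
   case (elim m)
   hence "real (Suc m) > 2 / eps" using M by linarith
   hence "2 / real (Suc m) \<le> eps" using eps(1) by (simp add: field_simps)
   from est[OF _ this] show ?case by (simp add: divide_inverse)
  qed
  have "(\<lambda>m. 8 * C * V * \<delta> + 4 * C * CA * g * inverse (real (Suc m))) \<longlonglongrightarrow> 8 * C * V * \<delta> + 4 * C * CA * g * 0"
   by (intro tendsto_intros LIMSEQ_inverse_real_of_nat)
  from tendsto_le[OF _ this tendsto_rabs[OF lim] ev] show ?thesis by simp
 qed
 \<comment> \<open>The bound \<open>8 * C * V * \<delta>\<close> is available for every
   \<open>\<delta>\<close>; one proportional to \<open>\<bar>I\<bar>\<close> gives the
   contradiction.\<close>
 have "I = 0"
 proof (rule ccontr)
  assume "I \<noteq> 0"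
  define k where "k = 8 * C * V"
  have k: "k \<ge> 0" using C by (simp add: k_def V_def)
  have "\<bar>I\<bar> \<le> k * (\<bar>I\<bar> / (2 * (k + 1)))" unfolding k_def by (rule smallI) (use \<open>I \<noteq> 0\<close> k in \<open>auto simp: k_def\<close>)
  also have "... = \<bar>I\<bar> * (k / (2 * (k + 1)))" by simp
  also have "... < \<bar>I\<bar> * 1" using k \<open>I \<noteq> 0\<close> by (intro mult_strict_left_mono) auto
  finally show False by simp
 qed
 thus ?thesis unfolding I_def K_def P_def .
qed

section \<open>Level heights as coordinates\<close>

text \<open>For \<open>y = e^t grad u\<close> this is the gradient \<open>(p, q)\<close> of the
  level height: implicit differentiation gives \<open>p = - grad' u / u_n\<close> and
  \<open>q = e^(-t) / u_n\<close>.\<close>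

definition slope :: "'a::euclidean_space \<times> real \<Rightarrow> 'a \<times> real" where "slope y = (1 / snd y) *\<^sub>R (- fst y, 1)"

text \<open>The field \<open>(p / q, - (1 + |p|^2) / (2 * q^2))\<close> in terms of \<open>y\<close>
  instead of \<open>(p, q)\<close>; in this variable it is polynomial.\<close>

definition flux :: "'a::euclidean_space \<times> real \<Rightarrow> 'a \<times> real" where "flux y = (- fst y, - (norm y)\<^sup>2 / 2)"

text \<open>Monotonicity of the gradient of the convex function
  \<open>(1 + |p|^2) / (2 * q)\<close>. The parametrization by \<open>y\<close> turns it into an
  exact algebraic identity.\<close>

lemma flux_slope:
 assumes "snd y0 > 0" "snd y1 > 0"
 shows "(flux y1 - flux y0) \<bullet> (slope y1 - slope y0) = (1 / snd y0 + 1 / snd y1) / 2 * (norm (y1 - y0))^2"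
proof -
 define a1 a0 s1 s0 where "a1 = fst y1" and "a0 = fst y0" and "s1 = snd y1" and "s0 = snd y0"
 have s: "s1 > 0" "s0 > 0" using assms by (auto simp: s1_def s0_def)
 define X M Z where "X = a1 \<bullet> a1" and "M = a1 \<bullet> a0" and "Z = a0 \<bullet> a0"
 have "(flux y1 - flux y0) \<bullet> (slope y1 - slope y0)
  = (a1 - a0) \<bullet> ((1 / s1) *\<^sub>R a1 - (1 / s0) *\<^sub>R a0) - (X + s1^2 - (Z + s0^2)) / 2 * (1 / s1 - 1 / s0)"
  by (simp add: flux_def slope_def inner_prod_def norm_prod_def power2_norm_eq_inner[symmetric] X_def Z_def
   a1_def[symmetric] a0_def[symmetric] s1_def[symmetric] s0_def[symmetric] inner_diff_left inner_diff_right algebra_simps diff_divide_distrib add_divide_distrib)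
 also have "(a1 - a0) \<bullet> ((1 / s1) *\<^sub>R a1 - (1 / s0) *\<^sub>R a0) = X / s1 - M / s0 - M / s1 + Z / s0"
  by (simp add: inner_diff_left inner_diff_right X_def M_def Z_def inner_commute diff_divide_distrib)
 also have "X / s1 - M / s0 - M / s1 + Z / s0 - (X + s1^2 - (Z + s0^2)) / 2 * (1 / s1 - 1 / s0)
  = (1 / s0 + 1 / s1) / 2 * (X - 2 * M + Z + (s1 - s0)^2)"
  using s by (simp add: field_simps power2_eq_square)
 also have "X - 2 * M + Z + (s1 - s0)^2 = (norm (y1 - y0))^2"
  unfolding power2_norm_eq_inner X_def M_def Z_def a1_def a0_def s1_def s0_def
  by (simp add: inner_prod_def inner_diff_left inner_diff_right inner_commute power2_eq_square)
 finally show ?thesis by (simp add: s1_def s0_def)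
qed

text \<open>The distance \<open>d\<close> in the variable \<open>y\<close> mediates between slopes
  and fluxes: both differences are Lipschitz in it and their product controls \<open>d^2\<close>.
  Coercivity and growth in terms of the slopes alone follow.\<close>

lemma flux_slope_bounds:
 assumes k: "0 < k0" "k0 \<le> snd y0" "snd y0 \<le> k1" "k0 \<le> snd y1" "snd y1 \<le> k1" and B: "norm y0 \<le> B" "norm y1 \<le> B"
 defines "d \<equiv> norm (y1 - y0)" and "Cs \<equiv> 1 / k0 + (B + 1) / k0^2"
 shows "(flux y1 - flux y0) \<bullet> (slope y1 - slope y0) \<ge> d^2 / k1"
  "norm (flux y1 - flux y0) \<le> (1 + B) * d" "norm (slope y1 - slope y0) \<le> Cs * d"
proof -
 define s1 s0 where "s1 = snd y1" and "s0 = snd y0"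
 have s: "s1 > 0" "s0 > 0" "s1 \<le> k1" "s0 \<le> k1" "k0 \<le> s1" "k0 \<le> s0" using k by (auto simp: s1_def s0_def)
 have d0: "d \<ge> 0" by (simp add: d_def)
 have B0: "B \<ge> 0" using B(1) norm_ge_zero order_trans by blast
 have "1 / k1 \<le> 1 / s1" "1 / k1 \<le> 1 / s0" using s by (auto intro!: divide_left_mono)
 hence "1 / k1 * d^2 \<le> (1 / s0 + 1 / s1) / 2 * d^2" by (intro mult_right_mono) auto
 also have "... = (flux y1 - flux y0) \<bullet> (slope y1 - slope y0)"
  using flux_slope[OF s(2)[unfolded s0_def] s(1)[unfolded s1_def]] by (simp only: s1_def s0_def d_def)
 finally show "(flux y1 - flux y0) \<bullet> (slope y1 - slope y0) \<ge> d^2 / k1" by simp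
 have fd: "norm (fst y1 - fst y0) \<le> d"
  using norm_fst_le[of "fst (y1 - y0)" "snd (y1 - y0)", unfolded prod.collapse] by (simp add: d_def)
 have sd: "\<bar>s1 - s0\<bar> \<le> d"
  using norm_snd_le[of "snd (y1 - y0)" "fst (y1 - y0)", unfolded prod.collapse] by (simp add: d_def s1_def s0_def)
 have nd: "\<bar>norm y1 - norm y0\<bar> \<le> d" unfolding d_def by (rule norm_triangle_ineq3)
 have "norm (flux y1 - flux y0) \<le> norm (fst (flux y1 - flux y0)) + norm (snd (flux y1 - flux y0))"
  using norm_Pair_le[of "fst (flux y1 - flux y0)" "snd (flux y1 - flux y0)"] by (simp only: prod.collapse)
 also have "fst (flux y1 - flux y0) = - (fst y1 - fst y0)" by (simp add: flux_def)
 also have "snd (flux y1 - flux y0) = - ((norm y1 + norm y0) / 2 * (norm y1 - norm y0))"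
  by (simp add: flux_def power2_eq_square field_simps)
 also have "norm (- (fst y1 - fst y0)) + norm (- ((norm y1 + norm y0) / 2 * (norm y1 - norm y0))) \<le> d + B * d"
 proof (rule add_mono)
  have "(norm y1 + norm y0) / 2 * \<bar>norm y1 - norm y0\<bar> \<le> B * d" using B B0 nd by (intro mult_mono) auto
  thus "norm (- ((norm y1 + norm y0) / 2 * (norm y1 - norm y0))) \<le> B * d" by (simp add: abs_mult)
 qed (use fd in \<open>simp only: norm_minus_cancel\<close>)
 finally show "norm (flux y1 - flux y0) \<le> (1 + B) * d" by (simp add: algebra_simps)
 have "slope y1 - slope y0 = (1 / s1) *\<^sub>R (- (fst y1 - fst y0), 0) + (1 / s1 - 1 / s0) *\<^sub>R (- fst y0, 1)"
  by (simp add: slope_def s1_def[symmetric] s0_def[symmetric] algebra_simps)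
 hence "norm (slope y1 - slope y0) \<le> norm ((1 / s1) *\<^sub>R (- (fst y1 - fst y0), 0 :: real)) + norm ((1 / s1 - 1 / s0) *\<^sub>R (- fst y0, 1 :: real))"
  by (simp only: norm_triangle_ineq)
 also have "... = 1 / s1 * norm (fst y1 - fst y0) + \<bar>1 / s1 - 1 / s0\<bar> * norm (- fst y0, 1 :: real)"
  unfolding norm_scaleR using s by (simp add: norm_minus_commute)
 also have "... \<le> 1 / k0 * d + (d / k0^2) * (B + 1)"
 proof (intro add_mono mult_mono)
  show "1 / s1 \<le> 1 / k0" using s k by (intro divide_left_mono) auto
  have "\<bar>1 / s1 - 1 / s0\<bar> = \<bar>s1 - s0\<bar> / (s1 * s0)" using s by (simp add: divide_simps abs_mult) 
  also have "... \<le> d / k0^2" using s k sd unfolding power2_eq_square by (intro frac_le mult_mono) auto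
  finally show "\<bar>1 / s1 - 1 / s0\<bar> \<le> d / k0^2" .
  have "norm (- fst y0, 1 :: real) \<le> norm (- fst y0) + norm (1 :: real)" by (rule norm_Pair_le)
  moreover have "norm (fst y0) \<le> B" using norm_fst_le[of "fst y0" "snd y0"] B(1) by simp
  ultimately show "norm (- fst y0, 1 :: real) \<le> B + 1" by simp
 qed (use fd d0 k in auto)
 also have "... = Cs * d" by (simp add: Cs_def algebra_simps)
 finally show "norm (slope y1 - slope y0) \<le> Cs * d" .
qed

lemma sum_Basis_prod_real:
 fixes f :: "'a::euclidean_space \<times> real \<Rightarrow> real"
 shows "(\<Sum>b\<in>Basis. f b) = (\<Sum>i\<in>Basis. f (i, 0)) + f (0, 1)"
proof -
 have "(\<Sum>b\<in>Basis. f b) = (\<Sum>b\<in>(\<lambda>i. (i, 0)) ` (Basis :: 'a set). f b) + (\<Sum>b\<in>{(0, 1)}. f b)"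
  unfolding Basis_prod_def by (subst sum.union_disjoint[symmetric]) auto
 also have "(\<Sum>b\<in>(\<lambda>i. (i, 0)) ` (Basis :: 'a set). f b) = (\<Sum>i\<in>Basis. f (i, 0))"
  by (subst sum.reindex) (auto simp: inj_on_def)
 finally show ?thesis by simp
qed

section \<open>The coordinates \<open>(x', t)\<close> and the derivatives of the level
  heights\<close>

context overdetermined begin

lemma snd_G_pos: assumes "x \<in> Om" shows "snd (G x) > 0"
proof -
 obtain k0 where "k0 > 0" "\<forall>x\<in>Om. snd (G x) \<ge> k0 * (1 - u x)" using Gn_lower by blast
 moreover have "1 - u x > 0" using u_less_1[OF Om_Cl(2)[OF assms]] by simp
 ultimately have "0 < k0 * (1 - u x)" "k0 * (1 - u x) \<le> snd (G x)" using assms by auto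
 thus ?thesis by simp
qed

lemma vertical_strict: assumes "x \<in> Cl" "s > 0" shows "u (x + (0, s)) > u x"
proof -
 obtain r where r: "0 < r" "r < s" "u (x + (0, s)) - u x = s * (G (x + (0, r)) \<bullet> (0, 1))"
  using u_mvt_up[OF assms] by blast
 have "x + (0, r) \<in> Om" using assms(1) r(1) by (simp add: Om_def Cl_def)
 hence "snd (G (x + (0, r))) > 0" by (rule snd_G_pos)
 hence "s * (G (x + (0, r)) \<bullet> (0, 1)) > 0" using assms(2) by (simp add: inner_prod_def)
 thus ?thesis using r(3) by simp
qed

text \<open>Meaningful for \<open>t > 0\<close> only, where the level \<open>u = 1 - e\<^sup>-\<^sup>t\<close> is attained exactly once above each \<open>x'\<close>.\<close>
definition hh :: "'a \<times> real \<Rightarrow> real" where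
 "hh z = (THE y. y > \<phi> (fst z) \<and> u (fst z, y) = 1 - exp (- snd z))"

definition hod :: "'a \<times> real \<Rightarrow> 'a \<times> real" where "hod z = (fst z, hh z)"

lemma hh_unique: assumes "y > \<phi> (fst z)" "u (fst z, y) = 1 - exp (- snd z)" shows "hh z = y"
 unfolding hh_def
proof (rule the_equality)
 show "y > \<phi> (fst z) \<and> u (fst z, y) = 1 - exp (- snd z)" using assms by simp
 fix y' assume y': "y' > \<phi> (fst z) \<and> u (fst z, y') = 1 - exp (- snd z)"
 have ne: "\<not> a < b" if "u (fst z, a) = u (fst z, b)" "a > \<phi> (fst z)" for a b
 proof
  assume "a < b"
  hence "u ((fst z, a) + (0, b - a)) > u (fst z, a)" using that by (intro vertical_strict) (auto simp: Cl_def dd_def)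
  thus False using that by simp
 qed
 show "y' = y" using ne[of y' y] ne[of y y'] y' assms by (metis linorder_neqE_linordered_idom)
qed

lemma hod: assumes "snd z > 0" shows "hod z \<in> Om" "u (hod z) = 1 - exp (- snd z)"
proof -
 define e where "e = 1 - exp (- snd z)"
 have e: "0 < e" "e < 1" using assms by (auto simp: e_def)
 obtain D where D: "D > 0" "\<And>x. dd x \<ge> D \<Longrightarrow> u x \<ge> 1 - exp (- snd z)" using deep_limit[of "exp (- snd z)"] by auto
 define f where "f s = u (fst z, \<phi> (fst z) + s)" for s
 have "continuous_on {0..D} f" unfolding f_def
  by (intro continuous_on_compose2[OF uc] continuous_intros) (auto simp: Cl_def dd_def)
 moreover have "f 0 = 0" unfolding f_def by (rule u_zero) (simp add: dd_def)
 moreover have "f D \<ge> e" unfolding f_def e_def by (rule D(2)) (simp add: dd_def)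
 ultimately obtain s where s: "0 \<le> s" "s \<le> D" "f s = e" using IVT'[of f 0 e D] e D(1) by auto
 have "s > 0" using s e \<open>f 0 = 0\<close> by (cases "s = 0") auto
 hence hz: "hh z = \<phi> (fst z) + s" using s(3) by (intro hh_unique) (auto simp: f_def e_def)
 show "hod z \<in> Om" "u (hod z) = 1 - exp (- snd z)"
  using hz \<open>s > 0\<close> s(3) by (auto simp: hod_def Om_def dd_def f_def e_def)
qed

definition hodD :: "'a \<times> real \<Rightarrow> 'a \<times> real \<Rightarrow> 'a \<times> real" where
 "hodD z v = (fst v, (exp (- snd z) * snd v - fst (G (hod z)) \<bullet> fst v) / snd (G (hod z)))"

text \<open>Inverse function theorem for the map sending \<open>x\<close> to
  \<open>(fst x, - ln (1 - u x))\<close>, whose inverse \<open>hod\<close> is already known. The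
  inverse matrix \<open>hodD\<close> exists because \<open>snd (G (hod z)) > 0\<close>.\<close>

lemma hod_deriv: assumes z: "snd z > 0" shows "(hod has_derivative hodD z) (at z)"
proof -
 define X where "X = hod z"
 have X: "X \<in> Om" and uX: "u X = 1 - exp (- snd z)" using hod[OF z] by (auto simp: X_def)
 define f where "f x = (fst x, - ln (1 - u x))" for x
 define f' where "f' v = (fst v, (G X \<bullet> v) / (1 - u X))" for v
 have "fst X = fst z" by (simp add: X_def hod_def)
 hence fX: "f X = z" by (simp add: f_def uX prod_eq_iff)
 have lt: "u x < 1" if "x \<in> Om" for x using u_less_1[OF Om_Cl(2)[OF that]] .
 have "(hod has_derivative hodD z) (at (f X))"
 proof (rule has_derivative_inverse_strong[OF open_Om X])
  show "continuous_on Om f" unfolding f_def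
  proof (intro continuous_intros continuous_on_subset[OF uc Om_Cl(1)] ballI)
   show "1 - u x \<noteq> 0" if "x \<in> Om" for x using lt[OF that] by simp
  qed
  show "hod (f x) = x" if x: "x \<in> Om" for x
  proof -
   have "hh (f x) = snd x"
    by (rule hh_unique) (use x lt[OF x] in \<open>auto simp: f_def Om_def dd_def\<close>)
   thus ?thesis by (simp add: hod_def f_def prod_eq_iff)
  qed
  have "((\<lambda>x. - ln (1 - u x)) has_derivative (\<lambda>v. (G X \<bullet> v) / (1 - u X))) (at X)"
  proof -
   have "((\<lambda>y. - ln (1 - y)) has_real_derivative 1 / (1 - u X)) (at (u X))"
    using lt[OF X] by (auto intro!: derivative_eq_intros)
   hence "((\<lambda>y. - ln (1 - y)) has_derivative (\<lambda>h. h / (1 - u X))) (at (u X))"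
    unfolding has_field_derivative_def by (rule has_derivative_eq_rhs) auto
   from has_derivative_compose[OF u_deriv[OF X] this] show ?thesis .
  qed
  thus "(f has_derivative f') (at X)" unfolding f_def[abs_def] f'_def[abs_def]
   by (intro has_derivative_Pair has_derivative_fst has_derivative_ident)
  show "f' \<circ> hodD z = id"
  proof
   fix v
   have "snd (G X) > 0" by (rule snd_G_pos[OF X])
   thus "(f' \<circ> hodD z) v = id v"
    by (simp add: f'_def hodD_def X_def[symmetric] inner_prod_def uX prod_eq_iff)
  qed
 qed
 thus ?thesis by (simp add: fX)
qed

lemma hod_cont: "continuous_on {z. snd z > 0} hod"
 by (intro continuous_at_imp_continuous_on ballI) (auto intro!: has_derivative_continuous[OF hod_deriv])

lemma G_hod_cont: "continuous_on {z. snd z > 0} (\<lambda>z. G (hod z))"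
proof (rule continuous_on_compose2[OF Gc hod_cont])
 show "hod ` {z. snd z > 0} \<subseteq> Cl" using Om_Cl(2)[OF hod(1)] by blast
qed

text \<open>On the level \<open>t\<close> one has \<open>1 - u = e^(-t)\<close>, so this is the
  gradient divided by \<open>1 - u\<close>. The two-sided bounds keep it in a bounded set with
  vertical component bounded away from 0.\<close>

definition Y :: "'a \<times> real \<Rightarrow> 'a \<times> real" where "Y z = exp (snd z) *\<^sub>R G (hod z)"

lemma Y_cont: "continuous_on {z. snd z > 0} Y"
 unfolding Y_def by (intro continuous_intros G_hod_cont)

lemma Y_pos: "snd z > 0 \<Longrightarrow> snd (Y z) > 0"
 using snd_G_pos[OF hod(1)] by (simp add: Y_def)



lemma hh_deriv: assumes z: "snd z > 0" shows "(hh has_derivative (\<lambda>v. slope (Y z) \<bullet> v)) (at z)"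
proof -
 have "((\<lambda>z. snd (hod z)) has_derivative (\<lambda>v. snd (hodD z v))) (at z)"
  by (rule has_derivative_snd[OF hod_deriv[OF z]])
 moreover have "(\<lambda>v. snd (hodD z v)) = (\<lambda>v. slope (Y z) \<bullet> v)"
 proof
  fix v
  have gen: "(inverse E * b - a) / g = 1 / (E * g) * (b - E * a)" if "E > 0" "g > 0" for E g a b :: real
   using that by (simp add: field_simps)
  have "slope (Y z) \<bullet> v = 1 / (exp (snd z) * snd (G (hod z))) * (snd v - exp (snd z) * (fst (G (hod z)) \<bullet> fst v))"
   unfolding slope_def inner_scaleR_left by (simp add: Y_def inner_prod_def)
  thus "snd (hodD z v) = slope (Y z) \<bullet> v"
   using gen[OF exp_gt_zero snd_G_pos[OF hod(1)[OF z]]] by (simp only: hodD_def exp_minus snd_conv)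
 qed
 ultimately show ?thesis by (simp add: hod_def)
qed

lemma Y_bounds:
 "\<exists>k0>0. \<exists>k1\<ge>k0. \<forall>z. snd z > 0 \<longrightarrow> k0 \<le> snd (Y z) \<and> snd (Y z) \<le> k1 \<and> norm (Y z) \<le> (1 + L) * k1"
proof -
 obtain k0 where k0: "k0 > 0" "\<And>x. x \<in> Om \<Longrightarrow> snd (G x) \<ge> k0 * (1 - u x)" using Gn_lower by blast
 obtain k1 where k1: "k1 > 0" "\<And>x. x \<in> Om \<Longrightarrow> snd (G x) \<le> k1 * (1 - u x)" using Gn_upper by blast
 have *: "k0 \<le> snd (Y z) \<and> snd (Y z) \<le> k1 \<and> norm (Y z) \<le> (1 + L) * k1" if z: "snd z > 0" for z
 proof -
  note X = hod[OF z]
  have e: "exp (snd z) * exp (- snd z) = 1" by (simp add: exp_minus)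
  have "exp (snd z) * (k0 * exp (- snd z)) \<le> snd (Y z)" unfolding Y_def using k0(2)[OF X(1)] X(2) by simp
  hence 1: "k0 \<le> snd (Y z)" using e by (simp add: mult.left_commute)
  have "snd (Y z) \<le> exp (snd z) * (k1 * exp (- snd z))" unfolding Y_def using k1(2)[OF X(1)] X(2) by simp
  hence 2: "snd (Y z) \<le> k1" using e by (simp add: mult.left_commute)
  have "norm (Y z) = exp (snd z) * norm (G (hod z))" by (simp add: Y_def)
  also have "... \<le> exp (snd z) * ((1 + L) * snd (G (hod z)))" by (intro mult_left_mono G_bound X(1)) auto
  also have "... = (1 + L) * snd (Y z)" by (simp add: Y_def)
  also have "... \<le> (1 + L) * k1" using 2 L0 by (intro mult_left_mono) auto
  finally show ?thesis using 1 2 by simp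
 qed
 have "k0 \<le> k1" using *[of "(0, 1)"] by simp
 thus ?thesis using k0(1) * by blast
qed

section \<open>The equation in divergence form\<close>

abbreviation HG :: "'a \<times> real \<Rightarrow> 'a \<times> real \<Rightarrow> 'a \<times> real" where
 "HG b \<equiv> grad (partial_deriv b u)"

lemma HG:
 assumes b: "b \<in> Basis"
 shows "x \<in> Om \<Longrightarrow> ((\<lambda>x. G x \<bullet> b) has_derivative (\<lambda>h. HG b x \<bullet> h)) (at x)" "continuous_on Om (HG b)"
proof -
 have Om: "Om = {x. snd x > \<phi> (fst x)}" by (auto simp: Om_def dd_def)
 have C: "C_k_on (Suc 0) Om (partial_deriv b u)" using u_C2 b unfolding Om numeral_2_eq_2 C_k_on.simps by blast
 hence "continuous_on Om (partial_deriv i (partial_deriv b u))" if "i \<in> Basis" for i using that unfolding C_k_on.simps by blast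
 thus "continuous_on Om (HG b)" unfolding grad_def by (intro continuous_intros) auto
 assume x: "x \<in> Om"
 have "partial_deriv b u differentiable (at x)" using C x unfolding C_k_on.simps by blast
 from has_derivative_grad[OF this]
 show "((\<lambda>x. G x \<bullet> b) has_derivative (\<lambda>h. HG b x \<bullet> h)) (at x)"
  by (rule has_derivative_transform_within_open[OF _ open_Om x]) (use G_grad b in \<open>auto simp: Om\<close>)
qed

lemma HG_trace: assumes x: "x \<in> Om" shows "(\<Sum>b\<in>Basis. HG b x \<bullet> b) = W' (u x)"
proof -
 have "HG b x \<bullet> b = partial_deriv b (partial_deriv b u) x" if "b \<in> Basis" for b
  using that unfolding grad_def by (simp add: inner_sum_left inner_Basis if_distrib cong: if_cong)
 hence "(\<Sum>b\<in>Basis. HG b x \<bullet> b) = laplacian u x" by (simp add: laplacian_def)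
 thus ?thesis using u_eq[of x] x by (simp add: Om_def dd_def)
qed

text \<open>The components \<open>- e\<^sup>-\<^sup>t \<nabla>'u\<close> and \<open>- \<bar>\<nabla>u\<bar>\<^sup>2 / 2\<close> are, up to a function of \<open>t\<close>, the entries of the stress-energy
  tensor for vertical translations, transported to the coordinates \<open>(x', t)\<close>.\<close>
definition field :: "'a \<times> real \<Rightarrow> 'a \<times> real" where
 "field z = (- exp (- snd z) *\<^sub>R fst (G (hod z)), - (norm (G (hod z)))\<^sup>2 / 2)"

text \<open>The diagonal entries of the Jacobian only, which is all that a divergence
  involves.\<close>

definition Dfield :: "'a \<times> real \<Rightarrow> 'a \<times> real \<Rightarrow> real" where
 "Dfield b z = (if b = (0, 1) then - (\<Sum>i\<in>Basis. (G (hod z) \<bullet> i) * (HG i (hod z) \<bullet> hodD z b))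
   else - exp (- snd z) * (HG b (hod z) \<bullet> hodD z b))"

text \<open>Both components scale with \<open>exp (- 2 * t)\<close>: the horizontal one is linear in
  the gradient and has an explicit factor \<open>exp (- t)\<close>, the vertical one is
  quadratic.\<close>

lemma field_flux: "field z = exp (- 2 * snd z) *\<^sub>R flux (Y z)"
proof -
 define e where "e = exp (- snd z)" define E where "E = exp (snd z)"
 have 1: "exp (- 2 * snd z) = e * e" by (simp add: e_def exp_add[symmetric])
 have eE: "e * E = 1" by (simp add: e_def E_def exp_minus)
 have "e * e * E = e * (e * E)" "e * e * (E * n)^2 = (e * E) * (e * E) * n^2" for n :: real
  by (simp_all add: power2_eq_square)
 hence 2: "e * e * E = e" "e * e * (E * n)^2 = n^2" for n :: real unfolding eE by simp_all
 have "norm (Y z) = E * norm (G (hod z))" "fst (Y z) = E *\<^sub>R fst (G (hod z))" by (simp_all add: Y_def E_def)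
 thus ?thesis unfolding 1 using 2(1) 2(2)[of "norm (G (hod z))"]
  by (simp add: field_def flux_def e_def[symmetric])
qed

lemma G_hod_line:
 assumes z: "snd z > 0" and b: "b \<in> Basis"
 shows "((\<lambda>s. G (hod (z + s *\<^sub>R v)) \<bullet> b) has_real_derivative (HG b (hod z) \<bullet> hodD z v)) (at 0)"
proof -
 have 1: "((\<lambda>s. z + s *\<^sub>R v) has_derivative (\<lambda>s. s *\<^sub>R v)) (at 0)" by (auto intro!: derivative_eq_intros)
 have "((\<lambda>z. G (hod z) \<bullet> b) has_derivative (\<lambda>h. HG b (hod z) \<bullet> hodD z h)) (at z)"
  by (rule has_derivative_compose[OF hod_deriv[OF z] HG(1)[OF b hod(1)[OF z]]])
 hence 2: "((\<lambda>z. G (hod z) \<bullet> b) has_derivative (\<lambda>h. HG b (hod z) \<bullet> hodD z h)) (at (z + 0 *\<^sub>R v))" by simp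
 have lin: "hodD z (s *\<^sub>R v) = s *\<^sub>R hodD z v" for s using has_derivative_linear[OF hod_deriv[OF z]] by (simp add: linear_scale)
 from has_derivative_compose[OF 1 2] show ?thesis
  by (simp add: lin has_field_derivative_def mult_commute_abs)
qed

lemma field_deriv:
 assumes z: "snd z > 0" and b: "b \<in> Basis"
 shows "((\<lambda>s. field (z + s *\<^sub>R b) \<bullet> b) has_real_derivative Dfield b z) (at 0)"
proof (cases "b = (0, 1)")
 case True
 have "((\<lambda>s. - (\<Sum>i\<in>Basis. (G (hod (z + s *\<^sub>R b)) \<bullet> i)^2) / 2) has_real_derivative
   - (\<Sum>i\<in>Basis. 2 * (G (hod z) \<bullet> i) * (HG i (hod z) \<bullet> hodD z b)) / 2) (at 0)"
  by (intro DERIV_cdivide DERIV_minus DERIV_sum) (use DERIV_power[OF G_hod_line[OF z], where n=2] in \<open>simp add: mult_ac\<close>)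
 moreover have "- (\<Sum>i\<in>Basis. 2 * (G (hod z) \<bullet> i) * (HG i (hod z) \<bullet> hodD z b)) / 2 = Dfield b z"
  using True by (simp add: Dfield_def mult.assoc sum_distrib_left[symmetric])
 moreover have "field y \<bullet> b = - (\<Sum>i\<in>Basis. (G (hod y) \<bullet> i)^2) / 2" for y
 proof -
  have "(norm (G (hod y)))^2 = (\<Sum>i\<in>Basis. (G (hod y) \<bullet> i)^2)"
   unfolding power2_norm_eq_inner by (subst euclidean_inner) (simp add: power2_eq_square)
  thus ?thesis using True by (simp add: field_def inner_prod_def)
 qed
 ultimately show ?thesis by simp
next
 case False
 hence b': "snd b = 0" "b = (fst b, 0)" using b by (auto simp: Basis_prod_def)
 have f: "field (z + s *\<^sub>R b) \<bullet> b = - exp (- snd z) * (G (hod (z + s *\<^sub>R b)) \<bullet> b)" for s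
  using b' by (simp add: field_def inner_prod_def)
 show ?thesis unfolding f using DERIV_cmult[OF G_hod_line[OF z b], of "- exp (- snd z)" b] False by (simp add: Dfield_def)
qed

lemma Dfield_cont: assumes b: "b \<in> Basis" shows "continuous_on {z. snd z > 0} (Dfield b)"
proof -
 have cH: "continuous_on {z. snd z > 0} (\<lambda>z. HG i (hod z))" if "i \<in> Basis" for i
  by (rule continuous_on_compose2[OF HG(2)[OF that] hod_cont]) (use hod(1) in auto)
 note cG = G_hod_cont
 have ne: "snd (G (hod z)) \<noteq> 0" if "snd z > 0" for z using snd_G_pos[OF hod(1)[OF that]] by simp
 have c0: "continuous_on {z. snd z > 0} (\<lambda>z. hodD z b)"
  unfolding hodD_def by (intro continuous_intros cG) (use ne in auto)
 show ?thesis
 proof (cases "b = (0, 1)")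
  case True
  have "continuous_on {z. snd z > 0} (\<lambda>z. - (\<Sum>i\<in>Basis. (G (hod z) \<bullet> i) * (HG i (hod z) \<bullet> hodD z b)))"
   by (intro continuous_intros cG cH c0) auto
  thus ?thesis using True by (simp add: Dfield_def[abs_def])
 next
  case False
  have "continuous_on {z. snd z > 0} (\<lambda>z. - exp (- snd z) * (HG b (hod z) \<bullet> hodD z b))"
   by (intro continuous_intros cG cH c0 b)
  thus ?thesis using False by (simp add: Dfield_def[abs_def])
 qed
qed

lemma field_cont: "continuous_on {z. snd z > 0} field"
 unfolding field_def by (intro continuous_intros G_hod_cont) auto

text \<open>The mixed second derivatives in the horizontal components and in the vertical component
  cancel; they occur with the same order of differentiation and the same factor
  \<open>e / g\<close>. What remains is \<open>- e\<close> times the Laplacian, which on a level set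
  is a function of \<open>t\<close>.\<close>

lemma field_div: assumes z: "snd z > 0"
 shows "(\<Sum>b\<in>Basis. Dfield b z) = - exp (- snd z) * W' (1 - exp (- snd z))"
proof -
 define X where "X = hod z" define e where "e = exp (- snd z)" define g where "g = snd (G X)"
 have X: "X \<in> Om" and uX: "u X = 1 - e" using hod[OF z] by (auto simp: X_def e_def)
 have g: "g > 0" unfolding g_def by (rule snd_G_pos[OF X])
 have "Dfield (i, 0) z = - e * (HG (i, 0) X \<bullet> (i, 0)) + e / g * ((fst (G X) \<bullet> i) * snd (HG (i, 0) X))" for i :: 'a
  by (simp add: Dfield_def hodD_def X_def[symmetric] e_def[symmetric] g_def[symmetric] inner_prod_def algebra_simps)
 hence 1: "(\<Sum>i\<in>Basis. Dfield (i, 0) z) = - e * (\<Sum>i\<in>Basis. HG (i, 0) X \<bullet> (i, 0)) + e / g * (\<Sum>i\<in>Basis. (fst (G X) \<bullet> i) * snd (HG (i, 0) X))"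
  by (simp only: sum.distrib sum_distrib_left)
 have "Dfield (0, 1) z = - (\<Sum>i\<in>Basis. (G X \<bullet> i) * (snd (HG i X) * (e / g)))"
  by (simp add: Dfield_def hodD_def X_def[symmetric] e_def[symmetric] g_def[symmetric] inner_prod_def)
 also have "... = - (\<Sum>i\<in>Basis. (fst (G X) \<bullet> i) * (snd (HG (i, 0) X) * (e / g))) - g * (snd (HG (0, 1) X) * (e / g))"
  by (subst sum_Basis_prod_real) (simp add: inner_prod_def g_def)
 also have "... = - (e / g * (\<Sum>i\<in>Basis. (fst (G X) \<bullet> i) * snd (HG (i, 0) X))) - e * (HG (0, 1) X \<bullet> (0, 1))"
  using g by (simp add: sum_distrib_left inner_prod_def mult_ac)
 finally have 2: "Dfield (0, 1) z = - (e / g * (\<Sum>i\<in>Basis. (fst (G X) \<bullet> i) * snd (HG (i, 0) X))) - e * (HG (0, 1) X \<bullet> (0, 1))" .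
 have "(\<Sum>b\<in>Basis. Dfield b z) = (\<Sum>i\<in>Basis. Dfield (i, 0) z) + Dfield (0, 1) z" by (rule sum_Basis_prod_real)
 also have "... = - e * ((\<Sum>i\<in>Basis. HG (i, 0) X \<bullet> (i, 0)) + HG (0, 1) X \<bullet> (0, 1))" unfolding 1 2 by (simp add: algebra_simps)
 also have "(\<Sum>i\<in>Basis. HG (i, 0) X \<bullet> (i, 0)) + HG (0, 1) X \<bullet> (0, 1) = (\<Sum>b\<in>Basis. HG b X \<bullet> b)" by (rule sum_Basis_prod_real[symmetric])
 also have "... = W' (1 - e)" using HG_trace[OF X] uX by simp
 finally show ?thesis by (simp add: e_def)
qed

text \<open>Along vertical lines \<open>- ln (1 - u)\<close> grows at least at rate
  \<open>k0\<close>, so the level \<open>t\<close> lies at height at most \<open>t / k0\<close>. In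
  particular the level heights tend to \<open>\<phi>\<close> uniformly as \<open>t\<close> tends to
  0.\<close>

lemma hh_height: "\<exists>k>0. \<forall>z. snd z > 0 \<longrightarrow> hh z - \<phi> (fst z) \<le> k * snd z"
proof -
 obtain k0 where k0: "k0 > 0" "\<And>x. x \<in> Om \<Longrightarrow> snd (G x) \<ge> k0 * (1 - u x)" using Gn_lower by blast
 have "hh z - \<phi> (fst z) \<le> 1 / k0 * snd z" if z: "snd z > 0" for z
 proof -
  define s where "s = hh z - \<phi> (fst z)"
  define x where "x = (fst z, \<phi> (fst z))"
  have s: "s > 0" using hod(1)[OF z] by (simp add: s_def Om_def dd_def hod_def)
  have xC: "x + (0, r) \<in> Cl" if "r \<ge> 0" for r using that by (simp add: x_def Cl_def dd_def)
  have xO: "x + (0, r) \<in> Om" if "r > 0" for r using that by (simp add: x_def Om_def dd_def)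
  define f where "f r = - ln (1 - u (x + (0, r)))" for r
  have "continuous_on {0..s} f" unfolding f_def
   using u_less_1[OF xC] by (intro continuous_intros continuous_on_compose2[OF uc] image_subsetI xC) (auto simp: less_imp_neq)
  moreover have "(f has_derivative (\<lambda>h. (snd (G (x + (0, r))) / (1 - u (x + (0, r)))) * h)) (at r)" if "0 < r" "r < s" for r
  proof -
   have "((\<lambda>r. x + (0, r)) has_derivative (\<lambda>h. (0, h))) (at r)" by (auto intro!: derivative_eq_intros)
   from has_derivative_compose[OF this u_deriv[OF xO[OF that(1)]]]
   have "((\<lambda>r. u (x + (0, r))) has_real_derivative snd (G (x + (0, r)))) (at r)"
    by (simp add: has_field_derivative_def inner_prod_def mult_commute_abs)
   hence "(f has_real_derivative snd (G (x + (0, r))) / (1 - u (x + (0, r)))) (at r)"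
    unfolding f_def[abs_def] using u_less_1[OF xC, of r] that by (auto intro!: derivative_eq_intros)
   thus ?thesis unfolding has_field_derivative_def .
  qed
  ultimately obtain r where r: "r \<in> {0<..<s}" "f s - f 0 = (snd (G (x + (0, r))) / (1 - u (x + (0, r)))) * (s - 0)"
   using mvt[OF s, of f "\<lambda>r h. (snd (G (x + (0, r))) / (1 - u (x + (0, r)))) * h"] by auto
  have "f 0 = 0" using u_zero[of x] by (simp add: f_def x_def dd_def zero_prod_def[symmetric])
  moreover have "f s = snd z" using hod(2)[OF z] by (simp add: f_def x_def s_def hod_def)
  moreover have "snd (G (x + (0, r))) / (1 - u (x + (0, r))) \<ge> k0"
   using k0(2)[OF xO, of r] u_less_1[OF xC, of r] r(1) by (simp add: field_simps)
  moreover from this have "k0 * s \<le> (snd (G (x + (0, r))) / (1 - u (x + (0, r)))) * s" using s by (intro mult_right_mono) auto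
  ultimately have "snd z \<ge> k0 * s" using r(2) by simp
  thus ?thesis using k0(1) by (simp add: s_def field_simps)
 qed
 thus ?thesis using k0(1) by (intro exI[of _ "1 / k0"]) auto
qed

text \<open>Here the overdetermined condition enters, through \<open>\<bar>\<nabla>u\<bar>\<^sup>2 = c\<^sup>2\<close> on the boundary.\<close>
lemma field_bottom:
 assumes \<delta>: "\<delta> > 0"
 shows "\<exists>eps>0. \<forall>z. norm (fst z) \<le> R \<longrightarrow> 0 < snd z \<longrightarrow> snd z < eps \<longrightarrow> \<bar>snd (field z) + c^2 / 2\<bar> \<le> \<delta>"
proof -
 obtain k where k: "k > 0" "\<And>z. snd z > 0 \<Longrightarrow> hh z - \<phi> (fst z) \<le> k * snd z" using hh_height by blast
 define F where "F y = (norm (G (fst y, \<phi> (fst y) + snd y)))^2 / 2" for y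
 define K where "K = cball (0 :: 'a) R \<times> {0..1 :: real}"
 have "continuous_on K F" unfolding F_def K_def
  by (intro continuous_intros continuous_on_compose2[OF Gc] continuous_on_compose2[OF phi_cont]) (auto simp: Cl_def dd_def)
 moreover have "compact K" unfolding K_def by (intro compact_Times) auto
 ultimately have "uniformly_continuous_on K F" by (intro compact_uniformly_continuous)
 then obtain d where d: "d > 0" "\<And>y y'. y \<in> K \<Longrightarrow> y' \<in> K \<Longrightarrow> dist y' y < d \<Longrightarrow> dist (F y') (F y) < \<delta>"
  unfolding uniformly_continuous_on_def using \<delta> by meson
 show ?thesis
 \<comment> \<open>For such \<open>t\<close> the level lies at height less than
   \<open>min 1 d\<close>, within reach of the uniform continuity of \<open>F\<close>.\<close>
 proof (intro exI[of _ "min 1 d / k"] conjI allI impI)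
  show "min 1 d / k > 0" using d k by simp
  fix z :: "'a \<times> real" assume z: "norm (fst z) \<le> R" "0 < snd z" "snd z < min 1 d / k"
  define s where "s = hh z - \<phi> (fst z)"
  have s0: "s > 0" using hod(1)[OF z(2)] by (simp add: s_def Om_def dd_def hod_def)
  have "s \<le> k * snd z" unfolding s_def by (rule k(2)[OF z(2)])
  also have "... < min 1 d" using z(3) k by (simp add: field_simps)
  finally have s1: "s < 1" "s < d" by auto
  have "dist (F (fst z, s)) (F (fst z, 0)) < \<delta>"
   by (rule d(2)) (use z s0 s1 in \<open>auto simp: K_def dist_norm\<close>)
  moreover have "F (fst z, 0) = c^2 / 2" unfolding F_def by (subst G_norm_bdry) (auto simp: dd_def)
  moreover have "F (fst z, s) = - snd (field z)" by (simp add: F_def s_def field_def hod_def)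
  ultimately show "\<bar>snd (field z) + c^2 / 2\<bar> \<le> \<delta>" by (simp add: dist_real_def)
 qed
qed


section \<open>Horizontal translates of the level heights\<close>

lemma hh_shift_le:
 assumes z: "snd z > 0" shows "hh (z + (tau, 0)) \<le> hh z + L * norm tau"
proof (rule ccontr)
 assume "\<not> ?thesis"
 hence gt: "hh (z + (tau, 0)) > hh z + L * norm tau" by simp
 have z': "snd (z + (tau, 0)) > 0" using z by simp
 define P where "P = hod z + (tau, L * norm tau)"
 define s where "s = hh (z + (tau, 0)) - (hh z + L * norm tau)"
 have zC: "hod z \<in> Cl" by (rule Om_Cl(2)[OF hod(1)[OF z]])
 have "dd P \<ge> dd (hod z) + L * norm tau - L * norm tau" unfolding P_def by (rule dd_add)
 hence PC: "P \<in> Cl" using zC by (simp add: Cl_def)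
 have "u (P + (0, s)) > u P" using gt by (intro vertical_strict[OF PC]) (simp add: s_def)
 moreover have "P + (0, s) = hod (z + (tau, 0))" by (simp add: P_def s_def hod_def)
 moreover have "u P \<ge> u (hod z)" unfolding P_def by (rule slide[OF _ zC]) simp
 ultimately show False using hod(2)[OF z] hod(2)[OF z'] by simp
qed

text \<open>A translation in \<open>x'\<close> changes neither the divergence, a function of
  \<open>t\<close>, nor the limit \<open>- c^2 / 2\<close> of the vertical component at the bottom.
  Both cancel in the difference.\<close>

lemma field_weak:
 assumes eta: "C1_strip eta Deta" and supp: "\<And>z. snd z > 0 \<Longrightarrow> norm (fst z) \<ge> R \<Longrightarrow> eta z = 0 \<and> Deta z = 0"
  and bd: "\<And>z. snd z > 0 \<Longrightarrow> \<bar>eta z\<bar> \<le> C \<and> norm (Deta z) \<le> C"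
  and CA: "\<And>z. snd z > 0 \<Longrightarrow> norm (field (z + (tau, 0)) - field z) \<le> CA * expw (snd z)"
 shows "(LINT z|lborel. indicator {z. snd z > 0} z * ((field (z + (tau, 0)) - field z) \<bullet> Deta z)) = 0"
proof (rule divergence_free_weak[where A="\<lambda>z. field (z + (tau, 0)) - field z" and D="\<lambda>b z. Dfield b (z + (tau, 0)) - Dfield b z", OF _ _ _ _ CA _ eta supp bd])
 fix z b :: "'a \<times> real" assume z: "snd z > 0" and b: "b \<in> Basis"
 have z': "snd (z + (tau, 0)) > 0" using z by simp
 have "((\<lambda>s. field (z + (tau, 0) + s *\<^sub>R b) \<bullet> b - field (z + s *\<^sub>R b) \<bullet> b) has_real_derivative (Dfield b (z + (tau, 0)) - Dfield b z)) (at 0)"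
  by (rule DERIV_diff[OF field_deriv[OF z' b] field_deriv[OF z b]])
 thus "((\<lambda>s. (field (z + s *\<^sub>R b + (tau, 0)) - field (z + s *\<^sub>R b)) \<bullet> b) has_real_derivative (Dfield b (z + (tau, 0)) - Dfield b z)) (at 0)"
  by (simp only: inner_diff_left add.commute add.left_commute)
next
 have sub: "(\<lambda>z. z + (tau, 0)) ` {z :: 'a \<times> real. snd z > 0} \<subseteq> {z. snd z > 0}" by auto
 have ct: "continuous_on {z :: 'a \<times> real. snd z > 0} (\<lambda>z. z + (tau, 0))" by (intro continuous_intros)
 show "continuous_on {z. snd z > 0} (\<lambda>z. field (z + (tau, 0)) - field z)"
  by (intro continuous_on_diff field_cont continuous_on_compose2[OF field_cont ct sub])
 show "continuous_on {z. snd z > 0} (\<lambda>z. Dfield b (z + (tau, 0)) - Dfield b z)" if "b \<in> Basis" for b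
  by (intro continuous_on_diff Dfield_cont[OF that] continuous_on_compose2[OF Dfield_cont[OF that] ct sub])
 show "(\<Sum>b\<in>Basis. Dfield b (z + (tau, 0)) - Dfield b z) = 0" if z: "snd z > 0" for z
 proof -
  have z': "snd (z + (tau, 0)) > 0" using z by simp
  show ?thesis unfolding sum_subtractf field_div[OF z] field_div[OF z'] by simp
 qed
 show "\<exists>eps>0. \<forall>z. norm (fst z) \<le> r \<longrightarrow> 0 < snd z \<longrightarrow> snd z < eps \<longrightarrow> \<bar>snd (field (z + (tau, 0)) - field z)\<bar> \<le> \<delta>" if \<delta>: "\<delta> > 0" for r \<delta>
 proof -
  obtain eps where e: "eps > 0" "\<And>z. norm (fst z) \<le> r + norm tau \<Longrightarrow> 0 < snd z \<Longrightarrow> snd z < eps \<Longrightarrow> \<bar>snd (field z) + c^2 / 2\<bar> \<le> \<delta> / 2"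
   using field_bottom[of "\<delta> / 2" "r + norm tau"] \<delta> by auto
  show ?thesis
  proof (intro exI[of _ eps] conjI allI impI e(1))
   fix z :: "'a \<times> real" assume z: "norm (fst z) \<le> r" "0 < snd z" "snd z < eps"
   have "norm (fst (z + (tau, 0))) \<le> r + norm tau" using z(1) norm_triangle_ineq[of "fst z" tau] by simp
   hence 1: "\<bar>snd (field (z + (tau, 0))) + c^2 / 2\<bar> \<le> \<delta> / 2" using z by (intro e(2)) auto
   have 2: "\<bar>snd (field z) + c^2 / 2\<bar> \<le> \<delta> / 2" using z by (intro e(2)) (auto intro: add_increasing2)
   have "snd (field (z + (tau, 0)) - field z) = (snd (field (z + (tau, 0))) + c^2 / 2) - (snd (field z) + c^2 / 2)" by simp
   thus "\<bar>snd (field (z + (tau, 0)) - field z)\<bar> \<le> \<delta>" using 1 2 by linarith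
  qed
 qed
qed

text \<open>The Liouville theorem for the difference of two translates. Sliding bounds it by
  \<open>L * norm tau\<close>, and since the flux is a uniformly monotone and Lipschitz function of
  the slope, the difference of the fluxes is admissible as \<open>J\<close> without any
  linearization.\<close>

lemma hh_translate: "\<exists>C. \<forall>z. snd z > 0 \<longrightarrow> hh (z + (tau, 0)) - hh z = C"
proof -
 obtain k0 k1 where k: "k0 > 0" "k1 \<ge> k0" and kb: "\<And>z. snd z > 0 \<Longrightarrow> k0 \<le> snd (Y z) \<and> snd (Y z) \<le> k1 \<and> norm (Y z) \<le> (1 + L) * k1"
  using Y_bounds by blast
 define B where "B = (1 + L) * k1"
 have B: "B \<ge> 0" using k L0 by (simp add: B_def)
 define Cs where "Cs = 1 / k0 + (B + 1) / k0^2"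
 have Cs: "Cs > 0" using k B by (simp add: Cs_def add_pos_nonneg)
 define T where "T z = z + (tau, 0)" for z :: "'a \<times> real"
 have T: "snd (T z) = snd z" for z by (simp add: T_def)
 define H where "H = {z :: 'a \<times> real. snd z > 0}"
 have oH: "open H" unfolding H_def by (intro open_Collect_less continuous_intros)
 \<comment> \<open>The value 0 for \<open>t \<le> 0\<close>, where \<open>hh\<close> has no meaning,
   makes the function Borel on the whole space.\<close>
 define w where "w z = (if z \<in> H then hh (T z) - hh z else 0)" for z
 define Dw where "Dw z = (if z \<in> H then slope (Y (T z)) - slope (Y z) else 0)" for z
 define J where "J z = (if z \<in> H then flux (Y (T z)) - flux (Y z) else 0)" for z
 define d where "d z = norm (Y (T z) - Y z)" for z
 have d0: "d z \<ge> 0" for z by (simp add: d_def)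
 have bounds: "J z \<bullet> Dw z \<ge> (d z)^2 / k1" "norm (J z) \<le> (1 + B) * d z" "norm (Dw z) \<le> Cs * d z" if z: "snd z > 0" for z
  using flux_slope_bounds[OF k(1), where ?y0.0="Y z" and ?y1.0="Y (T z)" and B=B and ?k1.0=k1] kb[OF z] kb[of "T z"] z T[of z]
  by (simp_all add: J_def Dw_def H_def d_def Cs_def B_def)
 have d2B: "d z \<le> 2 * B" if z: "snd z > 0" for z
  using kb[OF z] kb[of "T z"] z T[of z] norm_triangle_ineq4[of "Y (T z)" "Y z"] by (simp add: d_def B_def)
 have k1: "k1 > 0" using k by simp
 \<comment> \<open>Coercivity read backwards:
   \<open>d^2 / k1 \<le> J \<bullet> Dw \<le> (1 + B) * d * |Dw|\<close> bounds \<open>d\<close> by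
   the difference of the slopes.\<close>
 have dDw: "d z \<le> k1 * (1 + B) * norm (Dw z)" if z: "snd z > 0" for z
 proof (cases "d z = 0")
  case False
  hence dz: "d z > 0" using d0[of z] by simp
  have "(d z)^2 / k1 \<le> J z \<bullet> Dw z" by (rule bounds(1)[OF z])
  also have "... \<le> norm (J z) * norm (Dw z)" by (rule norm_cauchy_schwarz)
  also have "... \<le> (1 + B) * d z * norm (Dw z)" by (intro mult_right_mono bounds(2)[OF z]) auto
  finally have "(d z)^2 \<le> (1 + B) * d z * norm (Dw z) * k1" using k1 by (simp add: field_simps)
  hence "d z * d z \<le> d z * (k1 * (1 + B) * norm (Dw z))" by (simp add: power2_eq_square mult_ac)
  thus ?thesis using dz by simp
 qed (use k1 B in auto)
 have cT: "continuous_on H T" "T ` H \<subseteq> H" by (auto simp: T_def H_def intro!: continuous_intros)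
 have cY: "continuous_on H Y" "continuous_on H (\<lambda>z. Y (T z))"
  using Y_cont continuous_on_compose2[OF Y_cont[folded H_def] cT] by (auto simp: H_def)
 have Yne: "snd (Y z) \<noteq> 0" "snd (Y (T z)) \<noteq> 0" if "z \<in> H" for z
  using Y_pos[of z] Y_pos[of "T z"] that T[of z] by (auto simp: H_def)
 have cDw: "continuous_on H (\<lambda>z. slope (Y (T z)) - slope (Y z))" unfolding slope_def
  by (intro continuous_intros cY) (use Yne in auto)
 have cJ: "continuous_on H (\<lambda>z. flux (Y (T z)) - flux (Y z))" unfolding flux_def
  by (intro continuous_intros cY) auto
 have Hb: "H \<in> sets borel" using oH by simp
 have derw: "(w has_derivative (\<lambda>h. Dw z \<bullet> h)) (at z)" if z: "snd z > 0" for z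
 proof -
  have z': "snd (T z) > 0" using z T by simp
  have "(T has_derivative (\<lambda>h. h)) (at z)" unfolding T_def[abs_def] by (auto intro!: derivative_eq_intros)
  from has_derivative_compose[OF this hh_deriv[OF z']]
  have "((\<lambda>z. hh (T z) - hh z) has_derivative (\<lambda>h. slope (Y (T z)) \<bullet> h - slope (Y z) \<bullet> h)) (at z)"
   by (intro has_derivative_diff hh_deriv[OF z])
  hence "((\<lambda>z. hh (T z) - hh z) has_derivative (\<lambda>h. Dw z \<bullet> h)) (at z)" using z by (simp add: Dw_def H_def inner_diff_left)
  thus ?thesis by (rule has_derivative_transform_within_open[OF _ oH]) (use z in \<open>auto simp: w_def H_def\<close>)
 qed
 have cw: "continuous_on H (\<lambda>z. hh (T z) - hh z)"
 proof -
  have "continuous_on H w" by (intro continuous_at_imp_continuous_on ballI) (auto simp: H_def intro!: has_derivative_continuous[OF derw])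
  thus ?thesis by (rule continuous_on_eq) (auto simp: w_def)
 qed
 have C1w: "C1_strip w Dw"
  unfolding C1_strip_def
 proof (intro conjI allI impI)
  show "continuous_on {z. snd z > 0} Dw" using continuous_on_eq[OF cDw, of Dw] by (auto simp: Dw_def H_def)
  show "w \<in> borel_measurable borel" unfolding w_def[abs_def]
   by (rule borel_measurable_continuous_on_if[OF Hb cw]) auto
  show "Dw \<in> borel_measurable borel" unfolding Dw_def[abs_def]
   by (rule borel_measurable_continuous_on_if[OF Hb cDw]) auto
 qed (rule derw)
 have Jm: "J \<in> borel_measurable borel" unfolding J_def[abs_def]
  by (rule borel_measurable_continuous_on_if[OF Hb cJ]) auto
 have fieldJ: "field (T z) - field z = exp (- 2 * snd z) *\<^sub>R J z" if "snd z > 0" for z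
  using that by (simp add: field_flux T J_def H_def scaleR_diff_right)
 \<comment> \<open>The coercivity constant combines \<open>d^2 / k1\<close> with
   \<open>|Dw| \<le> Cs * d\<close>; the growth constant combines
   \<open>|J| \<le> (1 + B) * d\<close> with \<open>dDw\<close>.\<close>
 interpret strip_solution w Dw J "1 / (k1 * Cs^2)" "(1 + B) * (k1 * (1 + B))" "L * norm tau + Cs * (2 * B)"
 proof
  show "C1_strip w Dw" by (rule C1w)
  show "J \<in> borel_measurable borel" by (rule Jm)
  show "1 / (k1 * Cs^2) > 0" using k1 Cs by simp
  show "(1 + B) * (k1 * (1 + B)) \<ge> 0" using k1 B by simp
 next
  fix z :: "'a \<times> real" assume z: "snd z > 0"
  have z': "snd (T z) > 0" using z T by simp
  have Lt: "L * norm tau \<ge> 0" using L0 by simp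
  have "T z + (- tau, 0) = z" by (simp add: T_def prod_eq_iff)
  hence "hh z \<le> hh (T z) + L * norm tau" using hh_shift_le[OF z', of "- tau"] by simp
  moreover have "hh (T z) \<le> hh z + L * norm tau" unfolding T_def by (rule hh_shift_le[OF z])
  ultimately have "\<bar>w z\<bar> \<le> L * norm tau" using z by (simp add: w_def H_def)
  moreover have "Cs * (2 * B) \<ge> 0" using Cs B by simp
  ultimately show "\<bar>w z\<bar> \<le> L * norm tau + Cs * (2 * B)" by linarith
  have "norm (Dw z) \<le> Cs * (2 * B)" by (rule order_trans[OF bounds(3)[OF z] mult_left_mono[OF d2B[OF z]]]) (use Cs in simp)
  thus "norm (Dw z) \<le> L * norm tau + Cs * (2 * B)" using Lt by linarith
  have "(norm (Dw z))^2 \<le> (Cs * d z)^2" using bounds(3)[OF z] by (intro power_mono) auto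
  hence "1 / (k1 * Cs^2) * (norm (Dw z))^2 \<le> 1 / (k1 * Cs^2) * (Cs * d z)^2" using k1 by (intro mult_left_mono) auto
  also have "... = (d z)^2 / k1" using Cs by (simp add: power_mult_distrib)
  also note bounds(1)[OF z]
  finally show "1 / (k1 * Cs^2) * (norm (Dw z))^2 \<le> J z \<bullet> Dw z" .
  have "norm (J z) \<le> (1 + B) * (k1 * (1 + B) * norm (Dw z))"
   by (rule order_trans[OF bounds(2)[OF z] mult_left_mono[OF dDw[OF z]]]) (use B in simp)
  thus "norm (J z) \<le> (1 + B) * (k1 * (1 + B)) * norm (Dw z)" by (simp only: mult.assoc)
 next
  fix eta :: "'a \<times> real \<Rightarrow> real" and Deta R C
  assume eta: "C1_strip eta Deta" "\<And>z. snd z > 0 \<Longrightarrow> norm (fst z) \<ge> R \<Longrightarrow> eta z = 0 \<and> Deta z = 0"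
   "\<And>z. snd z > 0 \<Longrightarrow> \<bar>eta z\<bar> \<le> C \<and> norm (Deta z) \<le> C"
  have [measurable]: "Deta \<in> borel_measurable borel" by (rule C1_stripD(4)[OF eta(1)])
  have "(LINT z|lborel. indicator {z. snd z > 0} z * ((field (z + (tau, 0)) - field z) \<bullet> Deta z)) = 0"
  proof (rule field_weak[OF eta, where CA="(1 + B) * (2 * B)"])
   fix z :: "'a \<times> real" assume z: "snd z > 0"
   have "norm (J z) \<le> (1 + B) * (2 * B)" by (rule order_trans[OF bounds(2)[OF z] mult_left_mono[OF d2B[OF z]]]) (use B in simp)
   hence "exp (- 2 * snd z) * norm (J z) \<le> exp (- 2 * snd z) * ((1 + B) * (2 * B))" by (intro mult_left_mono) auto
   also have "... \<le> (1 + B) * (2 * B) * expw (snd z)" using z B by (simp add: expw_def)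
   finally show "norm (field (z + (tau, 0)) - field z) \<le> (1 + B) * (2 * B) * expw (snd z)"
    using fieldJ[OF z] by (simp add: T_def)
  qed
  moreover have "(LINT z|strip. J z \<bullet> Deta z) = (LINT z|lborel. expw (snd z) *\<^sub>R (J z \<bullet> Deta z))"
   unfolding strip_def using Jm by (intro integral_density) auto
  \<comment> \<open>The density of \<open>strip\<close> is twice the weight
    \<open>exp (- 2 * t)\<close> that \<open>field\<close> carries.\<close>
  moreover have "expw (snd z) *\<^sub>R (J z \<bullet> Deta z) = 2 * (indicator {z. snd z > 0} z * ((field (z + (tau, 0)) - field z) \<bullet> Deta z))" for z
   using fieldJ[of z] by (simp add: expw_def T_def indicator_def)
  ultimately show "(LINT z|strip. J z \<bullet> Deta z) = 0" by simp
 qed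
 obtain C where "\<And>z. snd z > 0 \<Longrightarrow> w z = C" using liouville by blast
 thus ?thesis by (intro exI[of _ C]) (auto simp: w_def H_def T_def)
qed

end

section \<open>One-dimensional symmetry and the profile\<close>

lemma half_line_mvt:
 fixes f :: "real \<Rightarrow> real"
 assumes der: "\<And>t. t \<ge> 0 \<Longrightarrow> (f has_real_derivative f' t) (at t within {0..})" and ab: "0 \<le> a" "a < b"
 shows "\<exists>xi. a < xi \<and> xi < b \<and> f b - f a = f' xi * (b - a)"
proof -
 have "continuous_on {a..b} f"
  by (rule continuous_on_subset[where s="{0..}"], rule DERIV_continuous_on[of _ _ f']) (use der ab in auto)
 moreover have "(f has_derivative (\<lambda>h. f' t * h)) (at t)" if "a < t" "t < b" for t
 proof -
  have "t \<in> interior {0..}" using that ab by (simp add: interior_real_atLeast)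
  hence "at t within {0..} = at t" by (rule at_within_interior)
  moreover have "(f has_real_derivative f' t) (at t within {0..})" by (rule der) (use that ab in simp)
  ultimately have "(f has_real_derivative f' t) (at t)" by (simp only:)
  thus ?thesis by (simp add: has_field_derivative_def)
 qed
 ultimately obtain xi where "xi \<in> {a<..<b}" "f b - f a = f' xi * (b - a)"
  using mvt[OF ab(2), of f "\<lambda>t h. f' t * h"] by auto
 thus ?thesis by (intro exI[of _ xi]) auto
qed

text \<open>At the endpoint the derivative is the limit of the derivatives inside, by the mean value
  theorem. As \<open>u\<close> is differentiable only inside, this is how the differential equation
  of the profile reaches 0.\<close>

lemma half_line_derivative:
 fixes f :: "real \<Rightarrow> real"
 assumes cf: "continuous_on {0..} f" and der: "\<And>s. s > 0 \<Longrightarrow> (f has_real_derivative f' s) (at s)"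
  and cf': "continuous_on {0..} f'" and s: "s \<ge> 0"
 shows "(f has_real_derivative f' s) (at s within {0..})"
proof (cases "s = 0")
 case False
 thus ?thesis using der[of s] s by (auto intro: has_field_derivative_at_within)
next
 case True
 have "((\<lambda>y. (f y - f 0) / (y - 0)) \<longlongrightarrow> f' 0) (at 0 within {0..})"
 proof (rule tendstoI)
  fix eps :: real assume e: "eps > 0"
  obtain d where d: "d > 0" "\<And>y. y \<ge> 0 \<Longrightarrow> dist y 0 < d \<Longrightarrow> dist (f' y) (f' 0) < eps"
   using cf' e unfolding continuous_on_iff by (metis atLeast_iff order_refl)
  show "eventually (\<lambda>y. dist ((f y - f 0) / (y - 0)) (f' 0) < eps) (at 0 within {0..})"
   unfolding eventually_at
  proof (intro exI[of _ d] conjI ballI impI d(1))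
   fix y :: real assume y: "y \<in> {0..}" "y \<noteq> 0 \<and> dist y 0 < d"
   hence y0: "y > 0" by auto
   have "continuous_on {0..y} f" by (rule continuous_on_subset[OF cf]) auto
   then obtain xi where x: "xi \<in> {0<..<y}" "f y - f 0 = f' xi * (y - 0)"
    using mvt[OF y0, of f "\<lambda>t h. f' t * h"] der by (auto simp: has_field_derivative_def)
   have "dist (f' xi) (f' 0) < eps" using x(1) y by (intro d(2)) auto
   thus "dist ((f y - f 0) / (y - 0)) (f' 0) < eps" using x(2) y0 by simp
  qed
 qed
 thus ?thesis using True by (simp add: has_field_derivative_iff)
qed

context overdetermined begin

text \<open>The increments \<open>C tau\<close> of \<open>hh\<close> do not depend on
  \<open>t\<close>. Letting \<open>t\<close> tend to 0, where \<open>hh\<close> tends to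
  \<open>\<phi>\<close>, they are increments of \<open>\<phi>\<close> as well, and increments
  independent of the base point force a constant derivative.\<close>

lemma phi_affine: "\<exists>a. (\<forall>x. \<phi> x = \<phi> 0 + a \<bullet> x) \<and> (\<forall>z. snd z > 0 \<longrightarrow> hh z = hh (0, snd z) + a \<bullet> fst z)"
proof -
 obtain C where C: "\<And>tau z. snd z > 0 \<Longrightarrow> hh (z + (tau, 0)) - hh z = C tau" using hh_translate by metis
 obtain k where k: "k > 0" "\<And>z. snd z > 0 \<Longrightarrow> hh z - \<phi> (fst z) \<le> k * snd z" using hh_height by blast
 have pos: "hh z - \<phi> (fst z) > 0" if "snd z > 0" for z using hod(1)[OF that] by (simp add: Om_def dd_def hod_def)
 have \<phi>C: "\<phi> (x + tau) - \<phi> x = C tau" for x tau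
 proof -
  have "\<bar>\<phi> (x + tau) - \<phi> x - C tau\<bar> \<le> 0 + eps" if e: "eps > 0" for eps
  proof -
   define t where "t = eps / k"
   have t: "t > 0" "k * t = eps" using e k by (auto simp: t_def)
   have "hh (x + tau, t) - hh (x, t) = C tau" using C[of "(x, t)" tau] t by simp
   thus ?thesis using k(2)[of "(x, t)"] k(2)[of "(x + tau, t)"] pos[of "(x, t)"] pos[of "(x + tau, t)"] t by simp
  qed
  hence "\<bar>\<phi> (x + tau) - \<phi> x - C tau\<bar> \<le> 0" by (rule field_le_epsilon)
  thus ?thesis by simp
 qed
 have D: "D\<phi> x = D\<phi> 0" for x
 proof -
  have "((\<lambda>y. y + x) has_derivative (\<lambda>h. h)) (at 0)" by (auto intro!: derivative_eq_intros)
  from has_derivative_compose[OF this, of \<phi> "\<lambda>h. D\<phi> x \<bullet> h"]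
  have "((\<lambda>y. \<phi> (y + x) - C x) has_derivative (\<lambda>h. D\<phi> x \<bullet> h)) (at 0)" using D\<phi>[of x] by (auto intro!: derivative_eq_intros)
  moreover have "\<phi> (y + x) - C x = \<phi> y" for y using \<phi>C[of y x] by simp
  ultimately have "(\<phi> has_derivative (\<lambda>h. D\<phi> x \<bullet> h)) (at 0)" by simp
  from has_derivative_unique[OF this D\<phi>] have "D\<phi> x \<bullet> h = D\<phi> 0 \<bullet> h" for h by (metis)
  thus ?thesis by (metis inner_commute vector_eq_ldot)
 qed
 define a where "a = D\<phi> 0"
 have "\<exists>k. \<forall>x\<in>UNIV. \<phi> x - a \<bullet> x = k"
 proof (rule has_derivative_zero_constant)
  show "((\<lambda>x. \<phi> x - a \<bullet> x) has_derivative (\<lambda>h. 0)) (at x within UNIV)" for x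
   using D\<phi>[of x] D[of x] by (auto intro!: derivative_eq_intros simp: a_def)
 qed auto
 then obtain k' where k': "\<And>x. \<phi> x - a \<bullet> x = k'" by blast
 have \<phi>a: "\<phi> x = \<phi> 0 + a \<bullet> x" for x using k'[of x] k'[of 0] by simp
 have "hh z = hh (0, snd z) + a \<bullet> fst z" if z: "snd z > 0" for z
 proof -
  have "hh ((0, snd z) + (fst z, 0)) - hh (0, snd z) = C (fst z)" by (rule C) (use z in simp)
  moreover have "C (fst z) = a \<bullet> fst z" using \<phi>C[of 0 "fst z"] \<phi>a[of "fst z"] by simp
  ultimately show ?thesis by simp
 qed
 thus ?thesis using \<phi>a by blast
qed

text \<open>All level sets are parallel hyperplanes, so \<open>u\<close> is a function of the signed
  distance \<open>m\<close> to the boundary. The diagonal entries of its Hessian are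
  \<open>k * (e \<bullet> v)^2\<close>, and since \<open>e\<close> is a unit vector their sum is the
  second derivative along the normal line \<open>l\<close>.\<close>

lemma one_dimensional:
 "\<exists>e g. norm e = 1 \<and> (\<exists>a b. a \<noteq> 0 \<and> Om = {x. x \<bullet> a > b}) \<and> (\<forall>x. x \<in> Om \<longleftrightarrow> (x - (0, \<phi> 0)) \<bullet> e > 0) \<and>
   is_profile W' g \<and> (\<forall>t<0. g t = 0) \<and> (\<forall>x\<in>Om. u x = g ((x - (0, \<phi> 0)) \<bullet> e))"
proof -
 obtain a where \<phi>a: "\<And>x. \<phi> x = \<phi> 0 + a \<bullet> x" and ha: "\<And>z. snd z > 0 \<Longrightarrow> hh z = hh (0, snd z) + a \<bullet> fst z"
  using phi_affine by blast
 define b where "b = \<phi> 0"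
 define N where "N = sqrt (1 + (norm a)^2)"
 have N: "N > 0" "N^2 = 1 + (norm a)^2" by (auto simp: N_def add_pos_nonneg)
 define e where "e = (1 / N) *\<^sub>R (- a, 1 :: real)"
 define P where "P = (0 :: 'a, b)"
 define m where "m x = (x - P) \<bullet> e" for x
 have ee: "e \<bullet> e = 1"
 proof -
  have "e \<bullet> e = (1 + (norm a)^2) / N^2"
   by (simp add: e_def inner_prod_def power2_norm_eq_inner power2_eq_square[of N] algebra_simps add_divide_distrib)
  also have "... = N^2 / N^2" by (simp only: N(2))
  finally show ?thesis using N(1) by simp
 qed
 have ne: "norm e = 1" using ee by (simp add: norm_eq_sqrt_inner)
 have ddm: "dd x = N * m x" for x
 proof -
  have "m x = (snd x - b - a \<bullet> fst x) / N"
   by (simp add: m_def e_def P_def inner_prod_def inner_commute diff_divide_distrib)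
  thus ?thesis using N(1) by (simp add: dd_def \<phi>a[of "fst x"] b_def[symmetric])
 qed
 define l where "l s = P + s *\<^sub>R e" for s
 have ml: "m (l s) = s" for s using ee by (simp add: m_def l_def)
 have lC: "l s \<in> Cl" if "s \<ge> 0" for s using that N(1) by (simp add: Cl_def ddm ml)
 have lO: "l s \<in> Om" if "s > 0" for s using that N(1) by (simp add: Om_def ddm ml)
 have Om_m: "x \<in> Om \<longleftrightarrow> m x > 0" for x using N(1) by (simp add: Om_def ddm zero_less_mult_iff)
 \<comment> \<open>\<open>x\<close> and the point \<open>l (m x)\<close> of the normal line have the
   same height above the boundary; by the affine form of \<open>hh\<close> they lie on the same
   level.\<close>
 have ul: "u x = u (l (m x))" if x: "x \<in> Om" for x
 proof -
  define t where "t = - ln (1 - u x)"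
  have ux: "0 < u x" "u x < 1" using u_positive[OF x] u_less_1[OF Om_Cl(2)[OF x]] by auto
  have t: "t > 0" "u x = 1 - exp (- t)" using ux by (auto simp: t_def)
  define y where "y = l (m x)"
  have dy: "dd y = dd x" by (simp add: y_def ddm ml)
  have "hh (fst x, t) = snd x" using x t(2) by (intro hh_unique) (auto simp: Om_def dd_def)
  hence "hh (0, t) = snd x - a \<bullet> fst x" using ha[of "(fst x, t)"] t by simp
  hence "hh (fst y, t) = snd x - a \<bullet> fst x + a \<bullet> fst y" using ha[of "(fst y, t)"] t by simp
  also have "... = snd y" using dy by (simp add: dd_def \<phi>a[of "fst x"] \<phi>a[of "fst y"])
  finally have "hod (fst y, t) = y" by (simp add: hod_def)
  thus ?thesis using hod(2)[of "(fst y, t)"] t by (simp add: y_def)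
 qed
 define g where "g s = (if s < 0 then 0 else u (l s))" for s
 define g' where "g' s = G (l s) \<bullet> e" for s
 have lcont: "continuous_on S l" for S unfolding l_def by (intro continuous_intros)
 have cg: "continuous_on {0..} g"
 proof -
  have "continuous_on {0..} (\<lambda>s. u (l s))" by (rule continuous_on_compose2[OF uc lcont]) (use lC in auto)
  thus ?thesis by (rule continuous_on_eq) (auto simp: g_def)
 qed
 have cg': "continuous_on {0..} g'" unfolding g'_def
  by (intro continuous_intros continuous_on_compose2[OF Gc lcont]) (use lC in auto)
 have g01: "0 \<le> g s \<and> g s < 1" if "s \<ge> 0" for s using u_nonneg[OF lC] u_less_1[OF lC] that by (simp add: g_def)
 have lder: "(l has_derivative (\<lambda>h. h *\<^sub>R e)) (at s)" for s unfolding l_def[abs_def] by (auto intro!: derivative_eq_intros)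
 have dg: "(g has_real_derivative g' s) (at s)" if s: "s > 0" for s
 proof -
  from has_derivative_compose[OF lder u_deriv[OF lO[OF s]]]
  have "((\<lambda>s. u (l s)) has_real_derivative g' s) (at s)"
   by (simp add: has_field_derivative_def g'_def mult_commute_abs)
  thus ?thesis by (rule has_field_derivative_transform_within_open[where S="{0<..}"]) (use s in \<open>auto simp: g_def\<close>)
 qed
 \<comment> \<open>The second derivative of \<open>u\<close> along the normal line. It is identified
   with \<open>W' (g s)\<close> only in \<open>kW\<close>, through the trace of the Hessian.\<close>
 define k where "k s = (\<Sum>b\<in>Basis. (HG b (l s) \<bullet> e) * (e \<bullet> b))" for s
 have dg': "(g' has_real_derivative k s) (at s)" if s: "s > 0" for s
 proof -
  have "((\<lambda>s. G (l s) \<bullet> b) has_real_derivative (HG b (l s) \<bullet> e)) (at s)" if b: "b \<in> Basis" for b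
   using has_derivative_compose[OF lder HG(1)[OF b lO[OF s]]] by (simp add: has_field_derivative_def mult_commute_abs)
  hence "((\<lambda>s. \<Sum>b\<in>Basis. (G (l s) \<bullet> b) * (e \<bullet> b)) has_real_derivative k s) (at s)"
   unfolding k_def by (intro DERIV_sum DERIV_cmult_right)
  moreover have "(\<lambda>s. \<Sum>b\<in>Basis. (G (l s) \<bullet> b) * (e \<bullet> b)) = g'" unfolding g'_def by (rule ext) (rule euclidean_inner[symmetric])
  ultimately show ?thesis by simp
 qed
 have mline: "m (x + r *\<^sub>R v) = m x + r * (e \<bullet> v)" for x r v by (simp add: m_def inner_diff_left inner_add_left inner_commute[of v e])
 have chain: "((\<lambda>r. f (m (x + r *\<^sub>R v))) has_real_derivative f' * (e \<bullet> v)) (at 0)" if "(f has_real_derivative f') (at (m x))" for f f' x v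
 proof -
  have "((\<lambda>r. m x + r * (e \<bullet> v)) has_real_derivative (e \<bullet> v)) (at 0)" by (auto intro!: derivative_eq_intros)
  from DERIV_chain2[where f=f, OF _ this] that show ?thesis by (simp add: mline)
 qed
 have near: "open ((\<lambda>r. x + r *\<^sub>R v) -` Om)" for x v by (intro open_vimage open_Om continuous_intros)
 have line: "((\<lambda>r. F (x + r *\<^sub>R v)) has_real_derivative D v) (at 0)" if "(F has_derivative D) (at x)" for F D and x v :: "'a \<times> real"
 proof -
  have "((\<lambda>r. x + r *\<^sub>R v) has_derivative (\<lambda>r. r *\<^sub>R v)) (at 0)" by (auto intro!: derivative_eq_intros)
  from has_derivative_compose[OF this, of F D] that
  have "((\<lambda>r. F (x + r *\<^sub>R v)) has_derivative (\<lambda>r. D (r *\<^sub>R v))) (at 0)" by simp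
  thus ?thesis using linear_scale[OF has_derivative_linear[OF that]] by (simp add: has_field_derivative_def mult_commute_abs)
 qed
 have Gb: "G x \<bullet> v = g' (m x) * (e \<bullet> v)" if x: "x \<in> Om" for x v
 proof -
  have "((\<lambda>r. g (m (x + r *\<^sub>R v))) has_real_derivative g' (m x) * (e \<bullet> v)) (at 0)"
   by (rule chain) (use dg x Om_m in auto)
  hence "((\<lambda>r. u (x + r *\<^sub>R v)) has_real_derivative g' (m x) * (e \<bullet> v)) (at 0)"
   by (rule has_field_derivative_transform_within_open[OF _ near[of x v]])
    (use x ul Om_m in \<open>auto simp: g_def\<close>)
  with line[OF u_deriv[OF x], of v] show ?thesis by (rule DERIV_unique)
 qed
 have HGb: "HG v x \<bullet> v = k (m x) * (e \<bullet> v) * (e \<bullet> v)" if x: "x \<in> Om" and v: "v \<in> Basis" for x v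
 proof -
  have "((\<lambda>r. g' (m (x + r *\<^sub>R v)) * (e \<bullet> v)) has_real_derivative k (m x) * (e \<bullet> v) * (e \<bullet> v)) (at 0)"
   by (intro DERIV_cmult_right chain dg') (use x Om_m in auto)
  hence "((\<lambda>r. G (x + r *\<^sub>R v) \<bullet> v) has_real_derivative k (m x) * (e \<bullet> v) * (e \<bullet> v)) (at 0)"
   by (rule has_field_derivative_transform_within_open[OF _ near[of x v]]) (use x Gb in auto)
  with line[OF HG(1)[OF v x], of v] show ?thesis by (rule DERIV_unique)
 qed
 have kW: "k s = W' (g s)" if s: "s > 0" for s
 proof -
  have "W' (u (l s)) = (\<Sum>v\<in>Basis. HG v (l s) \<bullet> v)" by (rule HG_trace[OF lO[OF s], symmetric])
  also have "... = (\<Sum>v\<in>Basis. k s * ((e \<bullet> v) * (e \<bullet> v)))" using HGb[OF lO[OF s]] by (intro sum.cong) (auto simp: ml)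
  also have "... = k s" unfolding sum_distrib_left[symmetric] euclidean_inner[symmetric] by (simp add: ee)
  finally show ?thesis using s by (simp add: g_def)
 qed
 have cW: "continuous_on {0..1} W'" by (rule lipschitz_on_continuous_on[OF W'_lipschitz])
 have cWg: "continuous_on {0..} (\<lambda>s. W' (g s))"
 proof (rule continuous_on_compose2[OF cW cg])
  show "g ` {0..} \<subseteq> {0..1}"
  proof
   fix y assume "y \<in> g ` {0..}"
   then obtain s where "s \<ge> 0" "y = g s" by auto
   thus "y \<in> {0..1}" using g01[of s] by simp
  qed
 qed
 have lim: "(g \<longlongrightarrow> 1) at_top"
 proof (rule tendstoI)
  fix eps :: real assume eps: "eps > 0"
  obtain D where D: "D > 0" "\<And>x. dd x \<ge> D \<Longrightarrow> u x \<ge> 1 - eps / 2" using deep_limit[of "eps / 2"] eps by auto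
  show "eventually (\<lambda>s. dist (g s) 1 < eps) at_top"
   using eventually_ge_at_top[of "D / N"]
  proof eventually_elim
   case (elim s)
   have s: "s \<ge> 0" using elim D(1) N(1) by (meson divide_nonneg_pos less_imp_le order_trans)
   have "dd (l s) \<ge> D" using elim N(1) by (simp add: ddm ml field_simps)
   hence "g s \<ge> 1 - eps / 2" using D(2)[of "l s"] s by (simp add: g_def)
   thus ?case using g01[OF s] eps by (simp add: dist_real_def)
  qed
 qed
 have "is_profile W' g"
  unfolding is_profile_def
 proof (intro conjI allI impI lim)
  show "0 \<le> g t" "g t < 1" if "t \<ge> 0" for t using g01[OF that] by auto
  show "g 0 = 0" using u_zero[of "l 0"] by (simp add: g_def ddm ml)
  show "\<exists>g'. \<forall>t\<ge>0. (g has_real_derivative g' t) (at t within {0..}) \<and> (g' has_real_derivative W' (g t)) (at t within {0..})"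
  proof (intro exI[of _ g'] allI impI conjI)
   fix t :: real assume t: "t \<ge> 0"
   show "(g has_real_derivative g' t) (at t within {0..})" by (rule half_line_derivative[OF cg dg cg' t])
   show "(g' has_real_derivative W' (g t)) (at t within {0..})"
    by (rule half_line_derivative[OF cg' _ cWg t]) (use dg' kW in auto)
  qed
 qed
 moreover have "Om = {x. x \<bullet> (- a, 1) > b}"
 proof -
  have "x \<in> Om \<longleftrightarrow> x \<bullet> (- a, 1) > b" for x
   using \<phi>a[of "fst x"] by (auto simp: Om_def dd_def b_def inner_prod_def inner_commute[of "fst x"])
  thus ?thesis by blast
 qed
 moreover have "\<forall>x\<in>Om. u x = g ((x - (0, \<phi> 0)) \<bullet> e)"
  using ul Om_m by (auto simp: g_def m_def P_def b_def)
 moreover have "\<forall>x. x \<in> Om \<longleftrightarrow> (x - (0, \<phi> 0)) \<bullet> e > 0" using Om_m by (auto simp: m_def P_def b_def)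
 moreover have "\<forall>t<0. g t = 0" by (simp add: g_def)
 moreover have "(- a, 1 :: real) \<noteq> 0" by (simp add: zero_prod_def)
 ultimately show ?thesis using ne by blast
qed

end

text \<open>The energy \<open>E\<close> is conserved. No limit of \<open>g'\<close> at infinity is
  given, so \<open>E\<close> is evaluated at the mean value points \<open>xi n\<close> between
  consecutive integers, where \<open>g'\<close> equals an increment of \<open>g\<close> and tends to
  0. The sign of the root follows from \<open>g \<ge> 0 = g 0\<close>.\<close>

lemma profile_initial_slope:
 assumes W: "\<And>s. s \<ge> 0 \<Longrightarrow> (W has_real_derivative W' s) (at s within {0..})" and W1: "W 1 = 0"
  and g0: "g 0 = 0" and gpos: "\<And>t. t \<ge> 0 \<Longrightarrow> g t \<ge> 0" and lim: "(g \<longlongrightarrow> 1) at_top"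
  and dg: "\<And>t. t \<ge> 0 \<Longrightarrow> (g has_real_derivative g' t) (at t within {0..})"
  and dg': "\<And>t. t \<ge> 0 \<Longrightarrow> (g' has_real_derivative W' (g t)) (at t within {0..})"
 shows "g' 0 = sqrt (2 * W 0)"
proof -
 define E where "E t = (g' t)^2 / 2 - W (g t)" for t
 have dE: "(E has_real_derivative 0) (at t within {0..})" if t: "t \<ge> 0" for t
 proof -
  have "(W has_real_derivative W' (g t)) (at (g t) within g ` {0..})"
   by (rule DERIV_subset[OF W[OF gpos[OF t]]]) (use gpos in auto)
  from DERIV_image_chain[OF this dg[OF t]]
  have "((\<lambda>t. W (g t)) has_real_derivative W' (g t) * g' t) (at t within {0..})" by (simp add: o_def)
  moreover have "((\<lambda>t. (g' t)^2 / 2) has_real_derivative (W' (g t) * g' t)) (at t within {0..})"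
   using dg'[OF t] by (auto intro!: derivative_eq_intros)
  ultimately have "((\<lambda>t. (g' t)^2 / 2 - W (g t)) has_real_derivative (W' (g t) * g' t - W' (g t) * g' t)) (at t within {0..})"
   by (intro DERIV_diff)
  thus ?thesis by (simp add: E_def[abs_def])
 qed
 have EE: "E t = E 0" if t: "t \<ge> 0" for t
 proof (cases "t = 0")
  case False
  thus ?thesis using half_line_mvt[of E "\<lambda>_. 0" 0 t] dE t by auto
 qed simp
 have "\<forall>n. \<exists>xi. real n < xi \<and> xi < real (Suc n) \<and> g (real (Suc n)) - g (real n) = g' xi * (real (Suc n) - real n)"
  by (intro allI half_line_mvt dg) auto
 then obtain xi where xi: "\<And>n. real n < xi n" "\<And>n. g (real (Suc n)) - g (real n) = g' (xi n) * (real (Suc n) - real n)" by metis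
 have glim: "(\<lambda>n. g (f n)) \<longlonglongrightarrow> 1" if "\<And>n. real n \<le> f n" for f
 proof (rule filterlim_compose[OF lim])
  show "filterlim f at_top sequentially" by (rule filterlim_at_top_mono[OF filterlim_real_sequentially]) (use that in auto)
 qed
 have "(\<lambda>n. g (real (Suc n)) - g (real n)) \<longlonglongrightarrow> 1 - 1" by (intro tendsto_diff glim) auto
 moreover have "(\<lambda>n. g (real (Suc n)) - g (real n)) = (\<lambda>n. g' (xi n))" using xi(2) by auto
 ultimately have g'lim: "(\<lambda>n. g' (xi n)) \<longlonglongrightarrow> 0" by simp
 have "(1::real) \<in> interior {0..}" by (simp add: interior_real_atLeast)
 hence "at (1::real) within {0..} = at 1" by (rule at_within_interior)
 hence "isCont W 1" using W[of 1] DERIV_isCont by fastforce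
 hence "(\<lambda>n. W (g (xi n))) \<longlonglongrightarrow> W 1" by (rule isCont_tendsto_compose) (intro glim less_imp_le xi(1))
 hence "(\<lambda>n. E (xi n)) \<longlonglongrightarrow> 0\<^sup>2 / 2 - W 1" unfolding E_def by (intro tendsto_intros g'lim) auto
 moreover have "E (xi n) = E 0" for n using xi(1)[of n] by (intro EE) linarith
 ultimately have "E 0 = 0" using W1 LIMSEQ_unique[OF tendsto_const[of "E 0"]] by auto
 hence sq: "(g' 0)^2 = 2 * W 0" by (simp add: E_def g0)
 have "g' 0 \<ge> 0"
 proof (rule ccontr)
  assume "\<not> g' 0 \<ge> 0"
  then obtain d where d: "d > 0" "\<And>h. h > 0 \<Longrightarrow> 0 + h \<in> {0..} \<Longrightarrow> h < d \<Longrightarrow> g 0 > g (0 + h)"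
   using has_real_derivative_neg_dec_right[OF dg[of 0]] by auto
  have "g 0 > g (0 + d / 2)" using d(1) by (intro d(2)) auto
  thus False using gpos[of "d / 2"] d(1) g0 by simp
 qed
 thus ?thesis using sq by (metis real_sqrt_unique)
qed

text \<open>The common initial slope turns the boundary value problem on the half-line into an
  initial value problem, and Gronwall's argument applies: \<open>D t * exp (- K * t)\<close> does
  not increase and starts at 0.\<close>

lemma profile_eqI:
 assumes W: "\<And>s. s \<ge> 0 \<Longrightarrow> (W has_real_derivative W' s) (at s within {0..})" and W1: "W 1 = 0"
  and lip: "C0-lipschitz_on {0..1} W'"
  and g: "is_profile W' g" "\<forall>t<0. g t = 0" and h: "is_profile W' h" "\<forall>t<0. h t = 0"
 shows "g = h"
proof
 fix t :: real
 have C0: "C0 \<ge> 0" by (rule lipschitz_on_nonneg[OF lip])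
 obtain g' where dg: "\<And>t. t \<ge> 0 \<Longrightarrow> (g has_real_derivative g' t) (at t within {0..})"
  "\<And>t. t \<ge> 0 \<Longrightarrow> (g' has_real_derivative W' (g t)) (at t within {0..})" using g(1) unfolding is_profile_def by blast
 obtain h' where dh: "\<And>t. t \<ge> 0 \<Longrightarrow> (h has_real_derivative h' t) (at t within {0..})"
  "\<And>t. t \<ge> 0 \<Longrightarrow> (h' has_real_derivative W' (h t)) (at t within {0..})" using h(1) unfolding is_profile_def by blast
 have gp: "g 0 = 0" "\<And>t. t \<ge> 0 \<Longrightarrow> 0 \<le> g t" "\<And>t. t \<ge> 0 \<Longrightarrow> g t < 1" "(g \<longlongrightarrow> 1) at_top" using g(1) by (auto simp: is_profile_def)
 have hp: "h 0 = 0" "\<And>t. t \<ge> 0 \<Longrightarrow> 0 \<le> h t" "\<And>t. t \<ge> 0 \<Longrightarrow> h t < 1" "(h \<longlongrightarrow> 1) at_top" using h(1) by (auto simp: is_profile_def)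
 have s: "g' 0 = sqrt (2 * W 0)" "h' 0 = sqrt (2 * W 0)"
  using profile_initial_slope[OF W W1 gp(1,2,4) dg] profile_initial_slope[OF W W1 hp(1,2,4) dh] by auto
 show "g t = h t"
 proof (cases "t > 0")
  case False
  thus ?thesis using g(2) h(2) gp(1) hp(1) by (cases "t = 0") auto
 next
  case True
  define K where "K = 1 + C0"
  define D where "D t = (g t - h t)^2 + (g' t - h' t)^2" for t
  define D' where "D' t = 2 * (g t - h t) * (g' t - h' t) + 2 * (g' t - h' t) * (W' (g t) - W' (h t))" for t
  have dD: "(D has_real_derivative D' t) (at t within {0..})" if t: "t \<ge> 0" for t
   unfolding D_def[abs_def] D'_def using dg[OF t] dh[OF t] by (auto intro!: derivative_eq_intros simp: algebra_simps)
  have D'K: "D' t \<le> K * D t" if t: "t \<ge> 0" for t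
  proof -
   define x y where "x = g t - h t" and "y = g' t - h' t"
   have "2 * x * y \<le> x^2 + y^2" by (rule sum_squares_bound)
   moreover have "2 * y * (W' (g t) - W' (h t)) \<le> C0 * (x^2 + y^2)"
   proof -
    have "\<bar>W' (g t) - W' (h t)\<bar> \<le> C0 * \<bar>x\<bar>" unfolding x_def using lipschitz_onD[OF lip, of "g t" "h t"] gp(2,3)[OF t] hp(2,3)[OF t] by (simp add: dist_norm)
    have "2 * y * (W' (g t) - W' (h t)) \<le> \<bar>2 * y * (W' (g t) - W' (h t))\<bar>" by (rule abs_ge_self)
    also have "... = 2 * \<bar>y\<bar> * \<bar>W' (g t) - W' (h t)\<bar>" by (simp add: abs_mult)
    also have "... \<le> 2 * \<bar>y\<bar> * (C0 * \<bar>x\<bar>)" by (rule mult_left_mono) (fact, simp)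
    also have "... = C0 * (2 * \<bar>x\<bar> * \<bar>y\<bar>)" by simp
    also have "... \<le> C0 * (\<bar>x\<bar>^2 + \<bar>y\<bar>^2)" using C0 by (intro mult_left_mono sum_squares_bound)
    finally show ?thesis by simp
   qed
   ultimately show ?thesis unfolding D'_def D_def K_def x_def[symmetric] y_def[symmetric] by (simp add: algebra_simps)
  qed
  have dF: "((\<lambda>t. D t * exp (- K * t)) has_real_derivative (D' t - K * D t) * exp (- K * t)) (at t within {0..})" if t: "t \<ge> 0" for t
  proof -
   have "((\<lambda>t. exp (- K * t)) has_real_derivative (exp (- K * t) * (- K))) (at t within {0..})" by (auto intro!: derivative_eq_intros)
   from DERIV_mult[OF dD[OF t] this] show ?thesis by (simp add: algebra_simps)
  qed
  obtain xi where xi: "0 < xi" "D t * exp (- K * t) - D 0 * exp (- K * 0) = (D' xi - K * D xi) * exp (- K * xi) * (t - 0)"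
   using half_line_mvt[where f="\<lambda>t. D t * exp (- K * t)" and f'="\<lambda>t. (D' t - K * D t) * exp (- K * t)", OF dF, of 0 t] True by auto
  have "(D' xi - K * D xi) * exp (- K * xi) * (t - 0) \<le> 0"
   using D'K[of xi] xi(1) True by (intro mult_nonpos_nonneg) auto
  moreover have "D 0 = 0" using s gp(1) hp(1) by (simp add: D_def)
  ultimately have "D t * exp (- K * t) \<le> 0" using xi(2) by simp
  hence "D t \<le> 0" by (simp add: mult_le_0_iff)
  moreover have "(g t - h t)^2 \<le> D t" by (simp add: D_def)
  ultimately have "(g t - h t)^2 \<le> 0" by linarith
  thus ?thesis by simp
 qed
qed

lemma profile_eq:
 assumes "\<And>s. s \<ge> 0 \<Longrightarrow> (W has_real_derivative W' s) (at s within {0..})" "W 1 = 0"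
  and "C0-lipschitz_on {0..1} W'"
  and "is_profile W' g" "\<forall>t<0. g t = 0"
 shows "profile W' = g"
 unfolding profile_def by (rule the_equality) (use assms profile_eqI[OF assms(1-3)] in blast)+

text \<open>\<open>W' 1 = 0\<close> because 1 is an interior minimum. The linear decrease near 0
  comes from the alternative in the assumptions: the sign of \<open>W'\<close> on
  \<open>(0, 1)\<close> forces \<open>W' 0 < 0\<close> or, if \<open>W' 0 = 0\<close>,
  \<open>W'' 0 < 0\<close>.\<close>

lemma double_wellD:
 assumes dw: "double_well W W' W''"
 shows "s \<ge> 0 \<Longrightarrow> (W has_real_derivative W' s) (at s within {0..})" "W 1 = 0" "W' 1 = 0"
  "0 < s \<Longrightarrow> s < 1 \<Longrightarrow> W' s < 0"
  "\<exists>C0. C0-lipschitz_on {0..1} W'"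
  "\<exists>\<gamma> \<kappa>. 0 < \<gamma> \<and> \<gamma> < 1 \<and> \<kappa> > 0 \<and> (\<forall>s r. \<gamma> \<le> s \<longrightarrow> s \<le> r \<longrightarrow> r \<le> 1 \<longrightarrow> W' r - W' s \<ge> \<kappa> * (r - s))"
  "\<exists>eps0>0. \<exists>s0>0. \<forall>s. 0 \<le> s \<longrightarrow> s \<le> s0 \<longrightarrow> W' s \<le> - eps0 * s"
  "\<exists>p cp. p > 1 \<and> cp > 0 \<and> (\<forall>s>1. W' s \<ge> cp * (s - 1) powr p)"
proof -
 have dW: "(W has_real_derivative W' s) (at s within {0..})" if "s \<ge> 0" for s
  using dw that by (auto simp: double_well_def C2_on_nonneg_def)
 have dW': "(W' has_real_derivative W'' s) (at s within {0..})" if "s \<ge> 0" for s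
  using dw that by (auto simp: double_well_def C2_on_nonneg_def)
 have cW'': "continuous_on {0..} W''" using dw by (auto simp: double_well_def C2_on_nonneg_def)
 have Wpos: "W s \<ge> 0" if "s \<ge> 0" for s using dw that by (auto simp: double_well_def)
 have neg: "W' s < 0" if "0 < s" "s < 1" for s using dw that by (auto simp: double_well_def)
 show "s \<ge> 0 \<Longrightarrow> (W has_real_derivative W' s) (at s within {0..})" by (rule dW)
 show W1: "W 1 = 0" using dw by (auto simp: double_well_def)
 show "0 < s \<Longrightarrow> s < 1 \<Longrightarrow> W' s < 0" by (rule neg)
 show "W' 1 = 0"
 proof -
  have "(1::real) \<in> interior {0..}" by (simp add: interior_real_atLeast)
  hence "at (1::real) within {0..} = at 1" by (rule at_within_interior)
  hence "(W has_real_derivative W' 1) (at 1)" using dW[of 1] by simp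
  thus ?thesis by (rule DERIV_local_min[of _ _ _ 1]) (use Wpos W1 in auto)
 qed
 have mvt: "\<exists>xi. a < xi \<and> xi < b \<and> W' b - W' a = W'' xi * (b - a)" if "0 \<le> a" "a < b" for a b
  by (rule half_line_mvt) (use dW' that in auto)
 show "\<exists>C0. C0-lipschitz_on {0..1} W'"
 proof -
  have "compact (W'' ` {0..1})" by (intro compact_continuous_image continuous_on_subset[OF cW'']) auto
  then obtain C0 where "\<forall>x\<in>{0..1}. \<bar>W'' x\<bar> \<le> C0" using compact_imp_bounded[of "W'' ` {0..1}"] by (auto simp: bounded_iff)
  hence C0: "\<bar>W'' s\<bar> \<le> C0" if "0 \<le> s" "s \<le> 1" for s using that by simp
  have *: "\<bar>W' s - W' r\<bar> \<le> C0 * \<bar>s - r\<bar>" if sr: "0 \<le> s" "s < r" "r \<le> 1" for s r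
  proof -
   obtain xi where xi: "s < xi" "xi < r" "W' r - W' s = W'' xi * (r - s)" using mvt[OF sr(1,2)] by blast
   have "\<bar>W' s - W' r\<bar> = \<bar>W'' xi\<bar> * \<bar>s - r\<bar>" using xi(3) by (simp add: abs_mult abs_minus_commute)
   also have "... \<le> C0 * \<bar>s - r\<bar>" using sr xi by (intro mult_right_mono C0) auto
   finally show ?thesis .
  qed
  have "\<bar>W' s - W' r\<bar> \<le> C0 * \<bar>s - r\<bar>" if "s \<in> {0..1}" "r \<in> {0..1}" for s r
   using *[of s r] *[of r s] that by (cases s r rule: linorder_cases) (auto simp: abs_minus_commute)
  moreover have "C0 \<ge> 0" using C0[of 0] by simp
  ultimately show ?thesis by (intro exI[of _ C0] lipschitz_onI) (auto simp: dist_norm)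
 qed
 show "\<exists>\<gamma> \<kappa>. 0 < \<gamma> \<and> \<gamma> < 1 \<and> \<kappa> > 0 \<and> (\<forall>s r. \<gamma> \<le> s \<longrightarrow> s \<le> r \<longrightarrow> r \<le> 1 \<longrightarrow> W' r - W' s \<ge> \<kappa> * (r - s))"
 proof -
  obtain \<gamma> \<kappa> where h: "0 < \<gamma>" "\<gamma> < 1" "\<kappa> > 0" "\<And>s. s \<ge> \<gamma> \<Longrightarrow> W'' s \<ge> \<kappa>" using dw by (auto simp: double_well_def)
  have "W' r - W' s \<ge> \<kappa> * (r - s)" if sr: "\<gamma> \<le> s" "s \<le> r" "r \<le> 1" for s r
  proof (cases "s = r")
   case False
   then obtain xi where xi: "s < xi" "xi < r" "W' r - W' s = W'' xi * (r - s)" using mvt[of s r] sr h(1) by auto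
   have "\<kappa> * (r - s) \<le> W'' xi * (r - s)" using sr xi by (intro mult_right_mono h(4)) auto
   thus ?thesis using xi(3) by simp
  qed simp
  thus ?thesis using h by blast
 qed
 show "\<exists>p cp. p > 1 \<and> cp > 0 \<and> (\<forall>s>1. W' s \<ge> cp * (s - 1) powr p)" using dw by (auto simp: double_well_def)
 show "\<exists>eps0>0. \<exists>s0>0. \<forall>s. 0 \<le> s \<longrightarrow> s \<le> s0 \<longrightarrow> W' s \<le> - eps0 * s"
 proof -
  have ev1: "eventually (\<lambda>s. 0 < s \<and> s < 1) (at (0::real) within {0..})"
   unfolding eventually_at by (intro exI[of _ 1]) (auto simp: dist_real_def)
  have nb: "at (0::real) within {0..} \<noteq> bot" by (simp add: at_within_Ici_at_right)
  have lim0: "(W' \<longlongrightarrow> W' 0) (at 0 within {0..})" using DERIV_continuous[OF dW'[of 0]] by (simp add: continuous_within)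
  have W'0: "W' 0 \<le> 0" by (rule tendsto_upperbound[OF lim0 _ nb]) (use ev1 in eventually_elim, use neg in \<open>auto intro: less_imp_le\<close>)
  show ?thesis
  proof (cases "W' 0 = 0")
   case False
   hence "W' 0 < W' 0 / 2" using W'0 by simp
   from order_tendstoD(2)[OF lim0 this] obtain d where d: "d > 0" "\<And>s. s \<ge> 0 \<Longrightarrow> s \<noteq> 0 \<Longrightarrow> dist s 0 < d \<Longrightarrow> W' s < W' 0 / 2"
    unfolding eventually_at by (auto simp: atLeast_def)
   have "W' s \<le> - (- W' 0 / 2) * s" if s: "0 \<le> s" "s \<le> min 1 (d / 2)" for s
   proof -
    have "W' s \<le> W' 0 / 2" using d(2)[of s] s d(1) W'0 by (cases "s = 0") auto
    also have "... \<le> W' 0 / 2 * s" using s W'0 mult_left_mono_neg[of s 1 "W' 0 / 2"] by simp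
    finally show ?thesis by simp
   qed
   moreover have "- W' 0 / 2 > 0" "min 1 (d / 2) > 0" using False W'0 d(1) by auto
   ultimately show ?thesis by blast
  next
   case True
   hence W''0: "W'' 0 \<noteq> 0" using dw by (auto simp: double_well_def)
   have lim1: "((\<lambda>s. W' s / s) \<longlongrightarrow> W'' 0) (at 0 within {0..})" using dW'[of 0] True by (simp add: has_field_derivative_iff)
   have "W'' 0 \<le> 0"
   proof (rule tendsto_upperbound[OF lim1 _ nb])
    show "eventually (\<lambda>s. W' s / s \<le> 0) (at 0 within {0..})"
     using ev1 by eventually_elim (use neg in \<open>auto intro: divide_nonpos_pos less_imp_le\<close>)
   qed
   hence "W'' 0 < W'' 0 / 2" using W''0 by simp
   from order_tendstoD(2)[OF lim1 this] obtain d where d: "d > 0" "\<And>s. s \<ge> 0 \<Longrightarrow> s \<noteq> 0 \<Longrightarrow> dist s 0 < d \<Longrightarrow> W' s / s < W'' 0 / 2"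
    unfolding eventually_at by (auto simp: atLeast_def)
   have "W' s \<le> - (- W'' 0 / 2) * s" if s: "0 \<le> s" "s \<le> d / 2" for s
   proof (cases "s = 0")
    case False
    thus ?thesis using d(2)[of s] s d(1) by (simp add: field_simps)
   qed (simp add: True)
   moreover have "- W'' 0 / 2 > 0" "d / 2 > 0" using W''0 \<open>W'' 0 \<le> 0\<close> d(1) by auto
   ultimately show ?thesis by blast
  qed
 qed
qed

section \<open>The epigraph and the conclusion\<close>

lemma closure_strict_epigraph:
 fixes \<phi> :: "'a::euclidean_space \<Rightarrow> real"
 assumes c: "continuous_on UNIV \<phi>"
 shows "open (strict_epigraph \<phi>)" "closure (strict_epigraph \<phi>) = {x. snd x \<ge> \<phi> (fst x)}"
  "frontier (strict_epigraph \<phi>) = {x. snd x = \<phi> (fst x)}"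
proof -
 have S: "strict_epigraph \<phi> = {x. snd x > \<phi> (fst x)}" by (auto simp: strict_epigraph_def)
 have c': "continuous_on UNIV (\<lambda>x :: 'a \<times> real. \<phi> (fst x))"
  by (rule continuous_on_compose2[OF c]) (auto intro: continuous_intros)
 show op: "open (strict_epigraph \<phi>)" unfolding S by (intro open_Collect_less c' continuous_intros)
 show cl: "closure (strict_epigraph \<phi>) = {x. snd x \<ge> \<phi> (fst x)}"
 proof
  show "closure (strict_epigraph \<phi>) \<subseteq> {x. snd x \<ge> \<phi> (fst x)}"
   by (rule closure_minimal) (auto simp: S intro!: closed_Collect_le c' continuous_intros)
  show "{x. snd x \<ge> \<phi> (fst x)} \<subseteq> closure (strict_epigraph \<phi>)"
  proof
   fix x :: "'a \<times> real" assume x: "x \<in> {x. snd x \<ge> \<phi> (fst x)}"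
   show "x \<in> closure (strict_epigraph \<phi>)" unfolding closure_approachable
   proof (intro allI impI)
    fix e :: real assume e: "e > 0"
    show "\<exists>y\<in>strict_epigraph \<phi>. dist y x < e"
     by (rule bexI[of _ "x + (0, e / 2)"]) (use x e in \<open>auto simp: S dist_norm\<close>)
   qed
  qed
 qed
 show "frontier (strict_epigraph \<phi>) = {x. snd x = \<phi> (fst x)}"
  unfolding frontier_def cl interior_open[OF op] by (auto simp: S)
qed

theorem theorem1p2:
  fixes \<phi> :: "real ^ 'm \<Rightarrow> real"
    and \<Omega> :: "((real ^ 'm) \<times> real) set"
    and W W' W'' :: "real \<Rightarrow> real"
    and u :: "(real ^ 'm) \<times> real \<Rightarrow> real"
    and c :: real
  assumes "smooth \<phi>"
    and "\<exists>L. L-lipschitz_on UNIV \<phi>"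
    and "\<Omega> = strict_epigraph \<phi>"
    and "double_well W W' W''"
    and "C_k_on 2 \<Omega> u" and "C1_on_closure \<Omega> u"
    and "\<forall>x\<in>\<Omega>. laplacian u x = W' (u x)"
    and "\<forall>x\<in>\<Omega>. u x > 0"
    and "\<forall>x\<in>frontier \<Omega>. u x = 0"
    and "\<forall>x\<in>frontier \<Omega>. has_outer_normal_derivative u c x (outer_normal \<phi> (fst x))"
  shows "half_space \<Omega> \<and>
    (\<exists>(T :: (real ^ 'm) \<times> real \<Rightarrow> (real ^ 'm) \<times> real) e.
       surj T \<and> (\<forall>x y. dist (T x) (T y) = dist x y) \<and> norm e = 1 \<and>
       T ` \<Omega> = {y. y \<bullet> e > 0} \<and> (\<forall>x\<in>\<Omega>. u x = profile W' (T x \<bullet> e)))"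
proof -
 obtain L where lip: "L-lipschitz_on UNIV \<phi>" using assms(2) by blast
 have c\<phi>: "continuous_on UNIV \<phi>" by (rule lipschitz_on_continuous_on[OF lip])
 have \<Omega>: "\<Omega> = {x. snd x > \<phi> (fst x)}" using assms(3) by (auto simp: strict_epigraph_def)
 note ep = closure_strict_epigraph[OF c\<phi>, folded assms(3)]
 have C1\<phi>: "C_k_on (Suc 0) UNIV \<phi>" using assms(1) unfolding smooth_def by blast
 note dwd = double_wellD[OF assms(4)]
 obtain C0 where W'lip: "C0-lipschitz_on {0..1} W'" using dwd(5) by blast
 obtain \<gamma> \<kappa> where \<gamma>\<kappa>: "0 < \<gamma>" "\<gamma> < 1" "\<kappa> > 0" "\<And>s r. \<gamma> \<le> s \<Longrightarrow> s \<le> r \<Longrightarrow> r \<le> 1 \<Longrightarrow> W' r - W' s \<ge> \<kappa> * (r - s)" using dwd(6) by blast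
 obtain eps0 s0 where epss: "eps0 > 0" "s0 > 0" "\<And>s. 0 \<le> s \<Longrightarrow> s \<le> s0 \<Longrightarrow> W' s \<le> - eps0 * s" using dwd(7) by blast
 obtain p cp where pc: "p > 1" "cp > 0" "\<And>s. s > 1 \<Longrightarrow> W' s \<ge> cp * (s - 1) powr p" using dwd(8) by blast
 have "\<forall>b\<in>Basis. \<exists>h. continuous_on (closure \<Omega>) h \<and> (\<forall>x\<in>\<Omega>. h x = partial_deriv b u x)"
  using assms(6) by (auto simp: C1_on_closure_def)
 from bchoice[OF this] obtain h where h: "\<And>b. b \<in> Basis \<Longrightarrow> continuous_on (closure \<Omega>) (h b)"
  "\<And>b x. b \<in> Basis \<Longrightarrow> x \<in> \<Omega> \<Longrightarrow> h b x = partial_deriv b u x" by blast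
 \<comment> \<open>The partial derivatives extend to the closure one by one; the chosen extensions
   are assembled into a vector field that agrees with the gradient inside.\<close>
 define G where "G x = (\<Sum>b\<in>Basis. h b x *\<^sub>R b)" for x
 interpret overdetermined \<phi> "grad \<phi>" L W' u G c C0 \<gamma> \<kappa> eps0 s0 p cp
 proof
  show "L-lipschitz_on UNIV \<phi>" by (rule lip)
  show "(\<phi> has_derivative (\<lambda>h. grad \<phi> x \<bullet> h)) (at x)" for x
   by (rule has_derivative_grad) (use C1\<phi> in simp)
  show "continuous_on UNIV (grad \<phi>)" unfolding grad_def
   by (intro continuous_intros) (use C1\<phi> in simp)
  show "C_k_on 2 {x. snd x > \<phi> (fst x)} u" using assms(5) unfolding \<Omega> .
  show "continuous_on {x. snd x \<ge> \<phi> (fst x)} u" using assms(6) by (simp add: C1_on_closure_def ep(2))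
  show "continuous_on {x. snd x \<ge> \<phi> (fst x)} G" unfolding G_def
   by (intro continuous_intros) (use h(1) in \<open>simp add: ep(2)\<close>)
  show "partial_deriv b u x = G x \<bullet> b" if "snd x > \<phi> (fst x)" "b \<in> Basis" for x b
   using h(2)[OF that(2), of x] that unfolding G_def \<Omega>
   by (simp add: inner_sum_left inner_Basis if_distrib cong: if_cong)
  show "laplacian u x = W' (u x)" if "snd x > \<phi> (fst x)" for x using assms(7) that unfolding \<Omega> by blast
  show "u x > 0" if "snd x > \<phi> (fst x)" for x using assms(8) that unfolding \<Omega> by blast
  show "u x = 0" if "snd x = \<phi> (fst x)" for x using assms(9) that unfolding ep(3) by blast
  show "has_outer_normal_derivative u c x ((1 / sqrt (1 + (norm (grad \<phi> (fst x)))^2)) *\<^sub>R (grad \<phi> (fst x), -1))"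
   if "snd x = \<phi> (fst x)" for x using assms(10) that unfolding ep(3) outer_normal_def by blast
 qed (use dwd W'lip \<gamma>\<kappa> epss pc in auto)
 have Om\<Omega>: "Om = \<Omega>" by (auto simp: Om_def dd_def \<Omega>)
 obtain e g where e: "norm e = 1" "\<exists>a b. a \<noteq> 0 \<and> \<Omega> = {x. x \<bullet> a > b}" "\<And>x. x \<in> \<Omega> \<longleftrightarrow> (x - (0, \<phi> 0)) \<bullet> e > 0"
  and g: "is_profile W' g" "\<forall>t<0. g t = 0" "\<And>x. x \<in> \<Omega> \<Longrightarrow> u x = g ((x - (0, \<phi> 0)) \<bullet> e)"
  using one_dimensional unfolding Om\<Omega> by blast
 have pg: "profile W' = g" by (rule profile_eq[OF dwd(1) dwd(2) W'lip g(1,2)])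
 \<comment> \<open>A translation is enough as isometry, since the unit normal \<open>e\<close> is
   not prescribed.\<close>
 define T where "T x = x - (0, \<phi> 0)" for x :: "(real ^ 'm) \<times> real"
 have inv: "T (y + (0, \<phi> 0)) = y" for y by (simp add: T_def)
 have "surj T" by (rule surjI[of T "\<lambda>y. y + (0, \<phi> 0)"]) (rule inv)
 moreover have "T ` \<Omega> = {y. y \<bullet> e > 0}"
 proof
  show "T ` \<Omega> \<subseteq> {y. y \<bullet> e > 0}" using e(3) by (auto simp: T_def)
  show "{y. y \<bullet> e > 0} \<subseteq> T ` \<Omega>"
  proof
   fix y assume "y \<in> {y. y \<bullet> e > 0}"
   hence "y + (0, \<phi> 0) \<in> \<Omega>" by (simp add: e(3))
   thus "y \<in> T ` \<Omega>" by (intro image_eqI[of _ _ "y + (0, \<phi> 0)"]) (simp_all add: inv)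
  qed
 qed
 moreover have "dist (T x) (T y) = dist x y" for x y by (simp add: T_def dist_norm)
 moreover have "\<forall>x\<in>\<Omega>. u x = profile W' (T x \<bullet> e)" unfolding pg using g(3) by (simp add: T_def)
 ultimately show ?thesis using e(1,2) unfolding half_space_def by blast
qed

end
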